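(* Fix $T>0$. Assume that the initial condition $u_0$ satisfies $\mathfrak r\le u_0(x)\le1-\mathfrak r$ for all $x\in\mathbb T^d$, for some $0<\mathfrak r<1/2$, and belongs to $H^{4+\beta}(\mathbb T^d)$ for some $0<\beta<1$. Let $u(t,x)$ be the solution of the hydrodynamic equation with initial condition $u_0$. Consider the inequality $$H_n(f_t\,|\,\nu^n_{u(t,\cdot)})+\int_0^tn^2\,I_n(f_s;\nu^n_{u(s,\cdot)})\,ds\ \le\ \big\{H_n(f_0\,|\,\nu^n_{u_0(\cdot)})+C_1\,\varkappa_n^{(d)}\big\}\,e^{C_1t}.\qquad( * )$$ (i) In dimension $d=1,2$, there exists a finite positive constant $C_1$, depending only on $\mathfrak r$, $h_j$, $c_{0,e_j}$ ($1\le j\le d$), $\|u\|_{T,4}$ and $T$, such that $( * )$ holds for all $0\le t\le T$ and $n\ge1$. In dimension $1$, a constant $0<b<1/6$ is fixed, $\varkappa_n^{(1)}=n^{(1/3)+b}$, and $C_1$ may also depend on $b$. In dimension $2$, $\varkappa^{(2)}_n=n^{4/5}$. (ii) In dimension $d=3$, fix $\kappa>1$. Then there exist a finite positive constant $C_1$, depending only on $\mathfrak r$, $h_j$, $c_{0,e_j}$ ($1\le j\le d$), $\|u\|_{T,4}$ and $T$ (in particular not on $\kappa$), and an integer $n_0$ depending on the previous variables and on $\kappa$, such that $( * )$ holds for all $n\ge n_0$ and $0\le t\le T$, with $\varkappa_n^{(3)}=n^{3/2}/\kappa^3$.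
   Context: Model. Let $\mathbb T^d=(\mathbb R/\mathbb Z)^d$, $\mathbb T^d_n=(\mathbb Z/n\mathbb Z)^d$, $\Omega_n=\{0,1\}^{\mathbb T^d_n}$ with elements $\eta=(\eta_x)$, and let $e_1,\dots,e_d$ be the canonical basis. A cylinder function is a function on $\{0,1\}^{\mathbb Z^d}$ depending on finitely many coordinates; it is also viewed as a function on $\Omega_n$ by reading coordinates modulo $n$. Set $(\tau_x\eta)_z=\eta_{x+z}$, $(\tau_xf)(\eta)=f(\tau_x\eta)$. For $1\le j\le d$, fix a cylinder function $c_{0,e_j}$, bounded below by a positive constant, not depending on $\eta_0,\eta_{e_j}$, and such that for some cylinder function $h_j$: $c_{0,e_j}(\eta)[\eta_{e_j}-\eta_0]=(\tau_{e_j}h_j)(\eta)-h_j(\eta)$. Put $c_{x,x+e_j}(\eta)=c_{0,e_j}(\tau_x\eta)$ and let $T_{x,y}\eta$ be $\eta$ with the values at $x$ and $y$ exchanged. The generator is $$(L_nf)(\eta)=n^2\sum_{x\in\mathbb T^d_n}\sum_{j=1}^dc_{x,x+e_j}(\eta)\{f(T_{x,x+e_j}\eta)-f(\eta)\},$$ with semigroup $(S^n_t)_{t\ge0}$. For $\alpha\in[0,1]$, $\nu_\alpha$ is the Bernoulli product measure on $\{0,1\}^{\mathbb Z^d}$ with density $\alpha$, and $D_j(\alpha)=\frac{d}{d\alpha}E_{\nu_\alpha}[h_j]=E_{\nu_\alpha}[c_{0,e_j}]$. For continuous $\rho\colon\mathbb T^d\to[0,1]$, $\nu^n_{\rho(\cdot)}$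 is the product measure on $\Omega_n$ with $\nu^n_{\rho(\cdot)}\{\eta_x=1\}=\rho(x/n)$. Hydrodynamic equation: $\partial_tu=\sum_j\partial_{x_j}(D_j(u)\partial_{x_j}u)$, $u(0,\cdot)=u_0$. $H^{4+\beta}(\mathbb T^d)$ is the Hölder space of exponent $4+\beta$. $\|F\|_{C^k}$ is the sum of the sup norms of all partial derivatives of order at most $k$, and $\|u\|_{T,p}=\sup_{0\le t\le T}\|u(t,\cdot)\|_{C^p}$. Fix any initial probability measure $\mu_n$ on $\Omega_n$; $f_t=f^n_t=d(\mu_nS^n_t)/d\nu^n_{u(t,\cdot)}$ is the density of the law at time $t$. For a density $f$ with respect to $\nu$, $H_n(f|\nu)=\int f\ln f\,d\nu$ is the relative entropy of $f\,d\nu$ with respect to $\nu$. For $f\ge0$ and a probability measure $\mu$ on $\Omega_n$, $$I_n(f;\mu)=\frac12\sum_{j=1}^d\sum_{x\in\mathbb T^d_n}\int c_{x,x+e_j}(\eta)\Big[\sqrt{f(T_{x,x+e_j}\eta)}-\sqrt{f(\eta)}\Big]^2\mu(d\eta).$$ *)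

theory Defs
  imports "HOL-Probability.Probability" "HOL-Number_Theory.Cong"
begin

section \<open>Configurations and cylinder functions\<close>

type_synonym 'd site = "int ^ 'd"
type_synonym 'd config = "'d site \<Rightarrow> bool"

abbreviation unit_site :: "'d::finite \<Rightarrow> 'd site"  (\<open>\<e>\<close>)
  where "\<e> j \<equiv> axis j 1"

definition shift :: "'d::finite site \<Rightarrow> 'd config \<Rightarrow> 'd config"
  where "shift x \<eta> = (\<lambda>z. \<eta> (x + z))"

definition cylinder :: "('d::finite config \<Rightarrow> real) \<Rightarrow> bool"
  where "cylinder f \<longleftrightarrow>
    (\<exists>A. finite A \<and> (\<forall>\<eta> \<xi>. (\<forall>x\<in>A. \<eta> x = \<xi> x) \<longrightarrow> f \<eta> = f \<xi>))"

text \<open>\<open>c j\<close> stands for the rate \<open>c\<^sub>0\<^sub>,\<^sub>e\<^sub>j\<close>.\<close>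

definition gradient_rates ::
    "('d::finite \<Rightarrow> 'd config \<Rightarrow> real) \<Rightarrow> ('d \<Rightarrow> 'd config \<Rightarrow> real) \<Rightarrow> bool"
  where "gradient_rates c h \<longleftrightarrow> (\<forall>j.
    cylinder (c j) \<and> cylinder (h j) \<and>
    (\<exists>a>0. \<forall>\<eta>. a \<le> c j \<eta>) \<and>
    (\<forall>\<eta> \<xi>. (\<forall>x. x \<noteq> 0 \<and> x \<noteq> \<e> j \<longrightarrow> \<eta> x = \<xi> x) \<longrightarrow> c j \<eta> = c j \<xi>) \<and>
    (\<forall>\<eta>. c j \<eta> * (of_bool (\<eta> (\<e> j)) - of_bool (\<eta> 0)) = h j (shift (\<e> j) \<eta>) - h j \<eta>))"


section \<open>The discrete torus\<close>

text \<open>A configuration on \<open>(\<int>/n\<int>)\<^sup>d\<close> is represented by its lift, an \<open>n\<close>-periodic configuration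
  on \<open>\<int>\<^sup>d\<close>. Reading the coordinates of a cylinder function modulo \<open>n\<close> is then plain application
  to the lift, and translations of the torus are translations of \<open>\<int>\<^sup>d\<close>. Sums over the sites of the
  torus range over the fundamental domain \<open>torus n\<close>.\<close>

definition site_cong :: "nat \<Rightarrow> 'd::finite site \<Rightarrow> 'd site \<Rightarrow> bool"
  where "site_cong n x y \<longleftrightarrow> (\<forall>i. [x $ i = y $ i] (mod int n))"

definition torus :: "nat \<Rightarrow> 'd::finite site set"
  where "torus n = {x. \<forall>i. 0 \<le> x $ i \<and> x $ i < int n}"

definition torus_configs :: "nat \<Rightarrow> 'd::finite config set"
  where "torus_configs n = {\<eta>. \<forall>x y. site_cong n x y \<longrightarrow> \<eta> x = \<eta> y}"

definition exchange :: "nat \<Rightarrow> 'd::finite site \<Rightarrow> 'd site \<Rightarrow> 'd config \<Rightarrow> 'd config"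
  where "exchange n x y \<eta> =
    (\<lambda>z. if site_cong n z x then \<eta> y else if site_cong n z y then \<eta> x else \<eta> z)"


section \<open>Dynamics\<close>

definition generator ::
    "('d::finite \<Rightarrow> 'd config \<Rightarrow> real) \<Rightarrow> nat \<Rightarrow> ('d config \<Rightarrow> real) \<Rightarrow> 'd config \<Rightarrow> real"
  where "generator c n f \<eta> = (real n)\<^sup>2 *
    (\<Sum>x\<in>torus n. \<Sum>j\<in>UNIV. c j (shift x \<eta>) * (f (exchange n x (x + \<e> j) \<eta>) - f \<eta>))"

text \<open>The state space is finite, so the semigroup is the exponential series of the generator.\<close>

definition semigroup_at ::
    "('d::finite \<Rightarrow> 'd config \<Rightarrow> real) \<Rightarrow> nat \<Rightarrow> real \<Rightarrow> ('d config \<Rightarrow> real) \<Rightarrow> 'd config \<Rightarrow> real"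
  where "semigroup_at c n t f \<eta> = (\<Sum>k. t ^ k / fact k * (generator c n ^^ k) f \<eta>)"

text \<open>The mass that \<open>\<mu>S\<^sup>n\<^sub>t\<close> gives to the single configuration \<open>\<eta>\<close>.\<close>

definition law :: "('d::finite \<Rightarrow> 'd config \<Rightarrow> real) \<Rightarrow> nat \<Rightarrow> 'd config pmf \<Rightarrow> real \<Rightarrow> 'd config \<Rightarrow> real"
  where "law c n \<mu> t \<eta> = measure_pmf.expectation \<mu> (semigroup_at c n t (indicator {\<eta>}))"


section \<open>Product measures, entropy and energy\<close>

definition bernoulli_product :: "real \<Rightarrow> 'd::finite config measure"
  where "bernoulli_product \<alpha> = (\<Pi>\<^sub>M x\<in>UNIV. measure_pmf (bernoulli_pmf \<alpha>))"

definition profile_measure :: "nat \<Rightarrow> (real ^ 'd \<Rightarrow> real) \<Rightarrow> 'd::finite config pmf"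
  where "profile_measure n \<rho> =
    map_pmf (\<lambda>\<xi> x. \<xi> (\<chi> i. x $ i mod int n))
      (Pi_pmf (torus n) False
        (\<lambda>x. bernoulli_pmf (\<rho> (\<chi> i. real_of_int (x $ i) / real n))))"

definition density_at ::
    "('d::finite \<Rightarrow> 'd config \<Rightarrow> real) \<Rightarrow> nat \<Rightarrow> 'd config pmf \<Rightarrow> real \<Rightarrow> (real ^ 'd \<Rightarrow> real) \<Rightarrow> 'd config \<Rightarrow> real"
  where "density_at c n \<mu> t \<rho> \<eta> = law c n \<mu> t \<eta> / pmf (profile_measure n \<rho>) \<eta>"

text \<open>The convention \<open>0 ln 0 = 0\<close> is built in, since \<open>ln 0 = 0\<close>.\<close>

definition rel_entropy :: "('d config \<Rightarrow> real) \<Rightarrow> 'd::finite config pmf \<Rightarrow> real"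
  where "rel_entropy f \<nu> = measure_pmf.expectation \<nu> (\<lambda>\<eta>. f \<eta> * ln (f \<eta>))"

definition energy ::
    "('d::finite \<Rightarrow> 'd config \<Rightarrow> real) \<Rightarrow> nat \<Rightarrow> ('d config \<Rightarrow> real) \<Rightarrow> 'd config pmf \<Rightarrow> real"
  where "energy c n f \<mu> = 1 / 2 * (\<Sum>j\<in>UNIV. \<Sum>x\<in>torus n.
    measure_pmf.expectation \<mu>
      (\<lambda>\<eta>. c j (shift x \<eta>) * (sqrt (f (exchange n x (x + \<e> j) \<eta>)) - sqrt (f \<eta>))\<^sup>2))"


section \<open>Function spaces on the continuous torus\<close>

text \<open>Functions on \<open>(\<real>/\<int>)\<^sup>d\<close> are represented by their \<open>1\<close>-periodic lifts to \<open>\<real>\<^sup>d\<close>.\<close>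

definition periodic :: "(real ^ 'd::finite \<Rightarrow> real) \<Rightarrow> bool"
  where "periodic f \<longleftrightarrow> (\<forall>x k. (\<forall>i. k $ i \<in> \<int>) \<longrightarrow> f (x + k) = f x)"

definition partial_differentiable :: "'d::finite \<Rightarrow> (real ^ 'd \<Rightarrow> real) \<Rightarrow> real ^ 'd \<Rightarrow> bool"
  where "partial_differentiable j f x \<longleftrightarrow>
    (\<lambda>s. f (x + s *\<^sub>R axis j 1)) field_differentiable (at 0)"

definition partial :: "'d::finite \<Rightarrow> (real ^ 'd \<Rightarrow> real) \<Rightarrow> real ^ 'd \<Rightarrow> real"
  where "partial j f x = deriv (\<lambda>s. f (x + s *\<^sub>R axis j 1)) 0"

primrec partials :: "'d::finite list \<Rightarrow> (real ^ 'd \<Rightarrow> real) \<Rightarrow> real ^ 'd \<Rightarrow> real" where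
  "partials [] f = f"
| "partials (j # js) f = partial j (partials js f)"

definition Ck :: "nat \<Rightarrow> (real ^ 'd::finite \<Rightarrow> real) \<Rightarrow> bool"
  where "Ck k f \<longleftrightarrow>
    (\<forall>js j x. length js < k \<longrightarrow> partial_differentiable j (partials js f) x) \<and>
    (\<forall>js. length js \<le> k \<longrightarrow> continuous_on UNIV (partials js f))"

text \<open>\<open>H\<^sup>k\<^sup>+\<^sup>\<beta>\<close> of the torus, for \<open>0 < \<beta> < 1\<close>. For a periodic function, a Hoelder bound for the
  Euclidean distance on \<open>\<real>\<^sup>d\<close> is the same as one for the distance of the torus.\<close>

definition holder_space :: "nat \<Rightarrow> real \<Rightarrow> (real ^ 'd::finite \<Rightarrow> real) \<Rightarrow> bool"
  where "holder_space k \<beta> f \<longleftrightarrow> periodic f \<and> Ck k f \<and>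
    (\<forall>js. length js = k \<longrightarrow>
      (\<exists>L. \<forall>x y. \<bar>partials js f x - partials js f y\<bar> \<le> L * dist x y powr \<beta>))"

text \<open>The partial derivatives of order at most \<open>k\<close> are indexed by the multi-indices of size at most
  \<open>k\<close>, here multisets of directions; for \<open>f\<close> of class \<open>C\<^sup>k\<close> the order of differentiation is
  immaterial, so any listing of the multiset will do. The norm is infinite off \<open>C\<^sup>k\<close>.\<close>

definition Ck_norm :: "nat \<Rightarrow> (real ^ 'd::finite \<Rightarrow> real) \<Rightarrow> ennreal"
  where "Ck_norm k f = (if Ck k f
    then \<Sum>m\<in>{m. size m \<le> k}. SUP x. ennreal \<bar>partials (SOME js. mset js = m) f x\<bar>
    else \<infinity>)"

definition sup_Ck_norm :: "real \<Rightarrow> nat \<Rightarrow> (real \<Rightarrow> real ^ 'd::finite \<Rightarrow> real) \<Rightarrow> ennreal"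
  where "sup_Ck_norm T p u = (SUP t\<in>{0..T}. Ck_norm p (u t))"


section \<open>The hydrodynamic equation\<close>

text \<open>For gradient rates, \<open>diffusivity c j \<alpha>\<close> is also the derivative in \<open>\<alpha>\<close> of the expectation of
  \<open>h j\<close> under \<open>bernoulli_product \<alpha>\<close>.\<close>

definition diffusivity :: "('d::finite \<Rightarrow> 'd config \<Rightarrow> real) \<Rightarrow> 'd \<Rightarrow> real \<Rightarrow> real"
  where "diffusivity c j \<alpha> = integral\<^sup>L (bernoulli_product \<alpha>) (c j)"

text \<open>Classical (\<open>C\<^sup>1\<^sup>,\<^sup>2\<close>) solutions on \<open>[0, T]\<close> with values in \<open>[0, 1]\<close>, the domain of the
  diffusivities; continuity of the time derivative follows from the equation. For an initial
  condition in \<open>H\<^sup>4\<^sup>+\<^sup>\<beta>\<close> bounded away from \<open>0\<close> and \<open>1\<close> there is exactly one such solution, and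
  parabolic regularity gives that \<open>sup_Ck_norm T 4 u\<close> is finite.\<close>

definition hydrodynamic_solution ::
    "('d::finite \<Rightarrow> 'd config \<Rightarrow> real) \<Rightarrow> real \<Rightarrow> (real ^ 'd \<Rightarrow> real) \<Rightarrow> (real \<Rightarrow> real ^ 'd \<Rightarrow> real) \<Rightarrow> bool"
  where "hydrodynamic_solution c T u\<^sub>0 u \<longleftrightarrow>
    u 0 = u\<^sub>0 \<and>
    (\<forall>t\<in>{0..T}. periodic (u t) \<and> Ck 2 (u t) \<and> (\<forall>x. 0 \<le> u t x \<and> u t x \<le> 1)) \<and>
    (\<forall>js. length js \<le> 2 \<longrightarrow>
      continuous_on ({0..T} \<times> UNIV) (\<lambda>(t, x). partials js (u t) x)) \<and>
    (\<forall>t\<in>{0..T}. \<forall>x.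
      ((\<lambda>s. u s x) has_real_derivative
        (\<Sum>j\<in>UNIV. partial j (\<lambda>y. diffusivity c j (u t y) * partial j (u t) y) x))
      (at t within {0..T}))"


section \<open>The entropy estimate\<close>

text \<open>The inequality at time \<open>t\<close>, with constant \<open>C\<close> and with error term \<open>C * \<kappa>\<close>.\<close>

definition entropy_estimate ::
    "('d::finite \<Rightarrow> 'd config \<Rightarrow> real) \<Rightarrow> nat \<Rightarrow> 'd config pmf \<Rightarrow> (real ^ 'd \<Rightarrow> real) \<Rightarrow>
     (real \<Rightarrow> real ^ 'd \<Rightarrow> real) \<Rightarrow> real \<Rightarrow> real \<Rightarrow> real \<Rightarrow> bool"
  where "entropy_estimate c n \<mu> u\<^sub>0 u C \<kappa> t \<longleftrightarrow>
    rel_entropy (density_at c n \<mu> t (u t)) (profile_measure n (u t)) +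
    integral {0..t} (\<lambda>s. (real n)\<^sup>2 *
      energy c n (density_at c n \<mu> s (u s)) (profile_measure n (u s)))
    \<le> (rel_entropy (density_at c n \<mu> 0 u\<^sub>0) (profile_measure n u\<^sub>0) + C * \<kappa>) * exp (C * t)"

end

theory Submission
  imports Defs "HOL-Real_Asymp.Real_Asymp"
begin

text \<open>
  The proof is Yau's relative entropy argument.  Sample the solution \<open>u (t, \<cdot>)\<close> at the sites and
  let \<open>H\<close> be the entropy of the law at time \<open>t\<close> relative to the product measure with this profile.
  Differentiating in time, the generator dissipates \<open>2 * n\<^sup>2\<close> times the energy, and what remains is
  the expectation under the law of an explicit function, the \<open>production\<close>
  (\<open>generator_entropy_bound\<close>, \<open>entropy_derivative_bound\<close>).  If this expectation is at most
  \<open>n\<^sup>2\<close> times the energy plus \<open>C * (H + \<kappa>)\<close>, the estimate follows from Gronwall's inequality.  So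
  everything rests on \<open>production_bound\<close>.

  A gradient rate allows one more summation by parts, after which the production is a sum over the
  sites of local functions of order one (\<open>production_eq\<close>).  Its mean is zero.  Its linear part in
  the occupation variables is the discretised hydrodynamic equation minus the time derivative of the
  profile, hence has coefficients of order \<open>1 / n\<close> (\<open>lin_coeff_current\<close>, \<open>consistency_direction\<close>).
  The rest is expanded by removing one site after the other (\<open>nonlinear_step\<close>) into sums of terms
  \<open>\<phi> x * om (x + z)\<close>, where \<open>om\<close> is a normalised occupation variable and \<open>\<phi> x\<close> is centred and
  reads no site ahead of \<open>x + z\<close> in all directions.

  In such a sum \<open>om (x + z)\<close> is replaced by its average over a box ahead of \<open>x + z\<close>
  (\<open>replacement_bound\<close>).  The box is enlarged in one direction at a time; the difference of two
  successive averages is a sum of increments of \<open>om\<close> along bonds of one direction, which is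
  integrated by parts against the density and costs a small multiple of the energy and sums of
  squares of averages of the \<open>\<phi> x\<close> (\<open>increment_bound\<close>).  By the entropy inequality it remains to
  bound exponential moments of these sums, and of the quadratic form left at the end, under the
  product measure.  They are at most \<open>exp (n ^ d / V)\<close>, with \<open>V\<close> the volume of the box
  (\<open>ex_exp_sum_squares\<close>, \<open>ex_exp_quadratic\<close>): averages over distant boxes are independent, and
  a quadratic form is an average, over sets of sites, of decoupled ones.

  Sides \<open>m ^ (2 ^ k)\<close>, \<open>k < d\<close>, make all steps of the replacement equally expensive.  With the longest
  side of order \<open>n\<close> this gives the error \<open>n ^ d / m ^ (2 ^ d - 1)\<close>, of order \<open>1\<close>, \<open>n powr (1/2)\<close> and
  \<open>n powr (5/4)\<close> in dimensions one, two and three.  In each case this is below the error that is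
  claimed; in dimension three a factor \<open>n powr (1/4)\<close> is left over, and it exceeds \<open>\<kappa> ^ 3\<close> once
  \<open>n \<ge> \<kappa> ^ 12\<close>, so that only the threshold depends on \<open>\<kappa>\<close>.

  Three points complete the argument.  The profile keeps its distance from \<open>0\<close> and \<open>1\<close> by the maximum
  principle (\<open>hydrodynamic_bounds\<close>).  An initial law that charges only some configurations is
  a limit of strictly positive ones (\<open>entropy_estimate_nonneg\<close>).  For the finitely many \<open>n\<close> that are
  too small for the boxes, the densities are bounded by a constant (\<open>entropy_estimate_crude\<close>).
\<close>

section \<open>Sites of the discrete torus\<close>

definition tmod :: "nat \<Rightarrow> 'd::finite site \<Rightarrow> 'd site"
  where "tmod n x = (\<chi> i. x $ i mod int n)"

definition nperiodic :: "nat \<Rightarrow> ('d::finite site \<Rightarrow> 'a) \<Rightarrow> bool"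
  where "nperiodic n g \<longleftrightarrow> (\<forall>x y. site_cong n x y \<longrightarrow> g x = g y)"

lemma site_cong_refl [simp, intro]: "site_cong n x x"
  by (simp add: site_cong_def)

lemma site_cong_sym: "site_cong n x y \<Longrightarrow> site_cong n y x"
  by (simp add: site_cong_def cong_sym)

lemma site_cong_commute: "site_cong n x y \<longleftrightarrow> site_cong n y x"
  using site_cong_sym by blast

lemma site_cong_trans: "site_cong n x y \<Longrightarrow> site_cong n y z \<Longrightarrow> site_cong n x z"
  unfolding site_cong_def using cong_trans by blast

lemma site_cong_add: "site_cong n x y \<Longrightarrow> site_cong n v w \<Longrightarrow> site_cong n (x + v) (y + w)"
  by (simp add: site_cong_def cong_add)

lemma site_cong_diff: "site_cong n x y \<Longrightarrow> site_cong n v w \<Longrightarrow> site_cong n (x - v) (y - w)"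
  by (simp add: site_cong_def cong_diff)

lemma site_cong_add_left [simp]: "site_cong n (x + v) (x + w) \<longleftrightarrow> site_cong n v w"
  by (simp add: site_cong_def cong_add_lcancel)

lemma site_cong_add_right [simp]: "site_cong n (v + x) (w + x) \<longleftrightarrow> site_cong n v w"
  by (simp add: site_cong_def cong_add_rcancel)

lemma site_cong_iff_diff: "site_cong n x y \<longleftrightarrow> (\<forall>i. int n dvd (x $ i - y $ i))"
  by (simp add: site_cong_def cong_iff_dvd_diff)

lemma tmod_cong [simp]: "site_cong n (tmod n x) x"
  by (simp add: site_cong_def tmod_def cong_def)

lemma site_cong_tmod: "site_cong n x y \<longleftrightarrow> tmod n x = tmod n y"
  by (simp add: site_cong_def tmod_def cong_def vec_eq_iff)

lemma tmod_in_torus [simp]: "1 \<le> n \<Longrightarrow> tmod n x \<in> torus n"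
  by (simp add: torus_def tmod_def)

lemma tmod_id: "x \<in> torus n \<Longrightarrow> tmod n x = x"
  by (simp add: torus_def tmod_def vec_eq_iff)

lemma torus_bij_PiE: "bij_betw (\<lambda>g. \<chi> i. g i) (PiE (UNIV::'d::finite set) (\<lambda>_. {0..<int n})) (torus n)"
proof (intro bij_betwI[where g = "\<lambda>x i. x $ i"])
qed (auto simp: torus_def PiE_def Pi_def)

lemma finite_torus [simp, intro]: "finite (torus n :: 'd::finite site set)"
  using torus_bij_PiE[of n, where 'd = 'd] finite_PiE[of "UNIV::'d set" "\<lambda>_. {0..<int n}"]
  by (metis bij_betw_finite finite finite_atLeastLessThan_int)

lemma card_torus: "card (torus n :: 'd::finite site set) = n ^ CARD('d)"
  using bij_betw_same_card[OF torus_bij_PiE[of n, where 'd = 'd]]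
  by (simp add: card_PiE)

lemma torus_nonempty: "1 \<le> n \<Longrightarrow> torus n \<noteq> ({} :: 'd::finite site set)"
  using tmod_in_torus by blast

lemma nperiodicD: "nperiodic n g \<Longrightarrow> site_cong n x y \<Longrightarrow> g x = g y"
  by (simp add: nperiodic_def)

lemma nperiodic_tmod: "nperiodic n g \<Longrightarrow> g (tmod n x) = g x"
  by (meson nperiodicD tmod_cong)

lemma torus_configs_iff: "\<eta> \<in> torus_configs n \<longleftrightarrow> nperiodic n \<eta>"
  by (simp add: torus_configs_def nperiodic_def)

lemma nperiodic_const [simp]: "nperiodic n (\<lambda>_. c)" by (simp add: nperiodic_def)

lemma nperiodic_shift: "nperiodic n g \<Longrightarrow> nperiodic n (\<lambda>x. g (x + s))"
  by (simp add: nperiodic_def)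

lemma nperiodic_comp: "nperiodic n g \<Longrightarrow> nperiodic n (\<lambda>x. F (g x))"
  unfolding nperiodic_def by (intro allI impI arg_cong[where f = F]) auto

lemma nperiodic_comp2: "nperiodic n g \<Longrightarrow> nperiodic n h \<Longrightarrow> nperiodic n (\<lambda>x. F (g x) (h x))"
  unfolding nperiodic_def by (intro allI impI arg_cong2[where f = F]) auto

lemma bij_betw_torus_shift:
  assumes "1 \<le> n"
  shows "bij_betw (\<lambda>x. tmod n (x + s)) (torus n) (torus n :: 'd::finite site set)"
proof (intro bij_betwI[where g = "\<lambda>x. tmod n (x - s)"])
  fix x :: "'d site" assume x: "x \<in> torus n"
  have "site_cong n (tmod n (x + s) - s) x"
    using site_cong_diff[OF tmod_cong[of n "x + s"] site_cong_refl[of n s]] by simp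
  then show "tmod n (tmod n (x + s) - s) = x" using x by (metis site_cong_tmod tmod_id)
  have "site_cong n (tmod n (x - s) + s) x"
    using site_cong_add[OF tmod_cong[of n "x - s"] site_cong_refl[of n s]] by simp
  then show "tmod n (tmod n (x - s) + s) = x" using x by (metis site_cong_tmod tmod_id)
qed (use assms in auto)

lemma sum_torus_shift:
  fixes g :: "'d::finite site \<Rightarrow> 'a::comm_monoid_add"
  assumes "1 \<le> n" "nperiodic n g"
  shows "(\<Sum>x\<in>torus n. g (x + s)) = (\<Sum>x\<in>torus n. g x)"
proof -
  have "(\<Sum>x\<in>torus n. g (x + s)) = (\<Sum>x\<in>torus n. g (tmod n (x + s)))"
    using assms(2) by (simp add: nperiodic_tmod)
  also have "\<dots> = (\<Sum>x\<in>torus n. g x)"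
    by (rule sum.reindex_bij_betw[OF bij_betw_torus_shift[OF assms(1)]])
  finally show ?thesis .
qed

lemma sum_torus_indicator:
  fixes g :: "'d::finite site \<Rightarrow> real"
  assumes "1 \<le> n" "nperiodic n g"
  shows "(\<Sum>x\<in>torus n. of_bool (site_cong n x y) * g x) = g y"
proof -
  have "(\<Sum>x\<in>torus n. of_bool (site_cong n x y) * g x)
      = (\<Sum>x\<in>torus n. if x = tmod n y then g x else 0)"
    by (rule sum.cong) (auto simp: site_cong_tmod tmod_id)
  also have "\<dots> = g y"
    using assms by (simp add: nperiodic_tmod)
  finally show ?thesis .
qed

lemma site_cong_small_imp_eq:
  assumes "\<And>i. \<bar>v $ i - w $ i\<bar> < int n" "site_cong n v w"
  shows "v = w"
proof -
  have "v $ i = w $ i" for i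
    using assms(2)[unfolded site_cong_iff_diff] assms(1)[of i] zdvd_imp_le[of "int n" "\<bar>v $ i - w $ i\<bar>"]
    by (metis abs_ge_zero dvd_abs_iff eq_iff_diff_eq_0 linorder_not_less abs_eq_0 order_le_less)
  then show ?thesis by (simp add: vec_eq_iff)
qed

definition offset_bound :: "'d::finite site set \<Rightarrow> nat \<Rightarrow> bool"
  where "offset_bound A D \<longleftrightarrow> (\<forall>a\<in>A. \<forall>i. \<bar>a $ i\<bar> \<le> int D)"

lemma offset_bound_exists:
  assumes "finite A"
  shows "\<exists>D. offset_bound (A :: 'd::finite site set) D"
proof -
  define M where "M = Max (insert 0 ((\<lambda>(a,i). \<bar>a $ i\<bar>) ` (A \<times> UNIV)))"
  have "\<bar>a $ i\<bar> \<le> M" if "a \<in> A" for a i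
    unfolding M_def by (intro Max_ge) (use assms that in force)+
  then have "offset_bound A (nat M)"
    unfolding offset_bound_def by fastforce
  then show ?thesis by blast
qed

lemma offset_bound_mono: "offset_bound A D \<Longrightarrow> B \<subseteq> A \<Longrightarrow> D \<le> D' \<Longrightarrow> offset_bound B D'"
  unfolding offset_bound_def by (meson of_nat_mono order_trans subsetD)

section \<open>Expectation under a product measure on the torus\<close>

locale torus_profile =
  fixes n :: nat and u :: "'d::finite site \<Rightarrow> real" and r :: real
  assumes n_pos: "1 \<le> n"
    and u_periodic: "nperiodic n u"
    and r_pos: "0 < r" and r_half: "r < 1/2"
    and u_lower: "\<And>x. r \<le> u x" and u_upper: "\<And>x. u x \<le> 1 - r"
begin

abbreviation "\<Omega> \<equiv> torus_configs n :: 'd config set"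

definition wt :: "'d config \<Rightarrow> real"
  where "wt \<eta> = (\<Prod>x\<in>torus n. if \<eta> x then u x else 1 - u x)"

definition ex :: "('d config \<Rightarrow> real) \<Rightarrow> real"
  where "ex f = (\<Sum>\<eta>\<in>\<Omega>. wt \<eta> * f \<eta>)"

end

lemma bij_configs_PiE:
  assumes "1 \<le> n"
  shows "bij_betw (\<lambda>g x. g (tmod n x)) (PiE (torus n) (\<lambda>_. UNIV)) (torus_configs n :: 'd::finite config set)"
proof (intro bij_betwI[where g = "\<lambda>\<eta>. restrict \<eta> (torus n)"])
  fix g :: "'d site \<Rightarrow> bool" assume "g \<in> PiE (torus n) (\<lambda>_. UNIV)"
  then show "restrict (\<lambda>x. g (tmod n x)) (torus n) = g"
    by (auto simp: restrict_def tmod_id PiE_def extensional_def)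
next
  fix \<eta> :: "'d config" assume "\<eta> \<in> torus_configs n"
  then show "(\<lambda>x. (restrict \<eta> (torus n)) (tmod n x)) = \<eta>"
    using assms by (auto simp: torus_configs_iff nperiodic_tmod)
qed (auto simp: torus_configs_iff nperiodic_def site_cong_tmod)

lemma finite_torus_configs [simp, intro]:
  assumes "1 \<le> n" shows "finite (torus_configs n :: 'd::finite config set)"
proof -
  have "finite (PiE (torus n :: 'd site set) (\<lambda>_. UNIV :: bool set))" by (rule finite_PiE) auto
  then show ?thesis using bij_betw_finite[OF bij_configs_PiE[OF assms, where 'd = 'd]] by blast
qed

lemma torus_configs_nonempty [simp]: "torus_configs n \<noteq> {}"
proof -
  have "(\<lambda>_. False) \<in> torus_configs n" by (simp add: torus_configs_def)
  then show ?thesis by blast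
qed

lemma sum_configs_prod:
  assumes "1 \<le> n"
  shows "(\<Sum>\<eta>\<in>torus_configs n. \<Prod>x\<in>torus n. g x (\<eta> x))
    = (\<Prod>x\<in>(torus n :: 'd::finite site set). g x True + (g x False :: real))"
proof -
  have "(\<Sum>\<eta>\<in>torus_configs n. \<Prod>x\<in>torus n. g x (\<eta> x))
     = (\<Sum>h\<in>PiE (torus n) (\<lambda>_. UNIV). \<Prod>x\<in>torus n. g x (h (tmod n x)))"
    by (rule sum.reindex_bij_betw[OF bij_configs_PiE[OF assms], symmetric])
  also have "\<dots> = (\<Sum>h\<in>PiE (torus n) (\<lambda>_. UNIV). \<Prod>x\<in>torus n. g x (h x))"
    by (intro sum.cong prod.cong) (auto simp: tmod_id)
  also have "\<dots> = (\<Prod>x\<in>torus n. \<Sum>b\<in>UNIV. g x b)"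
    by (rule prod_sum_PiE[symmetric]) auto
  finally show ?thesis by (simp add: UNIV_bool add.commute)
qed

definition depends_on :: "nat \<Rightarrow> ('d::finite config \<Rightarrow> 'a) \<Rightarrow> 'd site set \<Rightarrow> bool"
  where "depends_on n X A \<longleftrightarrow> (\<forall>\<eta>\<in>torus_configs n. \<forall>\<xi>\<in>torus_configs n. (\<forall>x\<in>A. \<eta> x = \<xi> x) \<longrightarrow> X \<eta> = X \<xi>)"

lemma depends_onD:
  "depends_on n X A \<Longrightarrow> \<eta> \<in> torus_configs n \<Longrightarrow> \<xi> \<in> torus_configs n \<Longrightarrow> (\<And>x. x \<in> A \<Longrightarrow> \<eta> x = \<xi> x) \<Longrightarrow> X \<eta> = X \<xi>"
  unfolding depends_on_def by blast

lemma depends_on_mono: "depends_on n X A \<Longrightarrow> A \<subseteq> B \<Longrightarrow> depends_on n X B"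
  unfolding depends_on_def by blast

lemma depends_on_const [simp]: "depends_on n (\<lambda>_. c) A"
  by (simp add: depends_on_def)

lemma depends_onI:
  "(\<And>\<eta> \<xi>. \<eta> \<in> torus_configs n \<Longrightarrow> \<xi> \<in> torus_configs n \<Longrightarrow> (\<And>x. x \<in> A \<Longrightarrow> \<eta> x = \<xi> x) \<Longrightarrow> X \<eta> = X \<xi>)
    \<Longrightarrow> depends_on n X A"
  unfolding depends_on_def by blast

lemma depends_on_comp: "depends_on n X A \<Longrightarrow> depends_on n (\<lambda>\<eta>. F (X \<eta>)) A"
  by (rule depends_onI, rule arg_cong[where f = F], erule depends_onD)

lemma depends_on_comp2:
  assumes "depends_on n X A" "depends_on n Y B"
  shows "depends_on n (\<lambda>\<eta>. F (X \<eta>) (Y \<eta>)) (A \<union> B)"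
  by (rule depends_onI, rule arg_cong2[where f = F], erule (1) depends_onD[OF assms(1)], simp,
      erule (1) depends_onD[OF assms(2)], simp)

lemma depends_on_sum: "(\<And>i. i \<in> I \<Longrightarrow> depends_on n (X i) A) \<Longrightarrow> depends_on n (\<lambda>\<eta>. \<Sum>i\<in>I. X i \<eta>) A"
  by (rule depends_onI, rule sum.cong) (simp, rule depends_onD)

lemma depends_on_prod: "(\<And>i. i \<in> I \<Longrightarrow> depends_on n (X i) A) \<Longrightarrow> depends_on n (\<lambda>\<eta>. \<Prod>i\<in>I. X i \<eta>) A"
  by (rule depends_onI, rule prod.cong) (simp, rule depends_onD)

lemma depends_on_site: "depends_on n (\<lambda>\<eta>. F (\<eta> x)) {x}"
  by (simp add: depends_on_def)

definition glue :: "'d::finite site set \<Rightarrow> 'd config \<Rightarrow> 'd config \<Rightarrow> 'd config"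
  where "glue S \<xi> \<eta> = (\<lambda>x. if x \<in> S then \<xi> x else \<eta> x)"

definition upd :: "nat \<Rightarrow> 'd::finite site \<Rightarrow> bool \<Rightarrow> 'd config \<Rightarrow> 'd config"
  where "upd n z b \<eta> = (\<lambda>x. if site_cong n x z then b else \<eta> x)"

lemma upd_in_configs [simp]: "\<eta> \<in> torus_configs n \<Longrightarrow> upd n z b \<eta> \<in> torus_configs n"
  unfolding torus_configs_def upd_def by (auto dest: site_cong_sym site_cong_trans)

lemma upd_same: "\<eta> \<in> torus_configs n \<Longrightarrow> upd n z (\<eta> z) \<eta> = \<eta>"
  by (auto simp: upd_def torus_configs_def fun_eq_iff)

lemma glue_in_configs:
  assumes "nperiodic n (\<lambda>x. x \<in> S)" "\<xi> \<in> torus_configs n" "\<eta> \<in> torus_configs n"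
  shows "glue S \<xi> \<eta> \<in> torus_configs n"
  using assms unfolding torus_configs_iff nperiodic_def glue_def by simp

context torus_profile
begin

lemma n_ge_1 [simp]: "Suc 0 \<le> n" "0 < n" "n \<noteq> 0"
  using n_pos by auto

lemma finite_Omega [simp, intro]: "finite \<Omega>"
  by (rule finite_torus_configs[OF n_pos])

lemma chi_pos: "0 < u x * (1 - u x)" and u_pos: "0 < u x" and u_less_1: "u x < 1"
  and chi_lower: "r\<^sup>2 \<le> u x * (1 - u x)" and chi_upper: "u x * (1 - u x) \<le> 1"
proof -
  show a: "0 < u x" "u x < 1" using u_lower[of x] u_upper[of x] r_pos by auto
  then show "0 < u x * (1 - u x)" by simp
  show "r\<^sup>2 \<le> u x * (1 - u x)" unfolding power2_eq_square
    by (rule mult_mono) (use u_lower[of x] u_upper[of x] r_pos in auto)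
  show "u x * (1 - u x) \<le> 1" using a by (smt (verit) mult_le_one)
qed

lemma wt_pos: "0 < wt \<eta>"
  unfolding wt_def by (rule prod_pos) (auto simp: u_pos u_less_1)

lemma wt_sum: "(\<Sum>\<eta>\<in>\<Omega>. wt \<eta>) = 1"
  unfolding wt_def
  using sum_configs_prod[OF n_pos, of "\<lambda>x b. if b then u x else 1 - u x"] by simp

lemma ex_const [simp]: "ex (\<lambda>_. c) = c"
  unfolding ex_def by (simp add: wt_sum flip: sum_distrib_right)

lemma ex_add: "ex (\<lambda>\<eta>. f \<eta> + g \<eta>) = ex f + ex g"
  by (simp add: ex_def algebra_simps sum.distrib)

lemma ex_diff: "ex (\<lambda>\<eta>. f \<eta> - g \<eta>) = ex f - ex g"
  by (simp add: ex_def algebra_simps sum_subtractf)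

lemma ex_cmult: "ex (\<lambda>\<eta>. c * f \<eta>) = c * ex f"
  unfolding ex_def sum_distrib_left by (intro sum.cong) auto

lemma ex_cmult_right: "ex (\<lambda>\<eta>. f \<eta> * c) = ex f * c"
  unfolding ex_def sum_distrib_right by (intro sum.cong) auto

lemma ex_sum: "ex (\<lambda>\<eta>. \<Sum>i\<in>I. f i \<eta>) = (\<Sum>i\<in>I. ex (f i))"
  unfolding ex_def sum_distrib_left by (rule sum.swap)

lemma ex_mono: "(\<And>\<eta>. \<eta> \<in> \<Omega> \<Longrightarrow> f \<eta> \<le> g \<eta>) \<Longrightarrow> ex f \<le> ex g"
  unfolding ex_def by (intro sum_mono mult_left_mono) (auto simp: less_imp_le[OF wt_pos])

lemma ex_cong: "(\<And>\<eta>. \<eta> \<in> \<Omega> \<Longrightarrow> f \<eta> = g \<eta>) \<Longrightarrow> ex f = ex g"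
  unfolding ex_def by (intro sum.cong) auto

lemma ex_nonneg: "(\<And>\<eta>. \<eta> \<in> \<Omega> \<Longrightarrow> 0 \<le> f \<eta>) \<Longrightarrow> 0 \<le> ex f"
  using ex_mono[of "\<lambda>_. 0" f] by simp

lemma ex_abs_bound: "(\<And>\<eta>. \<eta> \<in> \<Omega> \<Longrightarrow> \<bar>f \<eta>\<bar> \<le> B) \<Longrightarrow> \<bar>ex f\<bar> \<le> B"
  using ex_mono[of f "\<lambda>_. B"] ex_mono[of "\<lambda>_. - B" f] by (simp add: abs_le_iff) (smt (verit))

text \<open>Independence in its most useful form: exchanging the coordinates in \<open>S\<close> between two
  independent copies of the configuration preserves their joint law.\<close>

lemma ex_diagonal:
  assumes S: "nperiodic n (\<lambda>x. x \<in> S)"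
    and F: "\<And>\<xi> \<xi>' \<eta> \<eta>'. \<xi> \<in> \<Omega> \<Longrightarrow> \<xi>' \<in> \<Omega> \<Longrightarrow> \<eta> \<in> \<Omega> \<Longrightarrow> \<eta>' \<in> \<Omega> \<Longrightarrow>
      (\<And>x. x \<in> S \<Longrightarrow> \<xi> x = \<xi>' x) \<Longrightarrow> (\<And>x. x \<notin> S \<Longrightarrow> \<eta> x = \<eta>' x) \<Longrightarrow> F \<xi> \<eta> = F \<xi>' \<eta>'"
  shows "ex (\<lambda>\<eta>. F \<eta> \<eta>) = ex (\<lambda>\<xi>. ex (F \<xi>))"
proof -
  let ?h = "\<lambda>(\<xi>, \<eta>). (glue S \<xi> \<eta>, glue S \<eta> \<xi>)"
  have bij: "bij_betw ?h (\<Omega> \<times> \<Omega>) (\<Omega> \<times> \<Omega>)"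
    by (intro bij_betwI[where g = ?h]) (auto simp: glue_in_configs[OF S], auto simp: glue_def fun_eq_iff)
  have w: "wt \<xi> * wt \<eta> = wt (glue S \<xi> \<eta>) * wt (glue S \<eta> \<xi>)" for \<xi> \<eta>
    unfolding wt_def prod.distrib[symmetric] by (rule prod.cong) (auto simp: glue_def)
  have "ex (\<lambda>\<xi>. ex (F \<xi>)) = (\<Sum>(\<xi>,\<eta>)\<in>\<Omega> \<times> \<Omega>. wt \<xi> * wt \<eta> * F \<xi> \<eta>)"
    by (simp add: ex_def sum_distrib_left sum.cartesian_product mult_ac)
  also have "\<dots> = (\<Sum>p\<in>\<Omega> \<times> \<Omega>. (\<lambda>(\<zeta>,\<zeta>'). wt \<zeta> * wt \<zeta>' * F \<zeta> \<zeta>) (?h p))"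
  proof (rule sum.cong)
    fix p assume p: "p \<in> \<Omega> \<times> \<Omega>"
    obtain \<xi> \<eta> where [simp]: "p = (\<xi>, \<eta>)" by (cases p)
    have "F \<xi> \<eta> = F (glue S \<xi> \<eta>) (glue S \<xi> \<eta>)"
      by (rule F) (use p in \<open>auto simp: glue_in_configs[OF S]\<close>, auto simp: glue_def)
    then show "(case p of (\<xi>, \<eta>) \<Rightarrow> wt \<xi> * wt \<eta> * F \<xi> \<eta>) = (\<lambda>(\<zeta>,\<zeta>'). wt \<zeta> * wt \<zeta>' * F \<zeta> \<zeta>) (?h p)"
      using w by simp
  qed simp
  also have "\<dots> = (\<Sum>(\<zeta>,\<zeta>')\<in>\<Omega> \<times> \<Omega>. wt \<zeta> * wt \<zeta>' * F \<zeta> \<zeta>)"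
    by (rule sum.reindex_bij_betw[OF bij])
  also have "\<dots> = ex (\<lambda>\<zeta>. F \<zeta> \<zeta> * (\<Sum>\<zeta>'\<in>\<Omega>. wt \<zeta>'))"
    by (simp add: ex_def sum.cartesian_product[symmetric] sum_distrib_left mult_ac)
  finally show ?thesis by (simp add: wt_sum)
qed

definition saturation :: "'d site set \<Rightarrow> 'd site set"
  where "saturation A = {x. \<exists>a\<in>A. site_cong n x a}"

lemma nperiodic_saturation: "nperiodic n (\<lambda>x. x \<in> saturation A)"
  unfolding nperiodic_def saturation_def mem_Collect_eq
  by (intro allI impI iffI) (meson site_cong_sym site_cong_trans)+

lemma ex_indep:
  assumes X: "depends_on n X A" and Y: "depends_on n Y B"
    and AB: "\<And>a b. a \<in> A \<Longrightarrow> b \<in> B \<Longrightarrow> \<not> site_cong n a b"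
  shows "ex (\<lambda>\<eta>. X \<eta> * Y \<eta>) = ex X * ex Y"
proof -
  have "ex (\<lambda>\<eta>. X \<eta> * Y \<eta>) = ex (\<lambda>\<xi>. ex (\<lambda>\<eta>. X \<xi> * Y \<eta>))"
  proof (rule ex_diagonal[OF nperiodic_saturation[of A]])
    fix \<xi> \<xi>' \<eta> \<eta>' assume h: "\<xi> \<in> \<Omega>" "\<xi>' \<in> \<Omega>" "\<eta> \<in> \<Omega>" "\<eta>' \<in> \<Omega>"
      "\<And>x. x \<in> saturation A \<Longrightarrow> \<xi> x = \<xi>' x" "\<And>x. x \<notin> saturation A \<Longrightarrow> \<eta> x = \<eta>' x"
    have "X \<xi> = X \<xi>'" by (rule depends_onD[OF X h(1,2)]) (rule h(5), auto simp: saturation_def)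
    moreover have "Y \<eta> = Y \<eta>'"
      by (rule depends_onD[OF Y h(3,4)]) (rule h(6), use AB in \<open>auto simp: saturation_def dest: site_cong_sym\<close>)
    ultimately show "X \<xi> * Y \<eta> = X \<xi>' * Y \<eta>'" by simp
  qed
  then show ?thesis by (simp add: ex_cmult ex_cmult_right)
qed

lemma ex_indep_prod:
  assumes "finite I" "\<And>i. i \<in> I \<Longrightarrow> depends_on n (X i) (A i)"
    and "\<And>i j a b. i \<in> I \<Longrightarrow> j \<in> I \<Longrightarrow> i \<noteq> j \<Longrightarrow> a \<in> A i \<Longrightarrow> b \<in> A j \<Longrightarrow> \<not> site_cong n a b"
  shows "ex (\<lambda>\<eta>. \<Prod>i\<in>I. X i \<eta>) = (\<Prod>i\<in>I. ex (X i))"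
  using assms
proof (induction I rule: finite_induct)
  case (insert i I)
  have d: "depends_on n (\<lambda>\<eta>. \<Prod>j\<in>I. X j \<eta>) (\<Union>j\<in>I. A j)"
    by (rule depends_on_prod) (rule depends_on_mono[OF insert.prems(1)], auto)
  have "ex (\<lambda>\<eta>. X i \<eta> * (\<Prod>j\<in>I. X j \<eta>)) = ex (X i) * ex (\<lambda>\<eta>. \<Prod>j\<in>I. X j \<eta>)"
    by (rule ex_indep[OF insert.prems(1) d], simp) (metis UN_E insertCI insert.hyps(2) insert.prems(2))
  also have "ex (\<lambda>\<eta>. \<Prod>j\<in>I. X j \<eta>) = (\<Prod>j\<in>I. ex (X j))"
    by (rule insert.IH, rule insert.prems, simp, rule insert.prems(2), simp_all)
  finally show ?case using insert.hyps by simp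
qed simp

lemma ex_marginal: "ex (\<lambda>\<eta>. F (\<eta> z)) = u z * F True + (1 - u z) * F False"
proof -
  let ?w = "\<lambda>x b. (if b then u x else 1 - u x) * (if x = tmod n z then F b else 1)"
  have "ex (\<lambda>\<eta>. F (\<eta> z)) = (\<Sum>\<eta>\<in>\<Omega>. \<Prod>x\<in>torus n. ?w x (\<eta> x))"
    unfolding ex_def wt_def prod.distrib
    by (intro sum.cong refl) (simp add: torus_configs_iff nperiodic_tmod)
  also have "\<dots> = (\<Prod>x\<in>torus n. ?w x True + ?w x False)"
    by (rule sum_configs_prod[OF n_pos])
  also have "\<dots> = (\<Prod>x\<in>torus n. if x = tmod n z then u z * F True + (1 - u z) * F False else 1)"
    by (intro prod.cong refl) (auto simp: nperiodic_tmod[OF u_periodic])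
  also have "\<dots> = u z * F True + (1 - u z) * F False"
    by simp
  finally show ?thesis .
qed

definition site_avg :: "'d site \<Rightarrow> ('d config \<Rightarrow> real) \<Rightarrow> 'd config \<Rightarrow> real"
  where "site_avg z X \<eta> = u z * X (upd n z True \<eta>) + (1 - u z) * X (upd n z False \<eta>)"

lemma ex_site_avg: "ex (site_avg z X) = ex X"
proof -
  have "ex X = ex (\<lambda>\<eta>. X (upd n z (\<eta> z) \<eta>))"
    by (rule ex_cong) (simp add: upd_same)
  also have "\<dots> = ex (\<lambda>\<xi>. ex (\<lambda>\<eta>. X (upd n z (\<xi> z) \<eta>)))"
  proof (rule ex_diagonal[OF nperiodic_saturation[of "{z}"]])
    fix \<xi> \<xi>' \<eta> \<eta>' :: "'d config" assume h: "\<xi> \<in> \<Omega>" "\<xi>' \<in> \<Omega>" "\<eta> \<in> \<Omega>" "\<eta>' \<in> \<Omega>"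
      "\<And>x. x \<in> saturation {z} \<Longrightarrow> \<xi> x = \<xi>' x" "\<And>x. x \<notin> saturation {z} \<Longrightarrow> \<eta> x = \<eta>' x"
    have "upd n z (\<xi> z) \<eta> = upd n z (\<xi>' z) \<eta>'"
      using h(5,6) by (auto simp: upd_def fun_eq_iff saturation_def)
    then show "X (upd n z (\<xi> z) \<eta>) = X (upd n z (\<xi>' z) \<eta>')" by simp
  qed
  also have "\<dots> = ex (site_avg z X)"
    by (subst ex_marginal) (simp add: site_avg_def[abs_def] ex_add ex_cmult)
  finally show ?thesis ..
qed

end

section \<open>Exponential moments of sums of local functions\<close>

text \<open>Keeping the linear term apart makes it vanish under a centred law, which leaves the
  subgaussian bound \<open>exp (B\<^sup>2)\<close> for the Laplace transform of a variable bounded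
  by \<open>B\<close>.\<close>

lemma exp_le_add_exp_square: "exp x \<le> x + exp (x\<^sup>2)" for x :: real
proof -
  have e: "1 + x\<^sup>2 \<le> exp (x\<^sup>2)" by simp
  consider "x \<le> 0" | "0 \<le> x" "x \<le> 1" | "1 \<le> x" by linarith
  then show ?thesis
  proof cases
    case 1
    have "exp x * (1 - x) \<le> exp x * exp (- x)"
      using exp_ge_add_one_self[of "- x"] by (intro mult_left_mono) auto
    also have "\<dots> = 1" by (simp flip: exp_add)
    also have "1 \<le> (1 + x + x\<^sup>2) * (1 - x)"
      using 1 by (simp add: algebra_simps power2_eq_square mult_nonneg_nonpos mult_le_0_iff)
    finally have "exp x \<le> 1 + x + x\<^sup>2"
      using 1 by (simp add: mult_le_cancel_right)
    then show ?thesis using e by linarith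
  next
    case 2
    then show ?thesis using exp_bound[of x] e by linarith
  next
    case 3
    then have "x \<le> x\<^sup>2" by (simp add: power2_eq_square)
    then have "exp x \<le> exp (x\<^sup>2)" by simp
    then show ?thesis using 3 by linarith
  qed
qed

lemma power_le_fact_exp:
  assumes "0 \<le> x" shows "x ^ k \<le> fact k * exp (x :: real)"
proof -
  have "(\<lambda>i. x ^ i /\<^sub>R fact i) sums exp x" by (rule exp_converges)
  then have "(\<Sum>i\<in>{k}. x ^ i /\<^sub>R fact i) \<le> exp x"
    by (subst sums_unique, assumption, intro sum_le_suminf) (use assms in \<open>auto simp: sums_iff\<close>)
  then show ?thesis by (simp add: field_simps)
qed

lemma fact_double_le: "fact (2 * k) \<le> (fact k :: real) * (2 * real k) ^ k"
proof -
  have "fact (2 * k) = (fact k :: real) * (\<Prod>i\<in>{Suc k..2 * k}. real i)"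
  proof -
    have "fact (2 * k) = (\<Prod>i\<in>{1..2 * k}. real i)" by (simp add: fact_prod)
    also have "{1..2 * k} = {1..k} \<union> {Suc k..2 * k}" by auto
    also have "(\<Prod>i\<in>\<dots>. real i) = (\<Prod>i\<in>{1..k}. real i) * (\<Prod>i\<in>{Suc k..2 * k}. real i)"
      by (rule prod.union_disjoint) auto
    finally show ?thesis by (simp add: fact_prod)
  qed
  also have "\<dots> \<le> fact k * (\<Prod>i\<in>{Suc k..2 * k}. 2 * real k)"
    by (intro mult_left_mono prod_mono) auto
  finally show ?thesis by simp
qed

text \<open>Where \<open>M i\<close> does not divide \<open>n\<close>, the points stop early, so
  that the gap across the boundary of the torus is at least \<open>M i\<close> as well.\<close>

definition spaced :: "nat \<Rightarrow> ('d::finite \<Rightarrow> nat) \<Rightarrow> 'd site set"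
  where "spaced n M = {x. \<forall>i. \<exists>k < n div M i. x $ i = int (M i * k)}"

lemma spaced_bij:
  assumes "\<And>i. 1 \<le> M i"
  shows "bij_betw (\<lambda>g. \<chi> i. int (M i * g i)) (PiE (UNIV::'d::finite set) (\<lambda>i. {0..<n div M i})) (spaced n M)"
proof (intro bij_betwI[where g = "\<lambda>x i. nat (x $ i) div M i"])
  have M: "M i \<noteq> 0" for i using assms[of i] by simp
  show "(\<lambda>g. \<chi> i. int (M i * g i)) \<in> PiE UNIV (\<lambda>i. {0..<n div M i}) \<rightarrow> spaced n M"
    by (auto simp: spaced_def PiE_def Pi_def)
  show "(\<lambda>x i. nat (x $ i) div M i) \<in> spaced n M \<rightarrow> PiE UNIV (\<lambda>i. {0..<n div M i})"
  proof (intro funcsetI PiE_I)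
    fix x :: "'d site" and i assume "x \<in> spaced n M"
    then obtain k where "k < n div M i" "x $ i = int (M i * k)" unfolding spaced_def by blast
    then show "nat (x $ i) div M i \<in> {0..<n div M i}" using M[of i] by (simp add: nat_mult_distrib)
  qed auto
  fix x :: "'d site" assume x: "x \<in> spaced n M"
  have "int (M i * (nat (x $ i) div M i)) = x $ i" for i
  proof -
    obtain k where "k < n div M i" "x $ i = int (M i * k)" using x unfolding spaced_def by blast
    then show ?thesis using M[of i] by (simp add: nat_mult_distrib)
  qed
  then show "(\<chi> i. int (M i * (nat (x $ i) div M i))) = x" by (simp add: vec_eq_iff)
next
  fix g assume "g \<in> PiE (UNIV :: 'd set) (\<lambda>i. {0..<n div M i})"
  show "(\<lambda>i. nat ((\<chi> i. int (M i * g i)) $ i) div M i) = g"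
    using assms by (auto simp: fun_eq_iff nat_mult_distrib Suc_le_eq)
qed

lemma finite_spaced: "(\<And>i. 1 \<le> M i) \<Longrightarrow> finite (spaced n (M :: 'd::finite \<Rightarrow> nat))"
  using bij_betw_finite[OF spaced_bij] by (metis finite finite_PiE finite_atLeastLessThan)

lemma card_spaced: "(\<And>i. 1 \<le> M i) \<Longrightarrow> card (spaced n (M :: 'd::finite \<Rightarrow> nat)) = (\<Prod>i\<in>UNIV. n div M i)"
  using bij_betw_same_card[OF spaced_bij] by (metis (no_types, lifting) card_PiE card_atLeastLessThan diff_zero finite prod.cong)

lemma spaced_subset_torus:
  assumes M: "\<And>i. 1 \<le> M i"
  shows "spaced n M \<subseteq> torus n"
proof
  fix x :: "'a site" assume x: "x \<in> spaced n M"
  have "0 \<le> x $ i \<and> x $ i < int n" for i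
  proof -
    obtain k where k: "k < n div M i" "x $ i = int (M i * k)" using x unfolding spaced_def by blast
    have "M i * (k + 1) \<le> M i * (n div M i)" using k(1) by (intro mult_left_mono) auto
    also have "\<dots> \<le> n" by simp
    finally have "M i * k < n" using M[of i] by simp
    then have "int (M i * k) < int n" by (simp only: of_nat_less_iff)
    then show ?thesis unfolding k(2) by simp
  qed
  then show "x \<in> torus n" by (simp add: torus_def)
qed

text \<open>Boxes of sides \<open>M i\<close> attached to the points of the sublattice are
  disjoint modulo \<open>n\<close>: two points differ by at least \<open>M i\<close> and by at
  most \<open>n - M i\<close> in some direction.\<close>

lemma spaced_separated:
  assumes x: "x \<in> spaced n M" and x': "x' \<in> spaced n M" and ne: "x \<noteq> x'"
    and v: "\<And>i. lo i \<le> v $ i \<and> v $ i < lo i + int (M i)"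
    and w: "\<And>i. lo i \<le> w $ i \<and> w $ i < lo i + int (M i)"
  shows "\<not> site_cong n (x + v) (x' + w)"
proof
  assume c: "site_cong n (x + v) (x' + w)"
  obtain i where i: "x $ i \<noteq> x' $ i" using ne by (auto simp: vec_eq_iff)
  obtain k where k: "k < n div M i" "x $ i = int (M i * k)" using x unfolding spaced_def by blast
  obtain k' where k': "k' < n div M i" "x' $ i = int (M i * k')" using x' unfolding spaced_def by blast
  define m where "m = int (M i)"
  have m: "m > 0" using i k k' by (cases "M i = 0") (auto simp: m_def)
  define q where "q = int (n div M i)"
  have q: "m * q \<le> int n" unfolding m_def q_def by (metis of_nat_le_iff of_nat_mult times_div_less_eq_dividend)
  define j where "j = int k - int k'"
  have j: "j \<noteq> 0" "\<bar>j\<bar> \<le> q - 1" using i k k' by (auto simp: j_def q_def)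
  have d: "x $ i - x' $ i = m * j" by (simp add: k k' m_def j_def algebra_simps)
  have "1 \<le> \<bar>j\<bar>" using j by linarith
  then have 1: "m \<le> \<bar>m * j\<bar>" using m by (simp add: abs_mult mult_le_cancel_left1)
  have "m * \<bar>j\<bar> \<le> m * (q - 1)" using j m by (intro mult_left_mono) auto
  then have 2: "\<bar>m * j\<bar> \<le> int n - m" using q m by (simp add: abs_mult algebra_simps)
  have 3: "\<bar>v $ i - w $ i\<bar> < m" using v[of i] w[of i] by (simp add: m_def abs_less_iff)
  have dv: "int n dvd (x $ i - x' $ i) + (v $ i - w $ i)"
    using c unfolding site_cong_iff_diff by (simp add: algebra_simps)
  have "(x $ i - x' $ i) + (v $ i - w $ i) \<noteq> 0" "\<bar>(x $ i - x' $ i) + (v $ i - w $ i)\<bar> < int n"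
    using 1 2 3 unfolding d by linarith+
  then show False using dv by (meson zdvd_not_zless dvd_abs_iff zero_less_abs_iff)
qed

lemma div_lower_half:
  assumes "1 \<le> m" "m \<le> n" shows "real n / (2 * real m) \<le> real (n div m)"
proof -
  have "1 \<le> n div m" using assms by (simp add: Suc_le_eq div_greater_zero_iff)
  then have "m * 1 \<le> m * (n div m)" by (rule mult_left_mono) simp
  moreover have "n = m * (n div m) + n mod m" "n mod m < m" using assms by auto
  ultimately have "n \<le> 2 * (m * (n div m))" by linarith
  then have "n \<le> 2 * (n div m) * m" by (simp only: mult_ac)
  then have "real n \<le> real (2 * (n div m) * m)" by (rule of_nat_mono)
  then show ?thesis using assms by (simp add: field_simps)
qed

context torus_profile
begin

text \<open>Jensen's inequality: the exponential of an average is at most the average of the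
  exponentials, hence at most the largest of their bounds.\<close>

lemma ex_exp_avg:
  assumes "finite S" "S \<noteq> {}" "\<And>s. s \<in> S \<Longrightarrow> ex (\<lambda>\<eta>. exp (Y s \<eta>)) \<le> exp (B s)"
  shows "\<exists>s\<in>S. ex (\<lambda>\<eta>. exp ((\<Sum>s\<in>S. Y s \<eta>) / card S)) \<le> exp (B s)"
proof -
  let ?c = "1 / real (card S)"
  have c: "card S > 0" using assms by (simp add: card_gt_0_iff)
  have "exp ((\<Sum>s\<in>S. Y s \<eta>) / card S) \<le> (\<Sum>s\<in>S. ?c * exp (Y s \<eta>))" for \<eta>
  proof -
    have "exp (\<Sum>s\<in>S. ?c *\<^sub>R Y s \<eta>) \<le> (\<Sum>s\<in>S. ?c * exp (Y s \<eta>))"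
      by (rule convex_on_sum[OF assms(1,2) exp_convex]) (use c in auto)
    then show ?thesis by (simp add: sum_divide_distrib)
  qed
  then have "ex (\<lambda>\<eta>. exp ((\<Sum>s\<in>S. Y s \<eta>) / card S)) \<le> ex (\<lambda>\<eta>. \<Sum>s\<in>S. ?c * exp (Y s \<eta>))"
    by (rule ex_mono)
  also have "\<dots> = (\<Sum>s\<in>S. ?c * ex (\<lambda>\<eta>. exp (Y s \<eta>)))" by (simp only: ex_sum ex_cmult)
  also have "\<dots> \<le> (\<Sum>s\<in>S. ?c * exp (B s))" by (intro sum_mono mult_left_mono assms(3)) auto
  finally have le: "ex (\<lambda>\<eta>. exp ((\<Sum>s\<in>S. Y s \<eta>) / card S)) \<le> (\<Sum>s\<in>S. ?c * exp (B s))" .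
  obtain s where s: "s \<in> S" "\<And>t. t \<in> S \<Longrightarrow> B t \<le> B s"
  proof -
    have "Max (B ` S) \<in> B ` S" using assms(1,2) by (intro Max_in) auto
    then obtain s where "s \<in> S" "B s = Max (B ` S)" by (metis imageE)
    then show thesis using that assms(1) by (metis Max_ge finite_imageI imageI)
  qed
  have "(\<Sum>s\<in>S. ?c * exp (B s)) \<le> (\<Sum>t\<in>S. ?c * exp (B s))"
    by (intro sum_mono mult_left_mono) (use s in auto)
  also have "\<dots> = exp (B s)" using c by simp
  finally show ?thesis using le s(1) by (meson order_trans)
qed

text \<open>Sums of translates of a local function are averages, over the translations of the torus, of
  sums over a sublattice along which the summands are independent. Jensen's inequality then
  replaces the usual Hoelder inequality over residue classes, whether or not the spacing divides \<open>n\<close>.\<close>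

lemma ex_exp_block:
  fixes X :: "'d site \<Rightarrow> 'd config \<Rightarrow> real"
  assumes per: "\<And>\<eta>. \<eta> \<in> \<Omega> \<Longrightarrow> nperiodic n (\<lambda>y. X y \<eta>)"
    and dep: "\<And>y. depends_on n (X y) ((+) y ` R)"
    and R: "\<And>w i. w \<in> R \<Longrightarrow> lo i \<le> w $ i \<and> w $ i < lo i + int (M i)"
    and M: "\<And>i. 1 \<le> M i" "\<And>i. M i \<le> n"
    and b: "\<And>y. ex (\<lambda>\<eta>. exp ((\<Prod>i\<in>UNIV. real n / real (n div M i)) * X y \<eta>)) \<le> exp (b y)"
  shows "\<exists>s. ex (\<lambda>\<eta>. exp (\<Sum>y\<in>torus n. X y \<eta>)) \<le> exp (\<Sum>y\<in>spaced n M. b (y + s))"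
proof -
  let ?N = "\<Prod>i\<in>UNIV. real n / real (n div M i)"
  let ?C = "spaced n M"
  have q: "n div M i > 0" for i using M[of i] by (simp add: div_greater_zero_iff)
  have N: "?N * real (card ?C) = real (card (torus n :: 'd site set))"
    using q by (simp add: card_spaced[OF M(1)] card_torus prod_dividef)
  have avg: "(\<Sum>y\<in>torus n. X y \<eta>) = (\<Sum>s\<in>torus n. ?N * (\<Sum>y\<in>?C. X (y + s) \<eta>)) / real (card (torus n :: 'd site set))" if "\<eta> \<in> \<Omega>" for \<eta>
  proof -
    have p: "nperiodic n (\<lambda>y. X y \<eta>)" using per[OF that] .
    have "(\<Sum>s\<in>torus n. ?N * (\<Sum>y\<in>?C. X (y + s) \<eta>)) = ?N * (\<Sum>y\<in>?C. \<Sum>s\<in>torus n. X (s + y) \<eta>)"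
      by (simp add: sum_distrib_left sum.swap[of _ "torus n"] add.commute)
    also have "\<dots> = ?N * (\<Sum>y\<in>?C. \<Sum>s\<in>torus n. X s \<eta>)"
      by (simp only: sum_torus_shift[OF n_pos p])
    also have "\<dots> = real (card (torus n :: 'd site set)) * (\<Sum>s\<in>torus n. X s \<eta>)"
      using N by simp
    finally show ?thesis by (simp add: card_torus)
  qed
  have "\<exists>s\<in>torus n. ex (\<lambda>\<eta>. exp ((\<Sum>s\<in>torus n. ?N * (\<Sum>y\<in>?C. X (y + s) \<eta>)) / real (card (torus n :: 'd site set))))
      \<le> exp (\<Sum>y\<in>?C. b (y + s))"
  proof (rule ex_exp_avg)
    fix s :: "'d site"
    have "ex (\<lambda>\<eta>. exp (?N * (\<Sum>y\<in>?C. X (y + s) \<eta>))) = ex (\<lambda>\<eta>. \<Prod>y\<in>?C. exp (?N * X (y + s) \<eta>))"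
      by (simp add: sum_distrib_left exp_sum finite_spaced[OF M(1)])
    also have "\<dots> = (\<Prod>y\<in>?C. ex (\<lambda>\<eta>. exp (?N * X (y + s) \<eta>)))"
    proof (rule ex_indep_prod[OF finite_spaced[OF M(1)], where A = "\<lambda>y. (+) (y + s) ` R"])
      fix y y' a b' assume h: "y \<in> ?C" "y' \<in> ?C" "y \<noteq> y'" "a \<in> (+) (y + s) ` R" "b' \<in> (+) (y' + s) ` R"
      obtain v w where vw: "v \<in> R" "w \<in> R" "a = y + s + v" "b' = y' + s + w" using h by auto
      have "\<not> site_cong n (y + v) (y' + w)" by (rule spaced_separated[OF h(1-3) R[OF vw(1)] R[OF vw(2)]])
      then have "\<not> site_cong n (y + v + s) (y' + w + s)" by simp
      then show "\<not> site_cong n a b'" by (simp add: vw ac_simps)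
    qed (rule depends_on_comp[OF dep])
    also have "\<dots> \<le> (\<Prod>y\<in>?C. exp (b (y + s)))"
      by (intro prod_mono conjI b ex_nonneg) auto
    finally show "ex (\<lambda>\<eta>. exp (?N * (\<Sum>y\<in>?C. X (y + s) \<eta>))) \<le> exp (\<Sum>y\<in>?C. b (y + s))"
      by (simp add: exp_sum finite_spaced[OF M(1)])
  qed (use torus_nonempty[OF n_pos] in auto)
  moreover have "ex (\<lambda>\<eta>. exp (\<Sum>y\<in>torus n. X y \<eta>))
    = ex (\<lambda>\<eta>. exp ((\<Sum>s\<in>torus n. ?N * (\<Sum>y\<in>?C. X (y + s) \<eta>)) / real (card (torus n :: 'd site set))))"
    by (rule ex_cong) (simp only: avg)
  ultimately show ?thesis by auto
qed

lemma ex_exp_single: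
  assumes "\<And>\<eta>. \<eta> \<in> \<Omega> \<Longrightarrow> \<bar>X \<eta>\<bar> \<le> B" "ex X = 0"
  shows "ex (\<lambda>\<eta>. exp (X \<eta>)) \<le> exp (B\<^sup>2)"
proof -
  have "ex (\<lambda>\<eta>. exp (X \<eta>)) \<le> ex (\<lambda>\<eta>. X \<eta> + exp (B\<^sup>2))"
  proof (rule ex_mono)
    fix \<eta> assume "\<eta> \<in> \<Omega>"
    then have "(X \<eta>)\<^sup>2 \<le> B\<^sup>2" using assms(1) by (metis abs_le_square_iff abs_ge_zero abs_of_nonneg order_trans)
    then show "exp (X \<eta>) \<le> X \<eta> + exp (B\<^sup>2)"
      using exp_le_add_exp_square[of "X \<eta>"] by (smt (verit) exp_le_cancel_iff)
  qed
  then show ?thesis using assms(2) by (simp add: ex_add)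
qed

end

text \<open>The model is the family of translates of one local function, but the functions may vary with
  the site, as the profile does.\<close>

definition local_family :: "nat \<Rightarrow> 'd::finite site set \<Rightarrow> real \<Rightarrow> ('d site \<Rightarrow> 'd config \<Rightarrow> real) \<Rightarrow> bool"
  where "local_family n A B \<phi> \<longleftrightarrow> (\<forall>\<eta>\<in>torus_configs n. nperiodic n (\<lambda>x. \<phi> x \<eta>)) \<and>
    (\<forall>x. depends_on n (\<phi> x) ((+) x ` A)) \<and> (\<forall>x. \<forall>\<eta>\<in>torus_configs n. \<bar>\<phi> x \<eta>\<bar> \<le> B)"

lemma local_familyD:
  assumes "local_family n A B \<phi>"
  shows "\<eta> \<in> torus_configs n \<Longrightarrow> nperiodic n (\<lambda>x. \<phi> x \<eta>)" "depends_on n (\<phi> x) ((+) x ` A)" "\<eta> \<in> torus_configs n \<Longrightarrow> \<bar>\<phi> x \<eta>\<bar> \<le> B"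
  using assms by (auto simp: local_family_def)

lemma local_family_mono: "local_family n A B \<phi> \<Longrightarrow> B \<le> B' \<Longrightarrow> local_family n A B' \<phi>"
  unfolding local_family_def by (meson order_trans)

lemma local_family_bound_nonneg: "local_family n A B \<phi> \<Longrightarrow> 0 \<le> B"
  using local_familyD(3) torus_configs_nonempty by (metis abs_ge_zero all_not_in_conv order_trans)

context torus_profile
begin

text \<open>The summands are bounded and centred, and independent along a sublattice of spacing
  \<open>2 * D + 1\<close>. Jensen's inequality multiplies each of them by \<open>n ^ d\<close>
  over the number of points of that sublattice, at most \<open>(4 * D + 2) ^ d\<close>, and this
  factor enters squared.\<close>

lemma ex_exp_linear:
  assumes \<phi>: "local_family n A B \<phi>" "\<And>x. ex (\<phi> x) = 0"
    and A: "offset_bound A D" "2 * D + 1 \<le> n" and a: "nperiodic n a"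
  shows "ex (\<lambda>\<eta>. exp (\<Sum>x\<in>torus n. a x * \<phi> x \<eta>))
    \<le> exp (real (4 * D + 2) ^ (2 * CARD('d)) * B\<^sup>2 * (\<Sum>x\<in>torus n. (a x)\<^sup>2))"
proof -
  let ?M = "\<lambda>i::'d. 2 * D + 1"
  let ?N = "\<Prod>i\<in>(UNIV::'d set). real n / real (n div ?M i)"
  let ?K = "real (4 * D + 2) ^ CARD('d)"
  have "real n / real (n div ?M i) \<le> real (4 * D + 2)" for i :: 'd
  proof -
    have "n div ?M i > 0" using A(2) by (simp add: div_greater_zero_iff)
    then show ?thesis using div_lower_half[of "?M i" n] A(2) by (simp add: field_simps)
  qed
  then have N: "?N \<le> ?K" using prod_mono[of UNIV "\<lambda>i::'d. real n / real (n div ?M i)" "\<lambda>_. real (4 * D + 2)"] by simp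
  have N0: "0 \<le> ?N" by (intro prod_nonneg) auto
  let ?b = "\<lambda>x. ?K\<^sup>2 * B\<^sup>2 * (a x)\<^sup>2"
  have "\<exists>s. ex (\<lambda>\<eta>. exp (\<Sum>y\<in>torus n. a y * \<phi> y \<eta>)) \<le> exp (\<Sum>y\<in>spaced n ?M. ?b (y + s))"
  proof (rule ex_exp_block[where R = A and lo = "\<lambda>_. - int D"])
    show "nperiodic n (\<lambda>y. a y * \<phi> y \<eta>)" if "\<eta> \<in> \<Omega>" for \<eta>
      by (rule nperiodic_comp2[OF a local_familyD(1)[OF \<phi>(1) that]])
    show "depends_on n (\<lambda>\<eta>. a y * \<phi> y \<eta>) ((+) y ` A)" for y
      by (rule depends_on_comp[OF local_familyD(2)[OF \<phi>(1)]])
    show "- int D \<le> w $ i \<and> w $ i < - int D + int (?M i)" if "w \<in> A" for w i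
      using A(1) that unfolding offset_bound_def by (auto simp: abs_le_iff dest!: bspec spec[of _ i])
    show "ex (\<lambda>\<eta>. exp (?N * (a y * \<phi> y \<eta>))) \<le> exp (?b y)" for y
    proof -
      have "ex (\<lambda>\<eta>. exp (?N * (a y * \<phi> y \<eta>))) \<le> exp ((?N * \<bar>a y\<bar> * B)\<^sup>2)"
      proof (rule ex_exp_single)
        fix \<eta> assume "\<eta> \<in> \<Omega>"
        then have "\<bar>\<phi> y \<eta>\<bar> \<le> B" by (rule local_familyD(3)[OF \<phi>(1)])
        then show "\<bar>?N * (a y * \<phi> y \<eta>)\<bar> \<le> ?N * \<bar>a y\<bar> * B"
          using N0 by (simp add: abs_mult mult.assoc mult_left_mono)
      qed (simp add: ex_cmult \<phi>(2))
      also have "(?N * \<bar>a y\<bar> * B)\<^sup>2 \<le> ?b y"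
      proof -
        have "(?N * \<bar>a y\<bar> * B)\<^sup>2 = ?N\<^sup>2 * (B\<^sup>2 * (a y)\<^sup>2)" by (simp only: power_mult_distrib power2_abs mult_ac)
        also have "\<dots> \<le> ?K\<^sup>2 * (B\<^sup>2 * (a y)\<^sup>2)" by (intro mult_right_mono power_mono N N0) auto
        finally show ?thesis by (simp only: mult_ac)
      qed
      finally show ?thesis by simp
    qed
  qed (use A in auto)
  then obtain s where s: "ex (\<lambda>\<eta>. exp (\<Sum>y\<in>torus n. a y * \<phi> y \<eta>)) \<le> exp (\<Sum>y\<in>spaced n ?M. ?b (y + s))" ..
  have "(\<Sum>y\<in>spaced n ?M. ?b (y + s)) \<le> (\<Sum>y\<in>torus n. ?b (y + s))"
    by (rule sum_mono2) (use spaced_subset_torus[of ?M] in auto)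
  also have "\<dots> = (\<Sum>y\<in>torus n. ?b y)"
    by (rule sum_torus_shift[OF n_pos nperiodic_comp[OF a, of "\<lambda>t. ?K\<^sup>2 * B\<^sup>2 * t\<^sup>2"]])
  also have "\<dots> = real (4 * D + 2) ^ (2 * CARD('d)) * B\<^sup>2 * (\<Sum>x\<in>torus n. (a x)\<^sup>2)"
    by (simp add: sum_distrib_left power_mult[symmetric] mult.commute[of 2])
  finally show ?thesis using s by (meson exp_le_cancel_iff order_trans)
qed

text \<open>A subgaussian variable has a finite exponential moment of its square; the moments of even
  order are read off from the Laplace transform at the optimal point.\<close>

lemma ex_exp_square:
  assumes h: "\<And>l. ex (\<lambda>\<eta>. exp (l * h \<eta>)) \<le> exp (l\<^sup>2 * A)" and A: "0 < A"
    and \<theta>: "0 \<le> \<theta>" "20 * \<theta> * A \<le> 1"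
  shows "ex (\<lambda>\<eta>. exp (\<theta> * (h \<eta>)\<^sup>2)) \<le> 2"
proof -
  let ?m = "\<lambda>k. ex (\<lambda>\<eta>. (\<theta> * (h \<eta>)\<^sup>2) ^ k / fact k)"
  have s: "?m sums ex (\<lambda>\<eta>. exp (\<theta> * (h \<eta>)\<^sup>2))"
    unfolding ex_def
  proof (intro sums_sum sums_mult)
    fix \<eta> show "(\<lambda>k. (\<theta> * (h \<eta>)\<^sup>2) ^ k / fact k) sums exp (\<theta> * (h \<eta>)\<^sup>2)"
      using exp_converges[of "\<theta> * (h \<eta>)\<^sup>2"] by (simp add: divide_real_def mult.commute)
  qed
  have bound: "?m k \<le> 2 * (3/10) ^ k - of_bool (k = 0)" for k
  proof (cases "k = 0")
    case False
    \<comment> \<open>This \<open>l\<close> minimises \<open>exp (l\<^sup>2 * A) / l ^ (2 * k)\<close>, the bound for the moment of order \<open>2 * k\<close>.\<close>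
    define l where "l = sqrt (real k / A)"
    have l: "l > 0" "l\<^sup>2 = real k / A" using False A by (auto simp: l_def)
    have mom: "ex (\<lambda>\<eta>. (h \<eta>) ^ (2 * k)) \<le> 2 * fact (2 * k) * (A / k) ^ k * exp (real k)"
    proof -
      have "(l * h \<eta>) ^ (2 * k) \<le> fact (2 * k) * (exp (l * h \<eta>) + exp (- l * h \<eta>))" for \<eta>
      proof -
        have "(l * h \<eta>) ^ (2 * k) = \<bar>l * h \<eta>\<bar> ^ (2 * k)" by (simp add: power_mult)
        also have "\<dots> \<le> fact (2 * k) * exp \<bar>l * h \<eta>\<bar>" by (rule power_le_fact_exp) simp
        also have "\<dots> \<le> fact (2 * k) * (exp (l * h \<eta>) + exp (- l * h \<eta>))"
          by (intro mult_left_mono) (auto simp: abs_if)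
        finally show ?thesis .
      qed
      then have "ex (\<lambda>\<eta>. l ^ (2 * k) * (h \<eta>) ^ (2 * k)) \<le> ex (\<lambda>\<eta>. fact (2 * k) * (exp (l * h \<eta>) + exp (- l * h \<eta>)))"
        by (intro ex_mono) (simp add: power_mult_distrib)
      also have "\<dots> \<le> fact (2 * k) * (exp (l\<^sup>2 * A) + exp (l\<^sup>2 * A))"
        unfolding ex_cmult ex_add using h[of l] h[of "- l"] by (intro mult_left_mono add_mono) auto
      also have "l\<^sup>2 * A = real k" using A by (simp add: l(2))
      finally have *: "l ^ (2 * k) * ex (\<lambda>\<eta>. (h \<eta>) ^ (2 * k)) \<le> 2 * fact (2 * k) * exp (real k)"
        by (simp add: ex_cmult)
      have "l ^ (2 * k) = (real k / A) ^ k" by (simp add: power_mult l(2))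
      then have "ex (\<lambda>\<eta>. (h \<eta>) ^ (2 * k)) = (A / k) ^ k * (l ^ (2 * k) * ex (\<lambda>\<eta>. (h \<eta>) ^ (2 * k)))"
        using A False by (simp add: power_mult_distrib[symmetric] mult.assoc[symmetric])
      also have "\<dots> \<le> (A / k) ^ k * (2 * fact (2 * k) * exp (real k))"
        by (rule mult_left_mono[OF *]) (use A in auto)
      finally show ?thesis by (simp only: mult_ac)
    qed
    have "?m k = \<theta> ^ k / fact k * ex (\<lambda>\<eta>. (h \<eta>) ^ (2 * k))"
      by (simp add: ex_cmult[symmetric] power_mult_distrib power_mult)
    also have "\<dots> \<le> \<theta> ^ k / fact k * (2 * (fact k * (2 * real k) ^ k) * (A / k) ^ k * exp (real k))"
    proof (intro mult_left_mono order_trans[OF mom] mult_right_mono)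
      show "fact (2 * k) \<le> (fact k :: real) * (2 * real k) ^ k" by (rule fact_double_le)
    qed (use \<theta> A in auto)
    also have "\<dots> = 2 * (2 * exp 1 * \<theta> * A) ^ k"
      using False by (simp add: power_mult_distrib power_divide exp_of_nat_mult[of k 1, simplified])
    also have "\<dots> \<le> 2 * (3 / 10) ^ k"
    proof -
      have "exp 1 * (\<theta> * A) \<le> 3 * (\<theta> * A)" using exp_le \<theta> A by (intro mult_right_mono) auto
      then have "2 * exp 1 * \<theta> * A \<le> 3 / 10" using \<theta> by (simp add: mult.assoc)
      then show ?thesis using \<theta> A by (intro mult_left_mono power_mono) auto
    qed
    finally show ?thesis using False by simp
  qed simp
  have "(\<lambda>k. 2 * (3/10) ^ k - of_bool (k = 0) :: real) sums (2 * (1 / (1 - 3/10)) - 1)"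
    by (intro sums_diff sums_mult geometric_sums) (use sums_single[of 0 "\<lambda>_. 1::real"] in \<open>auto simp: of_bool_def eq_commute\<close>)
  then have "ex (\<lambda>\<eta>. exp (\<theta> * (h \<eta>)\<^sup>2)) \<le> 2 * (1 / (1 - 3/10)) - 1"
    by (rule sums_le[OF bound s])
  then show ?thesis by simp
qed

end

text \<open>A weighted sum over offsets around \<open>p\<close>, rewritten as a weighted sum over
  the sites of the torus. Since the offsets are distinct modulo \<open>n\<close>, the sum of the
  squared weights is unchanged.\<close>

lemma offsets_sum:
  fixes F g :: "'d::finite site \<Rightarrow> real" and p :: "'d site"
  assumes n: "1 \<le> n" and V: "finite V" "inj_on (tmod n) V"
  defines "b \<equiv> \<lambda>x. \<Sum>w\<in>V. g w * of_bool (site_cong n x (p - w))"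
  shows "nperiodic n F \<Longrightarrow> (\<Sum>w\<in>V. g w * F (p - w)) = (\<Sum>x\<in>torus n. b x * F x)"
    and "(\<Sum>x\<in>torus n. (b x)\<^sup>2) = (\<Sum>w\<in>V. (g w)\<^sup>2)"
    and "nperiodic n b"
proof -
  show nb: "nperiodic n b"
    unfolding nperiodic_def b_def
    by (intro allI impI sum.cong refl arg_cong2[where f = "(*)"] arg_cong[where f = of_bool] iffI)
       (meson site_cong_sym site_cong_trans)+
  show *: "(\<Sum>w\<in>V. g w * F (p - w)) = (\<Sum>x\<in>torus n. b x * F x)" if F: "nperiodic n F" for F :: "'d site \<Rightarrow> real"
  proof -
    have "(\<Sum>x\<in>torus n. b x * F x) = (\<Sum>w\<in>V. g w * (\<Sum>x\<in>torus n. of_bool (site_cong n x (p - w)) * F x))"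
      unfolding b_def sum_distrib_right sum_distrib_left by (subst sum.swap) (simp add: mult.assoc)
    then show ?thesis by (simp add: sum_torus_indicator[OF n F])
  qed
  have "b (p - w) = g w" if w: "w \<in> V" for w
  proof -
    have "b (p - w) = (\<Sum>w'\<in>V. if w' = w then g w else 0)"
      unfolding b_def
    proof (intro sum.cong refl)
      fix w' assume w': "w' \<in> V"
      have "site_cong n (p - w) (p - w') \<longleftrightarrow> w' = w"
      proof
        assume "site_cong n (p - w) (p - w')"
        from site_cong_diff[OF site_cong_refl[of n p] this] have "site_cong n w w'" by simp
        then show "w' = w" using inj_onD[OF V(2)] w w' by (simp add: site_cong_tmod)
      qed simp
      then show "g w' * of_bool (site_cong n (p - w) (p - w')) = (if w' = w then g w else 0)" by simp
    qed
    then show ?thesis using V(1) w by simp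
  qed
  then show "(\<Sum>x\<in>torus n. (b x)\<^sup>2) = (\<Sum>w\<in>V. (g w)\<^sup>2)"
    using *[OF nb] by (simp add: power2_eq_square)
qed

context torus_profile
begin

lemma ex_exp_offsets:
  assumes \<phi>: "local_family n A B \<phi>" "\<And>x. ex (\<phi> x) = 0"
    and A: "offset_bound A D" "2 * D + 1 \<le> n"
    and V: "finite V" "inj_on (tmod n) V"
  shows "ex (\<lambda>\<eta>. exp (\<Sum>w\<in>V. g w * \<phi> (p - w) \<eta>))
    \<le> exp (real (4 * D + 2) ^ (2 * CARD('d)) * B\<^sup>2 * (\<Sum>w\<in>V. (g w)\<^sup>2))"
proof -
  let ?b = "\<lambda>x. \<Sum>w\<in>V. g w * of_bool (site_cong n x (p - w))"
  have "ex (\<lambda>\<eta>. exp (\<Sum>w\<in>V. g w * \<phi> (p - w) \<eta>)) = ex (\<lambda>\<eta>. exp (\<Sum>x\<in>torus n. ?b x * \<phi> x \<eta>))"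
    by (rule ex_cong, rule arg_cong[where f = exp], rule offsets_sum(1)[OF n_pos V], rule local_familyD(1)[OF \<phi>(1)])
  then show ?thesis
    using ex_exp_linear[OF \<phi> A offsets_sum(3)[OF n_pos V, of g p]] offsets_sum(2)[OF n_pos V, of g p] by simp
qed

text \<open>The quadratic exponential moment: \<open>h y\<close> is a weighted sum of the family over a translate of the
  box of sides \<open>l\<close>, so that the \<open>h y\<close> are independent once the sites \<open>y\<close> are further apart than the
  sides of that box, enlarged by the reach of the local functions.\<close>

lemma ex_exp_sum_squares:
  fixes l :: "'d \<Rightarrow> nat"
  assumes \<phi>: "local_family n A B \<phi>" "\<And>x. ex (\<phi> x) = 0"
    and A: "offset_bound A D" "2 * D + 1 \<le> n"
    and V: "finite V" "\<forall>w\<in>V. \<forall>i. 0 \<le> w $ i \<and> w $ i < int (l i)"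
    and l: "\<And>i. 1 \<le> l i" "\<And>i. l i + 2 * D \<le> n"
    and h: "\<And>y \<eta>. h y \<eta> = (\<Sum>w\<in>V. g w * \<phi> (y - z - w) \<eta>)"
    and E: "(\<Sum>w\<in>V. (g w)\<^sup>2) \<le> E" "0 < E" and B: "0 < B"
    and \<theta>: "0 \<le> \<theta>"
      "20 * (\<theta> * (\<Prod>i\<in>UNIV. 2 * real (l i + 2 * D))) * (real (4 * D + 2) ^ (2 * CARD('d)) * B\<^sup>2 * E) \<le> 1"
  shows "ex (\<lambda>\<eta>. exp (\<theta> * (\<Sum>y\<in>torus n. (h y \<eta>)\<^sup>2))) \<le> exp (real n ^ CARD('d) / (\<Prod>i\<in>UNIV. real (l i)))"
proof -
  let ?M = "\<lambda>i. l i + 2 * D"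
  let ?N = "\<Prod>i\<in>UNIV. real n / real (n div ?M i)"
  let ?P = "\<Prod>i\<in>UNIV. 2 * real (?M i)"
  let ?K = "real (4 * D + 2) ^ (2 * CARD('d))"
  have M1: "1 \<le> ?M i" for i using l(1)[of i] by simp
  have q: "n div ?M i > 0" for i using l[of i] by (simp add: div_greater_zero_iff)
  have inj: "inj_on (tmod n) V"
  proof (rule inj_onI)
    fix w w' assume that: "w \<in> V" "w' \<in> V" "tmod n w = tmod n w'"
    have "\<bar>w $ i - w' $ i\<bar> < int n" for i
      using V(2)[rule_format, OF that(1), of i] V(2)[rule_format, OF that(2), of i] l(2)[of i] by linarith
    then show "w = w'" using that(3) by (intro site_cong_small_imp_eq[of w w' n]) (auto simp: site_cong_tmod)
  qed
  have "real n / real (n div ?M i) \<le> 2 * real (?M i)" for i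
    using div_lower_half[OF M1[of i] l(2)[of i]] q[of i] M1[of i] l(1)[of i] by (simp add: field_simps)
  then have N: "?N \<le> ?P" by (intro prod_mono) auto
  have N0: "0 \<le> ?N" by (intro prod_nonneg) auto
  have K0: "0 < ?K" by simp
  have "\<exists>s. ex (\<lambda>\<eta>. exp (\<Sum>y\<in>torus n. \<theta> * (h y \<eta>)\<^sup>2)) \<le> exp (\<Sum>y\<in>spaced n ?M. (\<lambda>_. ln 2) (y + s))"
  proof (rule ex_exp_block[where R = "\<Union>w\<in>V. (\<lambda>a. a - z - w) ` A" and lo = "\<lambda>i. - int D - z $ i - int (l i) + 1"])
    show "nperiodic n (\<lambda>y. \<theta> * (h y \<eta>)\<^sup>2)" if "\<eta> \<in> \<Omega>" for \<eta>
      unfolding nperiodic_def h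
    proof (intro allI impI arg_cong2[where f = "(*)"] arg_cong[where f = "\<lambda>t. t\<^sup>2"] sum.cong refl)
      fix x y w :: "'d site" assume "site_cong n x y"
      then have "site_cong n (x - z - w) (y - z - w)" by (intro site_cong_diff site_cong_refl)
      then show "\<phi> (x - z - w) \<eta> = \<phi> (y - z - w) \<eta>" by (rule nperiodicD[OF local_familyD(1)[OF \<phi>(1) that]])
    qed
    show "depends_on n (\<lambda>\<eta>. \<theta> * (h y \<eta>)\<^sup>2) ((+) y ` (\<Union>w\<in>V. (\<lambda>a. a - z - w) ` A))" for y
      unfolding h
    proof (intro depends_on_comp[where F = "\<lambda>t. \<theta> * t\<^sup>2"] depends_on_sum depends_on_comp[where F = "\<lambda>t. _ * t"])
      fix w assume w: "w \<in> V"
      show "depends_on n (\<phi> (y - z - w)) ((+) y ` (\<Union>w\<in>V. (\<lambda>a. a - z - w) ` A))"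
        by (rule depends_on_mono[OF local_familyD(2)[OF \<phi>(1)]]) (use w in \<open>force simp: image_iff algebra_simps\<close>)
    qed
    show "- int D - z $ i - int (l i) + 1 \<le> v $ i \<and> v $ i < - int D - z $ i - int (l i) + 1 + int (?M i)"
      if v: "v \<in> (\<Union>w\<in>V. (\<lambda>a. a - z - w) ` A)" for v i
    proof -
      obtain w a where wa: "w \<in> V" "a \<in> A" "v = a - z - w" using v by blast
      have "\<bar>a $ i\<bar> \<le> int D" using A(1) wa(2) by (auto simp: offset_bound_def)
      then show ?thesis using V(2)[rule_format, OF wa(1), of i] by (simp add: wa(3)) linarith
    qed
    fix y
    have "ex (\<lambda>\<eta>. exp ((?N * \<theta>) * (h y \<eta>)\<^sup>2)) \<le> 2"
    proof (rule ex_exp_square[where A = "?K * B\<^sup>2 * E"])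
      fix t
      have "ex (\<lambda>\<eta>. exp (t * h y \<eta>)) = ex (\<lambda>\<eta>. exp (\<Sum>w\<in>V. (t * g w) * \<phi> ((y - z) - w) \<eta>))"
        by (simp add: h sum_distrib_left mult.assoc)
      also have "\<dots> \<le> exp (?K * B\<^sup>2 * (\<Sum>w\<in>V. (t * g w)\<^sup>2))"
        by (rule ex_exp_offsets[OF \<phi> A V(1) inj])
      also have "\<dots> \<le> exp (t\<^sup>2 * (?K * B\<^sup>2 * E))"
      proof -
        have "?K * B\<^sup>2 * (\<Sum>w\<in>V. (t * g w)\<^sup>2) = t\<^sup>2 * (?K * B\<^sup>2 * (\<Sum>w\<in>V. (g w)\<^sup>2))"
          by (simp add: power_mult_distrib sum_distrib_left mult_ac)
        also have "\<dots> \<le> t\<^sup>2 * (?K * B\<^sup>2 * E)" using E(1) by (intro mult_left_mono) auto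
        finally show ?thesis by simp
      qed
      finally show "ex (\<lambda>\<eta>. exp (t * h y \<eta>)) \<le> exp (t\<^sup>2 * (?K * B\<^sup>2 * E))" .
    next
      show "0 < ?K * B\<^sup>2 * E" using E B by simp
      show "0 \<le> ?N * \<theta>" using N0 \<theta> by simp
      have "20 * (?N * \<theta>) * (?K * B\<^sup>2 * E) \<le> 20 * (?P * \<theta>) * (?K * B\<^sup>2 * E)"
        by (intro mult_right_mono mult_left_mono N) (use \<theta> E in auto)
      also have "\<dots> = 20 * (\<theta> * ?P) * (?K * B\<^sup>2 * E)" by (simp only: mult.commute[of \<theta>])
      finally show "20 * (?N * \<theta>) * (?K * B\<^sup>2 * E) \<le> 1" using \<theta>(2) by linarith
    qed
    then show "ex (\<lambda>\<eta>. exp (?N * (\<theta> * (h y \<eta>)\<^sup>2))) \<le> exp (ln 2)" by (simp add: mult.assoc)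
  qed (use M1 l in auto)
  then have "ex (\<lambda>\<eta>. exp (\<theta> * (\<Sum>y\<in>torus n. (h y \<eta>)\<^sup>2))) \<le> exp (real (card (spaced n ?M)) * ln 2)"
    by (simp add: sum_distrib_left)
  also have "\<dots> \<le> exp (real n ^ CARD('d) / (\<Prod>i\<in>UNIV. real (l i)))"
  proof -
    have "real (card (spaced n ?M)) = (\<Prod>i\<in>UNIV. real (n div ?M i))" by (subst card_spaced[OF M1]) simp
    also have "\<dots> \<le> (\<Prod>i\<in>UNIV. real n / real (l i))"
    proof (intro prod_mono conjI)
      fix i
      have "real (n div ?M i) \<le> real n / real (?M i)" by (metis floor_divide_of_nat_eq of_int_floor_le of_int_of_nat_eq)
      also have "\<dots> \<le> real n / real (l i)" using l(1)[of i] by (intro divide_left_mono) auto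
      finally show "real (n div ?M i) \<le> real n / real (l i)" .
    qed simp
    also have "\<dots> = real n ^ CARD('d) / (\<Prod>i\<in>UNIV. real (l i))" by (simp add: prod_dividef)
    finally have "real (card (spaced n ?M)) * ln 2 \<le> real n ^ CARD('d) / (\<Prod>i\<in>UNIV. real (l i)) * 1"
      using ln_2_less_1 by (intro mult_mono) (auto intro!: divide_nonneg_nonneg prod_nonneg)
    then show ?thesis by simp
  qed
  finally show ?thesis .
qed

text \<open>A uniformly random subset contains \<open>I\<close> and avoids \<open>J\<close> with
  probability \<open>2 ^ - (card I + card J)\<close>.\<close>

lemma card_subsets_between:
  assumes "finite U" "I \<subseteq> U" "J \<subseteq> U" "I \<inter> J = {}"
  shows "2 ^ (card I + card J) * card {S \<in> Pow U. I \<subseteq> S \<and> J \<inter> S = {}} = 2 ^ card U"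
proof -
  have fin: "finite I" "finite J" using finite_subset[OF assms(2,1)] finite_subset[OF assms(3,1)] by auto
  have "bij_betw (\<lambda>S. S - I) {S \<in> Pow U. I \<subseteq> S \<and> J \<inter> S = {}} (Pow (U - I - J))"
    by (rule bij_betwI[where g = "\<lambda>S. S \<union> I"]) (use assms in auto)
  then have "card {S \<in> Pow U. I \<subseteq> S \<and> J \<inter> S = {}} = 2 ^ card (U - I - J)"
    using bij_betw_same_card card_Pow[of "U - I - J"] assms(1) by fastforce
  moreover have "card (U - I - J) = card U - card I - card J"
  proof -
    have "card (U - I - J) = card (U - I) - card J"
      by (rule card_Diff_subset) (use assms fin in auto)
    then show ?thesis using card_Diff_subset[OF fin(1) assms(2)] by simp
  qed
  moreover have "card I + card J \<le> card U"
    using card_Un_disjoint[OF fin assms(4)] card_mono[OF assms(1), of "I \<union> J"] assms(2,3) by simp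
  ultimately show ?thesis by (simp flip: power_add)
qed

text \<open>Decoupling: choosing a uniformly random set of sites, the pairs for which \<open>\<phi>\<close> reads inside
  and \<open>\<psi>\<close> reads outside that set all have the same probability, so the quadratic form is an
  average of decoupled ones. A decoupled form is linear in the outer variables given the inner
  ones, and integrating them out leaves a sum of squares.\<close>

lemma ex_exp_quadratic:
  fixes l :: "'d \<Rightarrow> nat"
  assumes \<phi>: "local_family n A B \<phi>" "\<And>x. ex (\<phi> x) = 0"
    and \<psi>: "local_family n A' B' \<psi>" "\<And>x. ex (\<psi> x) = 0"
    and A: "offset_bound A D" "offset_bound A' D" "2 * D + 1 \<le> n" "finite A" "finite A'"
    and V: "finite V" "\<forall>w\<in>V. \<forall>i. 0 \<le> w $ i \<and> w $ i < int (l i)"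
    and disj: "\<forall>w\<in>V. \<forall>a\<in>A. \<forall>b\<in>A'. \<not> site_cong n (a - z - w) b"
    and l: "\<And>i. 1 \<le> l i" "\<And>i. l i + 2 * D \<le> n"
    and h: "\<And>y \<eta>. h y \<eta> = (\<Sum>w\<in>V. g w * \<phi> (y - z - w) \<eta>)"
    and E: "(\<Sum>w\<in>V. (g w)\<^sup>2) \<le> E" "0 < E" and B: "0 < B"
    and \<theta>: "\<theta> = real (4 * D + 2) ^ (2 * CARD('d)) * B'\<^sup>2 * (\<gamma> * 2 ^ (card A + card A'))\<^sup>2"
      "20 * (\<theta> * (\<Prod>i\<in>UNIV. 2 * real (l i + 2 * D))) * (real (4 * D + 2) ^ (2 * CARD('d)) * B\<^sup>2 * E) \<le> 1"
  shows "ex (\<lambda>\<eta>. exp (\<gamma> * (\<Sum>y\<in>torus n. \<psi> y \<eta> * h y \<eta>))) \<le> exp (real n ^ CARD('d) / (\<Prod>i\<in>UNIV. real (l i)))"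
proof -
  let ?k = "card A + card A'"
  let ?T = "torus n :: 'd site set"
  define inS where "inS S x \<longleftrightarrow> (\<forall>a\<in>A. tmod n (x + a) \<in> S)" for S x
  define outS where "outS S y \<longleftrightarrow> (\<forall>b\<in>A'. tmod n (y + b) \<notin> S)" for S y
  define \<phi>S where "\<phi>S S x \<eta> = of_bool (inS S x) * \<phi> x \<eta>" for S x \<eta>
  define \<psi>S where "\<psi>S S y \<eta> = of_bool (outS S y) * \<psi> y \<eta>" for S y \<eta>
  define hS where "hS S y \<eta> = (\<Sum>w\<in>V. g w * \<phi>S S (y - z - w) \<eta>)" for S y \<eta>
  let ?Y = "\<lambda>S \<eta>. \<Sum>y\<in>?T. (\<gamma> * 2 ^ ?k * hS S y \<eta>) * \<psi>S S y \<eta>"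
  have injA: "inj_on (\<lambda>a. tmod n (x + a)) C" if "offset_bound C D" for x :: "'d site" and C
  proof (rule inj_onI)
    fix a a' assume h: "a \<in> C" "a' \<in> C" "tmod n (x + a) = tmod n (x + a')"
    then have "site_cong n a a'" by (simp flip: site_cong_tmod)
    moreover have "\<bar>a $ i - a' $ i\<bar> < int n" for i
    proof -
      have "\<bar>a $ i\<bar> \<le> int D" "\<bar>a' $ i\<bar> \<le> int D" using that h(1,2) by (auto simp: offset_bound_def)
      then show ?thesis using A(3) by linarith
    qed
    ultimately show "a = a'" by (intro site_cong_small_imp_eq)
  qed
  have count: "(\<Sum>S\<in>Pow ?T. of_bool (inS S (y - z - w)) * of_bool (outS S y)) * 2 ^ ?k = (2 ^ card ?T :: real)"
    if w: "w \<in> V" for y w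
  proof -
    let ?I = "(\<lambda>a. tmod n ((y - z - w) + a)) ` A" and ?J = "(\<lambda>b. tmod n (y + b)) ` A'"
    have IJ: "?I \<inter> ?J = {}"
    proof -
      have "tmod n ((y - z - w) + a) \<noteq> tmod n (y + b)" if "a \<in> A" "b \<in> A'" for a b
      proof
        assume "tmod n ((y - z - w) + a) = tmod n (y + b)"
        then have "site_cong n (y + (a - z - w)) (y + b)" by (simp add: site_cong_tmod algebra_simps)
        then show False using disj w that by simp
      qed
      then show ?thesis by blast
    qed
    have "(\<Sum>S\<in>Pow ?T. of_bool (inS S (y - z - w)) * of_bool (outS S y) :: real)
       = (\<Sum>S\<in>Pow ?T. of_bool (?I \<subseteq> S \<and> ?J \<inter> S = {}))"
      by (intro sum.cong refl) (auto simp: inS_def outS_def)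
    also have "\<dots> = real (card {S \<in> Pow ?T. ?I \<subseteq> S \<and> ?J \<inter> S = {}})"
    proof -
      have "Pow ?T \<inter> {S. ?I \<subseteq> S \<and> ?J \<inter> S = {}} = {S \<in> Pow ?T. ?I \<subseteq> S \<and> ?J \<inter> S = {}}" by blast
      then show ?thesis by (subst sum_of_bool_eq) (simp, simp only:)
    qed
    finally have s: "(\<Sum>S\<in>Pow ?T. of_bool (inS S (y - z - w)) * of_bool (outS S y) :: real)
      = real (card {S \<in> Pow ?T. ?I \<subseteq> S \<and> ?J \<inter> S = {}})" .
    have "2 ^ (card ?I + card ?J) * card {S \<in> Pow ?T. ?I \<subseteq> S \<and> ?J \<inter> S = {}} = 2 ^ card ?T"
      by (rule card_subsets_between) (use IJ n_pos in auto)
    then have "real (2 ^ (card A + card A') * card {S \<in> Pow ?T. ?I \<subseteq> S \<and> ?J \<inter> S = {}}) = real (2 ^ card ?T)"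
      by (simp only: card_image[OF injA[OF A(1)]] card_image[OF injA[OF A(2)]])
    then show ?thesis unfolding s by (simp add: mult.commute)
  qed
  have avg: "\<gamma> * (\<Sum>y\<in>?T. \<psi> y \<eta> * h y \<eta>) = (\<Sum>S\<in>Pow ?T. ?Y S \<eta>) / real (card (Pow ?T))" for \<eta>
  proof -
    have "(\<Sum>S\<in>Pow ?T. ?Y S \<eta>)
      = (\<Sum>S\<in>Pow ?T. \<Sum>y\<in>?T. \<Sum>w\<in>V. \<gamma> * \<psi> y \<eta> * g w * \<phi> (y - z - w) \<eta> *
          (of_bool (inS S (y - z - w)) * of_bool (outS S y) * 2 ^ ?k))"
      by (simp add: hS_def \<psi>S_def \<phi>S_def sum_distrib_left sum_distrib_right mult_ac)
    also have "\<dots> = (\<Sum>y\<in>?T. \<Sum>w\<in>V. \<Sum>S\<in>Pow ?T. \<gamma> * \<psi> y \<eta> * g w * \<phi> (y - z - w) \<eta> *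
          (of_bool (inS S (y - z - w)) * of_bool (outS S y) * 2 ^ ?k))"
      by (subst sum.swap) (intro sum.cong refl sum.swap)
    also have "\<dots> = (\<Sum>y\<in>?T. \<Sum>w\<in>V. \<gamma> * \<psi> y \<eta> * g w * \<phi> (y - z - w) \<eta> * 2 ^ card ?T)"
    proof (intro sum.cong refl)
      fix y w assume "w \<in> V"
      from count[OF this, of y]
      show "(\<Sum>S\<in>Pow ?T. \<gamma> * \<psi> y \<eta> * g w * \<phi> (y - z - w) \<eta> *
          (of_bool (inS S (y - z - w)) * of_bool (outS S y) * 2 ^ ?k))
        = \<gamma> * \<psi> y \<eta> * g w * \<phi> (y - z - w) \<eta> * 2 ^ card ?T"
        unfolding sum_distrib_left[symmetric] sum_distrib_right[symmetric] by (rule arg_cong)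
    qed
    also have "\<dots> = \<gamma> * (\<Sum>y\<in>?T. \<psi> y \<eta> * h y \<eta>) * 2 ^ card ?T"
      by (simp add: h sum_distrib_left sum_distrib_right mult_ac)
    finally show ?thesis by (simp add: card_Pow)
  qed
  have perS: "nperiodic n (inS S)" "nperiodic n (outS S)" for S
  proof -
    have e: "tmod n (x + a) = tmod n (y + a)" if "site_cong n x y" for x y a :: "'d site"
      using that by (simp flip: site_cong_tmod)
    show "nperiodic n (inS S)" "nperiodic n (outS S)"
      unfolding nperiodic_def inS_def outS_def
      by (intro allI impI ball_cong refl, subst e, assumption, rule refl)+
  qed
  have famS: "local_family n A B (\<phi>S S)" "local_family n A' B' (\<psi>S S)" for S
    unfolding local_family_def \<phi>S_def \<psi>S_def
    using nperiodic_comp2[OF perS(1)[of S] local_familyD(1)[OF \<phi>(1)], of _ "\<lambda>i p. of_bool i * p"]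
      nperiodic_comp2[OF perS(2)[of S] local_familyD(1)[OF \<psi>(1)], of _ "\<lambda>i p. of_bool i * p"]
      local_familyD(2,3)[OF \<phi>(1)] local_familyD(2,3)[OF \<psi>(1)]
      local_family_bound_nonneg[OF \<phi>(1)] local_family_bound_nonneg[OF \<psi>(1)]
    by (auto simp: abs_mult intro: depends_on_comp)
  have cenS: "ex (\<phi>S S x) = 0" "ex (\<psi>S S x) = 0" for S x
    by (auto simp: \<phi>S_def[abs_def] \<psi>S_def[abs_def] ex_cmult \<phi>(2) \<psi>(2))
  have one: "ex (\<lambda>\<eta>. exp (?Y S \<eta>)) \<le> exp (real n ^ CARD('d) / (\<Prod>i\<in>UNIV. real (l i)))" for S
  proof -
    let ?F = "\<lambda>\<xi> \<eta>. exp (\<Sum>y\<in>?T. (\<gamma> * 2 ^ ?k * hS S y \<xi>) * \<psi>S S y \<eta>)"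
    have "ex (\<lambda>\<eta>. exp (?Y S \<eta>)) = ex (\<lambda>\<xi>. ex (?F \<xi>))"
    proof (rule ex_diagonal[where S = "{x. tmod n x \<in> S}"])
      show "nperiodic n (\<lambda>x. x \<in> {x. tmod n x \<in> S})" by (simp add: nperiodic_def site_cong_tmod)
      fix \<xi> \<xi>' \<eta> \<eta>' :: "'d config" assume c: "\<xi> \<in> \<Omega>" "\<xi>' \<in> \<Omega>" "\<eta> \<in> \<Omega>" "\<eta>' \<in> \<Omega>"
        "\<And>x. x \<in> {x. tmod n x \<in> S} \<Longrightarrow> \<xi> x = \<xi>' x" "\<And>x. x \<notin> {x. tmod n x \<in> S} \<Longrightarrow> \<eta> x = \<eta>' x"
      have "\<phi>S S x \<xi> = \<phi>S S x \<xi>'" for x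
      proof (cases "inS S x")
        case True
        have "\<phi> x \<xi> = \<phi> x \<xi>'"
          by (rule depends_onD[OF local_familyD(2)[OF \<phi>(1)] c(1,2)]) (use c(5) True in \<open>auto simp: inS_def\<close>)
        then show ?thesis by (simp add: \<phi>S_def)
      qed (simp add: \<phi>S_def)
      moreover have "\<psi>S S y \<eta> = \<psi>S S y \<eta>'" for y
      proof (cases "outS S y")
        case True
        have "\<psi> y \<eta> = \<psi> y \<eta>'"
          by (rule depends_onD[OF local_familyD(2)[OF \<psi>(1)] c(3,4)]) (use c(6) True in \<open>auto simp: outS_def\<close>)
        then show ?thesis by (simp add: \<psi>S_def)
      qed (simp add: \<psi>S_def)
      ultimately show "?F \<xi> \<eta> = ?F \<xi>' \<eta>'" by (simp add: hS_def)
    qed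
    also have "\<dots> \<le> ex (\<lambda>\<xi>. exp (\<theta> * (\<Sum>y\<in>?T. (hS S y \<xi>)\<^sup>2)))"
    proof (rule ex_mono)
      fix \<xi> :: "'d config" assume \<xi>: "\<xi> \<in> \<Omega>"
      have p: "nperiodic n (\<lambda>y. \<gamma> * 2 ^ ?k * hS S y \<xi>)"
        unfolding nperiodic_def hS_def
      proof (intro allI impI arg_cong2[where f = "(*)"] sum.cong refl)
        fix x y w :: "'d site" assume "site_cong n x y"
        then have "site_cong n (x - z - w) (y - z - w)" by (intro site_cong_diff site_cong_refl)
        then show "\<phi>S S (x - z - w) \<xi> = \<phi>S S (y - z - w) \<xi>"
          by (rule nperiodicD[OF local_familyD(1)[OF famS(1) \<xi>]])
      qed
      have "ex (?F \<xi>) \<le> exp (real (4 * D + 2) ^ (2 * CARD('d)) * B'\<^sup>2 * (\<Sum>y\<in>?T. (\<gamma> * 2 ^ ?k * hS S y \<xi>)\<^sup>2))"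
        by (rule ex_exp_linear[OF famS(2) cenS(2) A(2,3) p])
      also have "\<dots> = exp (\<theta> * (\<Sum>y\<in>?T. (hS S y \<xi>)\<^sup>2))"
        unfolding \<theta>(1) power_mult_distrib[of "\<gamma> * 2 ^ ?k"] sum_distrib_left[symmetric] by (simp only: mult.assoc)
      finally show "ex (?F \<xi>) \<le> exp (\<theta> * (\<Sum>y\<in>?T. (hS S y \<xi>)\<^sup>2))" .
    qed
    also have "\<dots> \<le> exp (real n ^ CARD('d) / (\<Prod>i\<in>UNIV. real (l i)))"
      by (rule ex_exp_sum_squares[OF famS(1) cenS(1) A(1,3) V l hS_def E B _ \<theta>(2)]) (simp add: \<theta>(1))
    finally show ?thesis .
  qed
  have "\<exists>S\<in>Pow ?T. ex (\<lambda>\<eta>. exp ((\<Sum>S\<in>Pow ?T. ?Y S \<eta>) / real (card (Pow ?T)))) \<le> exp (real n ^ CARD('d) / (\<Prod>i\<in>UNIV. real (l i)))"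
    by (rule ex_exp_avg) (use one in auto)
  then show ?thesis unfolding avg by blast
qed

section \<open>The entropy inequality and integration by parts\<close>

definition pos_density :: "('d config \<Rightarrow> real) \<Rightarrow> bool"
  where "pos_density f \<longleftrightarrow> (\<forall>\<eta>\<in>\<Omega>. 0 < f \<eta>) \<and> ex f = 1"

abbreviation entropy :: "('d config \<Rightarrow> real) \<Rightarrow> real"
  where "entropy f \<equiv> ex (\<lambda>\<eta>. f \<eta> * ln (f \<eta>))"

text \<open>The variational principle for relative entropy. It trades expectations under the
  unknown density \<open>f\<close> for exponential moments under the product measure.\<close>

lemma entropy_inequality:
  assumes dens: "pos_density f" and \<gamma>: "0 < \<gamma>"
    and X: "ex (\<lambda>\<eta>. exp (\<gamma> * X \<eta>)) \<le> exp b"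
  shows "ex (\<lambda>\<eta>. f \<eta> * X \<eta>) \<le> (entropy f + b) / \<gamma>"
proof -
  have f: "\<And>\<eta>. \<eta> \<in> \<Omega> \<Longrightarrow> 0 < f \<eta>" "ex f = 1" using dens by (auto simp: pos_density_def)
  have "ex (\<lambda>\<eta>. f \<eta> * (\<gamma> * X \<eta> - ln (f \<eta>) - b)) \<le> ex (\<lambda>\<eta>. exp (\<gamma> * X \<eta>) * exp (- b) - f \<eta>)"
  proof (rule ex_mono)
    fix \<eta> assume "\<eta> \<in> \<Omega>"
    then have p: "0 < f \<eta>" by (rule f)
    have "\<gamma> * X \<eta> - ln (f \<eta>) - b \<le> exp (\<gamma> * X \<eta> - ln (f \<eta>) - b) - 1"
      using exp_ge_add_one_self[of "\<gamma> * X \<eta> - ln (f \<eta>) - b"] by linarith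
    then have "f \<eta> * (\<gamma> * X \<eta> - ln (f \<eta>) - b) \<le> f \<eta> * (exp (\<gamma> * X \<eta> - ln (f \<eta>) - b) - 1)"
      using p by (intro mult_left_mono) auto
    also have "\<dots> = exp (\<gamma> * X \<eta>) * exp (- b) - f \<eta>"
      using p by (simp add: exp_diff exp_minus exp_add field_simps)
    finally show "f \<eta> * (\<gamma> * X \<eta> - ln (f \<eta>) - b) \<le> exp (\<gamma> * X \<eta>) * exp (- b) - f \<eta>" .
  qed
  also have "\<dots> = ex (\<lambda>\<eta>. exp (\<gamma> * X \<eta>)) * exp (- b) - 1" by (simp add: ex_diff ex_cmult_right f)
  also have "\<dots> \<le> 0" using X by (simp add: exp_minus field_simps)
  finally have le: "ex (\<lambda>\<eta>. f \<eta> * (\<gamma> * X \<eta> - ln (f \<eta>) - b)) \<le> 0" .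
  have "ex (\<lambda>\<eta>. f \<eta> * (\<gamma> * X \<eta> - ln (f \<eta>) - b)) = ex (\<lambda>\<eta>. \<gamma> * (f \<eta> * X \<eta>) - f \<eta> * ln (f \<eta>) - f \<eta> * b)"
    by (rule ex_cong) (simp add: algebra_simps)
  then have "ex (\<lambda>\<eta>. f \<eta> * (\<gamma> * X \<eta> - ln (f \<eta>) - b)) = \<gamma> * ex (\<lambda>\<eta>. f \<eta> * X \<eta>) - entropy f - b"
    by (simp add: ex_diff ex_cmult ex_cmult_right f)
  then show ?thesis using le \<gamma> by (simp add: field_simps)
qed

end

lemma exchange_in_configs [simp]:
  fixes x y :: "'d::finite site"
  assumes "\<eta> \<in> torus_configs n" shows "exchange n x y \<eta> \<in> torus_configs n"
  unfolding torus_configs_def mem_Collect_eq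
proof (intro allI impI)
  fix z z' :: "'d site" assume z: "site_cong n z z'"
  then have "site_cong n z x \<longleftrightarrow> site_cong n z' x" "site_cong n z y \<longleftrightarrow> site_cong n z' y"
    by (meson site_cong_sym site_cong_trans)+
  moreover have "\<eta> z = \<eta> z'" using assms z by (simp add: torus_configs_def)
  ultimately show "exchange n x y \<eta> z = exchange n x y \<eta> z'" by (simp add: exchange_def)
qed

lemma exchange_at:
  assumes "\<eta> \<in> torus_configs n"
  shows "exchange n x y \<eta> x = \<eta> y" "exchange n x y \<eta> y = \<eta> x"
    "\<not> site_cong n z x \<Longrightarrow> \<not> site_cong n z y \<Longrightarrow> exchange n x y \<eta> z = \<eta> z"
proof -
  show "exchange n x y \<eta> x = \<eta> y" "\<not> site_cong n z x \<Longrightarrow> \<not> site_cong n z y \<Longrightarrow> exchange n x y \<eta> z = \<eta> z"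
    by (auto simp: exchange_def)
  show "exchange n x y \<eta> y = \<eta> x"
    using assms by (auto simp: exchange_def torus_configs_def dest: site_cong_sym)
qed

lemma exchange_exchange [simp]:
  assumes \<eta>: "\<eta> \<in> torus_configs n" shows "exchange n x y (exchange n x y \<eta>) = \<eta>"
proof
  fix z
  have E: "exchange n x y \<eta> \<in> torus_configs n" using \<eta> by simp
  consider "site_cong n z x" | "site_cong n z y" | "\<not> site_cong n z x" "\<not> site_cong n z y" by blast
  then show "exchange n x y (exchange n x y \<eta>) z = \<eta> z"
  proof cases
    case 1
    then have "\<eta> z = \<eta> x" "exchange n x y (exchange n x y \<eta>) z = exchange n x y (exchange n x y \<eta>) x"
      using \<eta> exchange_in_configs[OF E] by (auto simp: torus_configs_def)
    then show ?thesis by (simp add: exchange_at[OF E] exchange_at[OF \<eta>])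
  next
    case 2
    then have "\<eta> z = \<eta> y" "exchange n x y (exchange n x y \<eta>) z = exchange n x y (exchange n x y \<eta>) y"
      using \<eta> exchange_in_configs[OF E] by (auto simp: torus_configs_def)
    then show ?thesis by (simp add: exchange_at[OF E] exchange_at[OF \<eta>])
  next
    case 3
    then show ?thesis by (simp add: exchange_at[OF E] exchange_at[OF \<eta>])
  qed
qed

lemma sum_exchange:
  "(\<Sum>\<eta>\<in>torus_configs n. F (exchange n x y \<eta>)) = (\<Sum>\<eta>\<in>torus_configs n. F \<eta>)"
  by (rule sum.reindex_bij_witness[of _ "exchange n x y" "exchange n x y"]) auto

lemma depends_on_exchange:
  assumes "depends_on n X A" "\<eta> \<in> torus_configs n"
    and "\<And>a. a \<in> A \<Longrightarrow> \<not> site_cong n a x \<and> \<not> site_cong n a y"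
  shows "X (exchange n x y \<eta>) = X \<eta>"
  by (rule depends_onD[OF assms(1)]) (use assms in \<open>auto simp: exchange_at\<close>)

context torus_profile
begin

text \<open>The occupation variable at \<open>x\<close>, centred and divided by its variance.\<close>

definition om :: "'d site \<Rightarrow> 'd config \<Rightarrow> real"
  where "om x \<eta> = (of_bool (\<eta> x) - u x) / (u x * (1 - u x))"

text \<open>The relative change of the product weight under an exchange, divided by the increment of the
  profile.\<close>

definition kk :: "'d site \<Rightarrow> 'd site \<Rightarrow> 'd config \<Rightarrow> real"
  where "kk x y \<eta> = om x \<eta> - om y \<eta> - (u y - u x) * (om x \<eta> * om y \<eta>)"

lemma om_values: "om x \<eta> = (if \<eta> x then 1 / u x else - 1 / (1 - u x))"
  using u_pos[of x] u_less_1[of x] by (simp add: om_def field_simps)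

lemma om_abs: "\<bar>om x \<eta>\<bar> \<le> 1 / r"
  unfolding om_values using u_lower[of x] u_upper[of x] r_pos by (auto simp: abs_if intro!: divide_left_mono)

lemma kk_values: "kk x y \<eta> = (if \<eta> x = \<eta> y then 0 else if \<eta> x then 1 / (u x * (1 - u y)) else - 1 / (u y * (1 - u x)))"
proof -
  define a b where "a = u x" and "b = u y"
  define c d where "c = 1 - a" and "d = 1 - b"
  have pos: "a \<noteq> 0" "b \<noteq> 0" "c \<noteq> 0" "d \<noteq> 0" and sub: "b - a = c - d" "a = 1 - c" "b = 1 - d"
    using u_pos[of x] u_less_1[of x] u_pos[of y] u_less_1[of y] by (auto simp: a_def b_def c_def d_def)
  have "1 / a - 1 / b - (b - a) * (1 / a * (1 / b)) = 0" using pos by (simp add: field_simps)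
  moreover have "- 1 / c - - 1 / d - (b - a) * (- 1 / c * (- 1 / d)) = 0" using pos by (simp add: sub(1) field_simps)
  moreover have "1 / a - - 1 / d - (b - a) * (1 / a * (- 1 / d)) = 1 / (a * d)"
  proof -
    have "1 / a - - 1 / d - (b - a) * (1 / a * (- 1 / d)) = (d + a + (b - a)) / (a * d)"
      using pos by (simp add: field_simps)
    then show ?thesis by (simp add: sub(3))
  qed
  moreover have "- 1 / c - 1 / b - (b - a) * (- 1 / c * (1 / b)) = - 1 / (b * c)"
  proof -
    have "- 1 / c - 1 / b - (b - a) * (- 1 / c * (1 / b)) = - (b + c - (b - a)) / (b * c)"
      using pos by (simp add: field_simps)
    then show ?thesis by (simp add: sub(2))
  qed
  ultimately show ?thesis
    unfolding kk_def om_values c_def[symmetric] d_def[symmetric] a_def[symmetric] b_def[symmetric]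
    by (cases "\<eta> x"; cases "\<eta> y") simp_all
qed

lemma kk_abs: "\<bar>kk x y \<eta>\<bar> \<le> 1 / r\<^sup>2"
proof -
  have "r\<^sup>2 \<le> u x * (1 - u y)" "r\<^sup>2 \<le> u y * (1 - u x)" for x y
    unfolding power2_eq_square
    by (rule mult_mono; use u_lower[of x] u_upper[of x] u_lower[of y] u_upper[of y] r_pos in auto)+
  then have "1 / (u x * (1 - u y)) \<le> 1 / r\<^sup>2" "0 < u x * (1 - u y)" for x y
    using r_pos by (auto intro!: divide_left_mono mult_pos_pos u_pos simp: u_less_1)
  then show ?thesis using r_pos unfolding kk_values by (simp add: abs_of_pos)
qed

lemma om_depends: "depends_on n (om x) {x}"
  unfolding om_def by (rule depends_on_site)

lemma om_periodic: "nperiodic n (\<lambda>x. om x \<eta>)" if "\<eta> \<in> \<Omega>"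
  using that u_periodic unfolding nperiodic_def om_def torus_configs_def by simp

lemma ex_om: "ex (om x) = 0"
proof -
  have "ex (om x) = u x * (1 / u x) + (1 - u x) * (- 1 / (1 - u x))"
    using ex_marginal[of "\<lambda>b. if b then 1 / u x else - 1 / (1 - u x)" x] by (simp add: om_values[abs_def])
  then show ?thesis using u_pos[of x] u_less_1[of x] by simp
qed

lemma wt_split:
  assumes "\<not> site_cong n x y" "\<eta> \<in> \<Omega>"
  shows "wt \<eta> = (if \<eta> x then u x else 1 - u x) * ((if \<eta> y then u y else 1 - u y) *
    (\<Prod>t\<in>torus n - {tmod n x} - {tmod n y}. if \<eta> t then u t else 1 - u t))"
proof -
  let ?g = "\<lambda>t. if \<eta> t then u t else 1 - u t"
  have p: "?g (tmod n x) = ?g x" for x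
    using assms(2) u_periodic by (simp add: nperiodic_tmod torus_configs_iff)
  have "wt \<eta> = ?g (tmod n x) * (\<Prod>t\<in>torus n - {tmod n x}. ?g t)"
    unfolding wt_def by (rule prod.remove) (auto simp: n_pos)
  also have "(\<Prod>t\<in>torus n - {tmod n x}. ?g t) = ?g (tmod n y) * (\<Prod>t\<in>torus n - {tmod n x} - {tmod n y}. ?g t)"
    by (rule prod.remove) (use assms(1) in \<open>auto simp: n_pos site_cong_tmod\<close>)
  finally show ?thesis unfolding p .
qed

lemma wt_exchange:
  assumes "\<not> site_cong n x y" "\<eta> \<in> \<Omega>"
  shows "wt (exchange n x y \<eta>) = wt \<eta> * (1 + (u y - u x) * kk x y \<eta>)"
proof -
  have E: "exchange n x y \<eta> \<in> \<Omega>" using assms by simp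
  have rest: "(\<Prod>t\<in>torus n - {tmod n x} - {tmod n y}. if exchange n x y \<eta> t then u t else 1 - u t)
    = (\<Prod>t\<in>torus n - {tmod n x} - {tmod n y}. if \<eta> t then u t else 1 - u t)"
    by (intro prod.cong refl) (auto simp: exchange_def site_cong_tmod tmod_id)
  show ?thesis
    unfolding wt_split[OF assms] wt_split[OF assms(1) E] rest exchange_at[OF assms(2)] kk_values
    using u_pos[of x] u_less_1[of x] u_pos[of y] u_less_1[of y]
    by (cases "\<eta> x"; cases "\<eta> y") (auto simp: field_simps)
qed

lemma wt_kk_antisym:
  assumes "\<not> site_cong n x y" "\<eta> \<in> \<Omega>"
  shows "wt (exchange n x y \<eta>) * kk x y (exchange n x y \<eta>) = - (wt \<eta> * kk x y \<eta>)"
proof -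
  define a b where "a = u x" and "b = u y"
  define c d where "c = 1 - a" and "d = 1 - b"
  have pos: "a \<noteq> 0" "b \<noteq> 0" "c \<noteq> 0" "d \<noteq> 0" and sub: "c = 1 - a" "d = 1 - b"
    using u_pos[of x] u_less_1[of x] u_pos[of y] u_less_1[of y] by (auto simp: a_def b_def c_def d_def)
  have "1 + (b - a) * (1 / (a * d)) = b * c / (a * d)" "1 + (b - a) * (- 1 / (b * c)) = a * d / (b * c)"
    using pos by (simp_all add: field_simps) (simp_all add: sub algebra_simps)
  then show ?thesis
    unfolding wt_exchange[OF assms] kk_values exchange_at[OF assms(2)]
      c_def[symmetric] d_def[symmetric] a_def[symmetric] b_def[symmetric]
    using pos by (cases "\<eta> x"; cases "\<eta> y") simp_all
qed

text \<open>Integration by parts. Because \<open>wt \<eta> * kk x y \<eta>\<close> changes sign under the exchange, testing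
  \<open>kk\<close> against \<open>f\<close> only sees the increment of \<open>f\<close>, which the Dirichlet form controls.\<close>

lemma integration_by_parts:
  assumes xy: "\<not> site_cong n x y" and g: "\<And>\<eta>. \<eta> \<in> \<Omega> \<Longrightarrow> g (exchange n x y \<eta>) = g \<eta>"
    and f: "\<And>\<eta>. \<eta> \<in> \<Omega> \<Longrightarrow> 0 \<le> f \<eta>" and b: "0 < b"
  shows "ex (\<lambda>\<eta>. f \<eta> * (g \<eta> * kk x y \<eta>))
    \<le> b / (2 * r\<^sup>2) * ex (\<lambda>\<eta>. (sqrt (f (exchange n x y \<eta>)) - sqrt (f \<eta>))\<^sup>2)
      + 1 / (2 * b * r\<^sup>2) * ex (\<lambda>\<eta>. f \<eta> * (g \<eta>)\<^sup>2)"
proof -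
  let ?T = "exchange n x y"
  define W where "W \<eta> = wt \<eta> * kk x y \<eta>" for \<eta>
  have anti: "W (?T \<eta>) = - W \<eta>" if "\<eta> \<in> \<Omega>" for \<eta>
    using wt_kk_antisym[OF xy that] by (simp add: W_def)
  have W: "\<bar>W \<eta>\<bar> \<le> wt \<eta> / r\<^sup>2" for \<eta>
    using mult_left_mono[OF kk_abs[of x y \<eta>] less_imp_le[OF wt_pos[of \<eta>]]] wt_pos[of \<eta>] by (simp add: W_def abs_mult)
  have S1: "ex (\<lambda>\<eta>. f \<eta> * (g \<eta> * kk x y \<eta>)) = (\<Sum>\<eta>\<in>\<Omega>. W \<eta> * g \<eta> * f \<eta>)"
    unfolding ex_def W_def by (intro sum.cong) auto
  also have S2: "\<dots> = (\<Sum>\<eta>\<in>\<Omega>. W (?T \<eta>) * g (?T \<eta>) * f (?T \<eta>))"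
    by (rule sum_exchange[symmetric])
  also have "\<dots> = - (\<Sum>\<eta>\<in>\<Omega>. W \<eta> * g \<eta> * f (?T \<eta>))"
    by (simp add: anti g sum_negf)
  finally have S3: "ex (\<lambda>\<eta>. f \<eta> * (g \<eta> * kk x y \<eta>)) = - (\<Sum>\<eta>\<in>\<Omega>. W \<eta> * g \<eta> * f (?T \<eta>))" .
  have "2 * ex (\<lambda>\<eta>. f \<eta> * (g \<eta> * kk x y \<eta>)) = (\<Sum>\<eta>\<in>\<Omega>. W \<eta> * g \<eta> * (f \<eta> - f (?T \<eta>)))"
    using S1 S3 by (simp add: right_diff_distrib sum_subtractf)
  also have "\<dots> \<le> (\<Sum>\<eta>\<in>\<Omega>. \<bar>W \<eta>\<bar> * (b * (sqrt (f (?T \<eta>)) - sqrt (f \<eta>))\<^sup>2 + (g \<eta>)\<^sup>2 * (f \<eta> + f (?T \<eta>)) / (2 * b)))"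
  proof (rule sum_mono)
    fix \<eta> assume \<eta>: "\<eta> \<in> \<Omega>"
    define p q where "p = sqrt (f \<eta>)" and "q = sqrt (f (?T \<eta>))"
    have pq: "f \<eta> = p\<^sup>2" "f (?T \<eta>) = q\<^sup>2" using f \<eta> by (auto simp: p_def q_def)
    have am: "s * t \<le> b * s\<^sup>2 + t\<^sup>2 / (4 * b)" for s t :: real
    proof -
      have "0 \<le> (2 * b * s - t)\<^sup>2" by simp
      then have "4 * b * (s * t) \<le> 4 * b * (b * s\<^sup>2) + t\<^sup>2" by (simp add: power2_eq_square algebra_simps)
      then show ?thesis using b by (simp add: field_simps)
    qed
    have "W \<eta> * g \<eta> * (f \<eta> - f (?T \<eta>)) \<le> \<bar>W \<eta>\<bar> * (\<bar>q - p\<bar> * (\<bar>g \<eta>\<bar> * \<bar>p + q\<bar>))"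
    proof -
      have "W \<eta> * g \<eta> * (f \<eta> - f (?T \<eta>)) = W \<eta> * g \<eta> * ((p - q) * (p + q))"
        by (simp add: pq power2_eq_square algebra_simps)
      also have "\<dots> \<le> \<bar>W \<eta> * g \<eta> * ((p - q) * (p + q))\<bar>" by simp
      also have "\<dots> = \<bar>W \<eta>\<bar> * (\<bar>q - p\<bar> * (\<bar>g \<eta>\<bar> * \<bar>p + q\<bar>))" by (simp add: abs_mult abs_minus_commute)
      finally show ?thesis .
    qed
    also have "\<bar>q - p\<bar> * (\<bar>g \<eta>\<bar> * \<bar>p + q\<bar>) \<le> b * (q - p)\<^sup>2 + (g \<eta>)\<^sup>2 * (p + q)\<^sup>2 / (4 * b)"
      using am[of "\<bar>q - p\<bar>" "\<bar>g \<eta>\<bar> * \<bar>p + q\<bar>"] by (simp add: power_mult_distrib)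
    also have "(g \<eta>)\<^sup>2 * (p + q)\<^sup>2 / (4 * b) \<le> (g \<eta>)\<^sup>2 * (f \<eta> + f (?T \<eta>)) / (2 * b)"
    proof -
      have "(p + q)\<^sup>2 \<le> 2 * (p\<^sup>2 + q\<^sup>2)" using sum_squares_bound[of p q] by (simp add: power2_sum)
      then have "(g \<eta>)\<^sup>2 * (p + q)\<^sup>2 \<le> (g \<eta>)\<^sup>2 * (2 * (p\<^sup>2 + q\<^sup>2))" by (rule mult_left_mono) simp
      then show ?thesis using b by (simp add: pq field_simps)
    qed
    finally show "W \<eta> * g \<eta> * (f \<eta> - f (?T \<eta>)) \<le> \<bar>W \<eta>\<bar> * (b * (sqrt (f (?T \<eta>)) - sqrt (f \<eta>))\<^sup>2 + (g \<eta>)\<^sup>2 * (f \<eta> + f (?T \<eta>)) / (2 * b))"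
      by (simp add: p_def q_def mult_left_mono)
  qed
  also have "\<dots> = b * (\<Sum>\<eta>\<in>\<Omega>. \<bar>W \<eta>\<bar> * (sqrt (f (?T \<eta>)) - sqrt (f \<eta>))\<^sup>2)
      + 1 / (2 * b) * ((\<Sum>\<eta>\<in>\<Omega>. \<bar>W \<eta>\<bar> * (g \<eta>)\<^sup>2 * f \<eta>) + (\<Sum>\<eta>\<in>\<Omega>. \<bar>W \<eta>\<bar> * (g \<eta>)\<^sup>2 * f (?T \<eta>)))"
    by (simp add: sum_distrib_left flip: sum.distrib) (intro sum.cong refl, simp add: algebra_simps add_divide_distrib)
  also have "(\<Sum>\<eta>\<in>\<Omega>. \<bar>W \<eta>\<bar> * (g \<eta>)\<^sup>2 * f (?T \<eta>)) = (\<Sum>\<eta>\<in>\<Omega>. \<bar>W \<eta>\<bar> * (g \<eta>)\<^sup>2 * f \<eta>)"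
    using sum_exchange[of "\<lambda>\<eta>. \<bar>W \<eta>\<bar> * (g \<eta>)\<^sup>2 * f \<eta>" n x y] by (simp add: anti g)
  also have "b * (\<Sum>\<eta>\<in>\<Omega>. \<bar>W \<eta>\<bar> * (sqrt (f (?T \<eta>)) - sqrt (f \<eta>))\<^sup>2)
      + 1 / (2 * b) * ((\<Sum>\<eta>\<in>\<Omega>. \<bar>W \<eta>\<bar> * (g \<eta>)\<^sup>2 * f \<eta>) + (\<Sum>\<eta>\<in>\<Omega>. \<bar>W \<eta>\<bar> * (g \<eta>)\<^sup>2 * f \<eta>))
    \<le> b * (\<Sum>\<eta>\<in>\<Omega>. wt \<eta> / r\<^sup>2 * (sqrt (f (?T \<eta>)) - sqrt (f \<eta>))\<^sup>2)
      + 1 / (2 * b) * ((\<Sum>\<eta>\<in>\<Omega>. wt \<eta> / r\<^sup>2 * (g \<eta>)\<^sup>2 * f \<eta>) + (\<Sum>\<eta>\<in>\<Omega>. wt \<eta> / r\<^sup>2 * (g \<eta>)\<^sup>2 * f \<eta>))"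
    by (intro add_mono mult_left_mono sum_mono mult_right_mono W) (use b f in auto)
  also have "\<dots> = b / r\<^sup>2 * ex (\<lambda>\<eta>. (sqrt (f (?T \<eta>)) - sqrt (f \<eta>))\<^sup>2) + 1 / (b * r\<^sup>2) * ex (\<lambda>\<eta>. f \<eta> * (g \<eta>)\<^sup>2)"
    by (simp add: ex_def sum_distrib_left mult_ac flip: sum.distrib)
  finally show ?thesis using b r_pos by (simp add: field_simps)
qed

definition dir_energy :: "'d \<Rightarrow> ('d config \<Rightarrow> real) \<Rightarrow> real"
  where "dir_energy j f = (\<Sum>y\<in>torus n. ex (\<lambda>\<eta>. (sqrt (f (exchange n y (y + \<e> j) \<eta>)) - sqrt (f \<eta>))\<^sup>2))"

lemma dir_energy_nonneg: "0 \<le> dir_energy j f"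
  unfolding dir_energy_def by (intro sum_nonneg ex_nonneg) auto

lemma entropy_nonneg: "pos_density f \<Longrightarrow> 0 \<le> entropy f"
  using entropy_inequality[of f 1 "\<lambda>_. 0" 0] by simp

end

section \<open>Replacing an occupation variable by its average over a box\<close>

text \<open>Boxes that grow in one direction at a time, in the order given by
  \<open>rk\<close>.\<close>

definition stage_box :: "('d::finite \<Rightarrow> nat) \<Rightarrow> ('d \<Rightarrow> nat) \<Rightarrow> nat \<Rightarrow> 'd site set"
  where "stage_box rk l k = {v. \<forall>i. if rk i < k then 0 \<le> v $ i \<and> v $ i < int (l i) else v $ i = 0}"

lemma box_bij:
  "bij_betw (\<lambda>g. \<chi> i. g i) (PiE UNIV (\<lambda>i. if rk i < k then {0..<int (l i)} else {0})) (stage_box rk l k)"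
  by (intro bij_betwI[where g = "\<lambda>x i. x $ i"]) (auto simp: stage_box_def PiE_def Pi_def split: if_splits)

lemma finite_box [simp]: "finite (stage_box rk l k)"
  using bij_betw_finite[OF box_bij] finite_PiE[of UNIV "\<lambda>i. if rk i < k then {0..<int (l i)} else {0}"] by fastforce

lemma card_box: "card (stage_box rk l k) = (\<Prod>i\<in>UNIV. if rk i < k then l i else 1)"
proof -
  have "card (stage_box rk l k) = (\<Prod>i\<in>UNIV. card (if rk i < k then {0..<int (l i)} else {0}))"
    using bij_betw_same_card[OF box_bij[of rk k l]] by (simp add: card_PiE)
  also have "\<dots> = (\<Prod>i\<in>UNIV. if rk i < k then l i else 1)" by (intro prod.cong) auto
  finally show ?thesis .
qed

lemma box_0: "stage_box rk l 0 = {0}"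
  by (auto simp: stage_box_def vec_eq_iff)

lemma box_bounds: "(\<And>i. 1 \<le> l i) \<Longrightarrow> w \<in> stage_box rk l k \<Longrightarrow> 0 \<le> w $ i \<and> w $ i < int (l i)"
  by (force simp: stage_box_def Suc_le_eq split: if_splits)

lemma box_Suc_bij:
  assumes "inj rk" "rk j = k"
  shows "bij_betw (\<lambda>(v, s). v + axis j (int s)) (stage_box rk l k \<times> {..<l j}) (stage_box rk l (Suc k))"
proof (intro bij_betwI[where g = "\<lambda>w. (w - axis j (w $ j), nat (w $ j))"])
  have r: "rk i = k \<longleftrightarrow> i = j" for i using assms by (auto dest: injD)
  show "(\<lambda>(v, s). v + axis j (int s)) \<in> stage_box rk l k \<times> {..<l j} \<rightarrow> stage_box rk l (Suc k)"
  proof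
    fix p assume "p \<in> stage_box rk l k \<times> {..<l j}"
    then obtain v s where p: "p = (v, s)" "v \<in> stage_box rk l k" "s < l j" by auto
    then have "v $ j = 0" using assms(2) by (auto simp: stage_box_def split: if_splits)
    then have "if rk i < Suc k then 0 \<le> (v + axis j (int s)) $ i \<and> (v + axis j (int s)) $ i < int (l i)
        else (v + axis j (int s)) $ i = 0" for i
      using p(2,3) assms(2) by (cases "i = j") (auto simp: stage_box_def less_Suc_eq r axis_def split: if_splits)
    then show "(\<lambda>(v, s). v + axis j (int s)) p \<in> stage_box rk l (Suc k)"
      unfolding p(1) stage_box_def prod.case by blast
  qed
  show "(\<lambda>w. (w - axis j (w $ j), nat (w $ j))) \<in> stage_box rk l (Suc k) \<rightarrow> stage_box rk l k \<times> {..<l j}"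
  proof
    fix w assume w: "w \<in> stage_box rk l (Suc k)"
    then have "0 \<le> w $ j \<and> w $ j < int (l j)" using assms(2) by (auto simp: stage_box_def split: if_splits)
    moreover have "w - axis j (w $ j) \<in> stage_box rk l k"
    proof -
      have "if rk i < k then 0 \<le> (w - axis j (w $ j)) $ i \<and> (w - axis j (w $ j)) $ i < int (l i)
          else (w - axis j (w $ j)) $ i = 0" for i
        using w assms(2) by (cases "i = j") (auto simp: stage_box_def less_Suc_eq r axis_def split: if_splits)
      then show ?thesis unfolding stage_box_def by blast
    qed
    ultimately show "(w - axis j (w $ j), nat (w $ j)) \<in> stage_box rk l k \<times> {..<l j}" by auto
  qed
  show "(\<lambda>w. (w - axis j (w $ j), nat (w $ j))) ((\<lambda>(v, s). v + axis j (int s)) p) = p"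
    if p0: "p \<in> stage_box rk l k \<times> {..<l j}" for p
  proof -
    obtain v s where p: "p = (v, s)" "v \<in> stage_box rk l k" using p0 by auto
    then have "v $ j = 0" using assms(2) by (auto simp: stage_box_def split: if_splits)
    then show ?thesis by (simp add: p(1) axis_def)
  qed
  show "(\<lambda>(v, s). v + axis j (int s)) (w - axis j (w $ j), nat (w $ j)) = w"
    if "w \<in> stage_box rk l (Suc k)" for w
  proof -
    have "0 \<le> w $ j" using that assms(2) by (auto simp: stage_box_def split: if_splits)
    then show ?thesis by simp
  qed
qed

lemma telescoping_average:
  fixes a :: "nat \<Rightarrow> real"
  assumes "1 \<le> l"
  shows "a 0 - (\<Sum>s<l. a s) / l = (\<Sum>s<l. (1 - (real s + 1) / l) * (a s - a (Suc s)))"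
proof -
  have *: "(\<Sum>s<l. (real l - (real s + 1)) * (a s - a (Suc s))) = real l * a 0 - (\<Sum>s<l. a s)"
  proof (induction l)
    case (Suc l)
    have "(\<Sum>s<Suc l. (real (Suc l) - (real s + 1)) * (a s - a (Suc s)))
      = (\<Sum>s<l. (real l - (real s + 1)) * (a s - a (Suc s))) + (\<Sum>s<l. a s - a (Suc s))"
      by (simp add: sum.distrib[symmetric] algebra_simps)
    also have "(\<Sum>s<l. a s - a (Suc s)) = a 0 - a l" by (rule sum_lessThan_telescope')
    finally show ?case unfolding Suc.IH by (simp add: algebra_simps)
  qed simp
  have "(\<Sum>s<l. (1 - (real s + 1) / l) * (a s - a (Suc s))) = (\<Sum>s<l. (real l - (real s + 1)) * (a s - a (Suc s))) / l"
    using assms by (simp add: sum_divide_distrib field_simps)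
  then show ?thesis using assms unfolding * by (simp add: field_simps)
qed

text \<open>Passing from one box to the next only averages in one more direction, and the difference of
  the two averages is a combination of increments in that direction.\<close>

lemma box_average_step:
  fixes a :: "'d::finite site \<Rightarrow> real"
  assumes rk: "inj rk" "rk j = k" and l: "\<And>i. 1 \<le> l i"
  shows "(\<Sum>v\<in>stage_box rk l k. a v) / card (stage_box rk l k) - (\<Sum>w\<in>stage_box rk l (Suc k). a w) / card (stage_box rk l (Suc k))
    = (\<Sum>w\<in>stage_box rk l (Suc k). (1 - (real_of_int (w $ j) + 1) / l j) / card (stage_box rk l k) * (a w - a (w + \<e> j)))"
    and "card (stage_box rk l (Suc k)) = card (stage_box rk l k) * l j"
proof -
  note bij = box_Suc_bij[OF rk, of l]
  show c: "card (stage_box rk l (Suc k)) = card (stage_box rk l k) * l j"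
    using bij_betw_same_card[OF bij] by (simp add: card_cartesian_product)
  have sum: "(\<Sum>w\<in>stage_box rk l (Suc k). F w) = (\<Sum>v\<in>stage_box rk l k. \<Sum>s<l j. F (v + axis j (int s)))" for F :: "'d site \<Rightarrow> real"
    using sum.reindex_bij_betw[OF bij, of F] by (simp add: sum.cartesian_product case_prod_unfold)
  have v0: "v $ j = 0" if "v \<in> stage_box rk l k" for v
    using that rk(2) by (auto simp: stage_box_def split: if_splits)
  let ?N = "real (card (stage_box rk l k))"
  have "(\<Sum>w\<in>stage_box rk l (Suc k). (1 - (real_of_int (w $ j) + 1) / l j) / ?N * (a w - a (w + \<e> j)))
    = (\<Sum>v\<in>stage_box rk l k. (\<Sum>s<l j. (1 - (real s + 1) / l j) * (a (v + axis j (int s)) - a (v + axis j (int (Suc s))))) / ?N)"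
    unfolding sum sum_divide_distrib
  proof (intro sum.cong refl)
    fix v s assume v: "v \<in> stage_box rk l k"
    have vj: "(v + axis j (int s)) $ j = int s" using v0[OF v] by (simp add: axis_def)
    have e: "v + axis j (int s) + \<e> j = v + axis j (int (Suc s))" by (simp add: vec_eq_iff axis_def)
    show "(1 - (real_of_int ((v + axis j (int s)) $ j) + 1) / l j) / ?N * (a (v + axis j (int s)) - a (v + axis j (int s) + \<e> j))
      = (1 - (real s + 1) / l j) * (a (v + axis j (int s)) - a (v + axis j (int (Suc s)))) / ?N"
      unfolding e vj by simp
  qed
  also have "\<dots> = (\<Sum>v\<in>stage_box rk l k. (a v - (\<Sum>s<l j. a (v + axis j (int s))) / l j) / ?N)"
  proof (intro sum.cong refl arg_cong2[where f = "(/)"])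
    fix v
    have a0: "axis j 0 = (0 :: 'd site)" by (simp add: vec_eq_iff axis_def)
    show "(\<Sum>s<l j. (1 - (real s + 1) / l j) * (a (v + axis j (int s)) - a (v + axis j (int (Suc s)))))
      = a v - (\<Sum>s<l j. a (v + axis j (int s))) / l j"
      using telescoping_average[OF l[of j], of "\<lambda>s. a (v + axis j (int s))"] by (simp add: a0)
  qed
  also have "\<dots> = (\<Sum>v\<in>stage_box rk l k. a v) / ?N - (\<Sum>w\<in>stage_box rk l (Suc k). a w) / card (stage_box rk l (Suc k))"
    unfolding sum c by (simp add: diff_divide_distrib sum_subtractf sum_divide_distrib[symmetric] mult.commute)
  finally show "(\<Sum>v\<in>stage_box rk l k. a v) / card (stage_box rk l k) - (\<Sum>w\<in>stage_box rk l (Suc k). a w) / card (stage_box rk l (Suc k))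
    = (\<Sum>w\<in>stage_box rk l (Suc k). (1 - (real_of_int (w $ j) + 1) / l j) / card (stage_box rk l k) * (a w - a (w + \<e> j)))" ..
qed

context torus_profile
begin

text \<open>One step of the replacement: increments in one direction are integrated by parts. The
  Dirichlet form absorbs the main term at the price of \<open>\<Sum>y. (h y)\<^sup>2 / n\<^sup>2\<close>; the inhomogeneity of the
  profile leaves a quadratic form with coefficient \<open>1 / n\<close>. Both are bounded by entropy.\<close>

lemma increment_bound:
  fixes l :: "'d \<Rightarrow> nat" and f :: "'d config \<Rightarrow> real"
  assumes \<phi>: "local_family n A B \<phi>" "\<And>x. ex (\<phi> x) = 0" and B: "0 < B"
    and A: "finite A" "offset_bound A D" "1 \<le> D" "2 * D + 1 \<le> n"
    and V: "finite V" "\<forall>w\<in>V. \<forall>i. 0 \<le> w $ i \<and> w $ i < int (l i)"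
    and disj: "\<forall>w\<in>V. \<forall>a\<in>A. \<forall>b\<in>{0, \<e> j}. \<not> site_cong n (a - z - w) b"
    and l: "\<And>i. 1 \<le> l i" "\<And>i. l i + 2 * D \<le> n"
    and h: "\<And>y \<eta>. h y \<eta> = (\<Sum>w\<in>V. g w * \<phi> (y - z - w) \<eta>)"
    and E: "(\<Sum>w\<in>V. (g w)\<^sup>2) \<le> E" "0 < E"
    and G: "20 * (\<Prod>i\<in>UNIV. 2 * real (l i + 2 * D)) * (real (4 * D + 2) ^ (2 * CARD('d)) * B\<^sup>2 * E) \<le> G * (real n)\<^sup>2" "0 < G"
    and L: "\<And>x. \<bar>u (x + \<e> j) - u x\<bar> \<le> L / n"
    and f: "pos_density f" and eps: "0 < \<epsilon>"
  shows "ex (\<lambda>\<eta>. f \<eta> * (\<Sum>y\<in>torus n. h y \<eta> * (om y \<eta> - om (y + \<e> j) \<eta>)))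
    \<le> \<epsilon> * (real n)\<^sup>2 * dir_energy j f
      + (G / (4 * \<epsilon> * r ^ 4) + real (4 * D + 2) ^ (2 * CARD('d)) * (L / r\<^sup>2)\<^sup>2 * (2 ^ (card A + 2))\<^sup>2 * G + 1)
        * (entropy f + real n ^ CARD('d) / (\<Prod>i\<in>UNIV. real (l i)))"
proof -
  let ?K = "real (4 * D + 2) ^ (2 * CARD('d))"
  let ?P = "\<Prod>i\<in>UNIV. 2 * real (l i + 2 * D)"
  let ?b = "real n ^ CARD('d) / (\<Prod>i\<in>UNIV. real (l i))"
  define \<theta>0 where "\<theta>0 = ?K * (L / r\<^sup>2)\<^sup>2 * (2 ^ (card A + 2))\<^sup>2"
  have n: "0 < real n" by simp
  have L0: "0 \<le> L" using order_trans[OF abs_ge_zero L[of 0]] n by (simp add: zero_le_divide_iff)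
  have b0: "0 \<le> ?b" by (intro divide_nonneg_nonneg prod_nonneg) auto
  have H0: "0 \<le> entropy f + ?b" using entropy_nonneg[OF f] b0 by simp
  have f0: "0 \<le> f \<eta>" if "\<eta> \<in> \<Omega>" for \<eta> using f that by (auto simp: pos_density_def less_imp_le)
  have ncong: "\<not> site_cong n y (y + \<e> j)" for y
  proof
    assume "site_cong n y (y + \<e> j)"
    then have "int n dvd - 1" unfolding site_cong_iff_diff by (auto dest: spec[of _ j])
    then show False using A(3,4) by auto
  qed
  have dvd_shift: "\<not> site_cong n (y - z - w + a) (y + b)" if "w \<in> V" "a \<in> A" "b \<in> {0, \<e> j}" for y w a b
  proof
    assume "site_cong n (y - z - w + a) (y + b)"
    then have "site_cong n (y + (a - z - w)) (y + b)" by (simp add: algebra_simps)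
    then show False unfolding site_cong_add_left using disj that by blast
  qed
  have hT: "h y (exchange n y (y + \<e> j) \<eta>) = h y \<eta>" if \<eta>: "\<eta> \<in> \<Omega>" for y \<eta>
    unfolding h
  proof (intro sum.cong refl arg_cong2[where f = "(*)"])
    fix w assume w: "w \<in> V"
    show "\<phi> (y - z - w) (exchange n y (y + \<e> j) \<eta>) = \<phi> (y - z - w) \<eta>"
    proof (rule depends_on_exchange[OF local_familyD(2)[OF \<phi>(1)] \<eta>])
      fix a assume "a \<in> (+) (y - z - w) ` A"
      then obtain a' where a': "a' \<in> A" "a = y - z - w + a'" by blast
      show "\<not> site_cong n a y \<and> \<not> site_cong n a (y + \<e> j)"
        using dvd_shift[OF w a'(1), of 0 y] dvd_shift[OF w a'(1), of "\<e> j" y] by (simp add: a'(2))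
    qed
  qed
  define \<psi> where "\<psi> y \<eta> = (u (y + \<e> j) - u y) * (om y \<eta> * om (y + \<e> j) \<eta>)" for y \<eta>
  have \<psi>: "local_family n {0, \<e> j} (L / n / r\<^sup>2) \<psi>"
    unfolding local_family_def
  proof (intro conjI ballI allI)
    fix \<eta> assume \<eta>: "\<eta> \<in> \<Omega>"
    show "nperiodic n (\<lambda>y. \<psi> y \<eta>)"
      unfolding \<psi>_def
      by (intro nperiodic_comp2[where F = "\<lambda>s t. s * t"] nperiodic_comp2[where F = "\<lambda>s t. s - t"] om_periodic[OF \<eta>] u_periodic
          nperiodic_shift[OF u_periodic] nperiodic_shift[OF om_periodic[OF \<eta>]])
    fix x
    have "\<bar>\<psi> x \<eta>\<bar> \<le> L / n * (1 / r * (1 / r))"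
      unfolding \<psi>_def abs_mult by (intro mult_mono L om_abs) (use L0 r_pos in auto)
    then show "\<bar>\<psi> x \<eta>\<bar> \<le> L / n / r\<^sup>2" by (simp add: power2_eq_square)
  next
    fix x show "depends_on n (\<psi> x) ((+) x ` {0, \<e> j})"
      unfolding \<psi>_def
      using depends_on_comp2[OF om_depends[of x] om_depends[of "x + \<e> j"], of "\<lambda>s t. (u (x + \<e> j) - u x) * (s * t)"]
      by (simp add: insert_commute)
  qed
  have \<psi>0: "ex (\<psi> y) = 0" for y
  proof -
    have "ex (\<lambda>\<eta>. om y \<eta> * om (y + \<e> j) \<eta>) = ex (om y) * ex (om (y + \<e> j))"
      by (rule ex_indep[OF om_depends om_depends]) (use ncong in auto)
    then show ?thesis by (simp add: \<psi>_def[abs_def] ex_cmult ex_om)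
  qed
  have split: "ex (\<lambda>\<eta>. f \<eta> * (\<Sum>y\<in>torus n. h y \<eta> * (om y \<eta> - om (y + \<e> j) \<eta>)))
    = (\<Sum>y\<in>torus n. ex (\<lambda>\<eta>. f \<eta> * (h y \<eta> * kk y (y + \<e> j) \<eta>))) + ex (\<lambda>\<eta>. f \<eta> * (\<Sum>y\<in>torus n. \<psi> y \<eta> * h y \<eta>))"
  proof -
    have "ex (\<lambda>\<eta>. f \<eta> * (\<Sum>y\<in>torus n. h y \<eta> * (om y \<eta> - om (y + \<e> j) \<eta>)))
      = ex (\<lambda>\<eta>. (\<Sum>y\<in>torus n. f \<eta> * (h y \<eta> * kk y (y + \<e> j) \<eta>)) + f \<eta> * (\<Sum>y\<in>torus n. \<psi> y \<eta> * h y \<eta>))"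
      by (rule ex_cong) (simp add: kk_def \<psi>_def sum_distrib_left sum.distrib[symmetric] algebra_simps)
    then show ?thesis by (simp add: ex_add ex_sum)
  qed
  have 1: "(\<Sum>y\<in>torus n. ex (\<lambda>\<eta>. f \<eta> * (h y \<eta> * kk y (y + \<e> j) \<eta>)))
    \<le> \<epsilon> * (real n)\<^sup>2 * dir_energy j f + 1 / (4 * \<epsilon> * r ^ 4 * (real n)\<^sup>2) * ex (\<lambda>\<eta>. f \<eta> * (\<Sum>y\<in>torus n. (h y \<eta>)\<^sup>2))"
  proof -
    let ?c = "2 * r\<^sup>2 * \<epsilon> * (real n)\<^sup>2"
    have "(\<Sum>y\<in>torus n. ex (\<lambda>\<eta>. f \<eta> * (h y \<eta> * kk y (y + \<e> j) \<eta>)))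
      \<le> (\<Sum>y\<in>torus n. ?c / (2 * r\<^sup>2) * ex (\<lambda>\<eta>. (sqrt (f (exchange n y (y + \<e> j) \<eta>)) - sqrt (f \<eta>))\<^sup>2)
        + 1 / (2 * ?c * r\<^sup>2) * ex (\<lambda>\<eta>. f \<eta> * (h y \<eta>)\<^sup>2))"
      by (intro sum_mono integration_by_parts ncong hT f0) (use eps r_pos in auto)
    also have "\<dots> = ?c / (2 * r\<^sup>2) * dir_energy j f + 1 / (2 * ?c * r\<^sup>2) * ex (\<lambda>\<eta>. f \<eta> * (\<Sum>y\<in>torus n. (h y \<eta>)\<^sup>2))"
      by (simp only: sum.distrib sum_distrib_left[symmetric] dir_energy_def ex_sum[symmetric])
    also have "?c / (2 * r\<^sup>2) = \<epsilon> * (real n)\<^sup>2" using r_pos by simp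
    also have "1 / (2 * ?c * r\<^sup>2) = 1 / (4 * \<epsilon> * r ^ 4 * (real n)\<^sup>2)"
      by (simp add: power2_eq_square power4_eq_xxxx mult_ac)
    finally show ?thesis .
  qed
  have 2: "ex (\<lambda>\<eta>. f \<eta> * (\<Sum>y\<in>torus n. (h y \<eta>)\<^sup>2)) \<le> (entropy f + ?b) * (G * (real n)\<^sup>2)"
  proof -
    let ?g = "1 / (G * (real n)\<^sup>2)"
    have g: "0 < ?g" using G(2) by simp
    have "20 * (?g * ?P) * (?K * B\<^sup>2 * E) = ?g * (20 * ?P * (?K * B\<^sup>2 * E))" by simp
    also have "\<dots> \<le> ?g * (G * (real n)\<^sup>2)" by (rule mult_left_mono[OF G(1)]) (use g in linarith)
    also have "\<dots> = 1" using G(2) by simp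
    finally have "ex (\<lambda>\<eta>. exp (?g * (\<Sum>y\<in>torus n. (h y \<eta>)\<^sup>2))) \<le> exp ?b"
      by (intro ex_exp_sum_squares[OF \<phi> A(2,4) V l h E B]) (use g in linarith)
    then have "ex (\<lambda>\<eta>. f \<eta> * (\<Sum>y\<in>torus n. (h y \<eta>)\<^sup>2)) \<le> (entropy f + ?b) / ?g"
      by (rule entropy_inequality[OF f g])
    then show ?thesis by simp
  qed
  have 3: "ex (\<lambda>\<eta>. f \<eta> * (\<Sum>y\<in>torus n. \<psi> y \<eta> * h y \<eta>)) \<le> (entropy f + ?b) * (\<theta>0 * G + 1)"
  proof -
    let ?g = "1 / (\<theta>0 * G + 1)"
    have t0: "0 \<le> \<theta>0 * G" using G(2) by (simp add: \<theta>0_def)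
    then have g: "0 < ?g" by simp
    have cA: "card {0, \<e> j :: 'd site} = 2" by (simp add: vec_eq_iff axis_def)
    have D: "offset_bound {0, \<e> j} D" using A(3) by (auto simp: offset_bound_def axis_def)
    let ?\<theta> = "?K * (L / n / r\<^sup>2)\<^sup>2 * (?g * 2 ^ (card A + card {0, \<e> j :: 'd site}))\<^sup>2"
    have th: "?\<theta> = \<theta>0 * ?g\<^sup>2 / (real n)\<^sup>2"
      unfolding cA by (simp add: \<theta>0_def power_mult_distrib power_divide)
    have "20 * (?\<theta> * ?P) * (?K * B\<^sup>2 * E) = \<theta>0 * ?g\<^sup>2 / (real n)\<^sup>2 * (20 * ?P * (?K * B\<^sup>2 * E))"
      unfolding th by simp
    also have "\<dots> \<le> \<theta>0 * ?g\<^sup>2 / (real n)\<^sup>2 * (G * (real n)\<^sup>2)"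
      by (rule mult_left_mono[OF G(1)]) (simp add: \<theta>0_def)
    also have "\<dots> = (\<theta>0 * G) * ?g\<^sup>2" using n by simp
    also have "\<dots> \<le> 1"
    proof -
      have "(\<theta>0 * G) * ?g\<^sup>2 = (\<theta>0 * G) / (\<theta>0 * G + 1)\<^sup>2" by (simp add: power_divide)
      also have "\<dots> \<le> 1"
      proof -
        have "(t + 1)\<^sup>2 = t\<^sup>2 + 2 * t + 1" for t :: real by (simp add: power2_eq_square algebra_simps)
        from this[of "\<theta>0 * G"] have "\<theta>0 * G \<le> (\<theta>0 * G + 1)\<^sup>2"
          using t0 zero_le_power2[of "\<theta>0 * G"] by linarith
        then show ?thesis using t0 by (simp add: divide_le_eq)
      qed
      finally show ?thesis .
    qed
    finally have c: "20 * (?\<theta> * ?P) * (?K * B\<^sup>2 * E) \<le> 1" .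
    have "ex (\<lambda>\<eta>. exp (?g * (\<Sum>y\<in>torus n. \<psi> y \<eta> * h y \<eta>))) \<le> exp ?b"
      by (rule ex_exp_quadratic[OF \<phi> \<psi> \<psi>0 A(2) D A(4,1) _ V disj l h E B refl c]) simp
    then have "ex (\<lambda>\<eta>. f \<eta> * (\<Sum>y\<in>torus n. \<psi> y \<eta> * h y \<eta>)) \<le> (entropy f + ?b) / ?g"
      by (rule entropy_inequality[OF f g])
    then show ?thesis by simp
  qed
  have "1 / (4 * \<epsilon> * r ^ 4 * (real n)\<^sup>2) * ex (\<lambda>\<eta>. f \<eta> * (\<Sum>y\<in>torus n. (h y \<eta>)\<^sup>2))
    \<le> 1 / (4 * \<epsilon> * r ^ 4 * (real n)\<^sup>2) * ((entropy f + ?b) * (G * (real n)\<^sup>2))"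
    by (rule mult_left_mono[OF 2]) (use eps in simp)
  also have "\<dots> = G / (4 * \<epsilon> * r ^ 4) * (entropy f + ?b)"
  proof -
    have "1 / (c * N) * (X * (G * N)) = G / c * X" if "N \<noteq> 0" for c N X :: real
      using that by (cases "c = 0") (simp_all add: field_simps)
    note gen = this
    have "(real n)\<^sup>2 \<noteq> 0" using n by simp
    then show ?thesis by (rule gen)
  qed
  finally have 4: "1 / (4 * \<epsilon> * r ^ 4 * (real n)\<^sup>2) * ex (\<lambda>\<eta>. f \<eta> * (\<Sum>y\<in>torus n. (h y \<eta>)\<^sup>2))
    \<le> G / (4 * \<epsilon> * r ^ 4) * (entropy f + ?b)" .
  have "ex (\<lambda>\<eta>. f \<eta> * (\<Sum>y\<in>torus n. h y \<eta> * (om y \<eta> - om (y + \<e> j) \<eta>)))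
    \<le> \<epsilon> * (real n)\<^sup>2 * dir_energy j f + G / (4 * \<epsilon> * r ^ 4) * (entropy f + ?b) + (entropy f + ?b) * (\<theta>0 * G + 1)"
    unfolding split using 1 3 4 by linarith
  also have "\<dots> = \<epsilon> * (real n)\<^sup>2 * dir_energy j f + (G / (4 * \<epsilon> * r ^ 4) + \<theta>0 * G + 1) * (entropy f + ?b)"
    by (simp only: ring_distribs mult.commute mult_1_left add.assoc)
  finally show ?thesis unfolding \<theta>0_def .
qed

end

context torus_profile
begin

text \<open>The side of the box in the direction of rank \<open>k\<close> is \<open>m ^ (2 ^ k)\<close>, so that after \<open>k\<close> steps the
  box has \<open>m ^ (2 ^ k - 1)\<close> sites and the next step costs \<open>m\<close>, the ratio of the next side to this
  volume, whatever \<open>k\<close> is. With \<open>m ^ (2 ^ (d - 1))\<close> of order \<open>n\<close> all errors balance.\<close>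

lemma replacement_bound:
  fixes f :: "'d config \<Rightarrow> real"
  assumes rk: "bij_betw rk (UNIV :: 'd set) {..<CARD('d)}"
    and m: "1 \<le> m" "4 * m ^ (2 ^ (CARD('d) - 1)) \<le> n"
    and \<phi>: "local_family n A B \<phi>" "\<And>x. ex (\<phi> x) = 0" and B: "0 < B"
    and A: "finite A" "offset_bound A D" "offset_bound {z} D" "1 \<le> D" "8 * D + 8 \<le> n"
    and zA: "\<forall>a\<in>A. \<exists>i. a $ i < z $ i"
    and L: "\<And>x j. \<bar>u (x + \<e> j) - u x\<bar> \<le> L / n"
    and f: "pos_density f" and eps: "0 < \<epsilon>"
  defines "K \<equiv> real (4 * D + 2) ^ (2 * CARD('d))"
  defines "G \<equiv> 20 * real (4 * D + 2) ^ CARD('d) * K * B\<^sup>2"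
  shows "ex (\<lambda>\<eta>. f \<eta> * (\<Sum>x\<in>torus n. \<phi> x \<eta> * om (x + z) \<eta>))
    \<le> \<epsilon> * (real n)\<^sup>2 * (\<Sum>j\<in>UNIV. dir_energy j f)
      + (real CARD('d) * (G / (4 * \<epsilon> * r ^ 4) + K * (L / r\<^sup>2)\<^sup>2 * (2 ^ (card A + 2))\<^sup>2 * G + 1)
          + (K * (1 / r)\<^sup>2 * (2 ^ (card A + 1))\<^sup>2 * G + 1))
        * (entropy f + real n ^ CARD('d) / real m ^ (2 ^ CARD('d) - 1))"
proof -
  let ?d = "CARD('d)"
  define l where "l i = m ^ (2 ^ rk i)" for i :: 'd
  define V where "V k = stage_box rk l k" for k
  have inj: "inj rk" using rk by (simp add: bij_betw_def)
  have rk_lt: "rk i < ?d" for i using rk by (auto simp: bij_betw_def)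
  have l1: "1 \<le> l i" for i using m(1) by (simp add: l_def)
  have l_le: "4 * l i \<le> n" for i
  proof -
    have "rk i \<le> ?d - 1" using rk_lt[of i] by simp
    then have "2 ^ rk i \<le> (2 ^ (?d - 1) :: nat)" by (rule power_increasing) simp
    then have "l i \<le> m ^ (2 ^ (?d - 1))" unfolding l_def using m(1) by (intro power_increasing) auto
    then show ?thesis using m(2) by linarith
  qed
  have l2: "l i + 2 * D \<le> n" for i using l_le[of i] A(5) by linarith
  have geo: "(\<Sum>t<k. 2 ^ t) = (2 ^ k - 1 :: nat)" for k :: nat
    by (induction k) auto
  have cardV: "card (V k) = m ^ (2 ^ k - 1)" if "k \<le> ?d" for k
  proof -
    have "card (V k) = (\<Prod>i\<in>UNIV. if rk i < k then m ^ (2 ^ rk i) else 1)"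
      unfolding V_def card_box l_def ..
    also have "\<dots> = (\<Prod>t<?d. if t < k then m ^ (2 ^ t) else 1)"
      by (rule prod.reindex_bij_betw[OF rk, of "\<lambda>t. if t < k then m ^ (2 ^ t) else 1"])
    also have "\<dots> = (\<Prod>t<k. m ^ (2 ^ t))"
      by (rule prod.mono_neutral_cong_right) (use that in auto)
    also have "\<dots> = m ^ (\<Sum>t<k. 2 ^ t)" by (simp add: power_sum)
    finally show ?thesis unfolding geo .
  qed
  have vol: "(\<Prod>i\<in>UNIV. real (l i)) = real m ^ (2 ^ ?d - 1)"
  proof -
    have "(\<Prod>i\<in>UNIV. l i) = card (V ?d)" unfolding V_def card_box using rk_lt by simp
    then have "real (\<Prod>i\<in>UNIV. l i) = real (m ^ (2 ^ ?d - 1))" using cardV[of ?d] by simp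
    then show ?thesis by simp
  qed
  let ?vol = "real m ^ (2 ^ ?d - 1)"
  have vol0: "0 < ?vol" using m(1) by simp
  have P: "(\<Prod>i\<in>UNIV. 2 * real (l i + 2 * D)) \<le> real (4 * D + 2) ^ ?d * ?vol"
  proof -
    have "(\<Prod>i\<in>UNIV. 2 * real (l i + 2 * D)) \<le> (\<Prod>i\<in>UNIV. real (4 * D + 2) * real (l i))"
    proof (intro prod_mono conjI)
      fix i
      have "l i + 2 * D \<le> l i + 2 * D * l i" using l1[of i] by simp
      then have "2 * (l i + 2 * D) \<le> (4 * D + 2) * l i" by (simp add: algebra_simps)
      then show "2 * real (l i + 2 * D) \<le> real (4 * D + 2) * real (l i)"
        by (metis of_nat_le_iff of_nat_mult of_nat_numeral)
    qed simp
    also have "\<dots> = real (4 * D + 2) ^ ?d * ?vol" by (simp only: prod.distrib vol prod_constant)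
    finally show ?thesis .
  qed
  have K0: "0 < K" by (simp add: K_def)
  have G0: "0 < G" using K0 B by (simp add: G_def)
  have box: "\<forall>w\<in>V k. \<forall>i. 0 \<le> w $ i \<and> w $ i < int (l i)" for k
    unfolding V_def using box_bounds[where l = l, OF l1] by blast
  have finV: "finite (V k)" for k by (simp add: V_def)
  have disj: "\<not> site_cong n (a - z - w) b" if w: "w \<in> V k" and a: "a \<in> A" and b: "\<And>i. 0 \<le> b $ i \<and> b $ i \<le> 1" for k w a b
  proof
    assume c: "site_cong n (a - z - w) b"
    have "\<bar>(a - z - w) $ i - b $ i\<bar> < int n" for i
    proof -
      have "\<bar>a $ i\<bar> \<le> int D" "\<bar>z $ i\<bar> \<le> int D" using A(2,3) a by (auto simp: offset_bound_def)
      moreover have "0 \<le> w $ i" "w $ i < int (l i)" using box w by auto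
      ultimately show ?thesis using b[of i] l_le[of i] A(5) by simp linarith
    qed
    then have e: "a - z - w = b" using c by (rule site_cong_small_imp_eq)
    obtain i where "a $ i < z $ i" using zA a by blast
    moreover have "a $ i - z $ i - w $ i = b $ i" using arg_cong[OF e, of "\<lambda>v. v $ i"] by simp
    moreover have "0 \<le> w $ i" using box w by blast
    ultimately show False using b[of i] by linarith
  qed
  define Q where "Q k \<eta> = (\<Sum>x\<in>torus n. \<phi> x \<eta> * ((\<Sum>v\<in>V k. om (x + z + v) \<eta>) / card (V k)))" for k \<eta>
  let ?b = "real n ^ ?d / ?vol"
  have b0: "0 \<le> ?b" by simp
  have H0: "0 \<le> entropy f + ?b" using entropy_nonneg[OF f] b0 by linarith
  let ?C1 = "G / (4 * \<epsilon> * r ^ 4) + K * (L / r\<^sup>2)\<^sup>2 * (2 ^ (card A + 2))\<^sup>2 * G + 1"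
  let ?C2 = "K * (1 / r)\<^sup>2 * (2 ^ (card A + 1))\<^sup>2 * G + 1"
  have per: "nperiodic n (\<lambda>x. \<phi> x \<eta> * F (om (x + v) \<eta>) (om (x + w) \<eta>))" if "\<eta> \<in> \<Omega>" for F v w \<eta>
    by (intro nperiodic_comp2[where F = "\<lambda>s t. s * t"] nperiodic_comp2[where F = F] local_familyD(1)[OF \<phi>(1)]
        nperiodic_shift[OF om_periodic] that)
  have reorder: "(\<Sum>x\<in>torus n. \<phi> x \<eta> * (\<Sum>w\<in>W. g w * F (om (x + z + w) \<eta>) (om (x + z + w + e) \<eta>)))
      = (\<Sum>y\<in>torus n. (\<Sum>w\<in>W. g w * \<phi> (y - z - w) \<eta>) * F (om y \<eta>) (om (y + e) \<eta>))"
    if \<eta>: "\<eta> \<in> \<Omega>" for g :: "'d site \<Rightarrow> real" and F W e \<eta>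
  proof -
    have "(\<Sum>y\<in>torus n. (\<Sum>w\<in>W. g w * \<phi> (y - z - w) \<eta>) * F (om y \<eta>) (om (y + e) \<eta>))
      = (\<Sum>w\<in>W. g w * (\<Sum>y\<in>torus n. \<phi> (y + (- z - w)) \<eta> * F (om y \<eta>) (om (y + e) \<eta>)))"
      by (simp add: sum_distrib_left sum_distrib_right mult.assoc sum.swap[of _ W] algebra_simps)
    also have "\<dots> = (\<Sum>w\<in>W. g w * (\<Sum>x\<in>torus n. \<phi> x \<eta> * F (om (x + (z + w)) \<eta>) (om (x + (z + w + e)) \<eta>)))"
    proof (rule sum.cong[OF refl], rule arg_cong2[where f = "(*)", OF refl])
      fix w
      show "(\<Sum>y\<in>torus n. \<phi> (y + (- z - w)) \<eta> * F (om y \<eta>) (om (y + e) \<eta>))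
        = (\<Sum>x\<in>torus n. \<phi> x \<eta> * F (om (x + (z + w)) \<eta>) (om (x + (z + w + e)) \<eta>))"
        using sum_torus_shift[OF n_pos per[OF \<eta>, of F "z + w" "z + w + e"], of "- z - w"] by (simp add: algebra_simps)
    qed
    also have "\<dots> = (\<Sum>x\<in>torus n. \<phi> x \<eta> * (\<Sum>w\<in>W. g w * F (om (x + z + w) \<eta>) (om (x + z + w + e) \<eta>)))"
      by (simp add: sum_distrib_left sum.swap[of _ W] mult.left_commute add.assoc)
    finally show ?thesis ..
  qed
  have step: "ex (\<lambda>\<eta>. f \<eta> * (Q k \<eta> - Q (Suc k) \<eta>)) \<le> \<epsilon> * (real n)\<^sup>2 * dir_energy j f + ?C1 * (entropy f + ?b)"
    if k: "rk j = k" for j k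
  proof -
    define g where "g w = (1 - (real_of_int (w $ j) + 1) / l j) / card (V k)" for w :: "'d site"
    define h where "h y \<eta> = (\<Sum>w\<in>V (Suc k). g w * \<phi> (y - z - w) \<eta>)" for y \<eta>
    have kd: "k < ?d" using rk_lt k by auto
    have cV: "0 < real (card (V k))" "real (card (V (Suc k))) = real (card (V k)) * l j"
      using cardV[of k] kd m(1) box_average_step(2)[where l = l, OF inj k l1] by (auto simp: V_def)
    have diff: "Q k \<eta> - Q (Suc k) \<eta> = (\<Sum>y\<in>torus n. h y \<eta> * (om y \<eta> - om (y + \<e> j) \<eta>))" if \<eta>: "\<eta> \<in> \<Omega>" for \<eta>
    proof -
      have "Q k \<eta> - Q (Suc k) \<eta> = (\<Sum>x\<in>torus n. \<phi> x \<eta> * (\<Sum>w\<in>V (Suc k). g w * (om (x + z + w) \<eta> - om (x + z + w + \<e> j) \<eta>)))"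
        unfolding Q_def sum_subtractf[symmetric] right_diff_distrib[symmetric]
        using box_average_step(1)[where l = l, OF inj k l1, of "\<lambda>v. om (_ + z + v) \<eta>"] unfolding V_def g_def by (simp add: add.assoc)
      also have "\<dots> = (\<Sum>y\<in>torus n. h y \<eta> * (om y \<eta> - om (y + \<e> j) \<eta>))"
        unfolding h_def by (rule reorder[OF \<eta>, where W = "V (Suc k)" and g = g and F = "\<lambda>s t. s - t" and e = "\<e> j"])
      finally show ?thesis .
    qed
    have E: "(\<Sum>w\<in>V (Suc k). (g w)\<^sup>2) \<le> real m"
    proof -
      have "(g w)\<^sup>2 \<le> (1 / real (card (V k)))\<^sup>2" if w: "w \<in> V (Suc k)" for w
      proof -
        have "0 \<le> w $ j" "w $ j + 1 \<le> int (l j)" using box w by (auto simp: int_less_real_le intro: zless_imp_add1_zle)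
        then have "0 \<le> real_of_int (w $ j)" "real_of_int (w $ j) + 1 \<le> real (l j)" by linarith+
        then have "0 \<le> 1 - (real_of_int (w $ j) + 1) / l j" "1 - (real_of_int (w $ j) + 1) / l j \<le> 1"
          using l1[of j] by (auto simp: divide_le_eq)
        then show ?thesis unfolding g_def using cV(1) by (intro power_mono divide_right_mono divide_nonneg_nonneg) auto
      qed
      then have "(\<Sum>w\<in>V (Suc k). (g w)\<^sup>2) \<le> real (card (V (Suc k))) * (1 / real (card (V k)))\<^sup>2"
        by (rule sum_bounded_above)
      also have "\<dots> = real (l j) / real (card (V k))" using cV by (simp add: power2_eq_square)
      also have "\<dots> = real m"
      proof -
        have "(2::nat) ^ k = 2 ^ k - 1 + 1" by simp
        then have "m ^ (2 ^ k) = m * m ^ (2 ^ k - 1)" by (metis power_add power_one_right mult.commute)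
        then show ?thesis using cardV[of k] kd m(1) k by (simp add: l_def field_simps)
      qed
      finally show ?thesis .
    qed
    have n2: "real m * ?vol \<le> (real n)\<^sup>2"
    proof -
      have "m * m ^ (2 ^ ?d - 1) = m ^ (2 ^ ?d)" by (metis One_nat_def Suc_pred power_Suc zero_less_numeral zero_less_power)
      also have "\<dots> = (m ^ (2 ^ (?d - 1)))\<^sup>2"
      proof -
        have "(2::nat) ^ ?d = 2 ^ (?d - 1) * 2" by (metis Suc_diff_1 power_Suc2 zero_less_card_finite)
        then show ?thesis by (simp add: power_mult)
      qed
      also have "\<dots> \<le> n\<^sup>2" using m(2) by (intro power_mono) auto
      finally have "real (m * m ^ (2 ^ ?d - 1)) \<le> real (n\<^sup>2)" by (rule of_nat_mono)
      then show ?thesis by simp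
    qed
    have Gc: "20 * (\<Prod>i\<in>UNIV. 2 * real (l i + 2 * D)) * (K * B\<^sup>2 * real m) \<le> G * (real n)\<^sup>2"
    proof -
      have "20 * (\<Prod>i\<in>UNIV. 2 * real (l i + 2 * D)) * (K * B\<^sup>2 * real m)
        \<le> 20 * (real (4 * D + 2) ^ ?d * ?vol) * (K * B\<^sup>2 * real m)"
        by (intro mult_right_mono mult_left_mono P) (use K0 in auto)
      also have "\<dots> = G * (real m * ?vol)" unfolding G_def by (simp only: mult_ac)
      also have "\<dots> \<le> G * (real n)\<^sup>2" using n2 G0 by (intro mult_left_mono) auto
      finally show ?thesis .
    qed
    have "ex (\<lambda>\<eta>. f \<eta> * (\<Sum>y\<in>torus n. h y \<eta> * (om y \<eta> - om (y + \<e> j) \<eta>)))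
      \<le> \<epsilon> * (real n)\<^sup>2 * dir_energy j f + ?C1 * (entropy f + real n ^ ?d / (\<Prod>i\<in>UNIV. real (l i)))"
      unfolding K_def
    proof (rule increment_bound[OF \<phi> B A(1,2,4) _ finV box _ l1 l2 h_def E _ _ G0 L f eps])
      show "2 * D + 1 \<le> n" using A(5) by simp
      show "\<forall>w\<in>V (Suc k). \<forall>a\<in>A. \<forall>b\<in>{0, \<e> j}. \<not> site_cong n (a - z - w) b"
        by (intro ballI disj) (auto simp: axis_def)
      show "20 * (\<Prod>i\<in>UNIV. 2 * real (l i + 2 * D)) * (real (4 * D + 2) ^ (2 * CARD('d)) * B\<^sup>2 * real m) \<le> G * (real n)\<^sup>2"
        using Gc unfolding K_def .
      show "0 < real m" using m(1) by simp
    qed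
    then show ?thesis unfolding vol using diff by (simp cong: ex_cong)
  qed
  have last: "ex (\<lambda>\<eta>. f \<eta> * Q ?d \<eta>) \<le> ?C2 * (entropy f + ?b)"
  proof -
    define g where "g w = 1 / ?vol" for w :: "'d site"
    define h where "h y \<eta> = (\<Sum>w\<in>V ?d. g w * \<phi> (y - z - w) \<eta>)" for y \<eta>
    define t where "t = K * (1 / r)\<^sup>2 * (2 ^ (card A + 1))\<^sup>2 * G"
    have t0: "0 \<le> t" using K0 G0 by (simp add: t_def)
    let ?g = "1 / (t + 1)"
    have g0: "0 < ?g" using t0 by simp
    have cVd: "real (card (V ?d)) = ?vol" using cardV[of ?d] by simp
    have E: "(\<Sum>w\<in>V ?d. (g w)\<^sup>2) \<le> 1 / ?vol"
      using vol0 by (simp add: g_def cVd power2_eq_square)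
    have Qd: "Q ?d \<eta> = (\<Sum>y\<in>torus n. om y \<eta> * h y \<eta>)" if "\<eta> \<in> \<Omega>" for \<eta>
    proof -
      have "Q ?d \<eta> = (\<Sum>x\<in>torus n. \<phi> x \<eta> * (\<Sum>w\<in>V ?d. g w * om (x + z + w) \<eta>))"
        unfolding Q_def cVd g_def by (simp add: sum_divide_distrib)
      then show ?thesis using reorder[OF that, where W = "V ?d" and g = g and F = "\<lambda>s t. s" and e = 0] by (simp add: h_def mult.commute)
    qed
    let ?\<theta> = "real (4 * D + 2) ^ (2 * CARD('d)) * (1 / r)\<^sup>2 * (?g * 2 ^ (card A + card {0 :: 'd site}))\<^sup>2"
    have "20 * (?\<theta> * (\<Prod>i\<in>UNIV. 2 * real (l i + 2 * D))) * (K * B\<^sup>2 * (1 / ?vol))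
      \<le> 20 * (?\<theta> * (real (4 * D + 2) ^ ?d * ?vol)) * (K * B\<^sup>2 * (1 / ?vol))"
      by (intro mult_right_mono mult_left_mono P) (use K0 vol0 in auto)
    also have "\<dots> = t * ?g\<^sup>2"
    proof -
      have th: "?\<theta> = K * (1 / r)\<^sup>2 * ((2 ^ (card A + 1))\<^sup>2 * ?g\<^sup>2)"
        unfolding K_def power_mult_distrib[of ?g] by simp
      have gen: "20 * (a * b * (c * e) * (X * v)) * (k * q * (1 / v)) = s * e"
        if "v \<noteq> 0" "s = a * b * c * (20 * X * k * q)" for a b c e X v k q s :: real using that by simp
      show ?thesis unfolding th by (rule gen) (use m(1) in simp, simp only: t_def G_def)
    qed
    also have "\<dots> \<le> 1"
    proof -
      have "(t + 1)\<^sup>2 = t\<^sup>2 + 2 * t + 1" by (simp add: power2_eq_square algebra_simps)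
      then have "t \<le> (t + 1)\<^sup>2" using t0 zero_le_power2[of t] by linarith
      then show ?thesis using t0 by (simp add: power_divide divide_le_eq)
    qed
    finally have c: "20 * (?\<theta> * (\<Prod>i\<in>UNIV. 2 * real (l i + 2 * D))) * (real (4 * D + 2) ^ (2 * CARD('d)) * B\<^sup>2 * (1 / ?vol)) \<le> 1"
      unfolding K_def .
    have fam: "local_family n {0} (1 / r) om"
      unfolding local_family_def using om_periodic om_abs om_depends by simp
    have "ex (\<lambda>\<eta>. exp (?g * (\<Sum>y\<in>torus n. om y \<eta> * h y \<eta>))) \<le> exp (real n ^ ?d / (\<Prod>i\<in>UNIV. real (l i)))"
    proof (rule ex_exp_quadratic[OF \<phi> fam ex_om A(2) _ _ A(1) _ finV box _ l1 l2 h_def E _ B refl c])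
      show "\<forall>w\<in>V ?d. \<forall>a\<in>A. \<forall>b\<in>{0}. \<not> site_cong n (a - z - w) b" by (intro ballI disj) auto
    qed (use A(5) vol0 in \<open>auto simp: offset_bound_def\<close>)
    then have "ex (\<lambda>\<eta>. f \<eta> * (\<Sum>y\<in>torus n. om y \<eta> * h y \<eta>)) \<le> (entropy f + ?b) / ?g"
      unfolding vol by (rule entropy_inequality[OF f g0])
    then show ?thesis using Qd by (simp add: t_def mult.commute cong: ex_cong)
  qed
  define Z where "Z = ?C1 * (entropy f + ?b)"
  have tele: "ex (\<lambda>\<eta>. f \<eta> * (Q 0 \<eta> - Q k \<eta>)) \<le> \<epsilon> * (real n)\<^sup>2 * (\<Sum>t<k. dir_energy (inv_into UNIV rk t) f) + real k * Z"
    if "k \<le> ?d" for k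
    using that
  proof (induction k)
    case 0 then show ?case by simp
  next
    case (Suc k)
    have "rk (inv_into UNIV rk k) = k" using Suc.prems rk by (intro f_inv_into_f) (auto simp: bij_betw_def)
    note s = step[OF this, folded Z_def]
    have "ex (\<lambda>\<eta>. f \<eta> * (Q 0 \<eta> - Q (Suc k) \<eta>)) = ex (\<lambda>\<eta>. f \<eta> * (Q 0 \<eta> - Q k \<eta>)) + ex (\<lambda>\<eta>. f \<eta> * (Q k \<eta> - Q (Suc k) \<eta>))"
      unfolding ex_add[symmetric] by (rule ex_cong) (simp add: algebra_simps)
    also have "\<dots> \<le> (\<epsilon> * (real n)\<^sup>2 * (\<Sum>t<k. dir_energy (inv_into UNIV rk t) f) + real k * Z)
        + (\<epsilon> * (real n)\<^sup>2 * dir_energy (inv_into UNIV rk k) f + Z)"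
      using s Suc by (intro add_mono) auto
    finally show ?case by (simp add: distrib_left distrib_right)
  qed
  have Q0: "Q 0 \<eta> = (\<Sum>x\<in>torus n. \<phi> x \<eta> * om (x + z) \<eta>)" for \<eta>
    by (simp add: Q_def V_def box_0)
  have "ex (\<lambda>\<eta>. f \<eta> * Q 0 \<eta>) = ex (\<lambda>\<eta>. f \<eta> * (Q 0 \<eta> - Q ?d \<eta>)) + ex (\<lambda>\<eta>. f \<eta> * Q ?d \<eta>)"
    unfolding ex_add[symmetric] by (rule ex_cong) (simp add: algebra_simps)
  also have "\<dots> \<le> \<epsilon> * (real n)\<^sup>2 * (\<Sum>t<?d. dir_energy (inv_into UNIV rk t) f) + real ?d * Z + ?C2 * (entropy f + ?b)"
    using tele[of ?d] last by linarith
  also have "(\<Sum>t<?d. dir_energy (inv_into UNIV rk t) f) = (\<Sum>j\<in>UNIV. dir_energy j f)"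
    by (rule sum.reindex_bij_betw[OF bij_betw_inv_into[OF rk]])
  finally show ?thesis
    unfolding Q0 Z_def distrib_right[of "real ?d * ?C1"] by (simp only: mult.assoc add.assoc)
qed

end

section \<open>Decomposition of local functions\<close>

context torus_profile
begin

definition cen :: "'d site \<Rightarrow> 'd config \<Rightarrow> real"
  where "cen x \<eta> = of_bool (\<eta> x) - u x"

lemma cen_depends: "depends_on n (cen x) {x}"
  unfolding cen_def by (rule depends_on_site)

lemma om_cen: "om x \<eta> = cen x \<eta> / (u x * (1 - u x))"
  by (simp add: om_def cen_def)

lemma ex_om_cen: "ex (\<lambda>\<eta>. om x \<eta> * cen x \<eta>) = 1"
proof -
  have "ex (\<lambda>\<eta>. om x \<eta> * cen x \<eta>) = u x * (1 / u x * (1 - u x)) + (1 - u x) * (- 1 / (1 - u x) * (- u x))"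
    using ex_marginal[of "\<lambda>b. (if b then 1 / u x else - 1 / (1 - u x)) * (of_bool b - u x)" x]
    by (simp add: om_values cen_def)
  then show ?thesis using u_pos[of x] u_less_1[of x] by simp
qed

lemma ex_cen: "ex (cen x) = 0"
  using ex_marginal[of "\<lambda>b. of_bool b - u x" x] by (simp add: cen_def[abs_def] algebra_simps)

lemma cen_cong: "site_cong n x y \<Longrightarrow> \<eta> \<in> \<Omega> \<Longrightarrow> cen x \<eta> = cen y \<eta>"
  using u_periodic by (simp add: cen_def torus_configs_def nperiodic_def)

text \<open>The derivative with respect to the value at one site. The weight, the variance there, makes it
  the coefficient of \<open>om z\<close>.\<close>

definition site_diff :: "'d site \<Rightarrow> ('d config \<Rightarrow> real) \<Rightarrow> 'd config \<Rightarrow> real"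
  where "site_diff z X \<eta> = u z * (1 - u z) * (X (upd n z True \<eta>) - X (upd n z False \<eta>))"

text \<open>Every function of a single occupation variable is affine in \<open>om z\<close>, and
  the coefficients no longer read the site \<open>z\<close>.\<close>

lemma site_decomposition:
  assumes "\<eta> \<in> \<Omega>" shows "X \<eta> = site_avg z X \<eta> + site_diff z X \<eta> * om z \<eta>"
proof -
  have "X \<eta> = X (upd n z (\<eta> z) \<eta>)" by (simp add: upd_same assms)
  moreover have c: "u z * (1 - u z) * om z \<eta> = (if \<eta> z then 1 - u z else - u z)"
    using u_pos[of z] u_less_1[of z] by (simp add: om_values)
  have "site_diff z X \<eta> * om z \<eta> = (u z * (1 - u z) * om z \<eta>) * (X (upd n z True \<eta>) - X (upd n z False \<eta>))"
    by (simp add: site_diff_def)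
  then have "site_diff z X \<eta> * om z \<eta> = (if \<eta> z then 1 - u z else - u z) * (X (upd n z True \<eta>) - X (upd n z False \<eta>))"
    unfolding c .
  ultimately show ?thesis
    by (cases "\<eta> z") (simp_all add: site_avg_def algebra_simps)
qed

lemma site_family:
  assumes W: "local_family n \<Lambda> B W"
  shows "local_family n (\<Lambda> - {z}) B (\<lambda>x. site_avg (x + z) (W x))"
    and "local_family n (\<Lambda> - {z}) (2 * B) (\<lambda>x. site_diff (x + z) (W x))"
proof -
  have B0: "0 \<le> B" by (rule local_family_bound_nonneg[OF W])
  have agree: "W x (upd n (x + z) b \<eta>) = W x (upd n (x + z) b \<xi>)"
    if "\<eta> \<in> \<Omega>" "\<xi> \<in> \<Omega>" "\<And>y. y \<in> (+) x ` (\<Lambda> - {z}) \<Longrightarrow> \<eta> y = \<xi> y" for x b \<eta> \<xi>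
    by (rule depends_onD[OF local_familyD(2)[OF W] upd_in_configs[OF that(1)] upd_in_configs[OF that(2)]])
       (use that(3) in \<open>auto simp: upd_def\<close>)
  have per: "W x (upd n (x + z) b \<eta>) = W y (upd n (y + z) b \<eta>)" "u (x + z) = u (y + z)"
    if "site_cong n x y" "\<eta> \<in> \<Omega>" for x y b \<eta>
  proof -
    have c: "site_cong n (x + z) (y + z)" using that(1) by simp
    have "upd n (x + z) b \<eta> = upd n (y + z) b \<eta>"
    proof -
      have "site_cong n t (x + z) = site_cong n t (y + z)" for t
        using c by (meson site_cong_sym site_cong_trans)
      then show ?thesis by (simp add: upd_def)
    qed
    then show "W x (upd n (x + z) b \<eta>) = W y (upd n (y + z) b \<eta>)"
      using nperiodicD[OF local_familyD(1)[OF W] that(1), of "upd n (y + z) b \<eta>"] that(2) by simp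
    show "u (x + z) = u (y + z)" using u_periodic c by (rule nperiodicD)
  qed
  have bd: "\<bar>W x (upd n (x + z) b \<eta>)\<bar> \<le> B" if "\<eta> \<in> \<Omega>" for x b \<eta>
    by (rule local_familyD(3)[OF W]) (use that in simp)
  show "local_family n (\<Lambda> - {z}) B (\<lambda>x. site_avg (x + z) (W x))"
    unfolding local_family_def
  proof (intro conjI ballI allI)
    fix \<eta> assume \<eta>: "\<eta> \<in> \<Omega>"
    show "nperiodic n (\<lambda>x. site_avg (x + z) (W x) \<eta>)"
      unfolding nperiodic_def
    proof (intro allI impI)
      fix x y :: "'d site" assume c: "site_cong n x y"
      show "site_avg (x + z) (W x) \<eta> = site_avg (y + z) (W y) \<eta>"
        unfolding site_avg_def per[OF c \<eta>] by simp
    qed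
    fix x
    have "\<bar>site_avg (x + z) (W x) \<eta>\<bar> \<le> u (x + z) * B + (1 - u (x + z)) * B"
      unfolding site_avg_def
      by (rule order_trans[OF abs_triangle_ineq], unfold abs_mult, intro add_mono mult_mono bd \<eta>)
         (use u_pos[of "x + z"] u_less_1[of "x + z"] in auto)
    then show "\<bar>site_avg (x + z) (W x) \<eta>\<bar> \<le> B" by (simp add: algebra_simps)
  next
    fix x show "depends_on n (site_avg (x + z) (W x)) ((+) x ` (\<Lambda> - {z}))"
    proof (rule depends_onI)
      fix \<eta> \<xi> :: "'d config" assume h: "\<eta> \<in> \<Omega>" "\<xi> \<in> \<Omega>" "\<And>y. y \<in> (+) x ` (\<Lambda> - {z}) \<Longrightarrow> \<eta> y = \<xi> y"
      have "W x (upd n (x + z) b \<eta>) = W x (upd n (x + z) b \<xi>)" for b by (rule agree[OF h])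
      then show "site_avg (x + z) (W x) \<eta> = site_avg (x + z) (W x) \<xi>" by (simp only: site_avg_def)
    qed
  qed
  show "local_family n (\<Lambda> - {z}) (2 * B) (\<lambda>x. site_diff (x + z) (W x))"
    unfolding local_family_def
  proof (intro conjI ballI allI)
    fix \<eta> assume \<eta>: "\<eta> \<in> \<Omega>"
    show "nperiodic n (\<lambda>x. site_diff (x + z) (W x) \<eta>)"
      unfolding nperiodic_def
    proof (intro allI impI)
      fix x y :: "'d site" assume c: "site_cong n x y"
      show "site_diff (x + z) (W x) \<eta> = site_diff (y + z) (W y) \<eta>"
        unfolding site_diff_def per[OF c \<eta>] by simp
    qed
    fix x
    have "\<bar>site_diff (x + z) (W x) \<eta>\<bar> \<le> 1 * (B + B)"
      unfolding site_diff_def abs_mult[of "u (x + z) * (1 - u (x + z))"]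
      by (intro mult_mono order_trans[OF abs_triangle_ineq4] add_mono bd \<eta>)
         (use chi_pos[of "x + z"] chi_upper[of "x + z"] in auto)
    then show "\<bar>site_diff (x + z) (W x) \<eta>\<bar> \<le> 2 * B" by simp
  next
    fix x show "depends_on n (site_diff (x + z) (W x)) ((+) x ` (\<Lambda> - {z}))"
    proof (rule depends_onI)
      fix \<eta> \<xi> :: "'d config" assume h: "\<eta> \<in> \<Omega>" "\<xi> \<in> \<Omega>" "\<And>y. y \<in> (+) x ` (\<Lambda> - {z}) \<Longrightarrow> \<eta> y = \<xi> y"
      have "W x (upd n (x + z) b \<eta>) = W x (upd n (x + z) b \<xi>)" for b by (rule agree[OF h])
      then show "site_diff (x + z) (W x) \<eta> = site_diff (x + z) (W x) \<xi>" by (simp only: site_diff_def)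
    qed
  qed
qed

text \<open>The coefficient of \<open>om t\<close> in the expansion of \<open>\<Sum>y. W y\<close> is its covariance with the
  occupation variable at \<open>t\<close>.\<close>

definition lin_coeff :: "('d site \<Rightarrow> 'd config \<Rightarrow> real) \<Rightarrow> 'd site \<Rightarrow> real"
  where "lin_coeff W t = (\<Sum>y\<in>torus n. ex (\<lambda>\<eta>. W y \<eta> * cen t \<eta>))"

text \<open>The sum of the \<open>W y\<close> without its mean and its linear part: its projection
  on the span of the products of at least two of the variables \<open>om\<close>.\<close>

definition nonlinear :: "('d site \<Rightarrow> 'd config \<Rightarrow> real) \<Rightarrow> 'd config \<Rightarrow> real"
  where "nonlinear W \<eta> = (\<Sum>y\<in>torus n. W y \<eta> - ex (W y)) - (\<Sum>t\<in>torus n. lin_coeff W t * om t \<eta>)"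

text \<open>Because \<open>om\<close> is dual to \<open>cen\<close>, removing a site changes the
  linear coefficient there by the mean of \<open>site_diff\<close>; what is left is the centred
  coefficient times \<open>om\<close>.\<close>

lemma nonlinear_step:
  assumes W: "local_family n \<Lambda> B W" and z: "\<forall>a\<in>\<Lambda> - {z}. \<not> site_cong n a z" and \<eta>: "\<eta> \<in> \<Omega>"
  shows "nonlinear W \<eta> = nonlinear (\<lambda>x. site_avg (x + z) (W x)) \<eta>
    + (\<Sum>x\<in>torus n. (site_diff (x + z) (W x) \<eta> - ex (site_diff (x + z) (W x))) * om (x + z) \<eta>)"
proof -
  let ?W' = "\<lambda>x. site_avg (x + z) (W x)" and ?p = "\<lambda>x. site_diff (x + z) (W x)"
  note fam = site_family[OF W, of z]
  have sep: "\<not> site_cong n a (y + z)" if "a \<in> (+) y ` (\<Lambda> - {z})" for a y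
    using z that by auto
  have cov: "ex (\<lambda>\<eta>. ?p y \<eta> * om (y + z) \<eta> * cen t \<eta>) = of_bool (site_cong n t (y + z)) * ex (?p y)" for y t
  proof (cases "site_cong n t (y + z)")
    case True
    have "ex (\<lambda>\<eta>. ?p y \<eta> * om (y + z) \<eta> * cen t \<eta>) = ex (\<lambda>\<eta>. ?p y \<eta> * (om (y + z) \<eta> * cen (y + z) \<eta>))"
      by (rule ex_cong) (simp add: cen_cong[OF True] mult.assoc)
    also have "\<dots> = ex (?p y) * ex (\<lambda>\<eta>. om (y + z) \<eta> * cen (y + z) \<eta>)"
    proof (rule ex_indep[OF local_familyD(2)[OF fam(2)]])
      show "depends_on n (\<lambda>\<eta>. om (y + z) \<eta> * cen (y + z) \<eta>) {y + z}"
        using depends_on_comp2[OF om_depends[of "y + z"] cen_depends[of "y + z"], of "(*)"] by simp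
    qed (use sep in auto)
    finally show ?thesis using True by (simp add: ex_om_cen)
  next
    case False
    have "ex (\<lambda>\<eta>. ?p y \<eta> * om (y + z) \<eta> * cen t \<eta>) = ex (\<lambda>\<eta>. (?p y \<eta> * cen t \<eta>) * om (y + z) \<eta>)"
      by (rule ex_cong) simp
    also have "\<dots> = ex (\<lambda>\<eta>. ?p y \<eta> * cen t \<eta>) * ex (om (y + z))"
      by (rule ex_indep[OF depends_on_comp2[OF local_familyD(2)[OF fam(2)] cen_depends] om_depends])
         (use sep False in auto)
    finally show ?thesis using False by (simp add: ex_om)
  qed
  have split: "ex (\<lambda>\<eta>. W y \<eta> * cen t \<eta>) = ex (\<lambda>\<eta>. ?W' y \<eta> * cen t \<eta>) + of_bool (site_cong n y (t - z)) * ex (?p y)" for y t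
  proof -
    have "ex (\<lambda>\<eta>. W y \<eta> * cen t \<eta>) = ex (\<lambda>\<eta>. ?W' y \<eta> * cen t \<eta> + ?p y \<eta> * om (y + z) \<eta> * cen t \<eta>)"
      by (rule ex_cong, subst site_decomposition[where z = "y + z"], assumption) (simp add: distrib_right)
    moreover have "site_cong n t (y + z) \<longleftrightarrow> site_cong n y (t - z)"
      using site_cong_add_right[of n y z "t - z"] by (simp add: site_cong_commute)
    ultimately show ?thesis by (simp add: ex_add cov)
  qed
  have perp: "nperiodic n (\<lambda>y. ex (?p y))"
    unfolding nperiodic_def
    by (intro allI impI ex_cong) (rule nperiodicD[OF local_familyD(1)[OF fam(2)]])
  have lin: "lin_coeff W t = lin_coeff ?W' t + ex (?p (t - z))" for t
    unfolding lin_coeff_def split sum.distrib using sum_torus_indicator[OF n_pos perp] by simp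
  have "(\<Sum>t\<in>torus n. ex (?p (t - z)) * om t \<eta>) = (\<Sum>x\<in>torus n. ex (?p x) * om (x + z) \<eta>)"
    using sum_torus_shift[OF n_pos nperiodic_comp2[where F = "(*)", OF perp nperiodic_shift[OF om_periodic[OF \<eta>], of z]], of "- z"] by simp
  then have "(\<Sum>t\<in>torus n. lin_coeff W t * om t \<eta>)
    = (\<Sum>t\<in>torus n. lin_coeff ?W' t * om t \<eta>) + (\<Sum>x\<in>torus n. ex (?p x) * om (x + z) \<eta>)"
    by (simp add: lin distrib_right sum.distrib)
  moreover have "(\<Sum>y\<in>torus n. W y \<eta> - ex (W y)) = (\<Sum>y\<in>torus n. ?W' y \<eta> - ex (?W' y)) + (\<Sum>x\<in>torus n. ?p x \<eta> * om (x + z) \<eta>)"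
    unfolding sum.distrib[symmetric]
    by (intro sum.cong refl, subst site_decomposition[OF \<eta>, where z = "_ + z"]) (simp add: ex_site_avg)
  ultimately show ?thesis
    by (simp add: nonlinear_def left_diff_distrib sum_subtractf)
qed

lemma nonlinear_const:
  assumes W: "local_family n {} B W" and \<eta>: "\<eta> \<in> \<Omega>"
  shows "nonlinear W \<eta> = 0"
proof -
  have c: "W y \<xi> = W y \<eta>" if "\<xi> \<in> \<Omega>" for y \<xi>
    by (rule depends_onD[OF local_familyD(2)[OF W] that \<eta>]) simp
  have "ex (W y) = ex (\<lambda>_. W y \<eta>)" for y by (rule ex_cong) (rule c)
  moreover have "ex (\<lambda>\<xi>. W y \<xi> * cen t \<xi>) = ex (\<lambda>\<xi>. W y \<eta> * cen t \<xi>)" for y t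
    by (rule ex_cong) (simp add: c)
  ultimately show ?thesis by (simp add: nonlinear_def lin_coeff_def ex_cmult ex_cen)
qed

definition total_energy :: "('d config \<Rightarrow> real) \<Rightarrow> real"
  where "total_energy f = (\<Sum>j\<in>UNIV. dir_energy j f)"

lemma total_energy_nonneg: "0 \<le> total_energy f"
  unfolding total_energy_def by (intro sum_nonneg dir_energy_nonneg)

end

text \<open>What the replacement needs to know about the profile and the box. The longest side of the box,
  \<open>m ^ (2 ^ (d - 1))\<close>, leaves room in the torus for the sites that the local functions read.\<close>

definition slow_profile :: "real \<Rightarrow> real \<Rightarrow> nat \<Rightarrow> ('d::finite site \<Rightarrow> real) \<Rightarrow> nat \<Rightarrow> bool"
  where "slow_profile r L n u m \<longleftrightarrow> torus_profile n u r \<and> (\<forall>x j. \<bar>u (x + \<e> j) - u x\<bar> \<le> L / n) \<and>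
    1 \<le> m \<and> 4 * m ^ (2 ^ (CARD('d) - 1)) \<le> n"

lemma replacement:
  fixes A :: "'d::finite site set"
  assumes A: "finite A" "\<forall>a\<in>A. \<exists>i. a $ i < z $ i" and B: "0 < B" and eps: "0 < \<epsilon>"
  shows "\<exists>C\<ge>0. \<exists>n0. \<forall>n\<ge>n0. \<forall>u m \<phi> f. slow_profile r L n u m \<longrightarrow> local_family n A B \<phi> \<longrightarrow>
    (\<forall>x. torus_profile.ex n u (\<phi> x) = 0) \<longrightarrow> torus_profile.pos_density n u f \<longrightarrow>
    torus_profile.ex n u (\<lambda>\<eta>. f \<eta> * (\<Sum>x\<in>torus n. \<phi> x \<eta> * torus_profile.om u (x + z) \<eta>))
    \<le> \<epsilon> * (real n)\<^sup>2 * torus_profile.total_energy n u f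
      + C * (torus_profile.ex n u (\<lambda>\<eta>. f \<eta> * ln (f \<eta>)) + real n ^ CARD('d) / real m ^ (2 ^ CARD('d) - 1))"
proof -
  obtain rk where "bij_betw rk (UNIV :: 'd set) {0..<card (UNIV :: 'd set)}"
    using ex_bij_betw_finite_nat[OF finite_class.finite_UNIV] by blast
  then have rk: "bij_betw rk (UNIV :: 'd set) {..<CARD('d)}" by (simp add: atLeast0LessThan)
  obtain D' where D': "offset_bound (insert z A) D'" using offset_bound_exists A(1) by blast
  define D where "D = Suc D'"
  have D: "offset_bound A D" "offset_bound {z} D" "1 \<le> D"
    using D' by (auto intro: offset_bound_mono simp: D_def)
  let ?K = "real (4 * D + 2) ^ (2 * CARD('d))"
  let ?G = "20 * real (4 * D + 2) ^ CARD('d) * ?K * B\<^sup>2"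
  let ?C = "real CARD('d) * (?G / (4 * \<epsilon> * r ^ 4) + ?K * (L / r\<^sup>2)\<^sup>2 * (2 ^ (card A + 2))\<^sup>2 * ?G + 1)
          + (?K * (1 / r)\<^sup>2 * (2 ^ (card A + 1))\<^sup>2 * ?G + 1)"
  show ?thesis
  proof (intro exI[of _ ?C] exI[of _ "8 * D + 8"] conjI allI impI)
    show "0 \<le> ?C" using eps by (intro add_nonneg_nonneg mult_nonneg_nonneg divide_nonneg_nonneg) auto
  next
    fix n m :: nat and u :: "'d site \<Rightarrow> real" and \<phi> f
    assume n: "8 * D + 8 \<le> n" and sp: "slow_profile r L n u m" and \<phi>: "local_family n A B \<phi>"
      "\<forall>x. torus_profile.ex n u (\<phi> x) = 0" and f: "torus_profile.pos_density n u f"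
    interpret torus_profile n u r using sp by (simp add: slow_profile_def)
    show "ex (\<lambda>\<eta>. f \<eta> * (\<Sum>x\<in>torus n. \<phi> x \<eta> * om (x + z) \<eta>))
      \<le> \<epsilon> * (real n)\<^sup>2 * total_energy f + ?C * (entropy f + real n ^ CARD('d) / real m ^ (2 ^ CARD('d) - 1))"
      unfolding total_energy_def
      by (rule replacement_bound[OF rk _ _ \<phi>(1) _ B A(1) D(1,2,3) n A(2) _ f eps])
         (use sp \<phi>(2) in \<open>auto simp: slow_profile_def\<close>)
  qed
qed

text \<open>Removing the sites of a local function one at a time, from the largest coordinate sum
  downwards, each step produces centred functions times an occupation variable ahead of them.\<close>

lemma nonlinear_bound:
  fixes \<Lambda> :: "'d::finite site set"
  assumes "finite \<Lambda>" and B: "0 < B" and "0 < \<epsilon>"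
  shows "\<exists>C\<ge>0. \<exists>n0. \<forall>n\<ge>n0. \<forall>u m W f. slow_profile r L n u m \<longrightarrow> local_family n \<Lambda> B W \<longrightarrow>
    torus_profile.pos_density n u f \<longrightarrow>
    torus_profile.ex n u (\<lambda>\<eta>. f \<eta> * torus_profile.nonlinear n u W \<eta>)
    \<le> \<epsilon> * (real n)\<^sup>2 * torus_profile.total_energy n u f
      + C * (torus_profile.ex n u (\<lambda>\<eta>. f \<eta> * ln (f \<eta>)) + real n ^ CARD('d) / real m ^ (2 ^ CARD('d) - 1))"
  using assms(1,3)
proof (induction \<Lambda> arbitrary: \<epsilon> rule: finite_psubset_induct)
  case (psubset \<Lambda>)
  show ?case
  proof (cases "\<Lambda> = {}")
    case True
    show ?thesis
    proof (intro exI[of _ 0] conjI exI[of _ "0::nat"] allI impI)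
      fix n m :: nat and u :: "'d site \<Rightarrow> real" and W f
      assume sp: "slow_profile r L n u m" and W: "local_family n \<Lambda> B W"
      interpret torus_profile n u r using sp by (simp add: slow_profile_def)
      have "ex (\<lambda>\<eta>. f \<eta> * nonlinear W \<eta>) = ex (\<lambda>_. 0)"
        by (rule ex_cong) (use nonlinear_const W True in simp)
      also have "\<dots> \<le> \<epsilon> * (real n)\<^sup>2 * total_energy f" using total_energy_nonneg[of f] psubset.prems by simp
      finally show "ex (\<lambda>\<eta>. f \<eta> * nonlinear W \<eta>) \<le> \<epsilon> * (real n)\<^sup>2 * total_energy f
        + 0 * (entropy f + real n ^ CARD('d) / real m ^ (2 ^ CARD('d) - 1))" by simp
    qed simp
  next
    case False
    let ?s = "\<lambda>a :: 'd site. \<Sum>i\<in>UNIV. a $ i"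
    have "Max (?s ` \<Lambda>) \<in> ?s ` \<Lambda>" using False psubset.hyps by (intro Max_in) auto
    then obtain z where z': "Max (?s ` \<Lambda>) = ?s z" "z \<in> \<Lambda>" by (rule imageE)
    note z = z'(2) z'(1)[symmetric]
    have zmax: "?s a \<le> ?s z" if "a \<in> \<Lambda>" for a
      unfolding z(2) using that psubset.hyps by (intro Max_ge) auto
    let ?A = "\<Lambda> - {z}"
    \<comment> \<open>No remaining site lies ahead of \<open>z\<close> in all directions, so the boxes starting at \<open>z\<close> avoid
      the sites that the coefficient reads.\<close>
    have zA: "\<forall>a\<in>?A. \<exists>i. a $ i < z $ i"
    proof (rule ccontr)
      assume "\<not> ?thesis"
      then obtain a where a: "a \<in> \<Lambda>" "a \<noteq> z" "\<And>i. z $ i \<le> a $ i" by (auto simp: not_less)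
      obtain i where "a $ i \<noteq> z $ i" using a(2) by (auto simp: vec_eq_iff)
      then have "z $ i < a $ i" using a(3)[of i] by simp
      then have "?s z < ?s a" using a(3) by (intro sum_strict_mono_ex1) auto
      then show False using zmax[OF a(1)] by simp
    qed
    have sub: "?A \<subset> \<Lambda>" using z by blast
    have fA: "finite ?A" using psubset.hyps by simp
    have e2: "0 < \<epsilon> / 2" using psubset.prems by simp
    obtain C1 n1 where C1: "0 \<le> C1" and
      1: "\<And>n u m W f. n1 \<le> n \<Longrightarrow> slow_profile r L n u m \<Longrightarrow> local_family n ?A B W \<Longrightarrow> torus_profile.pos_density n u f \<Longrightarrow>
        torus_profile.ex n u (\<lambda>\<eta>. f \<eta> * torus_profile.nonlinear n u W \<eta>) \<le> \<epsilon> / 2 * (real n)\<^sup>2 * torus_profile.total_energy n u f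
        + C1 * (torus_profile.ex n u (\<lambda>\<eta>. f \<eta> * ln (f \<eta>)) + real n ^ CARD('d) / real m ^ (2 ^ CARD('d) - 1))"
      using psubset.IH[OF sub e2] by blast
    have B4: "0 < 4 * B" using B by simp
    obtain C2 n2 where C2: "0 \<le> C2" and
      2: "\<And>n u m \<phi> f. n2 \<le> n \<Longrightarrow> slow_profile r L n u m \<Longrightarrow> local_family n ?A (4 * B) \<phi> \<Longrightarrow>
        (\<forall>x. torus_profile.ex n u (\<phi> x) = 0) \<Longrightarrow> torus_profile.pos_density n u f \<Longrightarrow>
        torus_profile.ex n u (\<lambda>\<eta>. f \<eta> * (\<Sum>x\<in>torus n. \<phi> x \<eta> * torus_profile.om u (x + z) \<eta>)) \<le> \<epsilon> / 2 * (real n)\<^sup>2 * torus_profile.total_energy n u f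
        + C2 * (torus_profile.ex n u (\<lambda>\<eta>. f \<eta> * ln (f \<eta>)) + real n ^ CARD('d) / real m ^ (2 ^ CARD('d) - 1))"
      using replacement[OF fA zA B4 e2, of r L] by blast
    obtain D where D: "offset_bound \<Lambda> D" using offset_bound_exists psubset.hyps by blast
    show ?thesis
    proof (intro exI[of _ "C1 + C2"] conjI exI[of _ "n1 + n2 + 2 * D + 1"] allI impI)
      show "0 \<le> C1 + C2" using C1 C2 by simp
    next
      fix n m :: nat and u :: "'d site \<Rightarrow> real" and W f
      assume n: "n1 + n2 + 2 * D + 1 \<le> n" and sp: "slow_profile r L n u m" and W: "local_family n \<Lambda> B W"
        and f: "torus_profile.pos_density n u f"
      interpret torus_profile n u r using sp by (simp add: slow_profile_def)
      let ?W' = "\<lambda>x. site_avg (x + z) (W x)" and ?p = "\<lambda>x. site_diff (x + z) (W x)"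
      let ?\<phi> = "\<lambda>x \<eta>. ?p x \<eta> - ex (?p x)"
      note fam = site_family[OF W, of z]
      have nc: "\<forall>a\<in>?A. \<not> site_cong n a z"
      proof (intro ballI notI)
        fix a assume a: "a \<in> ?A" "site_cong n a z"
        have "\<bar>a $ i - z $ i\<bar> < int n" for i
        proof -
          have "\<bar>a $ i\<bar> \<le> int D" "\<bar>z $ i\<bar> \<le> int D" using D a(1) z(1) by (auto simp: offset_bound_def)
          then show ?thesis using n by linarith
        qed
        then show False using site_cong_small_imp_eq[of a z n] a by blast
      qed
      have f\<phi>: "local_family n ?A (4 * B) ?\<phi>"
        unfolding local_family_def
      proof (intro conjI ballI allI)
        fix x show "depends_on n (?\<phi> x) ((+) x ` ?A)"
          by (rule depends_on_comp[OF local_familyD(2)[OF fam(2)]])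
      next
        fix \<eta> assume \<eta>: "\<eta> \<in> \<Omega>"
        have "nperiodic n (\<lambda>y. ex (?p y))"
          unfolding nperiodic_def
          by (intro allI impI ex_cong) (rule nperiodicD[OF local_familyD(1)[OF fam(2)]])
        then show "nperiodic n (\<lambda>x. ?\<phi> x \<eta>)"
          by (rule nperiodic_comp2[OF local_familyD(1)[OF fam(2) \<eta>]])
        fix x
        have "\<bar>?p x \<eta>\<bar> \<le> 2 * B" "\<bar>ex (?p x)\<bar> \<le> 2 * B"
          using local_familyD(3)[OF fam(2)] \<eta> by (auto intro: ex_abs_bound)
        then show "\<bar>?\<phi> x \<eta>\<bar> \<le> 4 * B" by linarith
      qed
      have c\<phi>: "\<forall>x. ex (?\<phi> x) = 0" by (simp add: ex_diff)
      have "ex (\<lambda>\<eta>. f \<eta> * nonlinear W \<eta>)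
        = ex (\<lambda>\<eta>. f \<eta> * nonlinear ?W' \<eta> + f \<eta> * (\<Sum>x\<in>torus n. ?\<phi> x \<eta> * om (x + z) \<eta>))"
        by (rule ex_cong) (simp add: nonlinear_step[OF W nc] distrib_left)
      also have "\<dots> \<le> (\<epsilon> / 2 * (real n)\<^sup>2 * total_energy f + C1 * (entropy f + real n ^ CARD('d) / real m ^ (2 ^ CARD('d) - 1)))
         + (\<epsilon> / 2 * (real n)\<^sup>2 * total_energy f + C2 * (entropy f + real n ^ CARD('d) / real m ^ (2 ^ CARD('d) - 1)))"
        unfolding ex_add by (intro add_mono 1[OF _ sp fam(1) f] 2[OF _ sp f\<phi> c\<phi> f]) (use n in auto)
      finally show "ex (\<lambda>\<eta>. f \<eta> * nonlinear W \<eta>) \<le> \<epsilon> * (real n)\<^sup>2 * total_energy f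
        + (C1 + C2) * (entropy f + real n ^ CARD('d) / real m ^ (2 ^ CARD('d) - 1))"
        unfolding distrib_right[of C1 C2] by linarith
    qed
  qed
qed

section \<open>The entropy production of the product measure\<close>

definition reads :: "'d::finite site set \<Rightarrow> ('d config \<Rightarrow> real) \<Rightarrow> bool"
  where "reads A f \<longleftrightarrow> (\<forall>\<eta> \<xi>. (\<forall>x\<in>A. \<eta> x = \<xi> x) \<longrightarrow> f \<eta> = f \<xi>)"

lemma readsD: "reads A f \<Longrightarrow> (\<And>x. x \<in> A \<Longrightarrow> \<eta> x = \<xi> x) \<Longrightarrow> f \<eta> = f \<xi>"
  unfolding reads_def by blast

lemma reads_mono: "reads A f \<Longrightarrow> A \<subseteq> B \<Longrightarrow> reads B f"
  unfolding reads_def by blast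

lemma cylinder_reads: "cylinder f \<longleftrightarrow> (\<exists>A. finite A \<and> reads A f)"
  by (simp add: cylinder_def reads_def)

lemma cylinder_bounded:
  assumes "cylinder f" shows "\<exists>M. \<forall>\<eta>. \<bar>f \<eta>\<bar> \<le> M"
proof -
  obtain A where A: "finite A" "reads A f" using assms cylinder_reads by blast
  have "\<bar>f \<eta>\<bar> \<le> Max ((\<lambda>B. \<bar>f (\<lambda>x. x \<in> B)\<bar>) ` Pow A)" for \<eta>
  proof -
    have "f \<eta> = f (\<lambda>x. x \<in> {x \<in> A. \<eta> x})" by (rule readsD[OF A(2)]) simp
    then have "\<bar>f \<eta>\<bar> \<in> (\<lambda>B. \<bar>f (\<lambda>x. x \<in> B)\<bar>) ` Pow A"
      by (intro image_eqI[where x = "{x \<in> A. \<eta> x}"]) auto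
    then show ?thesis using A(1) by (intro Max_ge) auto
  qed
  then show ?thesis by blast
qed

lemma reads_remove:
  assumes "reads A f" "\<forall>\<eta> \<xi>. (\<forall>x. x \<notin> B \<longrightarrow> \<eta> x = \<xi> x) \<longrightarrow> f \<eta> = f \<xi>"
  shows "reads (A - B) f"
  unfolding reads_def
proof (intro allI impI)
  fix \<eta> \<xi> :: "'a config" assume h: "\<forall>x\<in>A - B. \<eta> x = \<xi> x"
  define \<zeta> where "\<zeta> x = (if x \<in> B then \<eta> x else \<xi> x)" for x
  have "f \<xi> = f \<zeta>" using assms(2) by (simp add: \<zeta>_def)
  moreover have "f \<eta> = f \<zeta>" by (rule readsD[OF assms(1)]) (use h in \<open>auto simp: \<zeta>_def\<close>)
  ultimately show "f \<eta> = f \<xi>" by simp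
qed

lemma gradient_rates_data:
  fixes c h :: "'d::finite \<Rightarrow> 'd config \<Rightarrow> real"
  assumes "gradient_rates c h"
  obtains S M c0 where "finite S" "0 < M" "0 < c0" "\<And>j \<eta>. c0 \<le> c j \<eta>" "\<And>j \<eta>. \<bar>c j \<eta>\<bar> \<le> M" "\<And>j \<eta>. \<bar>h j \<eta>\<bar> \<le> M"
    "\<And>j. reads (S - {0, \<e> j}) (c j)" "\<And>j. reads S (h j)" "0 \<in> S" "\<And>j. \<e> j \<in> S"
proof -
  note g = assms[unfolded gradient_rates_def, rule_format]
  have "\<exists>A. finite A \<and> reads A (c j)" "\<exists>A. finite A \<and> reads A (h j)" for j
    using g[of j] cylinder_reads by blast+
  then obtain Ac Ah where A: "\<And>j. finite (Ac j) \<and> reads (Ac j) (c j)" "\<And>j. finite (Ah j) \<and> reads (Ah j) (h j)" by metis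
  have "\<exists>M. \<forall>\<eta>. \<bar>c j \<eta>\<bar> \<le> M" "\<exists>M. \<forall>\<eta>. \<bar>h j \<eta>\<bar> \<le> M" for j
    using g[of j] cylinder_bounded by blast+
  then obtain Mc Mh where M: "\<And>j \<eta>. \<bar>c j \<eta>\<bar> \<le> Mc j" "\<And>j \<eta>. \<bar>h j \<eta>\<bar> \<le> Mh j" by metis
  have "\<exists>a>0. \<forall>\<eta>. a \<le> c j \<eta>" for j using g[of j] by blast
  then obtain a where a: "\<And>j. 0 < a j" "\<And>j \<eta>. a j \<le> c j \<eta>" by metis
  define S where "S = (\<Union>j. Ac j \<union> Ah j \<union> {0, \<e> j})"
  define M' where "M' = (\<Sum>j\<in>UNIV. Mc j + Mh j) + 1"
  define c0 where "c0 = Min (range a)"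
  have M0: "0 \<le> Mc j" "0 \<le> Mh j" for j using order_trans[OF abs_ge_zero M(1)] order_trans[OF abs_ge_zero M(2)] by auto
  have le: "Mc j + Mh j \<le> M'" for j
    unfolding M'_def using member_le_sum[of j UNIV "\<lambda>j. Mc j + Mh j"] M0 by (simp add: add_increasing2)
  show thesis
  proof (rule that)
    show "finite S" unfolding S_def using A by auto
    show "0 < M'" unfolding M'_def using M0 by (intro add_nonneg_pos sum_nonneg) (auto intro: add_nonneg_nonneg)
    show "0 < c0" unfolding c0_def using a(1) by (subst Min_gr_iff) auto
    show "c0 \<le> c j \<eta>" for j \<eta>
      unfolding c0_def by (rule order_trans[OF Min_le a(2)]) auto
    show "\<bar>c j \<eta>\<bar> \<le> M'" for j \<eta> using M(1)[of j \<eta>] le[of j] M0(2)[of j] by linarith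
    show "\<bar>h j \<eta>\<bar> \<le> M'" for j \<eta> using M(2)[of j \<eta>] le[of j] M0(1)[of j] by linarith
    show "reads (S - {0, \<e> j}) (c j)" for j
    proof (rule reads_remove)
      show "reads S (c j)" by (rule reads_mono[of "Ac j"]) (use A in \<open>auto simp: S_def\<close>)
      show "\<forall>\<eta> \<xi>. (\<forall>x. x \<notin> {0, \<e> j} \<longrightarrow> \<eta> x = \<xi> x) \<longrightarrow> c j \<eta> = c j \<xi>" using g[of j] by simp
    qed
    show "reads S (h j)" for j by (rule reads_mono[of "Ah j"]) (use A in \<open>auto simp: S_def\<close>)
    show "0 \<in> S" "\<e> j \<in> S" for j by (auto simp: S_def)
  qed
qed

lemma shift_in_configs [simp]: "\<eta> \<in> torus_configs n \<Longrightarrow> shift x \<eta> \<in> torus_configs n"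
  by (simp add: torus_configs_def shift_def)

lemma shift_shift: "shift x (shift y \<eta>) = shift (x + y) \<eta>"
  by (simp add: shift_def ac_simps)

lemma shift_cong:
  assumes "\<eta> \<in> torus_configs n" "site_cong n x y"
  shows "shift x \<eta> = shift y \<eta>"
proof -
  have "\<eta> (x + z) = \<eta> (y + z)" for z using assms by (simp add: torus_configs_def)
  then show ?thesis by (simp add: shift_def)
qed

lemma depends_on_shift: "reads A f \<Longrightarrow> depends_on n (\<lambda>\<eta>. f (shift x \<eta>)) ((+) x ` A)"
  by (rule depends_onI, erule readsD) (simp add: shift_def)

context torus_profile
begin

text \<open>The coefficient of the density in the derivative of its entropy: the adjoint of the generator
  applied to the constant one, minus the logarithmic derivative in time of the product weight when
  \<open>u\<close> moves with velocity \<open>v\<close>.\<close>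

definition production :: "('d \<Rightarrow> 'd config \<Rightarrow> real) \<Rightarrow> ('d site \<Rightarrow> real) \<Rightarrow> 'd config \<Rightarrow> real"
  where "production c v \<eta> = (real n)\<^sup>2 * (\<Sum>x\<in>torus n. \<Sum>j\<in>UNIV.
      c j (shift x \<eta>) * ((u (x + \<e> j) - u x) * kk x (x + \<e> j) \<eta>)) - (\<Sum>x\<in>torus n. v x * om x \<eta>)"

definition discrete_drift :: "('d \<Rightarrow> 'd config \<Rightarrow> real) \<Rightarrow> 'd site \<Rightarrow> real"
  where "discrete_drift c x = (real n)\<^sup>2 * (\<Sum>j\<in>UNIV.
      ex (\<lambda>\<eta>. c j (shift x \<eta>)) * (u (x + \<e> j) - u x)
      - ex (\<lambda>\<eta>. c j (shift (x - \<e> j) \<eta>)) * (u x - u (x - \<e> j)))"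

definition chi :: "'d site \<Rightarrow> real" where "chi x = u x * (1 - u x)"

lemma inverse_chi_lipschitz: "\<bar>1 / chi x - 1 / chi y\<bar> \<le> \<bar>u x - u y\<bar> / r ^ 4"
proof -
  have pos: "0 < chi x" "0 < chi y" "r\<^sup>2 \<le> chi x" "r\<^sup>2 \<le> chi y" by (auto simp: chi_def chi_pos chi_lower)
  have "chi y - chi x = (u y - u x) * (1 - u x - u y)" by (simp add: chi_def algebra_simps)
  then have "\<bar>chi y - chi x\<bar> = \<bar>u x - u y\<bar> * \<bar>1 - u x - u y\<bar>" by (simp add: abs_mult abs_minus_commute)
  also have "\<dots> \<le> \<bar>u x - u y\<bar> * 1"
    by (rule mult_left_mono) (use u_pos[of x] u_less_1[of x] u_pos[of y] u_less_1[of y] in auto)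
  finally have a: "\<bar>chi y - chi x\<bar> \<le> \<bar>u x - u y\<bar>" by simp
  have "r ^ 4 = r\<^sup>2 * r\<^sup>2" by (simp add: power2_eq_square power4_eq_xxxx)
  also have "\<dots> \<le> chi x * chi y" by (intro mult_mono pos) (use pos in auto)
  finally have b: "r ^ 4 \<le> chi x * chi y" .
  have "1 / chi x - 1 / chi y = (chi y - chi x) / (chi x * chi y)" using pos by (simp add: field_simps)
  then have "\<bar>1 / chi x - 1 / chi y\<bar> = \<bar>chi y - chi x\<bar> / (chi x * chi y)" using pos by (simp add: abs_mult)
  also have "\<dots> \<le> \<bar>u x - u y\<bar> / r ^ 4"
    using a b r_pos pos by (intro frac_le) auto
  finally show ?thesis .
qed

lemma inverse_chi_bounds: "0 < 1 / chi x" "1 / chi x \<le> 1 / r\<^sup>2"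
  using chi_pos[of x] chi_lower[of x] r_pos by (auto simp: chi_def intro!: divide_left_mono mult_pos_pos u_pos)

lemma cen_abs: "\<bar>cen x \<eta>\<bar> \<le> 1"
  using u_pos[of x] u_less_1[of x] by (auto simp: cen_def abs_if)

text \<open>The gradient condition turns \<open>c * (om x - om (x + \<e> j))\<close>, which is multiplied by
  \<open>n\<^sup>2 * (u (x + \<e> j) - u x)\<close> of order \<open>n\<close>, into a difference that can be summed by parts; what
  remains are local functions of order one.\<close>

definition current :: "('d \<Rightarrow> 'd config \<Rightarrow> real) \<Rightarrow> ('d \<Rightarrow> 'd config \<Rightarrow> real) \<Rightarrow> 'd site \<Rightarrow> 'd config \<Rightarrow> real"
  where "current c h x \<eta> = (\<Sum>j\<in>UNIV.
    (real n)\<^sup>2 * ((u (x + \<e> j) - u x) / chi x - (u x - u (x - \<e> j)) / chi (x - \<e> j)) * h j (shift x \<eta>)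
    + (real n)\<^sup>2 * c j (shift x \<eta>) * ((u (x + \<e> j) - u x)\<^sup>2 / chi x
        + (u (x + \<e> j) - u x) * (cen (x + \<e> j) \<eta> * (1 / chi x - 1 / chi (x + \<e> j)))
        - (u (x + \<e> j) - u x)\<^sup>2 * (om x \<eta> * om (x + \<e> j) \<eta>)))"

lemma production_eq:
  assumes grad: "\<And>j \<eta>. c j \<eta> * (of_bool (\<eta> (\<e> j)) - of_bool (\<eta> 0)) = h j (shift (\<e> j) \<eta>) - h j \<eta>"
    and \<eta>: "\<eta> \<in> \<Omega>"
  shows "production c v \<eta> = (\<Sum>x\<in>torus n. current c h x \<eta>) - (\<Sum>x\<in>torus n. v x * om x \<eta>)"
proof -
  let ?D = "\<lambda>j x. (u (x + \<e> j) - u x) / chi x"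
  let ?H = "\<lambda>j x. h j (shift x \<eta>)"
  let ?R = "\<lambda>j x. (real n)\<^sup>2 * c j (shift x \<eta>) * ((u (x + \<e> j) - u x)\<^sup>2 / chi x
        + (u (x + \<e> j) - u x) * (cen (x + \<e> j) \<eta> * (1 / chi x - 1 / chi (x + \<e> j)))
        - (u (x + \<e> j) - u x)\<^sup>2 * (om x \<eta> * om (x + \<e> j) \<eta>))"
  have bond: "(real n)\<^sup>2 * (c j (shift x \<eta>) * ((u (x + \<e> j) - u x) * kk x (x + \<e> j) \<eta>))
    = (real n)\<^sup>2 * (?D j x * (?H j x - ?H j (x + \<e> j))) + ?R j x" for j x
  proof -
    have g: "c j (shift x \<eta>) * (of_bool (\<eta> (x + \<e> j)) - of_bool (\<eta> x)) = ?H j (x + \<e> j) - ?H j x"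
      using grad[of j "shift x \<eta>"] unfolding shift_shift add.commute[of "\<e> j"] by (simp add: shift_def)
    have om: "om x \<eta> - om (x + \<e> j) \<eta> = (of_bool (\<eta> x) - of_bool (\<eta> (x + \<e> j))) * (1 / chi x) + (u (x + \<e> j) - u x) / chi x
      + cen (x + \<e> j) \<eta> * (1 / chi x - 1 / chi (x + \<e> j))"
      unfolding om_cen chi_def[symmetric] by (simp add: cen_def diff_divide_distrib add_divide_distrib algebra_simps)
    have gen': "c * (D * ((s - t) * (1 / i))) = D / i * (- (c * (t - s)))" for c D s t i :: real
      by (simp add: algebra_simps diff_divide_distrib)
    have e: "c j (shift x \<eta>) * ((u (x + \<e> j) - u x) * ((of_bool (\<eta> x) - of_bool (\<eta> (x + \<e> j))) * (1 / chi x)))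
      = ?D j x * (?H j x - ?H j (x + \<e> j))"
      unfolding gen' g minus_diff_eq ..
    have gen: "N * (c * (D * (s * (1 / i) + D / i + X - D * Q))) = N * (c * (D * (s * (1 / i)))) + N * c * (D\<^sup>2 / i + D * X - D\<^sup>2 * Q)"
      for N c D s i X Q :: real by (simp add: power2_eq_square algebra_simps)
    show ?thesis unfolding kk_def om gen e ..
  qed
  have parts: "(\<Sum>x\<in>torus n. ?D j x * (?H j x - ?H j (x + \<e> j))) = (\<Sum>x\<in>torus n. (?D j x - ?D j (x - \<e> j)) * ?H j x)" for j
  proof -
    have pD: "nperiodic n (\<lambda>x. ?D j x)"
      unfolding chi_def
      by (intro nperiodic_comp2[where F = "\<lambda>s t. (s - t) / (t * (1 - t))"] nperiodic_shift u_periodic)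
    have pH: "nperiodic n (\<lambda>x. ?H j x)"
      unfolding nperiodic_def using shift_cong[OF \<eta>] by metis
    have "(\<Sum>x\<in>torus n. ?D j (x - \<e> j) * ?H j x) = (\<Sum>x\<in>torus n. ?D j x * ?H j (x + \<e> j))"
      using sum_torus_shift[OF n_pos nperiodic_comp2[where F = "(*)", OF pD nperiodic_shift[OF pH, of "\<e> j"]], of "- \<e> j"] by simp
    then show ?thesis by (simp add: left_diff_distrib right_diff_distrib sum_subtractf)
  qed
  have "(real n)\<^sup>2 * (\<Sum>x\<in>torus n. \<Sum>j\<in>UNIV. c j (shift x \<eta>) * ((u (x + \<e> j) - u x) * kk x (x + \<e> j) \<eta>))
    = (\<Sum>j\<in>UNIV. \<Sum>x\<in>torus n. (real n)\<^sup>2 * (c j (shift x \<eta>) * ((u (x + \<e> j) - u x) * kk x (x + \<e> j) \<eta>)))"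
    unfolding sum_distrib_left by (rule sum.swap)
  also have "\<dots> = (\<Sum>j\<in>UNIV. (real n)\<^sup>2 * (\<Sum>x\<in>torus n. ?D j x * (?H j x - ?H j (x + \<e> j))) + (\<Sum>x\<in>torus n. ?R j x))"
    unfolding bond sum.distrib sum_distrib_left ..
  also have "\<dots> = (\<Sum>j\<in>UNIV. \<Sum>x\<in>torus n. (real n)\<^sup>2 * (?D j x - ?D j (x - \<e> j)) * ?H j x + ?R j x)"
    unfolding parts sum.distrib sum_distrib_left mult.assoc ..
  also have "\<dots> = (\<Sum>x\<in>torus n. current c h x \<eta>)"
    unfolding current_def by (subst sum.swap) simp
  finally show ?thesis by (simp add: production_def)
qed

text \<open>All terms are of order one in \<open>n\<close>: second differences of \<open>u\<close>
  are of order \<open>1 / n\<^sup>2\<close>, and so are squares of first differences and their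
  products with increments of \<open>1 / chi\<close>.\<close>

lemma current_family:
  assumes S: "\<And>j. reads S (c j)" "\<And>j. reads S (h j)" "0 \<in> S" "\<And>j. \<e> j \<in> S"
    and M: "\<And>j \<eta>. \<bar>c j \<eta>\<bar> \<le> M" "\<And>j \<eta>. \<bar>h j \<eta>\<bar> \<le> M"
    and L: "\<And>x j. \<bar>u (x + \<e> j) - u x\<bar> \<le> L / n"
    and L2: "\<And>x j. \<bar>u (x + \<e> j) - 2 * u x + u (x - \<e> j)\<bar> \<le> L / (real n)\<^sup>2"
  shows "local_family n S (real CARD('d) * ((L / r\<^sup>2 + L\<^sup>2 / r ^ 4) * M + M * (L\<^sup>2 / r\<^sup>2 + L\<^sup>2 / r ^ 4 + L\<^sup>2 / r\<^sup>2))) (current c h)"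
  unfolding local_family_def
proof (intro conjI ballI allI)
  fix \<eta> assume \<eta>: "\<eta> \<in> \<Omega>"
  show "nperiodic n (\<lambda>x. current c h x \<eta>)"
    unfolding nperiodic_def
  proof (intro allI impI)
    fix x y :: "'d site" assume c: "site_cong n x y"
    have e: "u (x + a) = u (y + a)" "u (x - a) = u (y - a)" for a
      using nperiodicD[OF u_periodic] c by (auto intro: site_cong_add site_cong_diff)
    have "u x = u y" "shift x \<eta> = shift y \<eta>" "om x \<eta> = om y \<eta>" "om (x + a) \<eta> = om (y + a) \<eta>" "cen (x + a) \<eta> = cen (y + a) \<eta>" for a
      using nperiodicD[OF u_periodic c] shift_cong[OF \<eta> c] nperiodicD[OF om_periodic[OF \<eta>]] c cen_cong[OF _ \<eta>] by auto
    then show "current c h x \<eta> = current c h y \<eta>" unfolding current_def chi_def e by simp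
  qed
  fix x
  have n0: "0 < real n" by simp
  have M0: "0 \<le> M" using order_trans[OF abs_ge_zero M(1)] .
  have L0: "0 \<le> L" using order_trans[OF abs_ge_zero L[of 0]] n0 by (simp add: zero_le_divide_iff)
  have bnd: "\<bar>(real n)\<^sup>2 * ((u (x + \<e> j) - u x) / chi x - (u x - u (x - \<e> j)) / chi (x - \<e> j)) * h j (shift x \<eta>)
    + (real n)\<^sup>2 * c j (shift x \<eta>) * ((u (x + \<e> j) - u x)\<^sup>2 / chi x
        + (u (x + \<e> j) - u x) * (cen (x + \<e> j) \<eta> * (1 / chi x - 1 / chi (x + \<e> j)))
        - (u (x + \<e> j) - u x)\<^sup>2 * (om x \<eta> * om (x + \<e> j) \<eta>))\<bar>
    \<le> (L / r\<^sup>2 + L\<^sup>2 / r ^ 4) * M + M * (L\<^sup>2 / r\<^sup>2 + L\<^sup>2 / r ^ 4 + L\<^sup>2 / r\<^sup>2)" for j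
  proof -
    define p where "p = real n * (u (x + \<e> j) - u x)"
    define q where "q = real n * (u x - u (x - \<e> j))"
    have sc: "\<bar>real n * t\<bar> \<le> L" if "\<bar>t\<bar> \<le> L / n" for t
      using that unfolding abs_mult pos_le_divide_eq[OF n0] by (simp add: mult.commute)
    have p: "\<bar>p\<bar> \<le> L" unfolding p_def by (rule sc[OF L])
    have q: "\<bar>q\<bar> \<le> L" unfolding q_def using sc[OF L[of "x - \<e> j" j]] by simp
    have pq: "\<bar>real n * (p - q)\<bar> \<le> L"
    proof -
      have "real n * (p - q) = (real n)\<^sup>2 * (u (x + \<e> j) - 2 * u x + u (x - \<e> j))"
        by (simp add: p_def q_def power2_eq_square algebra_simps)
      moreover have "\<bar>(real n)\<^sup>2 * (u (x + \<e> j) - 2 * u x + u (x - \<e> j))\<bar> = (real n)\<^sup>2 * \<bar>u (x + \<e> j) - 2 * u x + u (x - \<e> j)\<bar>"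
        by (simp only: abs_mult abs_power2)
      moreover have "\<dots> \<le> (real n)\<^sup>2 * (L / (real n)\<^sup>2)" by (intro mult_left_mono L2) simp
      ultimately show ?thesis using n0 by simp
    qed
    have i1: "\<bar>real n * (1 / chi x - 1 / chi (x - \<e> j))\<bar> \<le> L / r ^ 4"
      and i2: "\<bar>real n * (1 / chi x - 1 / chi (x + \<e> j))\<bar> \<le> L / r ^ 4"
    proof -
      have ib: "\<bar>real n * (1 / chi x - 1 / chi y)\<bar> \<le> L / r ^ 4" if "\<bar>u x - u y\<bar> \<le> L / n" for y
      proof -
        have "real n * \<bar>1 / chi x - 1 / chi y\<bar> \<le> real n * ((L / n) / r ^ 4)"
          by (intro mult_left_mono order_trans[OF inverse_chi_lipschitz] divide_right_mono that) auto
        then show ?thesis using n0 unfolding abs_mult by simp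
      qed
      have "\<bar>u x - u (x - \<e> j)\<bar> \<le> L / n" "\<bar>u x - u (x + \<e> j)\<bar> \<le> L / n"
        using L[of "x - \<e> j" j] L[of x j] by (simp_all add: abs_minus_commute)
      then show "\<bar>real n * (1 / chi x - 1 / chi (x - \<e> j))\<bar> \<le> L / r ^ 4" "\<bar>real n * (1 / chi x - 1 / chi (x + \<e> j))\<bar> \<le> L / r ^ 4"
        by (simp_all only: ib)
    qed
    have ic: "\<bar>1 / chi x\<bar> \<le> 1 / r\<^sup>2" using inverse_chi_bounds[of x] by simp
    have A: "(real n)\<^sup>2 * ((u (x + \<e> j) - u x) / chi x - (u x - u (x - \<e> j)) / chi (x - \<e> j))
      = real n * (p - q) * (1 / chi x) + q * (real n * (1 / chi x - 1 / chi (x - \<e> j)))"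
    proof -
      have "N\<^sup>2 * (a / i - b / k) = N * (N * a - N * b) * (1 / i) + N * b * (N * (1 / i - 1 / k))" for N a b i k :: real
        by (simp add: power2_eq_square algebra_simps diff_divide_distrib)
      then show ?thesis unfolding p_def q_def .
    qed
    have a: "\<bar>\<dots>\<bar> \<le> L * (1 / r\<^sup>2) + L * (L / r ^ 4)"
      by (rule order_trans[OF abs_triangle_ineq], unfold abs_mult[of "_ * _" "1 / chi x"] abs_mult[of q])
         (intro add_mono mult_mono pq ic q i1, use L0 in auto)
    have R: "(real n)\<^sup>2 * c j (shift x \<eta>) * ((u (x + \<e> j) - u x)\<^sup>2 / chi x
        + (u (x + \<e> j) - u x) * (cen (x + \<e> j) \<eta> * (1 / chi x - 1 / chi (x + \<e> j)))
        - (u (x + \<e> j) - u x)\<^sup>2 * (om x \<eta> * om (x + \<e> j) \<eta>))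
      = c j (shift x \<eta>) * (p\<^sup>2 * (1 / chi x) + p * (cen (x + \<e> j) \<eta> * (real n * (1 / chi x - 1 / chi (x + \<e> j)))) - p\<^sup>2 * (om x \<eta> * om (x + \<e> j) \<eta>))"
    proof -
      have "N\<^sup>2 * c * (a\<^sup>2 / i + a * (t * s) - a\<^sup>2 * w) = c * ((N * a)\<^sup>2 * (1 / i) + N * a * (t * (N * s)) - (N * a)\<^sup>2 * w)"
        for N c a i t s w :: real by (simp add: power2_eq_square algebra_simps)
      then show ?thesis unfolding p_def .
    qed
    have p2: "\<bar>p\<^sup>2\<bar> \<le> L\<^sup>2" using power_mono[OF p, of 2] by simp
    have b1: "\<bar>p\<^sup>2 * (1 / chi x)\<bar> \<le> L\<^sup>2 * (1 / r\<^sup>2)"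
      unfolding abs_mult[of "p\<^sup>2"] by (intro mult_mono p2 ic) auto
    have b2: "\<bar>p * (cen (x + \<e> j) \<eta> * (real n * (1 / chi x - 1 / chi (x + \<e> j))))\<bar> \<le> L * (1 * (L / r ^ 4))"
      unfolding abs_mult[of p] abs_mult[of "cen _ _"] by (intro mult_mono p i2 cen_abs) (use L0 in auto)
    have b3: "\<bar>p\<^sup>2 * (om x \<eta> * om (x + \<e> j) \<eta>)\<bar> \<le> L\<^sup>2 * (1 / r * (1 / r))"
      unfolding abs_mult[of "p\<^sup>2"] abs_mult[of "om x \<eta>"] by (intro mult_mono p2 om_abs) (use r_pos in auto)
    have b: "\<bar>p\<^sup>2 * (1 / chi x) + p * (cen (x + \<e> j) \<eta> * (real n * (1 / chi x - 1 / chi (x + \<e> j)))) - p\<^sup>2 * (om x \<eta> * om (x + \<e> j) \<eta>)\<bar>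
      \<le> L\<^sup>2 * (1 / r\<^sup>2) + L * (1 * (L / r ^ 4)) + L\<^sup>2 * (1 / r * (1 / r))"
      using b1 b2 b3 by linarith
    have "\<bar>(real n * (p - q) * (1 / chi x) + q * (real n * (1 / chi x - 1 / chi (x - \<e> j)))) * h j (shift x \<eta>)
        + c j (shift x \<eta>) * (p\<^sup>2 * (1 / chi x) + p * (cen (x + \<e> j) \<eta> * (real n * (1 / chi x - 1 / chi (x + \<e> j)))) - p\<^sup>2 * (om x \<eta> * om (x + \<e> j) \<eta>))\<bar>
      \<le> (L * (1 / r\<^sup>2) + L * (L / r ^ 4)) * M + M * (L\<^sup>2 * (1 / r\<^sup>2) + L * (1 * (L / r ^ 4)) + L\<^sup>2 * (1 / r * (1 / r)))"
      by (rule order_trans[OF abs_triangle_ineq], unfold abs_mult[of _ "h j (shift x \<eta>)"] abs_mult[of "c j (shift x \<eta>)"])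
         (intro add_mono mult_mono a b M, use L0 M0 in auto)
    also have "\<dots> = (L / r\<^sup>2 + L\<^sup>2 / r ^ 4) * M + M * (L\<^sup>2 / r\<^sup>2 + L\<^sup>2 / r ^ 4 + L\<^sup>2 / r\<^sup>2)"
      by (simp add: power2_eq_square)
    finally show ?thesis unfolding A R .
  qed
  show "\<bar>current c h x \<eta>\<bar> \<le> real CARD('d) * ((L / r\<^sup>2 + L\<^sup>2 / r ^ 4) * M + M * (L\<^sup>2 / r\<^sup>2 + L\<^sup>2 / r ^ 4 + L\<^sup>2 / r\<^sup>2))"
    unfolding current_def by (rule order_trans[OF sum_abs]) (rule sum_bounded_above, rule bnd)
next
  fix x
  have x: "x \<in> (+) x ` S" "x + \<e> j \<in> (+) x ` S" for j using S(3,4) by (force simp: image_iff)+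
  show "depends_on n (current c h x) ((+) x ` S)"
  proof (rule depends_onI)
    fix \<eta> \<xi> :: "'d config" assume h: "\<eta> \<in> \<Omega>" "\<xi> \<in> \<Omega>" "\<And>y. y \<in> (+) x ` S \<Longrightarrow> \<eta> y = \<xi> y"
    have s: "shift x \<eta> a = shift x \<xi> a" if "a \<in> S" for a
      unfolding shift_def by (rule h(3)) (use that in simp)
    have "c j (shift x \<eta>) = c j (shift x \<xi>)" "h j (shift x \<eta>) = h j (shift x \<xi>)" for j
      by (rule readsD[OF S(1)], erule s) (rule readsD[OF S(2)], erule s)
    moreover have "om x \<eta> = om x \<xi>" "om (x + \<e> j) \<eta> = om (x + \<e> j) \<xi>" "cen (x + \<e> j) \<eta> = cen (x + \<e> j) \<xi>" for j
      using h(3)[OF x(1)] h(3)[OF x(2)[of j]] by (auto simp: om_def cen_def)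
    ultimately show "current c h x \<eta> = current c h x \<xi>" by (simp add: current_def)
  qed
qed

text \<open>Testing the production against an occupation variable gives back the generator applied to that
  variable, since weighting by \<open>kk\<close> is the adjoint of an exchange.\<close>

lemma ex_kk_adjoint:
  assumes xy: "\<not> site_cong n x y" and a: "\<And>\<eta>. \<eta> \<in> \<Omega> \<Longrightarrow> a (exchange n x y \<eta>) = a \<eta>"
  shows "ex (\<lambda>\<eta>. a \<eta> * ((u y - u x) * kk x y \<eta>) * g \<eta>) = ex (\<lambda>\<eta>. a \<eta> * (g (exchange n x y \<eta>) - g \<eta>))"
proof -
  have "ex (\<lambda>\<eta>. a \<eta> * g (exchange n x y \<eta>)) = (\<Sum>\<eta>\<in>\<Omega>. wt (exchange n x y \<eta>) * (a (exchange n x y \<eta>) * g (exchange n x y (exchange n x y \<eta>))))"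
    unfolding ex_def by (rule sum_exchange[symmetric])
  also have "\<dots> = (\<Sum>\<eta>\<in>\<Omega>. wt \<eta> * (a \<eta> * g \<eta> + a \<eta> * ((u y - u x) * kk x y \<eta>) * g \<eta>))"
    by (intro sum.cong refl) (simp add: wt_exchange[OF xy] a algebra_simps)
  also have "\<dots> = ex (\<lambda>\<eta>. a \<eta> * g \<eta>) + ex (\<lambda>\<eta>. a \<eta> * ((u y - u x) * kk x y \<eta>) * g \<eta>)"
    by (simp add: ex_def distrib_left sum.distrib)
  finally show ?thesis by (simp add: right_diff_distrib ex_diff)
qed

end

context torus_profile
begin

lemma bond_not_cong: "2 \<le> n \<Longrightarrow> \<not> site_cong n x (x + \<e> j)"
proof
  assume n: "2 \<le> n" and "site_cong n x (x + \<e> j)"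
  then have "int n dvd - 1" unfolding site_cong_iff_diff by (auto dest: spec[of _ j])
  then show False using n by auto
qed

lemma small_offsets_not_cong:
  assumes "offset_bound S D" "2 * D + 1 \<le> n" "a \<in> S" "b \<in> S" "a \<noteq> b"
  shows "\<not> site_cong n a b"
proof
  assume c: "site_cong n a b"
  have "\<bar>a $ i - b $ i\<bar> < int n" for i
  proof -
    have "\<bar>a $ i\<bar> \<le> int D" "\<bar>b $ i\<bar> \<le> int D" using assms(1,3,4) by (auto simp: offset_bound_def)
    then show ?thesis using assms(2) by linarith
  qed
  then show False using site_cong_small_imp_eq[OF _ c] assms(5) by blast
qed

lemma rate_invariant:
  assumes c: "reads (S - {0, \<e> j}) (c j)" and S: "offset_bound S D" "2 * D + 1 \<le> n" "0 \<in> S" "\<e> j \<in> S"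
    and \<eta>: "\<eta> \<in> \<Omega>"
  shows "c j (shift x (exchange n x (x + \<e> j) \<eta>)) = c j (shift x \<eta>)"
proof (rule depends_on_exchange[OF depends_on_shift[OF c] \<eta>])
  fix a assume "a \<in> (+) x ` (S - {0, \<e> j})"
  then obtain b where b: "a = x + b" "b \<in> S" "b \<noteq> 0" "b \<noteq> \<e> j" by auto
  have "\<not> site_cong n (x + b) (x + 0)" "\<not> site_cong n (x + b) (x + \<e> j)"
    unfolding site_cong_add_left
    using small_offsets_not_cong[OF S(1,2) b(2) S(3)] small_offsets_not_cong[OF S(1,2) b(2) S(4)] b(3,4) by blast+
  then show "\<not> site_cong n a x \<and> \<not> site_cong n a (x + \<e> j)" by (simp add: b(1))
qed

lemma ex_rate_increment:
  assumes c: "reads (S - {0, \<e> j}) (c j)" and S: "offset_bound S D" "2 * D + 1 \<le> n" "0 \<in> S" "\<e> j \<in> S"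
  shows "ex (\<lambda>\<eta>. c j (shift x \<eta>) * (of_bool (\<eta> (x + \<e> j)) - of_bool (\<eta> x)))
    = ex (\<lambda>\<eta>. c j (shift x \<eta>)) * (u (x + \<e> j) - u x)"
proof -
  have "ex (\<lambda>\<eta>. c j (shift x \<eta>) * (of_bool (\<eta> (x + \<e> j)) - of_bool (\<eta> x)))
    = ex (\<lambda>\<eta>. c j (shift x \<eta>)) * ex (\<lambda>\<eta>. of_bool (\<eta> (x + \<e> j)) - of_bool (\<eta> x))"
  proof (rule ex_indep[OF depends_on_shift[OF c]])
    show "depends_on n (\<lambda>\<eta>. of_bool (\<eta> (x + \<e> j)) - of_bool (\<eta> x) :: real) ({x + \<e> j} \<union> {x})"
      by (rule depends_on_comp2[OF depends_on_site[of n "\<lambda>b. b" "x + \<e> j"] depends_on_site[of n "\<lambda>b. b" x], of "\<lambda>s t. of_bool s - of_bool t"])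
    fix a b assume "a \<in> (+) x ` (S - {0, \<e> j})" "b \<in> {x + \<e> j} \<union> {x}"
    then obtain a' b' where ab: "a = x + a'" "a' \<in> S" "b = x + b'" "b' \<in> S" "a' \<noteq> b'" using S(3,4) by force
    show "\<not> site_cong n a b"
      unfolding ab(1,3) site_cong_add_left by (rule small_offsets_not_cong[OF S(1,2) ab(2,4,5)])
  qed
  also have "ex (\<lambda>\<eta>. of_bool (\<eta> (x + \<e> j)) - of_bool (\<eta> x)) = u (x + \<e> j) - u x"
    unfolding ex_diff using ex_marginal[of of_bool "x + \<e> j"] ex_marginal[of of_bool x] by simp
  finally show ?thesis .
qed

text \<open>Testing against the occupation variable at \<open>t\<close> gives, by the adjoint relation, the expected net
  current into \<open>t\<close>. The rate of a bond does not read its endpoints, so the expectation of each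
  current factorises; this is the discrete form of the hydrodynamic equation.\<close>

lemma lin_coeff_current:
  assumes grad: "\<And>j \<eta>. c j \<eta> * (of_bool (\<eta> (\<e> j)) - of_bool (\<eta> 0)) = h j (shift (\<e> j) \<eta>) - h j \<eta>"
    and c: "\<And>j. reads (S - {0, \<e> j}) (c j)" and S: "offset_bound S D" "2 * D + 1 \<le> n" "0 \<in> S" "\<And>j. \<e> j \<in> S"
    and n2: "2 \<le> n"
  shows "lin_coeff (current c h) t = discrete_drift c t"
    and "(\<Sum>x\<in>torus n. ex (current c h x)) = 0"
proof -
  let ?k = "\<lambda>j x \<eta>. c j (shift x \<eta>) * ((u (x + \<e> j) - u x) * kk x (x + \<e> j) \<eta>)"
  let ?F = "\<lambda>j x. ex (\<lambda>\<eta>. c j (shift x \<eta>))"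
  have tot: "(\<Sum>x\<in>torus n. current c h x \<eta>) = (real n)\<^sup>2 * (\<Sum>x\<in>torus n. \<Sum>j\<in>UNIV. ?k j x \<eta>)" if "\<eta> \<in> \<Omega>" for \<eta>
    using production_eq[OF grad that, of "\<lambda>_. 0"] by (simp add: production_def)
  have adj: "ex (\<lambda>\<eta>. ?k j x \<eta> * g \<eta>) = ex (\<lambda>\<eta>. c j (shift x \<eta>) * (g (exchange n x (x + \<e> j) \<eta>) - g \<eta>))" for j x g
    by (rule ex_kk_adjoint[OF bond_not_cong[OF n2]]) (rule rate_invariant[OF c S])
  have swap: "(\<Sum>x\<in>torus n. ex (\<lambda>\<eta>. current c h x \<eta> * g \<eta>)) = (real n)\<^sup>2 * (\<Sum>x\<in>torus n. \<Sum>j\<in>UNIV. ex (\<lambda>\<eta>. ?k j x \<eta> * g \<eta>))" for g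
  proof -
    have "(\<Sum>x\<in>torus n. ex (\<lambda>\<eta>. current c h x \<eta> * g \<eta>)) = ex (\<lambda>\<eta>. (\<Sum>x\<in>torus n. current c h x \<eta>) * g \<eta>)"
      by (simp add: ex_sum sum_distrib_right)
    also have "\<dots> = ex (\<lambda>\<eta>. (real n)\<^sup>2 * (\<Sum>x\<in>torus n. \<Sum>j\<in>UNIV. ?k j x \<eta> * g \<eta>))"
      by (rule ex_cong) (simp only: tot sum_distrib_right mult.assoc)
    finally show ?thesis by (simp only: ex_cmult ex_sum)
  qed
  show "(\<Sum>x\<in>torus n. ex (current c h x)) = 0"
  proof -
    have "ex (?k j x) = 0" for j x using adj[of j x "\<lambda>_. 1"] by simp
    then show ?thesis using swap[of "\<lambda>_. 1"] by simp
  qed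
  let ?G = "\<lambda>j x. ?F j x * (u (x + \<e> j) - u x)"
  have bond: "ex (\<lambda>\<eta>. ?k j x \<eta> * cen t \<eta>) = of_bool (site_cong n x t) * ?G j x - of_bool (site_cong n x (t - \<e> j)) * ?G j x" for j x
  proof -
    have ee: "site_cong n x (t - \<e> j) \<longleftrightarrow> site_cong n (x + \<e> j) t"
      using site_cong_add_right[of n x "\<e> j" "t - \<e> j"] by simp
    have pt: "cen t (exchange n x (x + \<e> j) \<eta>) - cen t \<eta>
      = (of_bool (site_cong n x t) - of_bool (site_cong n x (t - \<e> j))) * (of_bool (\<eta> (x + \<e> j)) - of_bool (\<eta> x))"
      if \<eta>: "\<eta> \<in> \<Omega>" for \<eta>
    proof -
      have E: "exchange n x (x + \<e> j) \<eta> \<in> \<Omega>" using \<eta> by simp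
      have nc: "\<not> (site_cong n x t \<and> site_cong n (x + \<e> j) t)"
        using bond_not_cong[OF n2, of x j] by (meson site_cong_sym site_cong_trans)
      consider "site_cong n x t" "\<not> site_cong n (x + \<e> j) t" | "\<not> site_cong n x t" "site_cong n (x + \<e> j) t"
        | "\<not> site_cong n x t" "\<not> site_cong n (x + \<e> j) t" using nc by blast
      then show ?thesis
      proof cases
        case 1
        have "cen t \<xi> = cen x \<xi>" if "\<xi> \<in> \<Omega>" for \<xi> using cen_cong[OF 1(1) that] by simp
        then show ?thesis using 1 E \<eta> by (simp add: ee) (simp add: cen_def exchange_at)
      next
        case 2
        have "cen t \<xi> = cen (x + \<e> j) \<xi>" if "\<xi> \<in> \<Omega>" for \<xi> using cen_cong[OF 2(2) that] by simp
        then show ?thesis using 2 E \<eta> by (simp add: ee) (simp add: cen_def exchange_at)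
      next
        case 3
        then have "exchange n x (x + \<e> j) \<eta> t = \<eta> t"
          by (intro exchange_at(3)[OF \<eta>]) (auto dest: site_cong_sym)
        then show ?thesis using 3 by (simp add: ee cen_def)
      qed
    qed
    have "ex (\<lambda>\<eta>. ?k j x \<eta> * cen t \<eta>) = ex (\<lambda>\<eta>. (of_bool (site_cong n x t) - of_bool (site_cong n x (t - \<e> j)))
        * (c j (shift x \<eta>) * (of_bool (\<eta> (x + \<e> j)) - of_bool (\<eta> x))))"
      unfolding adj by (rule ex_cong) (simp add: pt)
    also have "\<dots> = (of_bool (site_cong n x t) - of_bool (site_cong n x (t - \<e> j))) * ?G j x"
      unfolding ex_cmult by (rule arg_cong2[where f = "(*)", OF refl], rule ex_rate_increment[OF c S])
    finally show ?thesis by (simp add: left_diff_distrib)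
  qed
  have pG: "nperiodic n (?G j)" for j
  proof -
    have "nperiodic n (?F j)"
      unfolding nperiodic_def by (intro allI impI ex_cong) (simp add: shift_cong)
    then show ?thesis
      by (intro nperiodic_comp2[where F = "(*)"] nperiodic_comp2[where F = "(-)"] nperiodic_shift u_periodic)
  qed
  have "lin_coeff (current c h) t = (real n)\<^sup>2 * (\<Sum>j\<in>UNIV. \<Sum>x\<in>torus n. of_bool (site_cong n x t) * ?G j x - of_bool (site_cong n x (t - \<e> j)) * ?G j x)"
    unfolding lin_coeff_def swap bond by (subst sum.swap) (rule refl)
  also have "\<dots> = (real n)\<^sup>2 * (\<Sum>j\<in>UNIV. ?G j t - ?G j (t - \<e> j))"
    unfolding sum_subtractf by (simp only: sum_torus_indicator[OF n_pos pG])
  also have "\<dots> = discrete_drift c t"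
    by (simp add: discrete_drift_def)
  finally show "lin_coeff (current c h) t = discrete_drift c t" .
qed

text \<open>Coefficients of order \<open>1 / n\<close> have sum of squares \<open>n ^ d /
  n\<^sup>2\<close>, which is dominated by the error of the replacement.\<close>

lemma linear_term_bound:
  assumes \<beta>: "nperiodic n \<beta>" "\<And>x. \<bar>\<beta> x\<bar> \<le> L / n" and f: "pos_density f"
  shows "ex (\<lambda>\<eta>. f \<eta> * (\<Sum>x\<in>torus n. \<beta> x * om x \<eta>))
    \<le> entropy f + 2 ^ (2 * CARD('d)) * (L / r)\<^sup>2 * (real n ^ CARD('d) / (real n)\<^sup>2)"
proof -
  have fam: "local_family n {0} (1 / r) om"
    unfolding local_family_def using om_periodic om_abs om_depends by simp
  have n0: "0 < real n" by simp
  have "(\<Sum>x\<in>(torus n :: 'd site set). (\<beta> x)\<^sup>2) \<le> (\<Sum>x\<in>(torus n :: 'd site set). (L / n)\<^sup>2)"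
  proof (rule sum_mono)
    fix x show "(\<beta> x)\<^sup>2 \<le> (L / n)\<^sup>2" using power_mono[OF \<beta>(2)[of x] abs_ge_zero, of 2] by simp
  qed
  also have "\<dots> = real n ^ CARD('d) * (L / n)\<^sup>2" by (simp add: card_torus)
  finally have s: "(\<Sum>x\<in>(torus n :: 'd site set). (\<beta> x)\<^sup>2) \<le> real n ^ CARD('d) * (L / n)\<^sup>2" .
  have D: "offset_bound {0 :: 'd site} 0" "2 * 0 + 1 \<le> n" using n_pos by (auto simp: offset_bound_def)
  let ?K = "real (4 * 0 + 2) ^ (2 * CARD('d)) * (1 / r)\<^sup>2"
  have "ex (\<lambda>\<eta>. exp (1 * (\<Sum>x\<in>torus n. \<beta> x * om x \<eta>))) \<le> exp (?K * (\<Sum>x\<in>(torus n :: 'd site set). (\<beta> x)\<^sup>2))"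
    using ex_exp_linear[OF fam ex_om D \<beta>(1)] by simp
  also have "\<dots> \<le> exp (?K * (real n ^ CARD('d) * (L / n)\<^sup>2))"
    using s by (simp add: mult_left_mono)
  finally have "ex (\<lambda>\<eta>. f \<eta> * (\<Sum>x\<in>torus n. \<beta> x * om x \<eta>)) \<le> (entropy f + ?K * (real n ^ CARD('d) * (L / n)\<^sup>2)) / 1"
    by (intro entropy_inequality[OF f]) simp
  also have "\<dots> = entropy f + 2 ^ (2 * CARD('d)) * (L / r)\<^sup>2 * (real n ^ CARD('d) / (real n)\<^sup>2)"
    by (simp add: power_divide)
  finally show ?thesis .
qed

end

text \<open>The production splits into the nonlinear part of \<open>current\<close>, controlled by
  replacement, and a linear part with coefficients \<open>discrete_drift - v\<close>, which are of
  order \<open>1 / n\<close> as soon as \<open>v\<close> is the time derivative prescribed by the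
  hydrodynamic equation. The mean vanishes identically, because the generator annihilates
  constants.\<close>

theorem production_bound:
  fixes c h :: "'d::finite \<Rightarrow> 'd config \<Rightarrow> real"
  assumes gr: "gradient_rates c h" and eps: "0 < \<epsilon>"
  shows "\<exists>C\<ge>0. \<exists>n0. \<forall>n\<ge>n0. \<forall>u m v f. slow_profile r L n u m \<longrightarrow>
    (\<forall>x j. \<bar>u (x + \<e> j) - 2 * u x + u (x - \<e> j)\<bar> \<le> L / (real n)\<^sup>2) \<longrightarrow>
    nperiodic n v \<longrightarrow> (\<forall>x. \<bar>torus_profile.discrete_drift n u c x - v x\<bar> \<le> L / n) \<longrightarrow>
    torus_profile.pos_density n u f \<longrightarrow>
    torus_profile.ex n u (\<lambda>\<eta>. f \<eta> * torus_profile.production n u c v \<eta>)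
    \<le> \<epsilon> * (real n)\<^sup>2 * torus_profile.total_energy n u f
      + C * (torus_profile.ex n u (\<lambda>\<eta>. f \<eta> * ln (f \<eta>)) + real n ^ CARD('d) / real m ^ (2 ^ CARD('d) - 1))"
proof -
  note g = gr[unfolded gradient_rates_def, rule_format]
  have grad: "c j \<eta> * (of_bool (\<eta> (\<e> j)) - of_bool (\<eta> 0)) = h j (shift (\<e> j) \<eta>) - h j \<eta>" for j \<eta>
    using g[of j] by blast
  obtain S M c0 where S: "finite S" "0 < M" "\<And>j \<eta>. \<bar>c j \<eta>\<bar> \<le> M" "\<And>j \<eta>. \<bar>h j \<eta>\<bar> \<le> M"
    "\<And>j. reads (S - {0, \<e> j}) (c j)" "\<And>j. reads S (h j)" "0 \<in> S" "\<And>j. \<e> j \<in> S"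
    using gradient_rates_data[OF gr] by metis
  have Sc: "reads S (c j)" for j by (rule reads_mono[OF S(5)]) auto
  obtain D where D: "offset_bound S D" using offset_bound_exists[OF S(1)] by blast
  let ?B0 = "real CARD('d) * ((L / r\<^sup>2 + L\<^sup>2 / r ^ 4) * M + M * (L\<^sup>2 / r\<^sup>2 + L\<^sup>2 / r ^ 4 + L\<^sup>2 / r\<^sup>2))"
  define B where "B = max ?B0 1"
  have B: "0 < B" by (simp add: B_def)
  obtain C1 n1 where C1: "0 \<le> C1" and
    1: "\<And>n u m W f. n1 \<le> n \<Longrightarrow> slow_profile r L n u m \<Longrightarrow> local_family n S B W \<Longrightarrow> torus_profile.pos_density n u f \<Longrightarrow>
      torus_profile.ex n u (\<lambda>\<eta>. f \<eta> * torus_profile.nonlinear n u W \<eta>) \<le> \<epsilon> * (real n)\<^sup>2 * torus_profile.total_energy n u f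
      + C1 * (torus_profile.ex n u (\<lambda>\<eta>. f \<eta> * ln (f \<eta>)) + real n ^ CARD('d) / real m ^ (2 ^ CARD('d) - 1))"
    using nonlinear_bound[OF S(1) B eps, of r L] by blast
  let ?k = "2 ^ (2 * CARD('d)) * (L / r)\<^sup>2"
  show ?thesis
  proof (intro exI[of _ "C1 + 1 + ?k"] conjI exI[of _ "n1 + 2 * D + 2"] allI impI)
    show "0 \<le> C1 + 1 + ?k" using C1 by simp
  next
    fix n m :: nat and u v :: "'d site \<Rightarrow> real" and f
    assume n: "n1 + 2 * D + 2 \<le> n" and sp: "slow_profile r L n u m"
      and L2: "\<forall>x j. \<bar>u (x + \<e> j) - 2 * u x + u (x - \<e> j)\<bar> \<le> L / (real n)\<^sup>2"
      and v: "nperiodic n v" "\<forall>x. \<bar>torus_profile.discrete_drift n u c x - v x\<bar> \<le> L / n"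
      and f: "torus_profile.pos_density n u f"
    interpret torus_profile n u r using sp by (simp add: slow_profile_def)
    have n': "2 * D + 1 \<le> n" "2 \<le> n" "n1 \<le> n" using n by auto
    have L1: "\<bar>u (x + \<e> j) - u x\<bar> \<le> L / n" for x j using sp by (simp add: slow_profile_def)
    have W: "local_family n S B (current c h)"
    proof -
      have "local_family n S ?B0 (current c h)"
        by (rule current_family[OF Sc S(6-8) S(3,4) L1]) (use L2 in blast)
      then show ?thesis by (rule local_family_mono) (simp add: B_def)
    qed
    note lc = lin_coeff_current[OF grad S(5) D n'(1) S(7,8) n'(2)]
    let ?\<beta> = "\<lambda>t. discrete_drift c t - v t"
    have p\<beta>: "nperiodic n ?\<beta>"
    proof -
      have "nperiodic n (lin_coeff (current c h))"
        unfolding nperiodic_def lin_coeff_def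
        by (intro allI impI sum.cong refl ex_cong) (simp add: cen_cong)
      then have "nperiodic n (discrete_drift c)" unfolding lc(1)[abs_def] by simp
      then show ?thesis using v(1) by (rule nperiodic_comp2)
    qed
    have eq: "production c v \<eta> = nonlinear (current c h) \<eta> + (\<Sum>t\<in>torus n. ?\<beta> t * om t \<eta>)" if "\<eta> \<in> \<Omega>" for \<eta>
      using lc(2) unfolding production_eq[OF grad that] nonlinear_def lc(1)
      by (simp add: sum_subtractf left_diff_distrib)
    have "ex (\<lambda>\<eta>. f \<eta> * production c v \<eta>)
      = ex (\<lambda>\<eta>. f \<eta> * nonlinear (current c h) \<eta> + f \<eta> * (\<Sum>t\<in>torus n. ?\<beta> t * om t \<eta>))"
      by (rule ex_cong) (simp add: eq distrib_left)
    also have "\<dots> \<le> (\<epsilon> * (real n)\<^sup>2 * total_energy f + C1 * (entropy f + real n ^ CARD('d) / real m ^ (2 ^ CARD('d) - 1)))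
        + (entropy f + ?k * (real n ^ CARD('d) / (real n)\<^sup>2))"
      unfolding ex_add by (intro add_mono 1[OF n'(3) sp W f] linear_term_bound[OF p\<beta> _ f]) (use v(2) in auto)
    also have "real n ^ CARD('d) / (real n)\<^sup>2 \<le> real n ^ CARD('d) / real m ^ (2 ^ CARD('d) - 1)"
    proof (rule divide_left_mono)
      have m: "1 \<le> m" "m ^ (2 ^ (CARD('d) - 1)) \<le> n" using sp by (auto simp: slow_profile_def)
      have "m ^ (2 ^ CARD('d) - 1) \<le> m ^ (2 ^ (CARD('d) - 1) * 2)"
      proof (rule power_increasing[OF _ m(1)])
        have "(2::nat) ^ CARD('d) = 2 ^ (CARD('d) - 1) * 2" by (metis Suc_diff_1 power_Suc2 zero_less_card_finite)
        then show "2 ^ CARD('d) - 1 \<le> (2::nat) ^ (CARD('d) - 1) * 2" by simp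
      qed
      also have "\<dots> = (m ^ (2 ^ (CARD('d) - 1)))\<^sup>2" by (simp add: power_mult)
      also have "\<dots> \<le> n\<^sup>2" using m(2) by (rule power_mono) simp
      finally have "real (m ^ (2 ^ CARD('d) - 1)) \<le> real (n\<^sup>2)" by (rule of_nat_mono)
      then show "real m ^ (2 ^ CARD('d) - 1) \<le> (real n)\<^sup>2" by simp
      show "0 < (real n)\<^sup>2 * real m ^ (2 ^ CARD('d) - 1)" using m(1) n' by simp
    qed simp
    finally have fin: "ex (\<lambda>\<eta>. f \<eta> * production c v \<eta>) \<le> (\<epsilon> * (real n)\<^sup>2 * total_energy f + C1 * (entropy f + real n ^ CARD('d) / real m ^ (2 ^ CARD('d) - 1)))
        + (entropy f + ?k * (real n ^ CARD('d) / real m ^ (2 ^ CARD('d) - 1)))"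
      by (simp add: mult_left_mono)
    have "0 \<le> real n ^ CARD('d) / real m ^ (2 ^ CARD('d) - 1)" by simp
    moreover have "0 \<le> ?k * entropy f" using entropy_nonneg[OF f] by simp
    ultimately show "ex (\<lambda>\<eta>. f \<eta> * production c v \<eta>) \<le> \<epsilon> * (real n)\<^sup>2 * total_energy f
      + (C1 + 1 + ?k) * (entropy f + real n ^ CARD('d) / real m ^ (2 ^ CARD('d) - 1))"
      using fin unfolding distrib_left distrib_right by linarith
  qed
qed

section \<open>The forward equation\<close>

locale torus_dynamics =
  fixes n :: nat and c :: "'d::finite \<Rightarrow> 'd config \<Rightarrow> real"
  assumes n_pos: "1 \<le> n" and c_nonneg: "\<And>j \<eta>. 0 \<le> c j \<eta>"
begin

abbreviation "\<Xi> \<equiv> torus_configs n :: 'd config set"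

abbreviation "G \<equiv> generator c n"

definition rate :: "'d config \<Rightarrow> 'd config \<Rightarrow> real"
  where "rate \<zeta> \<eta> = G (indicator {\<eta>}) \<zeta>"

lemma fin: "finite \<Xi>"
  using finite_torus_configs[OF n_pos] .

lemma indicator_expand: "\<zeta> \<in> \<Xi> \<Longrightarrow> f \<zeta> = (\<Sum>\<eta>\<in>\<Xi>. f \<eta> * indicator {\<eta>} \<zeta>)" for f :: "'d config \<Rightarrow> real"
  using fin by (simp add: indicator_def)

lemma generator_expand:
  assumes "\<zeta> \<in> \<Xi>" shows "G f \<zeta> = (\<Sum>\<eta>\<in>\<Xi>. f \<eta> * rate \<zeta> \<eta>)"
proof -
  have "G f \<zeta> = (real n)\<^sup>2 * (\<Sum>x\<in>torus n. \<Sum>j\<in>UNIV. \<Sum>\<eta>\<in>\<Xi>.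
      f \<eta> * (c j (shift x \<zeta>) * (indicator {\<eta>} (exchange n x (x + \<e> j) \<zeta>) - indicator {\<eta>} \<zeta>)))"
    unfolding generator_def
  proof (intro arg_cong2[where f = "(*)"] refl sum.cong)
    fix x j
    have "f (exchange n x (x + \<e> j) \<zeta>) - f \<zeta> = (\<Sum>\<eta>\<in>\<Xi>. f \<eta> * indicator {\<eta>} (exchange n x (x + \<e> j) \<zeta>)) - (\<Sum>\<eta>\<in>\<Xi>. f \<eta> * indicator {\<eta>} \<zeta>)"
      using indicator_expand[OF assms, of f] indicator_expand[of "exchange n x (x + \<e> j) \<zeta>" f] assms by simp
    then show "c j (shift x \<zeta>) * (f (exchange n x (x + \<e> j) \<zeta>) - f \<zeta>)
      = (\<Sum>\<eta>\<in>\<Xi>. f \<eta> * (c j (shift x \<zeta>) * (indicator {\<eta>} (exchange n x (x + \<e> j) \<zeta>) - indicator {\<eta>} \<zeta>)))"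
      by (simp add: sum_subtractf[symmetric] sum_distrib_left algebra_simps)
  qed
  also have "\<dots> = (\<Sum>\<eta>\<in>\<Xi>. f \<eta> * rate \<zeta> \<eta>)"
  proof -
    have "(\<Sum>x\<in>torus n. \<Sum>j\<in>UNIV. \<Sum>\<eta>\<in>\<Xi>. F \<eta> x j) = (\<Sum>\<eta>\<in>\<Xi>. \<Sum>x\<in>torus n. \<Sum>j\<in>UNIV. F \<eta> x j)"
      for F :: "'d config \<Rightarrow> 'd site \<Rightarrow> 'd \<Rightarrow> real"
    proof -
      have "(\<Sum>x\<in>torus n. \<Sum>j\<in>UNIV. \<Sum>\<eta>\<in>\<Xi>. F \<eta> x j) = (\<Sum>x\<in>torus n. \<Sum>\<eta>\<in>\<Xi>. \<Sum>j\<in>UNIV. F \<eta> x j)"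
        by (intro sum.cong refl sum.swap)
      also have "\<dots> = (\<Sum>\<eta>\<in>\<Xi>. \<Sum>x\<in>torus n. \<Sum>j\<in>UNIV. F \<eta> x j)" by (rule sum.swap)
      finally show ?thesis .
    qed
    then show ?thesis
      unfolding rate_def generator_def by (simp add: sum_distrib_left mult.left_commute)
  qed
  finally show ?thesis .
qed

lemma generator_pow_expand:
  assumes "\<xi> \<in> \<Xi>" shows "(G ^^ k) f \<xi> = (\<Sum>\<zeta>\<in>\<Xi>. f \<zeta> * (G ^^ k) (indicator {\<zeta>}) \<xi>)"
  using assms
proof (induction k arbitrary: \<xi>)
  case 0 then show ?case using indicator_expand by simp
next
  case (Suc k)
  have "(G ^^ Suc k) f \<xi> = (\<Sum>\<eta>\<in>\<Xi>. (\<Sum>\<zeta>\<in>\<Xi>. f \<zeta> * (G ^^ k) (indicator {\<zeta>}) \<eta>) * rate \<xi> \<eta>)"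
    by (simp add: generator_expand[OF Suc.prems] Suc.IH)
  also have "\<dots> = (\<Sum>\<zeta>\<in>\<Xi>. f \<zeta> * (\<Sum>\<eta>\<in>\<Xi>. (G ^^ k) (indicator {\<zeta>}) \<eta> * rate \<xi> \<eta>))"
    unfolding sum_distrib_left sum_distrib_right by (subst sum.swap) (simp add: mult.assoc)
  finally show ?case by (simp add: generator_expand[OF Suc.prems])
qed

definition rate_bound :: real where "rate_bound = (\<Sum>\<zeta>\<in>\<Xi>. \<Sum>\<eta>\<in>\<Xi>. \<bar>rate \<zeta> \<eta>\<bar>)"

lemma generator_pow_bound:
  assumes "\<And>\<eta>. \<eta> \<in> \<Xi> \<Longrightarrow> \<bar>f \<eta>\<bar> \<le> 1" "\<xi> \<in> \<Xi>"
  shows "\<bar>(G ^^ k) f \<xi>\<bar> \<le> rate_bound ^ k"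
  using assms(2)
proof (induction k arbitrary: \<xi>)
  case 0 then show ?case using assms(1) by simp
next
  case (Suc k)
  have R0: "0 \<le> rate_bound" unfolding rate_bound_def by (intro sum_nonneg) auto
  have "\<bar>(G ^^ Suc k) f \<xi>\<bar> \<le> (\<Sum>\<eta>\<in>\<Xi>. \<bar>(G ^^ k) f \<eta> * rate \<xi> \<eta>\<bar>)"
    by (simp add: generator_expand[OF Suc.prems] sum_abs)
  also have "\<dots> \<le> (\<Sum>\<eta>\<in>\<Xi>. rate_bound ^ k * \<bar>rate \<xi> \<eta>\<bar>)"
    unfolding abs_mult by (intro sum_mono mult_right_mono Suc.IH) auto
  also have "\<dots> = rate_bound ^ k * (\<Sum>\<eta>\<in>\<Xi>. \<bar>rate \<xi> \<eta>\<bar>)" by (simp add: sum_distrib_left)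
  also have "\<dots> \<le> rate_bound ^ k * rate_bound"
    unfolding rate_bound_def using fin Suc.prems
    by (intro mult_left_mono member_le_sum[where f = "\<lambda>\<zeta>. \<Sum>\<eta>\<in>\<Xi>. \<bar>rate \<zeta> \<eta>\<bar>"]) (auto intro!: sum_nonneg zero_le_power)
  finally show ?case by (simp add: mult.commute)
qed

text \<open>The semigroup acting on the initial masses \<open>w\<close>. These are arbitrary real numbers, which makes
  the evolution linear in \<open>w\<close>.\<close>

definition evolve :: "('d config \<Rightarrow> real) \<Rightarrow> real \<Rightarrow> 'd config \<Rightarrow> real"
  where "evolve w t \<eta> = (\<Sum>\<xi>\<in>\<Xi>. w \<xi> * semigroup_at c n t (indicator {\<eta>}) \<xi>)"

lemma law_evolve:
  assumes "set_pmf \<mu> \<subseteq> \<Xi>" shows "law c n \<mu> t \<eta> = evolve (pmf \<mu>) t \<eta>"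
  unfolding law_def evolve_def
  by (subst integral_measure_pmf_real[OF fin]) (use assms in \<open>auto simp: mult.commute\<close>)

text \<open>The \<open>k\<close>-th time derivative of \<open>evolve w\<close> at time
  \<open>0\<close>.\<close>

definition coeff :: "('d config \<Rightarrow> real) \<Rightarrow> nat \<Rightarrow> 'd config \<Rightarrow> real"
  where "coeff w k \<eta> = (\<Sum>\<xi>\<in>\<Xi>. w \<xi> * (G ^^ k) (indicator {\<eta>}) \<xi>)"

lemma coeff_0: "\<eta> \<in> \<Xi> \<Longrightarrow> coeff w 0 \<eta> = w \<eta>"
  using fin by (simp add: coeff_def indicator_def eq_commute[of _ \<eta>])

lemma coeff_Suc: "coeff w (Suc k) \<eta> = (\<Sum>\<zeta>\<in>\<Xi>. rate \<zeta> \<eta> * coeff w k \<zeta>)"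
proof -
  have "coeff w (Suc k) \<eta> = (\<Sum>\<xi>\<in>\<Xi>. w \<xi> * (\<Sum>\<zeta>\<in>\<Xi>. rate \<zeta> \<eta> * (G ^^ k) (indicator {\<zeta>}) \<xi>))"
    unfolding coeff_def
  proof (intro sum.cong refl arg_cong2[where f = "(*)"])
    fix \<xi> assume "\<xi> \<in> \<Xi>"
    then have "(G ^^ k) (G (indicator {\<eta>})) \<xi> = (\<Sum>\<zeta>\<in>\<Xi>. rate \<zeta> \<eta> * (G ^^ k) (indicator {\<zeta>}) \<xi>)"
      by (subst generator_pow_expand) (simp_all add: rate_def)
    then show "(G ^^ Suc k) (indicator {\<eta>}) \<xi> = (\<Sum>\<zeta>\<in>\<Xi>. rate \<zeta> \<eta> * (G ^^ k) (indicator {\<zeta>}) \<xi>)"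
      by (simp add: funpow_swap1)
  qed
  also have "\<dots> = (\<Sum>\<zeta>\<in>\<Xi>. rate \<zeta> \<eta> * coeff w k \<zeta>)"
    unfolding coeff_def sum_distrib_left by (subst sum.swap) (simp add: mult.left_commute)
  finally show ?thesis .
qed

lemma summable_semigroup:
  assumes "\<xi> \<in> \<Xi>" shows "summable (\<lambda>k. t ^ k / fact k * (G ^^ k) (indicator {\<eta>}) \<xi>)"
proof (rule summable_comparison_test'[of "\<lambda>k. (\<bar>t\<bar> * rate_bound) ^ k / fact k"])
  show "summable (\<lambda>k. (\<bar>t\<bar> * rate_bound) ^ k / fact k)"
    using summable_exp[of "\<bar>t\<bar> * rate_bound"] by (simp add: divide_inverse mult.commute)
  fix k
  have "\<bar>(G ^^ k) (indicator {\<eta>}) \<xi>\<bar> \<le> rate_bound ^ k"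
    by (rule generator_pow_bound[OF _ assms]) (simp add: indicator_def)
  then have "\<bar>t\<bar> ^ k / fact k * \<bar>(G ^^ k) (indicator {\<eta>}) \<xi>\<bar> \<le> \<bar>t\<bar> ^ k / fact k * rate_bound ^ k"
    by (rule mult_left_mono) simp
  then show "norm (t ^ k / fact k * (G ^^ k) (indicator {\<eta>}) \<xi>) \<le> (\<bar>t\<bar> * rate_bound) ^ k / fact k"
    by (simp add: abs_mult power_abs power_mult_distrib)
qed

lemma evolve_sums: "(\<lambda>k. coeff w k \<eta> / fact k * t ^ k) sums evolve w t \<eta>"
proof -
  have "(\<lambda>k. \<Sum>\<xi>\<in>\<Xi>. w \<xi> * (t ^ k / fact k * (G ^^ k) (indicator {\<eta>}) \<xi>)) sums evolve w t \<eta>"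
    unfolding evolve_def semigroup_at_def
    by (intro sums_sum sums_mult summable_sums summable_semigroup)
  moreover have "(\<Sum>\<xi>\<in>\<Xi>. w \<xi> * (t ^ k / fact k * (G ^^ k) (indicator {\<eta>}) \<xi>)) = coeff w k \<eta> / fact k * t ^ k" for k
    by (simp add: coeff_def sum_distrib_left sum_distrib_right sum_divide_distrib mult_ac)
  ultimately show ?thesis by simp
qed

lemma evolve_0: "\<eta> \<in> \<Xi> \<Longrightarrow> evolve w 0 \<eta> = w \<eta>"
  using sums_unique2[OF evolve_sums[of w \<eta> 0] powser_sums_zero] coeff_0 by simp

lemma evolve_deriv: "((\<lambda>t. evolve w t \<eta>) has_real_derivative (\<Sum>\<zeta>\<in>\<Xi>. rate \<zeta> \<eta> * evolve w t \<zeta>)) (at t)"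
proof -
  let ?c = "\<lambda>k. coeff w k \<eta> / fact k"
  have "((\<lambda>t. \<Sum>k. ?c k * t ^ k) has_field_derivative (\<Sum>k. diffs ?c k * t ^ k)) (at t)"
    by (rule termdiffs_strong_converges_everywhere) (use evolve_sums in \<open>auto simp: sums_iff\<close>)
  moreover have "(\<lambda>t. \<Sum>k. ?c k * t ^ k) = (\<lambda>t. evolve w t \<eta>)"
    using evolve_sums by (auto simp: sums_iff)
  moreover have "(\<Sum>k. diffs ?c k * t ^ k) = (\<Sum>\<zeta>\<in>\<Xi>. rate \<zeta> \<eta> * evolve w t \<zeta>)"
  proof -
    have "(\<lambda>k. \<Sum>\<zeta>\<in>\<Xi>. rate \<zeta> \<eta> * (coeff w k \<zeta> / fact k * t ^ k)) sums (\<Sum>\<zeta>\<in>\<Xi>. rate \<zeta> \<eta> * evolve w t \<zeta>)"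
      by (intro sums_sum sums_mult evolve_sums)
    moreover have "(\<Sum>\<zeta>\<in>\<Xi>. rate \<zeta> \<eta> * (coeff w k \<zeta> / fact k * t ^ k)) = diffs ?c k * t ^ k" for k
      by (simp add: diffs_def coeff_Suc fact_reduce sum_distrib_left sum_distrib_right sum_divide_distrib field_simps del: of_nat_Suc)
    ultimately show ?thesis by (simp add: sums_iff)
  qed
  ultimately show ?thesis by simp
qed

lemma evolve_continuous: "continuous_on X (\<lambda>t. evolve w t \<eta>)"
  by (rule continuous_at_imp_continuous_on) (use evolve_deriv DERIV_isCont in blast)

lemma generator_one: "\<zeta> \<in> \<Xi> \<Longrightarrow> (\<Sum>\<eta>\<in>\<Xi>. rate \<zeta> \<eta>) = 0"
  using generator_expand[of \<zeta> "\<lambda>_. 1"] by (simp add: generator_def)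

lemma evolve_mass: "(\<Sum>\<eta>\<in>\<Xi>. evolve w t \<eta>) = (\<Sum>\<eta>\<in>\<Xi>. w \<eta>)"
proof -
  have "((\<lambda>t. \<Sum>\<eta>\<in>\<Xi>. evolve w t \<eta>) has_real_derivative 0) (at t)" for t
  proof -
    have "((\<lambda>t. \<Sum>\<eta>\<in>\<Xi>. evolve w t \<eta>) has_real_derivative (\<Sum>\<eta>\<in>\<Xi>. \<Sum>\<zeta>\<in>\<Xi>. rate \<zeta> \<eta> * evolve w t \<zeta>)) (at t)"
      by (intro DERIV_sum evolve_deriv)
    moreover have "(\<Sum>\<eta>\<in>\<Xi>. \<Sum>\<zeta>\<in>\<Xi>. rate \<zeta> \<eta> * evolve w t \<zeta>) = 0"
      by (subst sum.swap) (simp add: generator_one flip: sum_distrib_right)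
    ultimately show ?thesis by simp
  qed
  then have "(\<Sum>\<eta>\<in>\<Xi>. evolve w t \<eta>) = (\<Sum>\<eta>\<in>\<Xi>. evolve w 0 \<eta>)"
    using DERIV_isconst_all[of "\<lambda>t. \<Sum>\<eta>\<in>\<Xi>. evolve w t \<eta>" t 0] by blast
  then show ?thesis by (simp add: evolve_0)
qed

lemma rate_nonneg: "\<zeta> \<noteq> \<eta> \<Longrightarrow> 0 \<le> rate \<zeta> \<eta>"
  unfolding rate_def generator_def
  by (intro mult_nonneg_nonneg sum_nonneg c_nonneg) (auto simp: indicator_def)

text \<open>Until the first time at which some mass vanishes, every mass decays at most exponentially; so
  there is no such time.\<close>

lemma evolve_pos:
  assumes w: "\<And>\<eta>. \<eta> \<in> \<Xi> \<Longrightarrow> 0 < w \<eta>" and t: "0 \<le> t" and \<eta>: "\<eta> \<in> \<Xi>"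
  shows "0 < evolve w t \<eta>"
proof (rule ccontr)
  assume neg: "\<not> 0 < evolve w t \<eta>"
  \<comment> \<open>The set of times at which some mass is not positive; it is compact, so it has a first element.\<close>
  define E where "E = (\<Union>\<eta>\<in>\<Xi>. {0..t} \<inter> {s. evolve w s \<eta> \<le> 0})"
  have cE: "compact E"
    unfolding E_def
    by (intro compact_UN fin compact_Int_closed compact_Icc closed_Collect_le evolve_continuous continuous_on_const)
  have neE: "E \<noteq> {}" using neg t \<eta> by (force simp: E_def)
  obtain \<tau> where \<tau>: "\<tau> \<in> E" "\<And>s. s \<in> E \<Longrightarrow> \<tau> \<le> s"
    using compact_attains_inf[OF cE neE] by blast
  have before: "0 < evolve w s \<zeta>" if "0 \<le> s" "s < \<tau>" "\<zeta> \<in> \<Xi>" for s \<zeta>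
  proof (rule ccontr)
    assume "\<not> 0 < evolve w s \<zeta>"
    then have "s \<in> E" using that \<tau>(1) by (force simp: E_def)
    then show False using \<tau>(2) that by force
  qed
  obtain \<zeta> where \<zeta>: "\<zeta> \<in> \<Xi>" "evolve w \<tau> \<zeta> \<le> 0" "0 \<le> \<tau>" using \<tau>(1) by (auto simp: E_def)
  let ?l = "\<bar>rate \<zeta> \<zeta>\<bar>"
  let ?g = "\<lambda>s. exp (?l * s) * evolve w s \<zeta>"
  have "?g 0 \<le> ?g \<tau>"
  proof (rule DERIV_nonneg_imp_increasing_open[OF \<zeta>(3)])
    fix s assume s: "0 < s" "s < \<tau>"
    let ?d = "exp (?l * s) * (\<Sum>\<xi>\<in>\<Xi>. rate \<xi> \<zeta> * evolve w s \<xi>) + exp (?l * s) * ?l * evolve w s \<zeta>"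
    have "(?g has_real_derivative ?d) (at s)"
      by (auto intro!: derivative_eq_intros evolve_deriv)
    moreover have "0 \<le> ?d"
    proof -
      have "(\<Sum>\<xi>\<in>\<Xi>. rate \<xi> \<zeta> * evolve w s \<xi>) = rate \<zeta> \<zeta> * evolve w s \<zeta> + (\<Sum>\<xi>\<in>\<Xi> - {\<zeta>}. rate \<xi> \<zeta> * evolve w s \<xi>)"
        by (rule sum.remove[OF fin \<zeta>(1)])
      moreover have "0 \<le> (\<Sum>\<xi>\<in>\<Xi> - {\<zeta>}. rate \<xi> \<zeta> * evolve w s \<xi>)"
        using before s by (intro sum_nonneg mult_nonneg_nonneg rate_nonneg) (auto simp: less_imp_le)
      moreover have "0 \<le> (rate \<zeta> \<zeta> + ?l) * evolve w s \<zeta>"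
        using before[of s \<zeta>] s \<zeta>(1) by (intro mult_nonneg_nonneg) auto
      ultimately have "0 \<le> (\<Sum>\<xi>\<in>\<Xi>. rate \<xi> \<zeta> * evolve w s \<xi>) + ?l * evolve w s \<zeta>"
        by (simp add: distrib_right)
      then have "0 \<le> exp (?l * s) * ((\<Sum>\<xi>\<in>\<Xi>. rate \<xi> \<zeta> * evolve w s \<xi>) + ?l * evolve w s \<zeta>)" by simp
      then show ?thesis by (simp add: distrib_left mult.assoc)
    qed
    ultimately show "\<exists>y. (?g has_real_derivative y) (at s) \<and> 0 \<le> y" by blast
  qed (intro continuous_intros evolve_continuous)
  moreover have "0 < ?g 0" using w[OF \<zeta>(1)] by (simp add: evolve_0 \<zeta>(1))
  moreover have "?g \<tau> \<le> 0" using \<zeta>(2) by (simp add: mult_le_0_iff)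
  ultimately show False by linarith
qed

lemma evolve_dual: "(\<Sum>\<eta>\<in>\<Xi>. (\<Sum>\<zeta>\<in>\<Xi>. rate \<zeta> \<eta> * evolve w t \<zeta>) * g \<eta>) = (\<Sum>\<zeta>\<in>\<Xi>. evolve w t \<zeta> * G g \<zeta>)"
proof -
  have "(\<Sum>\<eta>\<in>\<Xi>. (\<Sum>\<zeta>\<in>\<Xi>. rate \<zeta> \<eta> * evolve w t \<zeta>) * g \<eta>) = (\<Sum>\<zeta>\<in>\<Xi>. evolve w t \<zeta> * (\<Sum>\<eta>\<in>\<Xi>. g \<eta> * rate \<zeta> \<eta>))"
    unfolding sum_distrib_left sum_distrib_right by (subst sum.swap) (simp add: mult_ac)
  then show ?thesis by (simp add: generator_expand)
qed

lemma evolve_affine: "evolve (\<lambda>\<xi>. a * w \<xi> + b * w' \<xi>) t \<eta> = a * evolve w t \<eta> + b * evolve w' t \<eta>"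
  by (simp add: evolve_def distrib_right sum.distrib sum_distrib_left mult.assoc)

end

section \<open>The entropy production inequality\<close>

text \<open>The elementary inequality \<open>ln x \<le> x - 1\<close> at \<open>x = sqrt (b /
  a)\<close>. The quadratic term is what produces the Dirichlet form of the square root of the
  density.\<close>

lemma mult_ln_ratio_le:
  fixes a b :: real assumes "0 < a" "0 < b"
  shows "a * (ln b - ln a) \<le> b - a - (sqrt b - sqrt a)\<^sup>2"
proof -
  have "ln (sqrt b / sqrt a) = (ln b - ln a) / 2" using assms by (simp add: ln_div ln_sqrt diff_divide_distrib)
  moreover have "ln (sqrt b / sqrt a) \<le> sqrt b / sqrt a - 1" by (rule ln_le_minus_one) (use assms in simp)
  ultimately have "(ln b - ln a) / 2 \<le> sqrt b / sqrt a - 1" by linarith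
  then have "a * ((ln b - ln a) / 2) \<le> a * (sqrt b / sqrt a - 1)" using assms by (intro mult_left_mono) auto
  also have "\<dots> = sqrt a * sqrt b - a"
  proof -
    have s: "a / sqrt a = sqrt a" using assms by (simp add: real_div_sqrt)
    have "a * (sqrt b / sqrt a - 1) = (a / sqrt a) * sqrt b - a" by (simp add: right_diff_distrib)
    then show ?thesis unfolding s .
  qed
  finally have "a * (ln b - ln a) \<le> 2 * (sqrt a * sqrt b) - 2 * a" by simp
  moreover have "(sqrt b - sqrt a)\<^sup>2 = b + a - 2 * (sqrt a * sqrt b)"
    using assms by (simp add: power2_diff)
  ultimately show ?thesis by linarith
qed

text \<open>The increments \<open>f (exchange \<eta>) - f \<eta>\<close> are moved onto the
  product measure by the adjoint relation; the measure is not invariant, and its defect is the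
  first part of \<open>production\<close>.\<close>

lemma (in torus_profile) generator_entropy_bound:
  assumes S: "\<And>j. reads (S - {0, \<e> j}) (c j)" "offset_bound S D" "2 * D + 2 \<le> n" "0 \<in> S" "\<And>j. \<e> j \<in> S"
    and c: "\<And>j \<eta>. 0 \<le> c j \<eta>" and f: "\<And>\<eta>. \<eta> \<in> \<Omega> \<Longrightarrow> 0 < f \<eta>"
  shows "ex (\<lambda>\<eta>. f \<eta> * generator c n (\<lambda>\<eta>. ln (f \<eta>)) \<eta>)
    \<le> ex (\<lambda>\<eta>. f \<eta> * production c (\<lambda>_. 0) \<eta>)
      - (real n)\<^sup>2 * (\<Sum>x\<in>torus n. \<Sum>j\<in>UNIV. ex (\<lambda>\<eta>. c j (shift x \<eta>) * (sqrt (f (exchange n x (x + \<e> j) \<eta>)) - sqrt (f \<eta>))\<^sup>2))"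
proof -
  let ?T = "\<lambda>x j. exchange n x (x + \<e> j)"
  have D: "2 * D + 1 \<le> n" "2 \<le> n" using S(3) by auto
  have "ex (\<lambda>\<eta>. f \<eta> * generator c n (\<lambda>\<eta>. ln (f \<eta>)) \<eta>)
    = (real n)\<^sup>2 * (\<Sum>x\<in>torus n. \<Sum>j\<in>UNIV. ex (\<lambda>\<eta>. c j (shift x \<eta>) * (f \<eta> * (ln (f (?T x j \<eta>)) - ln (f \<eta>)))))"
    unfolding generator_def ex_cmult[symmetric] ex_sum[symmetric]
    by (rule ex_cong) (simp add: sum_distrib_left mult_ac)
  also have "\<dots> \<le> (real n)\<^sup>2 * (\<Sum>x\<in>torus n. \<Sum>j\<in>UNIV.
      ex (\<lambda>\<eta>. c j (shift x \<eta>) * ((u (x + \<e> j) - u x) * kk x (x + \<e> j) \<eta>) * f \<eta>)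
      - ex (\<lambda>\<eta>. c j (shift x \<eta>) * (sqrt (f (?T x j \<eta>)) - sqrt (f \<eta>))\<^sup>2))"
  proof (intro mult_left_mono sum_mono)
    fix x j
    have "ex (\<lambda>\<eta>. c j (shift x \<eta>) * ((u (x + \<e> j) - u x) * kk x (x + \<e> j) \<eta>) * f \<eta>)
      = ex (\<lambda>\<eta>. c j (shift x \<eta>) * (f (?T x j \<eta>) - f \<eta>))"
      by (rule ex_kk_adjoint[OF bond_not_cong[OF D(2)]]) (rule rate_invariant[OF S(1,2) D(1) S(4,5)])
    moreover have "ex (\<lambda>\<eta>. c j (shift x \<eta>) * (f \<eta> * (ln (f (?T x j \<eta>)) - ln (f \<eta>))))
      \<le> ex (\<lambda>\<eta>. c j (shift x \<eta>) * (f (?T x j \<eta>) - f \<eta>) - c j (shift x \<eta>) * (sqrt (f (?T x j \<eta>)) - sqrt (f \<eta>))\<^sup>2)"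
      unfolding right_diff_distrib[of "c j _", symmetric]
      by (intro ex_mono mult_left_mono c mult_ln_ratio_le f) auto
    ultimately show "ex (\<lambda>\<eta>. c j (shift x \<eta>) * (f \<eta> * (ln (f (?T x j \<eta>)) - ln (f \<eta>))))
      \<le> ex (\<lambda>\<eta>. c j (shift x \<eta>) * ((u (x + \<e> j) - u x) * kk x (x + \<e> j) \<eta>) * f \<eta>)
      - ex (\<lambda>\<eta>. c j (shift x \<eta>) * (sqrt (f (?T x j \<eta>)) - sqrt (f \<eta>))\<^sup>2)" by (simp add: ex_diff)
  qed simp
  also have "\<dots> = (real n)\<^sup>2 * (\<Sum>x\<in>torus n. \<Sum>j\<in>UNIV. ex (\<lambda>\<eta>. c j (shift x \<eta>) * ((u (x + \<e> j) - u x) * kk x (x + \<e> j) \<eta>) * f \<eta>))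
      - (real n)\<^sup>2 * (\<Sum>x\<in>torus n. \<Sum>j\<in>UNIV. ex (\<lambda>\<eta>. c j (shift x \<eta>) * (sqrt (f (?T x j \<eta>)) - sqrt (f \<eta>))\<^sup>2))"
    by (simp add: sum_subtractf right_diff_distrib)
  also have "(real n)\<^sup>2 * (\<Sum>x\<in>torus n. \<Sum>j\<in>UNIV. ex (\<lambda>\<eta>. c j (shift x \<eta>) * ((u (x + \<e> j) - u x) * kk x (x + \<e> j) \<eta>) * f \<eta>))
    = ex (\<lambda>\<eta>. f \<eta> * production c (\<lambda>_. 0) \<eta>)"
    unfolding production_def ex_cmult[symmetric] ex_sum[symmetric]
    by (rule ex_cong) (simp add: sum_distrib_left mult_ac)
  finally show ?thesis .
qed

section \<open>The entropy estimate for a given production bound\<close>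

lemma continuous_on_mult_ln: "continuous_on {0..} (\<lambda>x::real. x * ln x)"
  unfolding continuous_on_def
proof
  fix x :: real assume "x \<in> {0..}"
  then consider "x = 0" | "0 < x" by fastforce
  then show "((\<lambda>x. x * ln x) \<longlongrightarrow> x * ln x) (at x within {0..})"
  proof cases
    case 1
    have "((\<lambda>x::real. x * ln x) \<longlongrightarrow> 0) (at_right 0)" by real_asymp
    then show ?thesis using 1 by (simp add: at_within_Ici_at_right)
  next
    case 2
    then have "isCont (\<lambda>x. x * ln x) x" by (intro continuous_intros) auto
    then show ?thesis using continuous_at_imp_continuous_at_within continuous_within by blast
  qed
qed

context torus_dynamics
begin

abbreviation dens :: "('d site \<Rightarrow> real) \<Rightarrow> ('d config \<Rightarrow> real) \<Rightarrow> real \<Rightarrow> 'd config \<Rightarrow> real"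
  where "dens u w s \<eta> \<equiv> evolve w s \<eta> / torus_profile.wt n u \<eta>"

definition ent :: "('d site \<Rightarrow> real) \<Rightarrow> ('d config \<Rightarrow> real) \<Rightarrow> real \<Rightarrow> real"
  where "ent u w s = torus_profile.ex n u (\<lambda>\<eta>. dens u w s \<eta> * ln (dens u w s \<eta>))"

definition enrg :: "('d site \<Rightarrow> real) \<Rightarrow> ('d config \<Rightarrow> real) \<Rightarrow> real \<Rightarrow> real"
  where "enrg u w s = 1 / 2 * (\<Sum>j\<in>UNIV. \<Sum>x\<in>torus n. torus_profile.ex n u
    (\<lambda>\<eta>. c j (shift x \<eta>) * (sqrt (dens u w s (exchange n x (x + \<e> j) \<eta>)) - sqrt (dens u w s \<eta>))\<^sup>2))"

text \<open>Adding a suitable constant to the initial masses reduces this to strict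
  positivity.\<close>

lemma evolve_nonneg:
  assumes w: "\<And>\<eta>. \<eta> \<in> \<Xi> \<Longrightarrow> 0 \<le> w \<eta>" and t: "0 \<le> t" "\<eta> \<in> \<Xi>"
  shows "0 \<le> evolve w t \<eta>"
proof (rule ccontr)
  assume neg: "\<not> 0 \<le> evolve w t \<eta>"
  have one: "0 < evolve (\<lambda>_. 1) t \<eta>" by (rule evolve_pos) (use t in auto)
  define e where "e = - evolve w t \<eta> / (2 * evolve (\<lambda>_. 1) t \<eta>)"
  have e: "0 < e" unfolding e_def by (rule divide_pos_pos) (use neg one in auto)
  have "0 < evolve (\<lambda>\<xi>. 1 * w \<xi> + e * 1) t \<eta>"
    by (rule evolve_pos) (use w e t in \<open>auto intro: add_nonneg_pos\<close>)
  also have "\<dots> = 1 * evolve w t \<eta> + e * evolve (\<lambda>_. 1) t \<eta>"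
    by (rule evolve_affine)
  also have "\<dots> = evolve w t \<eta> / 2" using one by (simp add: e_def)
  finally show False using neg by simp
qed

lemma energy_vs_total:
  assumes u: "torus_profile n u r" and c0: "\<And>j \<eta>. c0 \<le> c j \<eta>"
  shows "c0 / 2 * torus_profile.total_energy n u (dens u w s) \<le> enrg u w s"
proof -
  interpret torus_profile n u r by (rule u)
  have "c0 * total_energy (dens u w s) = (\<Sum>j\<in>UNIV. \<Sum>x\<in>torus n. ex (\<lambda>\<eta>. c0 * (sqrt (dens u w s (exchange n x (x + \<e> j) \<eta>)) - sqrt (dens u w s \<eta>))\<^sup>2))"
    by (simp add: total_energy_def dir_energy_def sum_distrib_left ex_cmult)
  also have "\<dots> \<le> (\<Sum>j\<in>UNIV. \<Sum>x\<in>torus n. ex (\<lambda>\<eta>. c j (shift x \<eta>) * (sqrt (dens u w s (exchange n x (x + \<e> j) \<eta>)) - sqrt (dens u w s \<eta>))\<^sup>2))"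
    by (intro sum_mono ex_mono mult_right_mono c0) auto
  finally show ?thesis by (simp add: enrg_def)
qed

lemma enrg_nonneg: "torus_profile n u r \<Longrightarrow> 0 \<le> enrg u w s"
proof -
  assume "torus_profile n u r"
  then interpret torus_profile n u r .
  show ?thesis unfolding enrg_def by (intro mult_nonneg_nonneg sum_nonneg ex_nonneg c_nonneg) auto
qed

lemma dens_pos_density:
  assumes u: "torus_profile n u r" and w: "\<And>\<eta>. \<eta> \<in> \<Xi> \<Longrightarrow> 0 < w \<eta>" "(\<Sum>\<eta>\<in>\<Xi>. w \<eta>) = 1" and s: "0 \<le> s"
  shows "torus_profile.pos_density n u (dens u w s)"
proof -
  interpret torus_profile n u r by (rule u)
  have "wt \<eta> * dens u w s \<eta> = evolve w s \<eta>" for \<eta> using wt_pos[of \<eta>] by simp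
  then have "ex (dens u w s) = 1" using evolve_mass[of w s] w(2) by (simp add: ex_def)
  then show ?thesis
    unfolding pos_density_def using evolve_pos[OF w(1) s] wt_pos by (simp add: divide_pos_pos)
qed

context
  fixes U v :: "real \<Rightarrow> 'd site \<Rightarrow> real" and r T :: real
  assumes prof: "\<And>s. s \<in> {0..T} \<Longrightarrow> torus_profile n (U s) r"
    and deriv: "\<And>s x. s \<in> {0..T} \<Longrightarrow> ((\<lambda>s. U s x) has_real_derivative v s x) (at s within {0..T})"
begin

lemma profile_continuous: "continuous_on {0..T} (\<lambda>s. U s x)"
  using deriv by (intro DERIV_continuous_on) blast

lemma wt_continuous: "continuous_on {0..T} (\<lambda>s. torus_profile.wt n (U s) \<eta>)"
proof -
  have c: "continuous_on {0..T} (\<lambda>s. \<Prod>x\<in>torus n. if \<eta> x then U s x else 1 - U s x)"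
  proof (rule continuous_on_prod)
    fix x show "continuous_on {0..T} (\<lambda>s. if \<eta> x then U s x else 1 - U s x)"
      by (cases "\<eta> x") (auto intro!: continuous_intros profile_continuous)
  qed
  have "torus_profile.wt n (U s) \<eta> = (\<Prod>x\<in>torus n. if \<eta> x then U s x else 1 - U s x)" if "s \<in> {0..T}" for s
    using torus_profile.wt_def[OF prof[OF that]] .
  note eq = this
  show ?thesis by (rule continuous_on_eq[OF c]) (simp only: eq)
qed

lemma wt_profile_pos: "s \<in> {0..T} \<Longrightarrow> 0 < torus_profile.wt n (U s) \<eta>"
  using torus_profile.wt_pos[OF prof] .

lemma wt_profile_nz: "s \<in> {0..T} \<Longrightarrow> torus_profile.wt n (U s) \<eta> \<noteq> 0"
  by (rule less_imp_neq[OF wt_profile_pos, symmetric])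

lemma ent_eq:
  assumes "s \<in> {0..T}" "\<And>\<eta>. \<eta> \<in> \<Xi> \<Longrightarrow> 0 < w \<eta>"
  shows "ent (U s) w s = (\<Sum>\<eta>\<in>\<Xi>. evolve w s \<eta> * (ln (evolve w s \<eta>) - ln (torus_profile.wt n (U s) \<eta>)))"
proof -
  interpret torus_profile n "U s" r by (rule prof[OF assms(1)])
  have "wt \<eta> * (dens (U s) w s \<eta> * ln (dens (U s) w s \<eta>)) = evolve w s \<eta> * (ln (evolve w s \<eta>) - ln (wt \<eta>))" if "\<eta> \<in> \<Xi>" for \<eta>
    using wt_pos[of \<eta>] evolve_pos[where w = w, OF assms(2) _ that, of s] assms(1) by (simp add: ln_div)
  then show ?thesis by (simp add: ent_def ex_def)
qed

lemma ent_continuous: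
  assumes "\<And>\<eta>. \<eta> \<in> \<Xi> \<Longrightarrow> 0 < w \<eta>"
  shows "continuous_on {0..T} (\<lambda>s. ent (U s) w s)"
proof -
  have c: "continuous_on {0..T} (\<lambda>s. \<Sum>\<eta>\<in>\<Xi>. evolve w s \<eta> * (ln (evolve w s \<eta>) - ln (torus_profile.wt n (U s) \<eta>)))"
  proof (intro continuous_intros evolve_continuous wt_continuous)
    show "\<forall>s\<in>{0..T}. evolve w s \<eta> \<noteq> 0" if "\<eta> \<in> \<Xi>" for \<eta>
      using evolve_pos[where w = w, OF assms _ that] by force
    show "\<forall>s\<in>{0..T}. torus_profile.wt n (U s) \<eta> \<noteq> 0" for \<eta>
      using wt_profile_nz by blast
  qed
  show ?thesis by (rule continuous_on_eq[OF c]) (simp only: ent_eq[where w = w, OF _ assms])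
qed

text \<open>The reference measure moves as well: the term with \<open>v\<close> is the logarithmic
  time derivative of its weight.\<close>

lemma ent_deriv:
  assumes w: "\<And>\<eta>. \<eta> \<in> \<Xi> \<Longrightarrow> 0 < w \<eta>" and s: "0 < s" "s < T"
  shows "((\<lambda>s. ent (U s) w s) has_real_derivative
    torus_profile.ex n (U s) (\<lambda>\<eta>. dens (U s) w s \<eta> * G (\<lambda>\<eta>. ln (dens (U s) w s \<eta>)) \<eta>)
    - torus_profile.ex n (U s) (\<lambda>\<eta>. dens (U s) w s \<eta> * (\<Sum>x\<in>torus n. v s x * torus_profile.om (U s) x \<eta>))) (at s)"
proof -
  have sT: "s \<in> {0..T}" using s by simp
  interpret torus_profile n "U s" r by (rule prof[OF sT])
  have dU: "((\<lambda>s. U s x) has_real_derivative v s x) (at s)" for x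
    using deriv[OF sT] at_within_Icc_at[OF s] by simp
  let ?p = "evolve w" and ?p' = "\<lambda>\<eta>. \<Sum>\<zeta>\<in>\<Xi>. rate \<zeta> \<eta> * evolve w s \<zeta>"
  have pp: "0 < ?p s \<eta>" if "\<eta> \<in> \<Xi>" for \<eta> using evolve_pos[where w = w, OF w _ that] s by simp
  let ?lw = "\<lambda>s \<eta>. \<Sum>x\<in>torus n. ln (if \<eta> x then U s x else 1 - U s x)"
  have lw: "ln (torus_profile.wt n (U t) \<eta>) = ?lw t \<eta>" if "t \<in> {0..T}" for t \<eta>
  proof -
    interpret t: torus_profile n "U t" r by (rule prof[OF that])
    show ?thesis unfolding t.wt_def
      by (subst ln_prod) (use t.u_pos t.u_less_1 in \<open>auto simp: less_imp_neq less_imp_neq[OF t.u_pos, symmetric]\<close>)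
  qed
  have dlw: "((\<lambda>t. ?lw t \<eta>) has_real_derivative (\<Sum>x\<in>torus n. v s x * om x \<eta>)) (at s)" for \<eta>
  proof (rule DERIV_sum)
    fix x
    show "((\<lambda>t. ln (if \<eta> x then U t x else 1 - U t x)) has_real_derivative v s x * om x \<eta>) (at s)"
    proof (cases "\<eta> x")
      case True
      then show ?thesis using DERIV_ln_divide[OF u_pos[of x]] dU[of x]
        by (auto intro!: derivative_eq_intros simp: om_values u_pos)
    next
      case False
      then show ?thesis using dU[of x]
        by (auto intro!: derivative_eq_intros simp: om_values u_less_1 divide_simps)
    qed
  qed
  let ?D = "\<Sum>\<eta>\<in>\<Xi>. ?p' \<eta> * (ln (?p s \<eta>) - ?lw s \<eta>) + ?p s \<eta> * (?p' \<eta> / ?p s \<eta> - (\<Sum>x\<in>torus n. v s x * om x \<eta>))"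
  have main: "((\<lambda>t. \<Sum>\<eta>\<in>\<Xi>. ?p t \<eta> * (ln (?p t \<eta>) - ?lw t \<eta>)) has_real_derivative ?D) (at s)"
  proof (rule DERIV_sum)
    fix \<eta> assume \<eta>: "\<eta> \<in> \<Xi>"
    have "((\<lambda>t. ln (?p t \<eta>)) has_real_derivative ?p' \<eta> / ?p s \<eta>) (at s)"
      using evolve_deriv[of w \<eta> s] pp[OF \<eta>] by (auto intro!: derivative_eq_intros)
    then show "((\<lambda>t. ?p t \<eta> * (ln (?p t \<eta>) - ?lw t \<eta>)) has_real_derivative
      ?p' \<eta> * (ln (?p s \<eta>) - ?lw s \<eta>) + ?p s \<eta> * (?p' \<eta> / ?p s \<eta> - (\<Sum>x\<in>torus n. v s x * om x \<eta>))) (at s)"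
      by (intro DERIV_cong[OF DERIV_mult[OF evolve_deriv DERIV_diff[OF _ dlw]]]) auto
  qed
  have "eventually (\<lambda>t. t \<in> {0<..<T}) (nhds s)"
    using s by (intro eventually_nhds_in_open) auto
  then have "eventually (\<lambda>t. ent (U t) w t = (\<Sum>\<eta>\<in>\<Xi>. ?p t \<eta> * (ln (?p t \<eta>) - ?lw t \<eta>))) (nhds s)"
    by eventually_elim (simp add: ent_eq[where w = w, OF _ w] lw)
  note ev = this
  have d: "((\<lambda>t. ent (U t) w t) has_real_derivative ?D) (at s)"
    using main DERIV_cong_ev[OF refl ev refl] by blast
  have "?D = (\<Sum>\<eta>\<in>\<Xi>. ?p' \<eta> * ln (dens (U s) w s \<eta>)) + (\<Sum>\<eta>\<in>\<Xi>. ?p' \<eta>) - (\<Sum>\<eta>\<in>\<Xi>. ?p s \<eta> * (\<Sum>x\<in>torus n. v s x * om x \<eta>))"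
    unfolding sum.distrib[symmetric] sum_subtractf[symmetric]
  proof (intro sum.cong refl)
    fix \<eta> assume \<eta>: "\<eta> \<in> \<Xi>"
    have "ln (dens (U s) w s \<eta>) = ln (?p s \<eta>) - ?lw s \<eta>"
      using pp[OF \<eta>] wt_pos[of \<eta>] by (simp add: ln_div flip: lw[OF sT])
    then show "?p' \<eta> * (ln (?p s \<eta>) - ?lw s \<eta>) + ?p s \<eta> * (?p' \<eta> / ?p s \<eta> - (\<Sum>x\<in>torus n. v s x * om x \<eta>))
      = ?p' \<eta> * ln (dens (U s) w s \<eta>) + ?p' \<eta> - ?p s \<eta> * (\<Sum>x\<in>torus n. v s x * om x \<eta>)"
      using pp[OF \<eta>] by (simp add: right_diff_distrib)
  qed
  also have "(\<Sum>\<eta>\<in>\<Xi>. ?p' \<eta>) = 0"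
    by (subst sum.swap) (simp add: generator_one flip: sum_distrib_right)
  also have "(\<Sum>\<eta>\<in>\<Xi>. ?p' \<eta> * ln (dens (U s) w s \<eta>)) = ex (\<lambda>\<eta>. dens (U s) w s \<eta> * G (\<lambda>\<eta>. ln (dens (U s) w s \<eta>)) \<eta>)"
    unfolding evolve_dual ex_def by (intro sum.cong refl) (use wt_pos in \<open>simp add: less_imp_neq[OF wt_pos, symmetric]\<close>)
  also have "(\<Sum>\<eta>\<in>\<Xi>. ?p s \<eta> * (\<Sum>x\<in>torus n. v s x * om x \<eta>)) = ex (\<lambda>\<eta>. dens (U s) w s \<eta> * (\<Sum>x\<in>torus n. v s x * om x \<eta>))"
    unfolding ex_def by (intro sum.cong refl) (simp add: less_imp_neq[OF wt_pos, symmetric])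
  finally show ?thesis using d by simp
qed

lemma enrg_joint_continuous:
  assumes w: "\<And>\<eta>. continuous_on E (\<lambda>e. w e \<eta>)" and w0: "\<And>e s \<eta>. evolve (w e) s \<eta> = a e * evolve w1 s \<eta> + b e * evolve w2 s \<eta>"
    and ab: "continuous_on E a" "continuous_on E b" and t: "t \<le> T"
  shows "continuous_on (E \<times> {0..t}) (\<lambda>(e, s). enrg (U s) (w e) s)"
proof -
  have ev: "continuous_on (E \<times> {0..t}) (\<lambda>p. evolve (w (fst p)) (snd p) \<eta>)" for \<eta>
    unfolding w0
    by (intro continuous_intros continuous_on_compose2[OF ab(1) continuous_on_fst] continuous_on_compose2[OF ab(2) continuous_on_fst]
        continuous_on_compose2[OF evolve_continuous[of UNIV] continuous_on_snd]) auto
  have wt: "continuous_on (E \<times> {0..t}) (\<lambda>p. torus_profile.wt n (U (snd p)) \<eta>)" for \<eta>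
    by (rule continuous_on_compose2[OF wt_continuous continuous_on_snd]) (use t in \<open>auto intro: continuous_on_id\<close>)
  have nz: "\<forall>p\<in>E \<times> {0..t}. torus_profile.wt n (U (snd p)) \<eta> \<noteq> 0" for \<eta>
    by (intro ballI wt_profile_nz) (use t in force)
  have "continuous_on (E \<times> {0..t}) (\<lambda>p. enrg (U (snd p)) (w (fst p)) (snd p))"
  proof -
    have c1: "continuous_on (E \<times> {0..t}) (\<lambda>p. 1 / 2 * (\<Sum>j\<in>UNIV. \<Sum>x\<in>torus n. \<Sum>\<eta>\<in>\<Xi>. torus_profile.wt n (U (snd p)) \<eta> *
      (c j (shift x \<eta>) * (sqrt (dens (U (snd p)) (w (fst p)) (snd p) (exchange n x (x + \<e> j) \<eta>)) - sqrt (dens (U (snd p)) (w (fst p)) (snd p) \<eta>))\<^sup>2)))"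
      by (intro continuous_intros wt ev nz)
    have eq: "enrg (U (snd p)) (w (fst p)) (snd p) = 1 / 2 * (\<Sum>j\<in>UNIV. \<Sum>x\<in>torus n. \<Sum>\<eta>\<in>\<Xi>. torus_profile.wt n (U (snd p)) \<eta> *
      (c j (shift x \<eta>) * (sqrt (dens (U (snd p)) (w (fst p)) (snd p) (exchange n x (x + \<e> j) \<eta>)) - sqrt (dens (U (snd p)) (w (fst p)) (snd p) \<eta>))\<^sup>2))"
      if "p \<in> E \<times> {0..t}" for p
    proof -
      have "snd p \<in> {0..T}" using that t by auto
      then show ?thesis unfolding enrg_def using torus_profile.ex_def[OF prof] by simp
    qed
    show ?thesis by (rule continuous_on_eq[OF c1]) (simp only: eq)
  qed
  then show ?thesis by (simp add: case_prod_unfold)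
qed

end

end

context torus_dynamics
begin

context
  fixes U v :: "real \<Rightarrow> 'd site \<Rightarrow> real" and r T :: real
  assumes prof: "\<And>s. s \<in> {0..T} \<Longrightarrow> torus_profile n (U s) r"
    and deriv: "\<And>s x. s \<in> {0..T} \<Longrightarrow> ((\<lambda>s. U s x) has_real_derivative v s x) (at s within {0..T})"
begin

lemma enrg_continuous: "t \<le> T \<Longrightarrow> continuous_on {0..t} (\<lambda>s. enrg (U s) w s)"
proof -
  assume t: "t \<le> T"
  have "continuous_on ({0::real} \<times> {0..t}) (\<lambda>(e, s). enrg (U s) ((\<lambda>_. w) e) s)"
    by (rule enrg_joint_continuous[where a = "\<lambda>_. 1" and b = "\<lambda>_. 0" and ?w1.0 = w and ?w2.0 = w, OF prof deriv])
       (use t in auto)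
  then have "continuous_on {0..t} (\<lambda>s. (\<lambda>(e, s). enrg (U s) ((\<lambda>_. w) e) s) (0 :: real, s))"
    by (rule continuous_on_compose2) (auto intro!: continuous_intros)
  then show ?thesis by simp
qed

text \<open>The entropy dissipates \<open>2 * n\<^sup>2\<close> times the energy. One half absorbs
  the energy in the bound of the production, where the factor \<open>c0 / 2\<close> comes from
  \<open>c0 \<le> c j\<close>; the other half is kept for the time integral.\<close>

lemma entropy_derivative_bound:
  assumes S: "\<And>j. reads (S - {0, \<e> j}) (c j)" "offset_bound S D" "2 * D + 2 \<le> n" "0 \<in> S" "\<And>j. \<e> j \<in> S"
    and c0: "\<And>j \<eta>. c0 \<le> c j \<eta>"
    and w: "\<And>\<eta>. \<eta> \<in> \<Xi> \<Longrightarrow> 0 < w \<eta>" "(\<Sum>\<eta>\<in>\<Xi>. w \<eta>) = 1"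
    and prod: "\<And>s f. s \<in> {0..T} \<Longrightarrow> torus_profile.pos_density n (U s) f \<Longrightarrow>
      torus_profile.ex n (U s) (\<lambda>\<eta>. f \<eta> * torus_profile.production n (U s) c (v s) \<eta>)
      \<le> c0 / 2 * (real n)\<^sup>2 * torus_profile.total_energy n (U s) f + C * (torus_profile.ex n (U s) (\<lambda>\<eta>. f \<eta> * ln (f \<eta>)) + \<kappa>)"
    and s: "0 < s" "s < T"
  shows "\<exists>d. ((\<lambda>s. ent (U s) w s) has_real_derivative d) (at s) \<and>
    d + (real n)\<^sup>2 * enrg (U s) w s \<le> C * (ent (U s) w s + \<kappa>)"
proof -
  have sT: "s \<in> {0..T}" using s by simp
  interpret torus_profile n "U s" r by (rule prof[OF sT])
  let ?f = "dens (U s) w s"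
  have pd: "pos_density ?f"
    by (rule dens_pos_density[OF prof[OF sT] w]) (use s in auto)
  then have fp: "0 < ?f \<eta>" if "\<eta> \<in> \<Xi>" for \<eta> using that unfolding pos_density_def by blast
  let ?d = "ex (\<lambda>\<eta>. ?f \<eta> * G (\<lambda>\<eta>. ln (?f \<eta>)) \<eta>) - ex (\<lambda>\<eta>. ?f \<eta> * (\<Sum>x\<in>torus n. v s x * om x \<eta>))"
  have "((\<lambda>s. ent (U s) w s) has_real_derivative ?d) (at s)"
    by (rule ent_deriv[OF prof deriv w(1) s])
  moreover have "?d \<le> ex (\<lambda>\<eta>. ?f \<eta> * production c (v s) \<eta>) - 2 * ((real n)\<^sup>2 * enrg (U s) w s)"
  proof -
    have "ex (\<lambda>\<eta>. ?f \<eta> * production c (\<lambda>_. 0) \<eta>) - ex (\<lambda>\<eta>. ?f \<eta> * (\<Sum>x\<in>torus n. v s x * om x \<eta>))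
      = ex (\<lambda>\<eta>. ?f \<eta> * production c (v s) \<eta>)"
      unfolding ex_diff[symmetric] by (rule ex_cong) (simp add: production_def right_diff_distrib)
    moreover have "(\<Sum>x\<in>torus n. \<Sum>j\<in>UNIV. ex (\<lambda>\<eta>. c j (shift x \<eta>) * (sqrt (?f (exchange n x (x + \<e> j) \<eta>)) - sqrt (?f \<eta>))\<^sup>2))
      = 2 * enrg (U s) w s"
      unfolding enrg_def by (subst sum.swap) simp
    ultimately show ?thesis
      using generator_entropy_bound[where f = ?f and c = c, OF S c_nonneg fp] by simp
  qed
  moreover have "ex (\<lambda>\<eta>. ?f \<eta> * production c (v s) \<eta>) \<le> (real n)\<^sup>2 * enrg (U s) w s + C * (ent (U s) w s + \<kappa>)"
  proof -
    have "c0 / 2 * total_energy ?f \<le> enrg (U s) w s" by (rule energy_vs_total[OF prof[OF sT] c0])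
    then have "(real n)\<^sup>2 * (c0 / 2 * total_energy ?f) \<le> (real n)\<^sup>2 * enrg (U s) w s" by (rule mult_left_mono) simp
    then have "c0 / 2 * (real n)\<^sup>2 * total_energy ?f \<le> (real n)\<^sup>2 * enrg (U s) w s" by (simp only: mult_ac)
    then show ?thesis using prod[OF sT pd] by (simp only: ent_def)
  qed
  ultimately show ?thesis by (intro exI[of _ ?d]) linarith
qed

text \<open>Gronwall's inequality for a strictly positive initial law, for which the density never
  vanishes and its logarithm can be differentiated.\<close>

lemma entropy_estimate_pos:
  assumes S: "\<And>j. reads (S - {0, \<e> j}) (c j)" "offset_bound S D" "2 * D + 2 \<le> n" "0 \<in> S" "\<And>j. \<e> j \<in> S"
    and c0: "\<And>j \<eta>. c0 \<le> c j \<eta>"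
    and w: "\<And>\<eta>. \<eta> \<in> \<Xi> \<Longrightarrow> 0 < w \<eta>" "(\<Sum>\<eta>\<in>\<Xi>. w \<eta>) = 1"
    and prod: "\<And>s f. s \<in> {0..T} \<Longrightarrow> torus_profile.pos_density n (U s) f \<Longrightarrow>
      torus_profile.ex n (U s) (\<lambda>\<eta>. f \<eta> * torus_profile.production n (U s) c (v s) \<eta>)
      \<le> c0 / 2 * (real n)\<^sup>2 * torus_profile.total_energy n (U s) f + C * (torus_profile.ex n (U s) (\<lambda>\<eta>. f \<eta> * ln (f \<eta>)) + \<kappa>)"
    and C: "0 \<le> C" "0 \<le> \<kappa>" and t: "t \<in> {0..T}"
  shows "ent (U t) w t + integral {0..t} (\<lambda>s. (real n)\<^sup>2 * enrg (U s) w s) \<le> (ent (U 0) w 0 + \<kappa>) * exp (C * t)"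
proof -
  let ?I = "\<lambda>s. (real n)\<^sup>2 * enrg (U s) w s"
  have cI: "continuous_on {0..t} ?I" using t by (intro continuous_intros enrg_continuous) auto
  define J where "J s = integral {0..s} ?I" for s
  let ?P = "\<lambda>s. (ent (U s) w s + J s + \<kappa>) * exp (- C * s)"
  have "?P t \<le> ?P 0"
  proof (rule DERIV_nonpos_imp_decreasing_open[of 0 t ?P])
    show "0 \<le> t" using t by simp
    have "continuous_on {0..t} (\<lambda>s. ent (U s) w s)"
      by (rule continuous_on_subset[OF ent_continuous[OF prof deriv w(1)]]) (use t in auto)
    moreover have "continuous_on {0..t} J"
      unfolding J_def[abs_def] by (rule indefinite_integral_continuous_1) (rule integrable_continuous_real[OF cI])
    ultimately show "continuous_on {0..t} ?P" by (intro continuous_intros)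
    fix s assume s: "0 < s" "s < t"
    then have sT: "s < T" using t by simp
    obtain d where d: "((\<lambda>s. ent (U s) w s) has_real_derivative d) (at s)" "d + ?I s \<le> C * (ent (U s) w s + \<kappa>)"
      using entropy_derivative_bound[OF S c0 w prod s(1) sT] by blast
    have di: "(J has_real_derivative ?I s) (at s)"
    proof -
      have "s \<in> {0..t}" using s by simp
      from integral_has_real_derivative[OF cI this] show ?thesis unfolding J_def[abs_def] at_within_Icc_at[OF s] .
    qed
    let ?d = "(d + ?I s) * exp (- C * s) + (ent (U s) w s + J s + \<kappa>) * (exp (- C * s) * (- C))"
    have "(?P has_real_derivative ?d) (at s)"
      by (auto intro!: derivative_eq_intros d(1) di)
    moreover have "?d \<le> 0"
    proof -
      have "0 \<le> J s"
        unfolding J_def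
      proof (rule integral_nonneg)
        show "?I integrable_on {0..s}"
          by (rule integrable_continuous_real, rule continuous_on_subset[OF cI]) (use s in auto)
        fix x assume "x \<in> {0..s}"
        then have "0 \<le> enrg (U x) w x" using enrg_nonneg[OF prof] sT by auto
        then show "0 \<le> ?I x" by simp
      qed
      then have "0 \<le> C * J s" using C by simp
      then have "d + ?I s \<le> C * (ent (U s) w s + J s + \<kappa>)"
        using d(2) by (simp add: algebra_simps)
      then have "(d + ?I s) * exp (- C * s) \<le> C * (ent (U s) w s + J s + \<kappa>) * exp (- C * s)"
        by (rule mult_right_mono) simp
      then show ?thesis by (simp add: mult_ac)
    qed
    ultimately show "\<exists>y. (?P has_real_derivative y) (at s) \<and> y \<le> 0" by blast
  qed
  moreover have "?P 0 = ent (U 0) w 0 + \<kappa>" by (simp add: J_def)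
  ultimately have "(ent (U t) w t + J t + \<kappa>) * exp (- C * t) * exp (C * t) \<le> (ent (U 0) w 0 + \<kappa>) * exp (C * t)"
    by (intro mult_right_mono) auto
  then have "ent (U t) w t + J t + \<kappa> \<le> (ent (U 0) w 0 + \<kappa>) * exp (C * t)"
    by (simp add: mult.assoc flip: exp_add)
  then show ?thesis using C(2) unfolding J_def by linarith
qed

text \<open>A general initial law is approximated by mixtures with the uniform one, whose evolution is
  strictly positive.\<close>

lemma entropy_estimate_nonneg:
  assumes S: "\<And>j. reads (S - {0, \<e> j}) (c j)" "offset_bound S D" "2 * D + 2 \<le> n" "0 \<in> S" "\<And>j. \<e> j \<in> S"
    and c0: "\<And>j \<eta>. c0 \<le> c j \<eta>"
    and w: "\<And>\<eta>. \<eta> \<in> \<Xi> \<Longrightarrow> 0 \<le> w \<eta>" "(\<Sum>\<eta>\<in>\<Xi>. w \<eta>) = 1"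
    and prod: "\<And>s f. s \<in> {0..T} \<Longrightarrow> torus_profile.pos_density n (U s) f \<Longrightarrow>
      torus_profile.ex n (U s) (\<lambda>\<eta>. f \<eta> * torus_profile.production n (U s) c (v s) \<eta>)
      \<le> c0 / 2 * (real n)\<^sup>2 * torus_profile.total_energy n (U s) f + C * (torus_profile.ex n (U s) (\<lambda>\<eta>. f \<eta> * ln (f \<eta>)) + \<kappa>)"
    and C: "0 \<le> C" "0 \<le> \<kappa>" and t: "t \<in> {0..T}"
  shows "ent (U t) w t + integral {0..t} (\<lambda>s. (real n)\<^sup>2 * enrg (U s) w s) \<le> (ent (U 0) w 0 + \<kappa>) * exp (C * t)"
proof -
  define z where "z \<eta> = 1 / real (card \<Xi>)" for \<eta> :: "'d config"
  define W where "W e \<eta> = (1 - e) * w \<eta> + e * z \<eta>" for e \<eta>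
  have card: "0 < card \<Xi>" using fin torus_configs_nonempty by (simp add: card_gt_0_iff)
  have We: "evolve (W e) s \<eta> = (1 - e) * evolve w s \<eta> + e * evolve z s \<eta>" for e s \<eta>
    unfolding W_def by (rule evolve_affine)
  have z: "0 < z \<eta>" "(\<Sum>\<eta>\<in>\<Xi>. z \<eta>) = 1" for \<eta> using card by (auto simp: z_def)
  have Wnn: "0 \<le> W e \<eta>" if "e \<in> {0..1}" "\<eta> \<in> \<Xi>" for e \<eta>
    unfolding W_def using that w(1)[OF that(2)] z(1)[of \<eta>] by (intro add_nonneg_nonneg mult_nonneg_nonneg) auto
  let ?F = "\<lambda>e. (ent (U 0) (W e) 0 + \<kappa>) * exp (C * t) - (ent (U t) (W e) t + integral {0..t} (\<lambda>s. (real n)\<^sup>2 * enrg (U s) (W e) s))"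
  have T0: "0 \<in> {0..T}" using t by auto
  have ce: "continuous_on {0..1} (\<lambda>e. ent (U s) (W e) s)" if s: "s \<in> {0..T}" for s
  proof -
    interpret torus_profile n "U s" r by (rule prof[OF s])
    have "continuous_on {0..1} (\<lambda>e. dens (U s) (W e) s \<eta> * ln (dens (U s) (W e) s \<eta>))" if \<eta>: "\<eta> \<in> \<Xi>" for \<eta>
    proof (rule continuous_on_compose2[OF continuous_on_mult_ln])
      show "continuous_on {0..1} (\<lambda>e. dens (U s) (W e) s \<eta>)"
        unfolding We by (intro continuous_intros) (simp add: less_imp_neq[OF wt_pos, symmetric])
      show "(\<lambda>e. dens (U s) (W e) s \<eta>) ` {0..1} \<subseteq> {0..}"
      proof (intro image_subsetI)
        fix e :: real assume e: "e \<in> {0..1}"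
        have "0 \<le> evolve (W e) s \<eta>" by (rule evolve_nonneg) (use Wnn[OF e] s \<eta> in auto)
        then show "dens (U s) (W e) s \<eta> \<in> {0..}" using less_imp_le[OF wt_pos] by (simp add: divide_nonneg_nonneg)
      qed
    qed
    then show ?thesis unfolding ent_def ex_def by (intro continuous_on_sum continuous_on_mult_left)
  qed
  have "continuous_on ({0..1} \<times> cbox 0 t) (\<lambda>(e, s). (real n)\<^sup>2 * enrg (U s) (W e) s)"
  proof -
    have "continuous_on ({0..1} \<times> {0..t}) (\<lambda>(e, s). enrg (U s) (W e) s)"
      by (rule enrg_joint_continuous[where a = "\<lambda>e. 1 - e" and b = "\<lambda>e. e" and ?w1.0 = w and ?w2.0 = z, OF prof deriv])
         (use t in \<open>auto intro!: continuous_intros simp: We W_def\<close>)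
    then show ?thesis by (auto intro!: continuous_intros simp: case_prod_unfold)
  qed
  then have "continuous_on {0..1} (\<lambda>e. integral (cbox 0 t) (\<lambda>s. (real n)\<^sup>2 * enrg (U s) (W e) s))"
    by (rule integral_continuous_on_param)
  then have "continuous_on {0..1} ?F"
    by (intro continuous_intros ce T0 t) simp
  moreover have "0 \<le> ?F e" if e: "e \<in> {0<..<1}" for e
  proof -
    have "ent (U t) (W e) t + integral {0..t} (\<lambda>s. (real n)\<^sup>2 * enrg (U s) (W e) s) \<le> (ent (U 0) (W e) 0 + \<kappa>) * exp (C * t)"
    proof (rule entropy_estimate_pos[OF S c0 _ _ prod C t])
      show "0 < W e \<eta>" if "\<eta> \<in> \<Xi>" for \<eta>
        unfolding W_def using e w(1)[OF that] z(1)[of \<eta>] by (intro add_nonneg_pos mult_nonneg_nonneg mult_pos_pos) auto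
      show "(\<Sum>\<eta>\<in>\<Xi>. W e \<eta>) = 1"
        unfolding W_def by (simp add: sum.distrib sum_distrib_left[symmetric] w(2) z(2))
    qed
    then show ?thesis by simp
  qed
  ultimately have "0 \<le> ?F 0"
    by (intro continuous_ge_on_closure[of "{0<..<1}" ?F 0 0]) auto
  moreover have "W 0 = w" by (simp add: W_def fun_eq_iff)
  ultimately show ?thesis by simp
qed

text \<open>For bounded \<open>n\<close> a crude bound suffices: the density is at most the inverse of the smallest
  weight.\<close>

lemma entropy_estimate_crude:
  assumes M: "\<And>j \<eta>. c j \<eta> \<le> M" and w: "\<And>\<eta>. \<eta> \<in> \<Xi> \<Longrightarrow> 0 \<le> w \<eta>" "(\<Sum>\<eta>\<in>\<Xi>. w \<eta>) = 1"
    and t: "t \<in> {0..T}"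
    and \<kappa>: "(1 / r ^ (n ^ CARD('d))) * ln (1 / r ^ (n ^ CARD('d)))
      + T * ((real n)\<^sup>2 * (real CARD('d) * real n ^ CARD('d) * (M * (1 / r ^ (n ^ CARD('d)))))) \<le> \<kappa>" and C: "0 \<le> C"
  shows "ent (U t) w t + integral {0..t} (\<lambda>s. (real n)\<^sup>2 * enrg (U s) w s) \<le> (ent (U 0) w 0 + \<kappa>) * exp (C * t)"
proof -
  have T0: "0 \<in> {0..T}" using t by auto
  let ?R = "1 / r ^ (n ^ CARD('d))"
  have r: "0 < r" "r < 1 / 2" using prof[OF T0] by (auto simp: torus_profile_def)
  have R1: "1 \<le> ?R" using r by (simp add: power_le_one)
  have M0: "0 \<le> M" using order_trans[OF c_nonneg M] .
  have fb: "0 \<le> dens (U s) w s \<eta> \<and> dens (U s) w s \<eta> \<le> ?R" if s: "s \<in> {0..T}" and \<eta>: "\<eta> \<in> \<Xi>" for s \<eta>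
  proof -
    interpret torus_profile n "U s" r by (rule prof[OF s])
    have p: "0 \<le> evolve w s \<zeta>" if "\<zeta> \<in> \<Xi>" for \<zeta> by (rule evolve_nonneg) (use w s that in auto)
    have "evolve w s \<eta> \<le> (\<Sum>\<eta>\<in>\<Xi>. evolve w s \<eta>)" by (rule member_le_sum) (use p \<eta> fin in auto)
    then have p1: "evolve w s \<eta> \<le> 1" using w(2) by (simp add: evolve_mass)
    have "(\<Prod>x\<in>(torus n :: 'd site set). r) \<le> wt \<eta>"
      unfolding wt_def by (rule prod_mono) (use u_lower u_upper r in \<open>force simp: algebra_simps\<close>)
    then have "r ^ (n ^ CARD('d)) \<le> wt \<eta>" by (simp add: card_torus)
    then have "dens (U s) w s \<eta> \<le> ?R" using p1 p[OF \<eta>] r by (intro frac_le) auto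
    then show ?thesis using p[OF \<eta>] wt_pos[of \<eta>] by (simp add: divide_nonneg_pos)
  qed
  have ent_le: "ent (U t) w t \<le> ?R * ln ?R"
  proof -
    interpret torus_profile n "U t" r by (rule prof[OF t])
    have "ent (U t) w t \<le> ex (\<lambda>_. ?R * ln ?R)"
      unfolding ent_def
    proof (rule ex_mono)
      fix \<eta> assume \<eta>: "\<eta> \<in> \<Xi>"
      show "dens (U t) w t \<eta> * ln (dens (U t) w t \<eta>) \<le> ?R * ln ?R"
      proof (cases "dens (U t) w t \<eta> \<le> 1")
        case True
        moreover have "y * ln y \<le> 0" if "0 \<le> y" "y \<le> 1" for y :: real
          using that by (cases "y = 0") (auto intro: mult_nonneg_nonpos)
        ultimately have "dens (U t) w t \<eta> * ln (dens (U t) w t \<eta>) \<le> 0" using fb[OF t \<eta>] by blast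
        also have "0 \<le> ?R * ln ?R" using R1 r by (intro mult_nonneg_nonneg) auto
        finally show ?thesis .
      next
        case False
        then show ?thesis using fb[OF t \<eta>] R1 r by (intro mult_mono) auto
      qed
    qed
    then show ?thesis by simp
  qed
  have ent_0: "0 \<le> ent (U 0) w 0"
  proof -
    interpret torus_profile n "U 0" r by (rule prof[OF T0])
    have "ex (\<lambda>\<eta>. dens (U 0) w 0 \<eta> - 1) \<le> ent (U 0) w 0"
      unfolding ent_def
    proof (rule ex_mono)
      fix \<eta> assume \<eta>: "\<eta> \<in> \<Xi>"
      have "y - 1 \<le> y * ln y" if "0 \<le> y" for y :: real
      proof (cases "y = 0")
        case False
        then have y: "0 < y" using that by simp
        have "ln (1 / y) \<le> 1 / y - 1" by (rule ln_le_minus_one) (use y in simp)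
        then have "y * ln (1 / y) \<le> y * (1 / y - 1)" using y by (intro mult_left_mono) auto
        then show ?thesis using y by (simp add: ln_div right_diff_distrib)
      qed simp
      then show "dens (U 0) w 0 \<eta> - 1 \<le> dens (U 0) w 0 \<eta> * ln (dens (U 0) w 0 \<eta>)"
        using fb[OF T0 \<eta>] by blast
    qed
    moreover have "ex (dens (U 0) w 0) = 1"
    proof -
      have "wt \<eta> * dens (U 0) w 0 \<eta> = evolve w 0 \<eta>" for \<eta> using wt_pos[of \<eta>] by simp
      then show ?thesis using evolve_mass[of w 0] w(2) by (simp add: ex_def)
    qed
    ultimately show ?thesis by (simp add: ex_diff)
  qed
  let ?B = "(real n)\<^sup>2 * (real CARD('d) * real n ^ CARD('d) * (M * ?R))"
  have B0: "0 \<le> ?B" using M0 r by (intro mult_nonneg_nonneg) auto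
  have en: "(real n)\<^sup>2 * enrg (U s) w s \<le> ?B" if s: "s \<in> {0..T}" for s
  proof -
    interpret torus_profile n "U s" r by (rule prof[OF s])
    have one: "ex (\<lambda>\<eta>. c j (shift x \<eta>) * (sqrt (dens (U s) w s (exchange n x (x + \<e> j) \<eta>)) - sqrt (dens (U s) w s \<eta>))\<^sup>2) \<le> M * (?R + ?R)" for j x
    proof -
      have "ex (\<lambda>\<eta>. c j (shift x \<eta>) * (sqrt (dens (U s) w s (exchange n x (x + \<e> j) \<eta>)) - sqrt (dens (U s) w s \<eta>))\<^sup>2) \<le> ex (\<lambda>_. M * (?R + ?R))"
      proof (intro ex_mono mult_mono M)
        fix \<eta> assume \<eta>: "\<eta> \<in> \<Xi>"
        let ?a = "dens (U s) w s (exchange n x (x + \<e> j) \<eta>)" and ?b = "dens (U s) w s \<eta>"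
        have ab: "0 \<le> ?a" "?a \<le> ?R" "0 \<le> ?b" "?b \<le> ?R" using fb[OF s] \<eta> by auto
        have "(sqrt ?a - sqrt ?b)\<^sup>2 = ?a + ?b - 2 * (sqrt ?a * sqrt ?b)" using ab by (simp add: power2_diff)
        moreover have "0 \<le> sqrt ?a * sqrt ?b" using ab by simp
        ultimately show "(sqrt ?a - sqrt ?b)\<^sup>2 \<le> ?R + ?R" using ab by linarith
      qed (use M0 in auto)
      then show ?thesis by simp
    qed
    have "enrg (U s) w s \<le> 1 / 2 * (\<Sum>j\<in>(UNIV :: 'd set). \<Sum>x\<in>(torus n :: 'd site set). M * (?R + ?R))"
      unfolding enrg_def by (intro mult_left_mono sum_mono one) auto
    also have "\<dots> = real CARD('d) * real n ^ CARD('d) * (M * ?R)" by (simp add: card_torus)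
    finally show ?thesis by (intro mult_left_mono) auto
  qed
  have "integral {0..t} (\<lambda>s. (real n)\<^sup>2 * enrg (U s) w s) \<le> integral {0..t} (\<lambda>_. ?B)"
  proof (rule integral_le)
    show "(\<lambda>s. (real n)\<^sup>2 * enrg (U s) w s) integrable_on {0..t}"
      using t by (intro integrable_continuous_real continuous_intros enrg_continuous) auto
    show "(real n)\<^sup>2 * enrg (U s) w s \<le> ?B" if "s \<in> {0..t}" for s by (rule en) (use that t in auto)
  qed auto
  also have "\<dots> = t * ?B" using t by simp
  also have "\<dots> \<le> T * ?B" using t B0 by (intro mult_right_mono) auto
  finally have "ent (U t) w t + integral {0..t} (\<lambda>s. (real n)\<^sup>2 * enrg (U s) w s) \<le> ent (U 0) w 0 + \<kappa>"
    using ent_le ent_0 \<kappa> by linarith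
  moreover have "(ent (U 0) w 0 + \<kappa>) * 1 \<le> (ent (U 0) w 0 + \<kappa>) * exp (C * t)"
  proof (rule mult_left_mono)
    have "0 \<le> T * ?B" by (rule mult_nonneg_nonneg[OF _ B0]) (use t in simp)
    moreover have "0 \<le> ?R * ln ?R" using R1 r by (intro mult_nonneg_nonneg) auto
    ultimately show "0 \<le> ent (U 0) w 0 + \<kappa>" using ent_0 \<kappa> by linarith
  qed (use C t in simp)
  ultimately show ?thesis unfolding mult_1_right by (rule order_trans)
qed

end

end

section \<open>Product measures with a sampled profile\<close>

abbreviation profile_at :: "nat \<Rightarrow> (real ^ 'd \<Rightarrow> real) \<Rightarrow> 'd::finite site \<Rightarrow> real"
  where "profile_at n \<rho> x \<equiv> \<rho> (\<chi> i. real_of_int (x $ i) / real n)"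

lemma pmf_profile_measure:
  assumes "torus_profile n (profile_at n \<rho>) r" "\<eta> \<in> torus_configs n"
  shows "pmf (profile_measure n \<rho>) \<eta> = torus_profile.wt n (profile_at n \<rho>) \<eta>"
proof -
  interpret torus_profile n "profile_at n \<rho>" r by (rule assms(1))
  let ?M = "Pi_pmf (torus n) False (\<lambda>x. bernoulli_pmf (profile_at n \<rho> x))"
  let ?l = "\<lambda>\<xi> x. \<xi> (\<chi> i. x $ i mod int n)"
  define \<xi> where "\<xi> x = (x \<in> torus n \<and> \<eta> x)" for x
  have l: "?l \<xi> = \<eta>"
    using assms(2) n_pos by (auto simp: \<xi>_def fun_eq_iff torus_configs_iff nperiodic_tmod simp flip: tmod_def)
  have p: "pmf ?M \<xi> = wt \<eta>"
  proof -
    have "pmf ?M \<xi> = (\<Prod>x\<in>torus n. pmf (bernoulli_pmf (profile_at n \<rho> x)) (\<xi> x))"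
      by (rule pmf_Pi') (auto simp: \<xi>_def)
    also have "\<dots> = wt \<eta>"
      unfolding wt_def by (intro prod.cong refl) (auto simp: \<xi>_def u_pos u_less_1 less_imp_le)
    finally show ?thesis .
  qed
  have inj: "inj_on ?l (set_pmf ?M)"
  proof (rule inj_onI)
    fix f g assume fg: "f \<in> set_pmf ?M" "g \<in> set_pmf ?M" "?l f = ?l g"
    show "f = g"
    proof
      fix x show "f x = g x"
      proof (cases "x \<in> torus n")
        case True
        then show ?thesis using fun_cong[OF fg(3), of x] by (simp add: tmod_id flip: tmod_def)
      next
        case False
        then show ?thesis using fg(1,2) set_Pi_pmf_subset[of "torus n" False "\<lambda>x. bernoulli_pmf (profile_at n \<rho> x)"]
          by (auto simp: subset_iff)
      qed
    qed
  qed
  have "\<xi> \<in> set_pmf ?M" using p wt_pos[of \<eta>] by (simp add: set_pmf_iff)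
  then have "pmf (map_pmf ?l ?M) (?l \<xi>) = pmf ?M \<xi>" by (rule pmf_map_inj[OF inj])
  then show ?thesis unfolding profile_measure_def l p .
qed

lemma expectation_profile_measure:
  assumes "torus_profile n (profile_at n \<rho>) r"
  shows "measure_pmf.expectation (profile_measure n \<rho>) g = torus_profile.ex n (profile_at n \<rho>) g"
proof -
  interpret torus_profile n "profile_at n \<rho>" r by (rule assms)
  have "set_pmf (profile_measure n \<rho>) \<subseteq> \<Omega>"
    by (auto simp: profile_measure_def torus_configs_iff nperiodic_def site_cong_tmod simp flip: tmod_def)
  then have "measure_pmf.expectation (profile_measure n \<rho>) g = (\<Sum>\<eta>\<in>\<Omega>. g \<eta> * pmf (profile_measure n \<rho>) \<eta>)"
    by (intro integral_measure_pmf_real) auto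
  then show ?thesis
    by (simp add: ex_def pmf_profile_measure[OF assms] mult.commute)
qed

lemma (in torus_dynamics) statement_bridge:
  assumes prof: "torus_profile n (profile_at n \<rho>) r" and \<mu>: "set_pmf \<mu> \<subseteq> \<Xi>"
  shows "rel_entropy (density_at c n \<mu> s \<rho>) (profile_measure n \<rho>) = ent (profile_at n \<rho>) (pmf \<mu>) s"
    and "energy c n (density_at c n \<mu> s \<rho>) (profile_measure n \<rho>) = enrg (profile_at n \<rho>) (pmf \<mu>) s"
proof -
  interpret torus_profile n "profile_at n \<rho>" r by (rule prof)
  have d: "density_at c n \<mu> s \<rho> \<eta> = dens (profile_at n \<rho>) (pmf \<mu>) s \<eta>" if "\<eta> \<in> \<Xi>" for \<eta>
    by (simp add: density_at_def pmf_profile_measure[OF prof that] law_evolve[OF \<mu>])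
  show "rel_entropy (density_at c n \<mu> s \<rho>) (profile_measure n \<rho>) = ent (profile_at n \<rho>) (pmf \<mu>) s"
    unfolding rel_entropy_def ent_def expectation_profile_measure[OF prof] by (rule ex_cong) (simp add: d)
  show "energy c n (density_at c n \<mu> s \<rho>) (profile_measure n \<rho>) = enrg (profile_at n \<rho>) (pmf \<mu>) s"
    unfolding energy_def enrg_def expectation_profile_measure[OF prof]
    by (intro arg_cong2[where f = "(*)"] refl sum.cong ex_cong) (simp add: d)
qed

section \<open>Regularity of the hydrodynamic equation\<close>

lemma real_deriv_bound:
  fixes g g' :: "real \<Rightarrow> real"
  assumes "\<And>s. (g has_real_derivative g' s) (at s)" "\<And>s. \<bar>g' s\<bar> \<le> K"
  shows "\<bar>g a - g b\<bar> \<le> K * \<bar>a - b\<bar>"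
  using field_differentiable_bound[of UNIV g g' K a b] assms by (auto intro: has_field_derivative_at_within)

lemma line_derivative:
  fixes f :: "real ^ 'd::finite \<Rightarrow> real"
  assumes "partial_differentiable j f (x + s *\<^sub>R axis j 1)"
  shows "((\<lambda>s. f (x + s *\<^sub>R axis j 1)) has_real_derivative partial j f (x + s *\<^sub>R axis j 1)) (at s)"
proof -
  let ?y = "x + s *\<^sub>R axis j 1"
  have "((\<lambda>t. f (?y + t *\<^sub>R axis j 1)) has_real_derivative partial j f ?y) (at 0)"
    using assms unfolding partial_differentiable_def partial_def by (simp add: field_differentiable_derivI)
  then have "((\<lambda>t. f (?y + (t - s) *\<^sub>R axis j 1)) has_real_derivative partial j f ?y) (at s)"
    using DERIV_shift[of "\<lambda>t. f (?y + (t - s) *\<^sub>R axis j 1)" "partial j f ?y" 0 s] by simp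
  moreover have "(\<lambda>t. f (?y + (t - s) *\<^sub>R axis j 1)) = (\<lambda>t. f (x + t *\<^sub>R axis j 1))"
    by (simp add: algebra_simps)
  ultimately show ?thesis by simp
qed

lemma lipschitz_directions:
  fixes f :: "real ^ 'd::finite \<Rightarrow> real"
  assumes "\<And>x j s. \<bar>f (x + s *\<^sub>R axis j 1) - f x\<bar> \<le> K * \<bar>s\<bar>"
  shows "\<bar>f (x + v) - f x\<bar> \<le> K * (\<Sum>j\<in>UNIV. \<bar>v $ j\<bar>)"
proof -
  have "\<bar>f (x + (\<Sum>j\<in>J. v $ j *\<^sub>R axis j 1)) - f x\<bar> \<le> K * (\<Sum>j\<in>J. \<bar>v $ j\<bar>)" if "finite J" for J
    using that
  proof (induction J rule: finite_induct)
    case (insert j J)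
    have "\<bar>f (x + (\<Sum>j\<in>J. v $ j *\<^sub>R axis j 1) + v $ j *\<^sub>R axis j 1) - f (x + (\<Sum>j\<in>J. v $ j *\<^sub>R axis j 1))\<bar> \<le> K * \<bar>v $ j\<bar>"
      by (rule assms)
    then show ?case using insert by (simp add: algebra_simps)
  qed simp
  from this[of UNIV] have "\<bar>f (x + (\<Sum>j\<in>UNIV. v $ j *\<^sub>R axis j 1)) - f x\<bar> \<le> K * (\<Sum>j\<in>UNIV. \<bar>v $ j\<bar>)" by simp
  moreover have "(\<Sum>j\<in>UNIV. v $ j *\<^sub>R axis j 1) = v"
    by (simp add: vec_eq_iff axis_def if_distrib[of "\<lambda>t. _ * t"] cong: if_cong)
  ultimately show ?thesis by simp
qed

text \<open>The norm controls, for each multiset of directions, one of the orders of differentiation.\<close>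

definition derivative_bound :: "real \<Rightarrow> (real ^ 'd::finite \<Rightarrow> real) \<Rightarrow> bool"
  where "derivative_bound K f \<longleftrightarrow> Ck 4 f \<and>
    (\<forall>j x. \<bar>partials [j] f x\<bar> \<le> K) \<and> (\<forall>j x. \<bar>partials [j, j] f x\<bar> \<le> K) \<and> (\<forall>j x. \<bar>partials [j, j, j] f x\<bar> \<le> K) \<and>
    (\<forall>i j. (\<forall>x. \<bar>partials [i, j] f x\<bar> \<le> K) \<or> (\<forall>x. \<bar>partials [j, i] f x\<bar> \<le> K))"

lemma finite_small_multisets: "finite {m :: 'd::finite multiset. size m \<le> k}"
proof (rule finite_subset)
  show "{m :: 'd multiset. size m \<le> k} \<subseteq> mset ` {xs. set xs \<subseteq> UNIV \<and> length xs \<le> k}"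
  proof
    fix m :: "'d multiset" assume "m \<in> {m. size m \<le> k}"
    moreover obtain xs where "mset xs = m" using ex_mset by blast
    ultimately show "m \<in> mset ` {xs. set xs \<subseteq> UNIV \<and> length xs \<le> k}" by force
  qed
  show "finite (mset ` {xs :: 'd list. set xs \<subseteq> UNIV \<and> length xs \<le> k})"
    by (intro finite_imageI finite_lists_length_le) simp
qed

lemma mset_replicate_unique: "mset js = replicate_mset k j \<Longrightarrow> js = replicate k j"
proof -
  assume a: "mset js = replicate_mset k j"
  have "length js = k" using arg_cong[OF a, of size] by simp
  moreover have "set js \<subseteq> {j}" using arg_cong[OF a, of set_mset] by (auto split: if_splits)
  ultimately show ?thesis by (intro replicate_eqI) auto
qed

text \<open>A constant multiset of directions has a single listing, so the pure derivatives are
  bounded; for two distinct directions the choice in the norm picks one of the two orders.\<close>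

lemma derivative_bound_from_norm:
  fixes u :: "real \<Rightarrow> real ^ 'd::finite \<Rightarrow> real"
  assumes n: "sup_Ck_norm T 4 u = ennreal K" and t: "t \<in> {0..T}"
  shows "derivative_bound (max K 0) (u t)"
proof -
  have "Ck_norm 4 (u t) \<le> sup_Ck_norm T 4 u" unfolding sup_Ck_norm_def using t by (rule SUP_upper)
  then have le: "Ck_norm 4 (u t) \<le> ennreal (max K 0)" using n by (simp add: ennreal_max_0)
  then have ck: "Ck 4 (u t)" unfolding Ck_norm_def by (auto split: if_splits simp: top_unique)
  have b: "\<bar>partials (SOME js. mset js = m) (u t) x\<bar> \<le> max K 0" if "size m \<le> 4" for m x
  proof -
    have "ennreal \<bar>partials (SOME js. mset js = m) (u t) x\<bar> \<le> (SUP x. ennreal \<bar>partials (SOME js. mset js = m) (u t) x\<bar>)"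
      by (rule SUP_upper) simp
    also have "\<dots> \<le> (\<Sum>m\<in>{m. size m \<le> 4}. SUP x. ennreal \<bar>partials (SOME js. mset js = m) (u t) x\<bar>)"
      by (rule member_le_sum) (use that finite_small_multisets in auto)
    also have "\<dots> \<le> ennreal (max K 0)" using le ck by (simp add: Ck_norm_def)
    finally show ?thesis by (rule iffD1[OF ennreal_le_iff, rotated]) simp
  qed
  have rep: "(SOME js. mset js = replicate_mset k j) = replicate k j" for k and j :: 'd
    by (rule some_equality) (auto intro: mset_replicate_unique)
  have r: "\<bar>partials (replicate k j) (u t) x\<bar> \<le> max K 0" if "k \<le> 4" for k j x
    using b[of "replicate_mset k j" x] that unfolding rep by simp
  have mixed: "(\<forall>x. \<bar>partials [i, j] (u t) x\<bar> \<le> max K 0) \<or> (\<forall>x. \<bar>partials [j, i] (u t) x\<bar> \<le> max K 0)" for i j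
  proof -
    define js where "js = (SOME js. mset js = {#i, j#})"
    have m: "mset js = {#i, j#}" unfolding js_def by (rule someI[of _ "[i, j]"]) simp
    have "length js = size {#i, j#}" unfolding m[symmetric] by simp
    then have "length js = 2" by simp
    then obtain a b where ab: "js = [a, b]" by (auto simp: numeral_2_eq_2 length_Suc_conv)
    then have "js = [i, j] \<or> js = [j, i]" using m by (auto simp: add_mset_eq_single add_eq_conv_ex)
    moreover have "\<bar>partials js (u t) x\<bar> \<le> max K 0" for x using b[of "{#i, j#}" x] unfolding js_def by simp
    ultimately show ?thesis by metis
  qed
  have "\<bar>partials [j] (u t) x\<bar> \<le> max K 0" "\<bar>partials [j, j] (u t) x\<bar> \<le> max K 0" "\<bar>partials [j, j, j] (u t) x\<bar> \<le> max K 0" for j x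
    using r[of 1 j x] r[of 2 j x] r[of 3 j x] by (simp_all add: numeral_2_eq_2 numeral_3_eq_3)
  then show ?thesis unfolding derivative_bound_def using ck mixed by blast
qed

context
  fixes f :: "real ^ 'd::finite \<Rightarrow> real" and K :: real
  assumes f: "derivative_bound K f"
begin

lemma line_deriv:
  "length js < 4 \<Longrightarrow> ((\<lambda>s. partials js f (x + s *\<^sub>R axis j 1)) has_real_derivative partials (j # js) f (x + s *\<^sub>R axis j 1)) (at s)"
  using f unfolding derivative_bound_def Ck_def by (simp add: line_derivative)

lemma bound_nonneg: "0 \<le> K"
  using f unfolding derivative_bound_def using abs_ge_zero order_trans by metis

lemma f_lipschitz: "\<bar>f (x + v) - f x\<bar> \<le> K * (\<Sum>j\<in>UNIV. \<bar>v $ j\<bar>)"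
proof (rule lipschitz_directions)
  fix x j s
  show "\<bar>f (x + s *\<^sub>R axis j 1) - f x\<bar> \<le> K * \<bar>s\<bar>"
    using real_deriv_bound[OF line_deriv[of "[]" x j], of K s 0] f by (simp add: derivative_bound_def)
qed

text \<open>A mixed second difference does not depend on the order of the directions, so a bound on either
  mixed derivative makes both first derivatives Lipschitz in the other direction.\<close>

lemma partial_lipschitz: "\<bar>partial j f (x + v) - partial j f x\<bar> \<le> K * (\<Sum>j\<in>UNIV. \<bar>v $ j\<bar>)"
proof (rule lipschitz_directions)
  fix x :: "real ^ 'd" and i s
  consider "\<forall>x. \<bar>partials [i, j] f x\<bar> \<le> K" | "\<forall>x. \<bar>partials [j, i] f x\<bar> \<le> K"
    using f unfolding derivative_bound_def by blast
  then show "\<bar>partial j f (x + s *\<^sub>R axis i 1) - partial j f x\<bar> \<le> K * \<bar>s\<bar>"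
  proof cases
    case 1
    then show ?thesis using real_deriv_bound[OF line_deriv[of "[j]" x i], of K s 0] by simp
  next
    case 2
    let ?e = "axis i 1 :: real ^ 'd" and ?d = "axis j 1 :: real ^ 'd"
    define g where "g t = f (x + s *\<^sub>R ?e + t *\<^sub>R ?d) - f (x + t *\<^sub>R ?d)" for t
    have g': "(g has_real_derivative partial j f (x + s *\<^sub>R ?e + t *\<^sub>R ?d) - partial j f (x + t *\<^sub>R ?d)) (at t)" for t
      unfolding g_def using line_deriv[of "[]" "x + s *\<^sub>R ?e" j t] line_deriv[of "[]" x j t] by (auto intro!: DERIV_diff)
    have gl: "\<bar>g t - g 0\<bar> \<le> K * \<bar>s\<bar> * \<bar>t\<bar>" for t
    proof -
      define k where "k r = f (x + t *\<^sub>R ?d + r *\<^sub>R ?e) - f (x + r *\<^sub>R ?e)" for r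
      have k': "(k has_real_derivative partial i f (x + t *\<^sub>R ?d + r *\<^sub>R ?e) - partial i f (x + r *\<^sub>R ?e)) (at r)" for r
        unfolding k_def using line_deriv[of "[]" "x + t *\<^sub>R ?d" i r] line_deriv[of "[]" x i r] by (auto intro!: DERIV_diff)
      have "\<bar>partial i f (x + t *\<^sub>R ?d + r *\<^sub>R ?e) - partial i f (x + r *\<^sub>R ?e)\<bar> \<le> K * \<bar>t\<bar>" for r
        using real_deriv_bound[OF line_deriv[of "[i]" "x + r *\<^sub>R ?e" j], of K t 0] 2 by (simp add: ac_simps)
      then have "\<bar>k s - k 0\<bar> \<le> (K * \<bar>t\<bar>) * \<bar>s - 0\<bar>" by (rule real_deriv_bound[OF k'])
      moreover have "k s - k 0 = g t - g 0" by (simp add: k_def g_def ac_simps)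
      ultimately show ?thesis by (simp add: mult_ac)
    qed
    have "((\<lambda>t. (g t - g 0) / t) \<longlongrightarrow> partial j f (x + s *\<^sub>R ?e) - partial j f x) (at 0)"
      using g'[of 0] by (simp add: has_field_derivative_iff)
    then have "((\<lambda>t. \<bar>(g t - g 0) / t\<bar>) \<longlongrightarrow> \<bar>partial j f (x + s *\<^sub>R ?e) - partial j f x\<bar>) (at 0)"
      by (rule tendsto_rabs)
    moreover have "eventually (\<lambda>t. \<bar>(g t - g 0) / t\<bar> \<le> K * \<bar>s\<bar>) (at (0 :: real))"
      unfolding eventually_at_filter
    proof (intro always_eventually allI impI)
      fix t :: real assume "t \<noteq> 0"
      then show "\<bar>(g t - g 0) / t\<bar> \<le> K * \<bar>s\<bar>" using gl[of t] by (simp add: abs_divide divide_le_eq)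
    qed
    ultimately show ?thesis by (intro tendsto_upperbound) auto
  qed
qed

lemma taylor:
  fixes x :: "real ^ 'd"
  shows "\<bar>f (x + s *\<^sub>R axis j 1) - 2 * f x + f (x - s *\<^sub>R axis j 1)\<bar> \<le> K * s\<^sup>2"
    and "\<bar>f (x + s *\<^sub>R axis j 1) - 2 * f x + f (x - s *\<^sub>R axis j 1) - partials [j, j] f x * s\<^sup>2\<bar> \<le> K * \<bar>s\<bar> ^ 3"
    and "\<bar>f x - f (x - s *\<^sub>R axis j 1) - partial j f x * s\<bar> \<le> K * s\<^sup>2"
proof -
  let ?e = "axis j 1 :: real ^ 'd"
  define D where "D m t = partials (replicate m j) f (x + t *\<^sub>R ?e)" for m t
  have D: "(D m has_real_derivative D (Suc m) t) (at t)" if "m < 4" for m t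
    unfolding D_def using line_deriv[of "replicate m j" x j t] that by simp
  have DK: "\<bar>D m t\<bar> \<le> K" if "m = 2 \<or> m = 3" for m t
    using that f unfolding derivative_bound_def D_def by (auto simp: numeral_2_eq_2 numeral_3_eq_3)
  have T: "\<exists>t. f (x + r *\<^sub>R ?e) = (\<Sum>m<k. D m 0 / fact m * r ^ m) + D k t / fact k * r ^ k" if "k \<le> 4" for k r
    using Maclaurin_bi_le[of D "\<lambda>t. f (x + t *\<^sub>R ?e)" k r] D that by (force simp: D_def)
  have two: "\<bar>f (x + r *\<^sub>R ?e) - f x - partial j f x * r\<bar> \<le> K / 2 * r\<^sup>2" for r
  proof -
    obtain t where t: "f (x + r *\<^sub>R ?e) = (\<Sum>m<2. D m 0 / fact m * r ^ m) + D 2 t / fact 2 * r ^ 2" using T[of 2 r] by auto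
    have eq: "f (x + r *\<^sub>R ?e) - f x - partial j f x * r = D 2 t / 2 * r\<^sup>2"
      unfolding t by (simp add: D_def numeral_2_eq_2)
    have "\<bar>D 2 t\<bar> / 2 * r\<^sup>2 \<le> K / 2 * r\<^sup>2" using DK[of 2 t] by (intro mult_right_mono) auto
    then show ?thesis unfolding eq by (simp add: abs_mult)
  qed
  have three: "\<bar>f (x + r *\<^sub>R ?e) - f x - partial j f x * r - partials [j, j] f x / 2 * r\<^sup>2\<bar> \<le> K / 2 * \<bar>r\<bar> ^ 3" for r
  proof -
    obtain t where t: "f (x + r *\<^sub>R ?e) = (\<Sum>m<3. D m 0 / fact m * r ^ m) + D 3 t / fact 3 * r ^ 3" using T[of 3 r] by auto
    have eq: "f (x + r *\<^sub>R ?e) - f x - partial j f x * r - partials [j, j] f x / 2 * r\<^sup>2 = D 3 t / 6 * r ^ 3"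
      unfolding t by (simp add: D_def numeral_2_eq_2 numeral_3_eq_3)
    have "\<bar>D 3 t\<bar> / 6 * \<bar>r\<bar> ^ 3 \<le> K / 2 * \<bar>r\<bar> ^ 3"
      using DK[of 3 t] bound_nonneg by (intro mult_right_mono) auto
    then show ?thesis unfolding eq by (simp add: abs_mult power_abs)
  qed
  show "\<bar>f (x + s *\<^sub>R ?e) - 2 * f x + f (x - s *\<^sub>R ?e)\<bar> \<le> K * s\<^sup>2"
  proof -
    have "f (x + s *\<^sub>R ?e) - 2 * f x + f (x - s *\<^sub>R ?e)
      = (f (x + s *\<^sub>R ?e) - f x - partial j f x * s) + (f (x + (- s) *\<^sub>R ?e) - f x - partial j f x * (- s))" by simp
    also have "\<bar>\<dots>\<bar> \<le> K / 2 * s\<^sup>2 + K / 2 * (- s)\<^sup>2"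
      by (rule order_trans[OF abs_triangle_ineq]) (intro add_mono two)
    finally show ?thesis by simp
  qed
  show "\<bar>f (x + s *\<^sub>R ?e) - 2 * f x + f (x - s *\<^sub>R ?e) - partials [j, j] f x * s\<^sup>2\<bar> \<le> K * \<bar>s\<bar> ^ 3"
  proof -
    have "f (x + s *\<^sub>R ?e) - 2 * f x + f (x - s *\<^sub>R ?e) - partials [j, j] f x * s\<^sup>2
      = (f (x + s *\<^sub>R ?e) - f x - partial j f x * s - partials [j, j] f x / 2 * s\<^sup>2)
        + (f (x + (- s) *\<^sub>R ?e) - f x - partial j f x * (- s) - partials [j, j] f x / 2 * (- s)\<^sup>2)" by simp
    also have "\<bar>\<dots>\<bar> \<le> K / 2 * \<bar>s\<bar> ^ 3 + K / 2 * \<bar>- s\<bar> ^ 3"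
      by (rule order_trans[OF abs_triangle_ineq]) (intro add_mono three)
    finally show ?thesis by simp
  qed
  have "K / 2 * s\<^sup>2 \<le> K * s\<^sup>2" using bound_nonneg by (intro mult_right_mono) auto
  then show "\<bar>f x - f (x - s *\<^sub>R ?e) - partial j f x * s\<bar> \<le> K * s\<^sup>2"
    using two[of "- s"] unfolding abs_le_iff by simp
qed

end

section \<open>Expectations of local functions as polynomials in the density\<close>

definition config_of :: "'d::finite site set \<Rightarrow> 'd config"
  where "config_of A = (\<lambda>x. x \<in> A)"

text \<open>The multi-affine Bernstein polynomial of \<open>f\<close>: the expectation of
  \<open>f\<close>, when it reads \<open>\<Lambda>\<close> only, under independent occupation
  variables with densities \<open>w\<close>.\<close>

definition bern :: "'d::finite site set \<Rightarrow> ('d config \<Rightarrow> real) \<Rightarrow> ('d site \<Rightarrow> real) \<Rightarrow> real"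
  where "bern \<Lambda> f w = (\<Sum>A\<in>Pow \<Lambda>. f (config_of A) * (\<Prod>z\<in>\<Lambda>. if z \<in> A then w z else 1 - w z))"

definition bern_partial :: "'d::finite site set \<Rightarrow> ('d config \<Rightarrow> real) \<Rightarrow> 'd site \<Rightarrow> ('d site \<Rightarrow> real) \<Rightarrow> real"
  where "bern_partial \<Lambda> f z w = (\<Sum>A\<in>Pow \<Lambda>. f (config_of A) *
    ((if z \<in> A then 1 else - 1) * (\<Prod>y\<in>\<Lambda> - {z}. if y \<in> A then w y else 1 - w y)))"

definition mass :: "'d::finite site set \<Rightarrow> ('d config \<Rightarrow> real) \<Rightarrow> real"
  where "mass \<Lambda> f = (\<Sum>A\<in>Pow \<Lambda>. \<bar>f (config_of A)\<bar>)"

lemma mass_nonneg: "0 \<le> mass \<Lambda> f"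
  unfolding mass_def by (intro sum_nonneg) auto

lemma prod_factor_bounds:
  assumes w: "\<And>z. 0 \<le> w z \<and> w z \<le> (1 :: real)" "\<And>z. 0 \<le> w' z \<and> w' z \<le> 1" and "finite \<Lambda>"
  shows "\<bar>\<Prod>z\<in>\<Lambda>. if z \<in> A then w z else 1 - w z\<bar> \<le> 1"
    and "\<bar>(\<Prod>z\<in>\<Lambda>. if z \<in> A then w z else 1 - w z) - (\<Prod>z\<in>\<Lambda>. if z \<in> A then w' z else 1 - w' z)\<bar> \<le> (\<Sum>z\<in>\<Lambda>. \<bar>w z - w' z\<bar>)"
proof -
  have "(\<Prod>z\<in>\<Lambda>. if z \<in> A then w z else 1 - w z) \<le> 1" "0 \<le> (\<Prod>z\<in>\<Lambda>. if z \<in> A then w z else 1 - w z)"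
    using w by (auto intro!: prod_le_1 prod_nonneg)
  then show "\<bar>\<Prod>z\<in>\<Lambda>. if z \<in> A then w z else 1 - w z\<bar> \<le> 1" by simp
  have "norm ((\<Prod>z\<in>\<Lambda>. if z \<in> A then w z else 1 - w z) - (\<Prod>z\<in>\<Lambda>. if z \<in> A then w' z else 1 - w' z))
    \<le> (\<Sum>z\<in>\<Lambda>. norm ((if z \<in> A then w z else 1 - w z) - (if z \<in> A then w' z else 1 - w' z)))"
  proof (rule norm_prod_diff)
    show "norm (if z \<in> A then w z else 1 - w z) \<le> 1" "norm (if z \<in> A then w' z else 1 - w' z) \<le> 1" for z
      using w(1)[of z] w(2)[of z] by auto
  qed
  also have "\<dots> = (\<Sum>z\<in>\<Lambda>. \<bar>w z - w' z\<bar>)" by (intro sum.cong) (auto simp: abs_minus_commute)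
  finally show "\<bar>(\<Prod>z\<in>\<Lambda>. if z \<in> A then w z else 1 - w z) - (\<Prod>z\<in>\<Lambda>. if z \<in> A then w' z else 1 - w' z)\<bar> \<le> (\<Sum>z\<in>\<Lambda>. \<bar>w z - w' z\<bar>)"
    by simp
qed

lemma bern_bounds:
  assumes "finite \<Lambda>" and w: "\<And>z. 0 \<le> w z \<and> w z \<le> 1" "\<And>z. 0 \<le> w' z \<and> w' z \<le> 1"
  shows "\<bar>bern \<Lambda> f w\<bar> \<le> mass \<Lambda> f"
    and "\<bar>bern \<Lambda> f w - bern \<Lambda> f w'\<bar> \<le> mass \<Lambda> f * (\<Sum>z\<in>\<Lambda>. \<bar>w z - w' z\<bar>)"
    and "\<bar>bern_partial \<Lambda> f z w\<bar> \<le> mass \<Lambda> f"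
    and "\<bar>bern_partial \<Lambda> f z w - bern_partial \<Lambda> f z w'\<bar> \<le> mass \<Lambda> f * (\<Sum>z\<in>\<Lambda>. \<bar>w z - w' z\<bar>)"
proof -
  let ?p = "\<lambda>\<Lambda> A w. \<Prod>z\<in>\<Lambda>. if z \<in> A then w z else 1 - (w z :: real)"
  have gen: "\<bar>\<Sum>A\<in>Pow \<Lambda>. f (config_of A) * t A\<bar> \<le> mass \<Lambda> f * S" if "\<And>A. \<bar>t A\<bar> \<le> S" for t S
  proof -
    have "\<bar>\<Sum>A\<in>Pow \<Lambda>. f (config_of A) * t A\<bar> \<le> (\<Sum>A\<in>Pow \<Lambda>. \<bar>f (config_of A)\<bar> * S)"
      by (rule order_trans[OF sum_abs]) (auto simp: abs_mult intro!: sum_mono mult_left_mono that)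
    then show ?thesis by (simp add: mass_def sum_distrib_right)
  qed
  show "\<bar>bern \<Lambda> f w\<bar> \<le> mass \<Lambda> f"
    using gen[of "\<lambda>A. ?p \<Lambda> A w" 1] prod_factor_bounds(1)[where w = w and w' = w', OF w assms(1)] by (simp add: bern_def)
  show "\<bar>bern \<Lambda> f w - bern \<Lambda> f w'\<bar> \<le> mass \<Lambda> f * (\<Sum>z\<in>\<Lambda>. \<bar>w z - w' z\<bar>)"
    using gen[of "\<lambda>A. ?p \<Lambda> A w - ?p \<Lambda> A w'", OF prod_factor_bounds(2)[where w = w and w' = w', OF w assms(1)]]
    by (simp add: bern_def sum_subtractf right_diff_distrib)
  have fin: "finite (\<Lambda> - {z})" using assms(1) by simp
  show "\<bar>bern_partial \<Lambda> f z w\<bar> \<le> mass \<Lambda> f"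
    using gen[of "\<lambda>A. (if z \<in> A then 1 else - 1) * ?p (\<Lambda> - {z}) A w" 1] prod_factor_bounds(1)[where w = w and w' = w', OF w fin]
    by (simp add: bern_partial_def abs_mult)
  have "(\<Sum>y\<in>\<Lambda> - {z}. \<bar>w y - w' y\<bar>) \<le> (\<Sum>z\<in>\<Lambda>. \<bar>w z - w' z\<bar>)" by (rule sum_mono2) (use assms(1) in auto)
  then have "\<bar>(if z \<in> A then 1 else - 1) * ?p (\<Lambda> - {z}) A w - (if z \<in> A then 1 else - 1) * ?p (\<Lambda> - {z}) A w'\<bar> \<le> (\<Sum>z\<in>\<Lambda>. \<bar>w z - w' z\<bar>)" for A
    using prod_factor_bounds(2)[where w = w and w' = w', OF w fin, of A] by (auto simp: abs_minus_commute)
  from gen[OF this] show "\<bar>bern_partial \<Lambda> f z w - bern_partial \<Lambda> f z w'\<bar> \<le> mass \<Lambda> f * (\<Sum>z\<in>\<Lambda>. \<bar>w z - w' z\<bar>)"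
    by (simp add: bern_partial_def sum_subtractf right_diff_distrib)
qed

lemma bern_derivative:
  assumes fin: "finite \<Lambda>" and w: "\<And>z. ((\<lambda>s. w s z) has_real_derivative w' z) (at t)"
  shows "((\<lambda>s. bern \<Lambda> f (w s)) has_real_derivative (\<Sum>z\<in>\<Lambda>. bern_partial \<Lambda> f z (w t) * w' z)) (at t)"
proof -
  have d: "((\<lambda>s. \<Prod>z\<in>\<Lambda>. if z \<in> A then w s z else 1 - w s z) has_real_derivative
    (\<Sum>z\<in>\<Lambda>. ((if z \<in> A then 1 else - 1) * w' z) * (\<Prod>y\<in>\<Lambda> - {z}. if y \<in> A then w t y else 1 - w t y))) (at t)" for A
  proof (rule has_field_derivative_prod)
    fix z show "((\<lambda>s. if z \<in> A then w s z else 1 - w s z) has_real_derivative (if z \<in> A then 1 else - 1) * w' z) (at t)"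
      using w[of z] by (cases "z \<in> A") (auto intro!: derivative_eq_intros)
  qed
  have "((\<lambda>s. bern \<Lambda> f (w s)) has_real_derivative
    (\<Sum>A\<in>Pow \<Lambda>. f (config_of A) * (\<Sum>z\<in>\<Lambda>. ((if z \<in> A then 1 else - 1) * w' z) * (\<Prod>y\<in>\<Lambda> - {z}. if y \<in> A then w t y else 1 - w t y)))) (at t)"
    unfolding bern_def by (intro DERIV_sum DERIV_cmult d)
  also have "(\<Sum>A\<in>Pow \<Lambda>. f (config_of A) * (\<Sum>z\<in>\<Lambda>. ((if z \<in> A then 1 else - 1) * w' z) * (\<Prod>y\<in>\<Lambda> - {z}. if y \<in> A then w t y else 1 - w t y)))
    = (\<Sum>z\<in>\<Lambda>. bern_partial \<Lambda> f z (w t) * w' z)"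
    unfolding bern_partial_def sum_distrib_left sum_distrib_right by (subst sum.swap) (simp add: mult_ac)
  finally show ?thesis .
qed

lemma reads_expansion:
  assumes "finite \<Lambda>" "reads \<Lambda> f"
  shows "f \<eta> = (\<Sum>A\<in>Pow \<Lambda>. f (config_of A) * (\<Prod>z\<in>\<Lambda>. of_bool (\<eta> z \<longleftrightarrow> z \<in> A)))"
proof -
  let ?A = "{z \<in> \<Lambda>. \<eta> z}"
  have "(\<Prod>z\<in>\<Lambda>. of_bool (\<eta> z \<longleftrightarrow> z \<in> A)) = (if A = ?A then 1 else 0 :: real)" if "A \<in> Pow \<Lambda>" for A
  proof (cases "A = ?A")
    case False
    have "\<exists>z\<in>\<Lambda>. \<not> (\<eta> z \<longleftrightarrow> z \<in> A)"
    proof (rule ccontr)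
      assume "\<not> ?thesis"
      then have "A = ?A" using that by auto
      then show False using False by simp
    qed
    then show ?thesis using False assms(1) by (auto intro!: prod_zero)
  qed (auto intro!: prod.neutral)
  then have "(\<Sum>A\<in>Pow \<Lambda>. f (config_of A) * (\<Prod>z\<in>\<Lambda>. of_bool (\<eta> z \<longleftrightarrow> z \<in> A)))
    = (\<Sum>A\<in>Pow \<Lambda>. if A = ?A then f (config_of A) else 0)"
    by (intro sum.cong refl) auto
  also have "\<dots> = f (config_of ?A)" using assms(1) by (simp add: sum.delta)
  also have "\<dots> = f \<eta>" by (rule readsD[OF assms(2)]) (simp add: config_of_def)
  finally show ?thesis ..
qed

lemma (in torus_profile) ex_local_bern:
  assumes "finite \<Lambda>" "reads \<Lambda> f" and \<Lambda>: "offset_bound \<Lambda> D" "2 * D + 1 \<le> n"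
  shows "ex (\<lambda>\<eta>. f (shift x \<eta>)) = bern \<Lambda> f (\<lambda>z. u (x + z))"
proof -
  have "ex (\<lambda>\<eta>. f (shift x \<eta>)) = ex (\<lambda>\<eta>. \<Sum>A\<in>Pow \<Lambda>. f (config_of A) * (\<Prod>z\<in>\<Lambda>. of_bool (\<eta> (x + z) \<longleftrightarrow> z \<in> A)))"
    by (rule ex_cong, subst reads_expansion[OF assms(1,2)]) (simp add: shift_def)
  also have "\<dots> = (\<Sum>A\<in>Pow \<Lambda>. f (config_of A) * ex (\<lambda>\<eta>. \<Prod>z\<in>\<Lambda>. of_bool (\<eta> (x + z) \<longleftrightarrow> z \<in> A)))"
    by (simp only: ex_sum ex_cmult)
  also have "\<dots> = bern \<Lambda> f (\<lambda>z. u (x + z))"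
    unfolding bern_def
  proof (intro sum.cong refl arg_cong2[where f = "(*)"])
    fix A
    have "ex (\<lambda>\<eta>. \<Prod>z\<in>\<Lambda>. of_bool (\<eta> (x + z) \<longleftrightarrow> z \<in> A)) = (\<Prod>z\<in>\<Lambda>. ex (\<lambda>\<eta>. of_bool (\<eta> (x + z) \<longleftrightarrow> z \<in> A)))"
    proof (rule ex_indep_prod[OF assms(1), where A = "\<lambda>z. {x + z}"])
      show "depends_on n (\<lambda>\<eta>. of_bool (\<eta> (x + z) \<longleftrightarrow> z \<in> A)) {x + z}" for z by (rule depends_on_site)
      fix i j a b assume "i \<in> \<Lambda>" "j \<in> \<Lambda>" "i \<noteq> j" "a \<in> {x + i}" "b \<in> {x + j}"
      then show "\<not> site_cong n a b" using small_offsets_not_cong[OF \<Lambda>] by simp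
    qed
    also have "\<dots> = (\<Prod>z\<in>\<Lambda>. if z \<in> A then u (x + z) else 1 - u (x + z))"
      by (intro prod.cong refl, subst ex_marginal) auto
    finally show "ex (\<lambda>\<eta>. \<Prod>z\<in>\<Lambda>. of_bool (\<eta> (x + z) \<longleftrightarrow> z \<in> A)) = (\<Prod>z\<in>\<Lambda>. if z \<in> A then u (x + z) else 1 - u (x + z))" .
  qed
  finally show ?thesis .
qed

text \<open>The diffusivity is an expectation under an infinite product measure; only the
  coordinates in \<open>\<Lambda>\<close> matter, which gives a polynomial in the density and
  hence differentiability.\<close>

lemma diffusivity_bern:
  assumes fin: "finite \<Lambda>" and c: "reads \<Lambda> (c j)" and \<alpha>: "0 \<le> \<alpha>" "\<alpha> \<le> 1"
  shows "diffusivity c j \<alpha> = bern \<Lambda> (c j) (\<lambda>_. \<alpha>)"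
proof -
  let ?B = "measure_pmf (bernoulli_pmf \<alpha>)"
  interpret product_prob_space "\<lambda>_ :: 'a site. ?B" UNIV ..
  let ?P = "\<Pi>\<^sub>M x\<in>(UNIV :: 'a site set). ?B"
  let ?E = "\<lambda>A. prod_emb UNIV (\<lambda>_. ?B) \<Lambda> (Pi\<^sub>E \<Lambda> (\<lambda>z. {z \<in> A}))"
  have E: "?E A \<in> sets ?P" for A by (intro sets_PiM_I) (use fin in auto)
  have m: "measure ?P (?E A) = (\<Prod>z\<in>\<Lambda>. if z \<in> A then \<alpha> else 1 - \<alpha>)" for A
  proof -
    have "emeasure ?P (?E A) = (\<Prod>z\<in>\<Lambda>. emeasure ?B {z \<in> A})"
      by (rule emeasure_PiM_emb) (use fin in auto)
    also have "\<dots> = (\<Prod>z\<in>\<Lambda>. ennreal (if z \<in> A then \<alpha> else 1 - \<alpha>))"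
      by (intro prod.cong refl) (use \<alpha> in \<open>auto simp: emeasure_pmf_single\<close>)
    also have "\<dots> = ennreal (\<Prod>z\<in>\<Lambda>. if z \<in> A then \<alpha> else 1 - \<alpha>)"
      by (rule prod_ennreal) (use \<alpha> in auto)
    finally show ?thesis unfolding measure_def using \<alpha> by (simp add: prod_nonneg)
  qed
  have ind: "(\<Prod>z\<in>\<Lambda>. of_bool (\<eta> z \<longleftrightarrow> z \<in> A)) = indicat_real (?E A) \<eta>" for A \<eta>
    using fin by (auto simp: prod_emb_def PiE_iff extensional_def restrict_def indicator_def prod_zero_iff split: if_splits)
  have "diffusivity c j \<alpha> = integral\<^sup>L ?P (\<lambda>\<eta>. \<Sum>A\<in>Pow \<Lambda>. c j (config_of A) * indicat_real (?E A) \<eta>)"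
    unfolding diffusivity_def bernoulli_product_def
    by (rule Bochner_Integration.integral_cong[OF refl]) (subst reads_expansion[OF fin c], simp only: ind)
  also have "\<dots> = (\<Sum>A\<in>Pow \<Lambda>. c j (config_of A) * measure ?P (?E A))"
    by (subst Bochner_Integration.integral_sum) (use E in \<open>auto simp: less_top[symmetric]\<close>)
  finally show ?thesis by (simp add: m bern_def)
qed

lemma periodic_reduce:
  fixes f :: "real ^ 'd::finite \<Rightarrow> real"
  assumes "periodic f" shows "\<exists>y\<in>cbox 0 1. f y = f x"
proof -
  define k where "k = (\<chi> i. real_of_int \<lfloor>x $ i\<rfloor>)"
  have "\<forall>i. k $ i \<in> \<int>" by (simp add: k_def)
  with assms have "f ((x - k) + k) = f (x - k)" unfolding periodic_def by blast
  moreover have "x - k \<in> cbox 0 1"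
    unfolding mem_box_cart k_def by (auto simp: of_int_floor_le) linarith
  ultimately show ?thesis by (intro bexI[of _ "x - k"]) auto
qed

text \<open>If \<open>v t x > M\<close>, then \<open>v - e * t\<close> still exceeds
  \<open>M\<close> somewhere for small \<open>e > 0\<close>, so its maximum over time and the
  torus is attained at a positive time. There the time derivative of \<open>v\<close> is at least
  \<open>e\<close>, although the point maximises \<open>v\<close> in space.\<close>

lemma parabolic_maximum_principle:
  fixes v :: "real \<Rightarrow> real ^ 'd::finite \<Rightarrow> real"
  assumes cont: "continuous_on ({0..T} \<times> UNIV) (\<lambda>(t, x). v t x)"
    and per: "\<And>t. t \<in> {0..T} \<Longrightarrow> periodic (v t)"
    and deriv: "\<And>t x. t \<in> {0..T} \<Longrightarrow> ((\<lambda>s. v s x) has_real_derivative v' t x) (at t within {0..T})"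
    and max: "\<And>t x. t \<in> {0..T} \<Longrightarrow> (\<And>y. v t y \<le> v t x) \<Longrightarrow> v' t x \<le> 0"
    and init: "\<And>x. v 0 x \<le> M" and t: "t \<in> {0..T}"
  shows "v t x \<le> M"
proof (rule ccontr)
  assume "\<not> v t x \<le> M"
  then have gt: "M < v t x" by simp
  define e where "e = (v t x - M) / (2 * (T + 1))"
  have T: "0 \<le> T" using t by auto
  have e: "0 < e" using gt T by (simp add: e_def)
  have eT: "e * T < v t x - M"
  proof -
    have "e * T \<le> e * (T + 1)" using e by (intro mult_left_mono) auto
    also have "\<dots> = (v t x - M) / 2" using T by (simp add: e_def field_simps)
    also have "\<dots> < v t x - M" using gt by simp
    finally show ?thesis .
  qed
  let ?Q = "{0..T} \<times> (cbox 0 1 :: (real ^ 'd) set)"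
  let ?g = "\<lambda>p. v (fst p) (snd p) - e * fst p"
  obtain y where y: "y \<in> cbox 0 1" "v t y = v t x" using periodic_reduce[OF per[OF t], of x] by blast
  have cpt: "compact ?Q" by (intro compact_Times compact_Icc compact_cbox)
  have ne: "?Q \<noteq> {}" using t y by auto
  have "continuous_on ?Q (\<lambda>p. v (fst p) (snd p))"
    by (rule continuous_on_subset[OF cont[unfolded case_prod_unfold]]) auto
  then have "continuous_on ?Q ?g" by (intro continuous_intros)
  then obtain p where p: "p \<in> ?Q" "\<And>q. q \<in> ?Q \<Longrightarrow> ?g q \<le> ?g p"
    using continuous_attains_sup[OF cpt ne] by blast
  obtain s0 y0 where py: "p = (s0, y0)" by (cases p)
  have s0: "s0 \<in> {0..T}" and y0: "y0 \<in> cbox 0 1" using p(1) by (auto simp: py)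
  have "e * t \<le> e * T" using e t by (intro mult_left_mono) auto
  then have big: "M < v s0 y0 - e * s0"
    using p(2)[of "(t, y)"] t y eT by (simp add: py)
  have "s0 \<noteq> 0" using big init[of y0] by auto
  then have s0p: "0 < s0" using s0 by simp
  have "v s0 z \<le> v s0 y0" for z
  proof -
    obtain z' where "z' \<in> cbox 0 1" "v s0 z' = v s0 z" using periodic_reduce[OF per[OF s0], of z] by blast
    then show ?thesis using p(2)[of "(s0, z')"] s0 by (simp add: py)
  qed
  then have "v' s0 y0 \<le> 0" by (rule max[OF s0])
  moreover have "e \<le> v' s0 y0"
  proof -
    have "((\<lambda>s. v s y0) has_real_derivative v' s0 y0) (at s0 within {0..s0})"
      by (rule DERIV_subset[OF deriv[OF s0]]) (use s0 in auto)
    then have "((\<lambda>s. (v s y0 - v s0 y0) / (s - s0)) \<longlongrightarrow> v' s0 y0) (at_left s0)"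
      unfolding has_field_derivative_iff at_within_Icc_at_left[OF s0p] .
    moreover have "eventually (\<lambda>s. e \<le> (v s y0 - v s0 y0) / (s - s0)) (at_left s0)"
    proof -
      have "eventually (\<lambda>s. s \<in> {0<..<s0}) (at_left s0)" by (rule eventually_at_leftI[OF _ s0p])
      then show ?thesis
      proof eventually_elim
        case (elim s)
        have "v s y0 - e * s \<le> v s0 y0 - e * s0" using p(2)[of "(s, y0)"] elim s0 y0 by (simp add: py)
        then have "v s y0 - v s0 y0 \<le> e * (s - s0)" by (simp add: algebra_simps)
        then show ?case using elim by (simp add: neg_le_divide_eq)
      qed
    qed
    ultimately show ?thesis by (intro tendsto_lowerbound) auto
  qed
  ultimately show False using e by simp
qed

lemma second_derivative_at_max:
  fixes g g' :: "real \<Rightarrow> real"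
  assumes g: "\<And>s. (g has_real_derivative g' s) (at s)" and g2: "(g' has_real_derivative b) (at 0)"
    and max: "\<And>s. g s \<le> g 0"
  shows "g' 0 = 0" "b \<le> 0"
proof -
  show z: "g' 0 = 0" by (rule DERIV_local_max[OF g[of 0], of 1]) (use max in auto)
  show "b \<le> 0"
  proof (rule ccontr)
    assume "\<not> b \<le> 0"
    then obtain d where d: "0 < d" "\<And>h. 0 < h \<Longrightarrow> h < d \<Longrightarrow> g' 0 < g' (0 + h)"
      using DERIV_pos_inc_right[OF g2] by auto
    obtain \<xi> where "0 < \<xi>" "\<xi> < d / 2" "g (d / 2) - g 0 = (d / 2 - 0) * g' \<xi>"
      using MVT2[of 0 "d / 2" g g'] g d(1) by auto
    moreover have "0 < g' \<xi>" using d(2)[of \<xi>] calculation z by auto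
    moreover have "0 < (d / 2 - 0) * g' \<xi>" using d(1) calculation by (intro mult_pos_pos) auto
    ultimately have "0 < g (d / 2) - g 0" by argo
    then show False using max[of "d / 2"] by simp
  qed
qed

lemma Ck2_differentiable:
  assumes "Ck 2 f"
  shows "partial_differentiable j f y" "partial_differentiable j (partials [j] f) y"
proof -
  have *: "length js < 2 \<Longrightarrow> partial_differentiable j (partials js f) y" for js
    using assms unfolding Ck_def by blast
  show "partial_differentiable j f y" using *[of "[]"] by simp
  show "partial_differentiable j (partials [j] f) y" by (rule *) simp
qed

text \<open>The divergence form of the equation, expanded with the product rule.\<close>

lemma flux_derivative:
  fixes f :: "real ^ 'd::finite \<Rightarrow> real"
  assumes fin: "finite S" and c: "reads S (c j)" and f: "Ck 2 f" "\<And>x. 0 \<le> f x \<and> f x \<le> 1"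
  shows "partial j (\<lambda>y. diffusivity c j (f y) * partial j f y) x
    = (\<Sum>z\<in>S. bern_partial S (c j) z (\<lambda>_. f x) * partial j f x) * partial j f x
      + bern S (c j) (\<lambda>_. f x) * partials [j, j] f x"
proof -
  let ?e = "axis j 1 :: real ^ 'd"
  have d0: "((\<lambda>s. f (x + s *\<^sub>R ?e)) has_real_derivative partial j f x) (at 0)"
    using line_derivative[of j f x 0] Ck2_differentiable(1)[OF f(1)] by simp
  have d1: "((\<lambda>s. partial j f (x + s *\<^sub>R ?e)) has_real_derivative partials [j, j] f x) (at 0)"
  proof -
    have "partial_differentiable j (partials [j] f) (x + 0 *\<^sub>R ?e)" by (rule Ck2_differentiable(2)[OF f(1)])
    from line_derivative[OF this] show ?thesis by simp
  qed
  have D: "diffusivity c j (f y) = bern S (c j) (\<lambda>_. f y)" for y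
    by (rule diffusivity_bern[where \<Lambda> = S and c = c and j = j, OF fin c]) (use f(2) in auto)
  have "((\<lambda>s. bern S (c j) (\<lambda>_. f (x + s *\<^sub>R ?e))) has_real_derivative (\<Sum>z\<in>S. bern_partial S (c j) z (\<lambda>_. f x) * partial j f x)) (at 0)"
    using bern_derivative[OF fin, where w = "\<lambda>s z. f (x + s *\<^sub>R ?e)" and w' = "\<lambda>_. partial j f x" and t = 0] d0 by simp
  from DERIV_mult[OF this d1] have "((\<lambda>s. diffusivity c j (f (x + s *\<^sub>R ?e)) * partial j f (x + s *\<^sub>R ?e)) has_real_derivative
    (\<Sum>z\<in>S. bern_partial S (c j) z (\<lambda>_. f x) * partial j f x) * partial j f x + bern S (c j) (\<lambda>_. f x) * partials [j, j] f x) (at 0)"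
    by (simp add: D mult.commute add.commute)
  then show ?thesis unfolding partial_def[of j "\<lambda>y. diffusivity c j (f y) * partial j f y"] by (rule DERIV_imp_deriv)
qed

text \<open>The sign \<open>\<sigma>\<close> covers maxima and minima at once. At an extremum the
  gradient term vanishes, and the second derivative is multiplied by a nonnegative
  diffusivity.\<close>

lemma flux_at_extremum:
  fixes f :: "real ^ 'd::finite \<Rightarrow> real"
  assumes fin: "finite S" and c: "reads S (c j)" "\<And>\<eta>. 0 \<le> c j \<eta>" and f: "Ck 2 f" "\<And>x. 0 \<le> f x \<and> f x \<le> 1"
    and sg: "\<sigma> = 1 \<or> \<sigma> = - 1" and max: "\<And>y. \<sigma> * f y \<le> \<sigma> * f x"
  shows "\<sigma> * partial j (\<lambda>y. diffusivity c j (f y) * partial j f y) x \<le> 0"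
proof -
  let ?e = "axis j 1 :: real ^ 'd"
  note pd = Ck2_differentiable[OF f(1)]
  have g: "((\<lambda>s. \<sigma> * f (x + s *\<^sub>R ?e)) has_real_derivative \<sigma> * partial j f (x + s *\<^sub>R ?e)) (at s)" for s
    by (rule DERIV_cmult[OF line_derivative[OF pd(1)]])
  have g2: "((\<lambda>s. \<sigma> * partial j f (x + s *\<^sub>R ?e)) has_real_derivative \<sigma> * partials [j, j] f x) (at 0)"
    using DERIV_cmult[OF line_derivative[OF pd(2)[where y = "x + 0 *\<^sub>R ?e"]], of \<sigma>] by simp
  note sd = second_derivative_at_max[OF g g2]
  have z: "partial j f x = 0" and b: "\<sigma> * partials [j, j] f x \<le> 0"
    using sd max sg by auto
  have "0 \<le> bern S (c j) (\<lambda>_. f x)"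
    unfolding bern_def using f(2)[of x] c(2) by (intro sum_nonneg mult_nonneg_nonneg prod_nonneg) auto
  then have "bern S (c j) (\<lambda>_. f x) * (\<sigma> * partials [j, j] f x) \<le> 0" using b by (rule mult_nonneg_nonpos)
  then show ?thesis unfolding flux_derivative[where c = c and j = j, OF fin c(1) f] z by (simp add: mult.left_commute)
qed

text \<open>The maximum principle, applied to \<open>u\<close> and to \<open>- u\<close>.\<close>

lemma hydrodynamic_bounds:
  fixes u :: "real \<Rightarrow> real ^ 'd::finite \<Rightarrow> real"
  assumes gr: "gradient_rates c h" and sol: "hydrodynamic_solution c T u\<^sub>0 u"
    and init: "\<And>x. r \<le> u\<^sub>0 x \<and> u\<^sub>0 x \<le> 1 - r" and t: "t \<in> {0..T}"
  shows "r \<le> u t x" "u t x \<le> 1 - r"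
proof -
  obtain S M c0 where S: "finite S" "0 < c0" "\<And>j \<eta>. c0 \<le> c j \<eta>" "\<And>j. reads (S - {0, \<e> j}) (c j)"
    using gradient_rates_data[OF gr] by metis
  have rd: "reads S (c j)" for j by (rule reads_mono[OF S(4)]) auto
  have c0: "0 \<le> c j \<eta>" for j \<eta> using S(2) S(3)[of j \<eta>] by linarith
  note sol' = sol[unfolded hydrodynamic_solution_def]
  let ?v = "\<lambda>t x. \<Sum>j\<in>UNIV. partial j (\<lambda>y. diffusivity c j (u t y) * partial j (u t) y) x"
  have u0: "u 0 = u\<^sub>0" using sol' by blast
  have C: "continuous_on ({0..T} \<times> UNIV) (\<lambda>(t, x). u t x)"
  proof -
    have "length js \<le> 2 \<Longrightarrow> continuous_on ({0..T} \<times> UNIV) (\<lambda>(t, x). partials js (u t) x)" for js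
      using sol' by blast
    from this[of "[]"] show ?thesis by simp
  qed
  have P: "periodic (u s)" "Ck 2 (u s)" "0 \<le> u s x \<and> u s x \<le> 1" if "s \<in> {0..T}" for s x
    using sol' that by blast+
  have D: "((\<lambda>s. u s x) has_real_derivative ?v s x) (at s within {0..T})" if "s \<in> {0..T}" for s x
    using sol' that by blast
  have main: "\<sigma> * u t x \<le> M" if sg: "\<sigma> = 1 \<or> \<sigma> = - 1" and i: "\<And>x. \<sigma> * u\<^sub>0 x \<le> M" for \<sigma> M
  proof (rule parabolic_maximum_principle[where v = "\<lambda>t x. \<sigma> * u t x" and v' = "\<lambda>t x. \<sigma> * ?v t x" and T = T])
    show "continuous_on ({0..T} \<times> UNIV) (\<lambda>(t, x). \<sigma> * u t x)"
      using continuous_on_mult_left[OF C, of \<sigma>] by (simp add: case_prod_unfold)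
    show "periodic (\<lambda>x. \<sigma> * u s x)" if "s \<in> {0..T}" for s using P(1)[OF that] by (simp add: periodic_def)
    show "((\<lambda>s. \<sigma> * u s x) has_real_derivative \<sigma> * ?v s x) (at s within {0..T})" if "s \<in> {0..T}" for s x
      by (rule DERIV_cmult[OF D[OF that]])
    show "\<sigma> * ?v s x \<le> 0" if s: "s \<in> {0..T}" and m: "\<And>y. \<sigma> * u s y \<le> \<sigma> * u s x" for s x
      unfolding sum_distrib_left
      by (intro sum_nonpos flux_at_extremum[where c = c, OF S(1) rd c0 P(2)[OF s] P(3)[OF s] sg m])
    show "\<sigma> * u 0 x \<le> M" for x unfolding u0 by (rule i)
  qed (rule t)
  show "u t x \<le> 1 - r" using main[of 1 "1 - r"] init by simp
  have "- 1 * u t x \<le> - r" by (rule main) (use init in auto)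
  then show "r \<le> u t x" by simp
qed

section \<open>Consistency of the discrete and the continuous equation\<close>

text \<open>With \<open>F\<close> the expected rate, the difference of the two discrete fluxes is
  \<open>F\<close> times the second difference of \<open>f\<close> plus the increment of
  \<open>F\<close> times a first difference. After multiplication by \<open>n\<^sup>2\<close>,
  each of these four factors is bounded and of order \<open>1 / n\<close> away from its
  counterpart in the expanded divergence; for the increment of \<open>F\<close>, a Bernstein
  polynomial in the values of \<open>f\<close> near the site, this is the mean value
  theorem.\<close>

lemma (in torus_profile) consistency_direction:
  fixes f :: "real ^ 'd \<Rightarrow> real" and c :: "'d \<Rightarrow> 'd config \<Rightarrow> real"
  assumes u: "u = profile_at n f" and f: "derivative_bound K f" "\<And>x. 0 \<le> f x \<and> f x \<le> 1"
    and S: "finite S" "reads S (c j)" "offset_bound S D" "2 * D + 1 \<le> n"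
  defines "m \<equiv> mass S (c j)" and "N \<equiv> real (card S)" and "d0 \<equiv> K * (real CARD('d) * real D + 1)"
  shows "\<bar>(real n)\<^sup>2 * (ex (\<lambda>\<eta>. c j (shift x \<eta>)) * (u (x + \<e> j) - u x) - ex (\<lambda>\<eta>. c j (shift (x - \<e> j) \<eta>)) * (u x - u (x - \<e> j)))
      - partial j (\<lambda>y. diffusivity c j (f y) * partial j f y) (\<chi> i. real_of_int (x $ i) / real n)\<bar>
    \<le> (m * (N * d0) * K + m * K + N * (m * (N * d0) * K + m * d0) * K + N * m * K * K) / n"
proof -
  let ?e = "axis j 1 :: real ^ 'd"
  define y where "y = (\<chi> i. real_of_int (x $ i) / real n)"
  define q where "q z = (\<chi> i. real_of_int (z $ i) / real n)" for z :: "'d site"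
  define s where "s = 1 / real n"
  have n0: "0 < real n" by simp
  have s: "0 < s" by (simp add: s_def)
  have K0: "0 \<le> K" by (rule bound_nonneg[OF f(1)])
  have m0: "0 \<le> m" by (simp add: m_def mass_nonneg)
  define W where "W \<tau> z = f (y + q z + \<tau> *\<^sub>R ?e)" for \<tau> z
  have W01: "0 \<le> W \<tau> z \<and> W \<tau> z \<le> 1" for \<tau> z unfolding W_def by (rule f(2))
  have pos: "u (x + z) = W 0 z" "u ((x - \<e> j) + z) = W (- s) z" for z
    unfolding u W_def by (rule arg_cong[where f = f], simp add: vec_eq_iff y_def q_def s_def axis_def add_divide_distrib diff_divide_distrib)+
  have ux: "u x = f y" "u (x + \<e> j) = f (y + s *\<^sub>R ?e)" "u (x - \<e> j) = f (y - s *\<^sub>R ?e)"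
    unfolding u by (rule arg_cong[where f = f], simp add: vec_eq_iff y_def s_def axis_def add_divide_distrib diff_divide_distrib)+
  define F where "F \<tau> = bern S (c j) (W \<tau>)" for \<tau>
  have F: "ex (\<lambda>\<eta>. c j (shift x \<eta>)) = F 0" "ex (\<lambda>\<eta>. c j (shift (x - \<e> j) \<eta>)) = F (- s)"
    unfolding F_def ex_local_bern[OF S] pos by simp_all
  define A where "A = partial j f y"
  define B where "B = partials [j, j] f y"
  define P where "P = bern S (c j) (\<lambda>_. f y)"
  define R where "R = (\<Sum>z\<in>S. bern_partial S (c j) z (\<lambda>_. f y) * A)"
  have Ck2: "Ck 2 f" using f(1) unfolding derivative_bound_def Ck_def by auto
  have flux: "partial j (\<lambda>y. diffusivity c j (f y) * partial j f y) y = R * A + P * B"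
    unfolding R_def P_def A_def B_def by (rule flux_derivative[where c = c and j = j, OF S(1,2) Ck2 f(2)])
  let ?\<delta> = "d0 / n"
  have off: "(\<Sum>i\<in>UNIV. \<bar>(q z + \<tau> *\<^sub>R ?e) $ i\<bar>) \<le> (real CARD('d) * real D + 1) / n" if z: "z \<in> S" and \<tau>: "\<bar>\<tau>\<bar> \<le> s" for z \<tau>
  proof -
    have "(\<Sum>i\<in>UNIV. \<bar>(q z + \<tau> *\<^sub>R ?e) $ i\<bar>) \<le> (\<Sum>i\<in>UNIV. \<bar>q z $ i\<bar>) + (\<Sum>i\<in>UNIV. \<bar>(\<tau> *\<^sub>R ?e) $ i\<bar>)"
      unfolding sum.distrib[symmetric] by (intro sum_mono) simp
    also have "(\<Sum>i\<in>UNIV. \<bar>q z $ i\<bar>) \<le> (\<Sum>i\<in>(UNIV :: 'd set). real D / n)"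
    proof (rule sum_mono)
      fix i
      have "\<bar>z $ i\<bar> \<le> int D" using S(3) z by (auto simp: offset_bound_def)
      then have "\<bar>real_of_int (z $ i)\<bar> \<le> real D" by linarith
      then show "\<bar>q z $ i\<bar> \<le> real D / n" by (simp add: q_def divide_right_mono)
    qed
    also have "(\<Sum>i\<in>UNIV. \<bar>(\<tau> *\<^sub>R ?e) $ i\<bar>) = \<bar>\<tau>\<bar>"
      by (simp add: axis_def if_distrib[of "\<lambda>t. _ * t"] if_distrib[of abs] cong: if_cong)
    also have "\<bar>\<tau>\<bar> \<le> 1 / n" using \<tau> by (simp add: s_def)
    finally show ?thesis by (simp add: add_divide_distrib)
  qed
  have Wd: "\<bar>W \<tau> z - f y\<bar> \<le> ?\<delta>" and pd: "\<bar>partial j f (y + q z + \<tau> *\<^sub>R ?e) - A\<bar> \<le> ?\<delta>" if "z \<in> S" "\<bar>\<tau>\<bar> \<le> s" for z \<tau>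
  proof -
    have k: "K * (\<Sum>i\<in>UNIV. \<bar>(q z + \<tau> *\<^sub>R ?e) $ i\<bar>) \<le> ?\<delta>"
      using mult_left_mono[OF off[OF that] K0] by (simp add: d0_def)
    show "\<bar>W \<tau> z - f y\<bar> \<le> ?\<delta>" using order_trans[OF f_lipschitz[OF f(1)] k, of y] by (simp add: W_def add.assoc)
    show "\<bar>partial j f (y + q z + \<tau> *\<^sub>R ?e) - A\<bar> \<le> ?\<delta>"
      using order_trans[OF partial_lipschitz[OF f(1)] k, of j y] by (simp add: A_def add.assoc)
  qed
  have sumW: "(\<Sum>z\<in>S. \<bar>W \<tau> z - f y\<bar>) \<le> N * ?\<delta>" if "\<bar>\<tau>\<bar> \<le> s" for \<tau>
    unfolding N_def by (rule sum_bounded_above) (rule Wd[OF _ that])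
  define X where "X = (real n)\<^sup>2 * (f (y + s *\<^sub>R ?e) - 2 * f y + f (y - s *\<^sub>R ?e))"
  define Z where "Z = real n * (f y - f (y - s *\<^sub>R ?e))"
  define Y where "Y = real n * (F 0 - F (- s))"
  have ns: "real n * s = 1" by (simp add: s_def)
  have ns2: "(real n)\<^sup>2 * s\<^sup>2 = 1" using ns by (simp add: power_mult_distrib[symmetric])
  have X: "\<bar>X\<bar> \<le> K"
  proof -
    have "\<bar>X\<bar> \<le> (real n)\<^sup>2 * (K * s\<^sup>2)" unfolding X_def abs_mult abs_power2 by (intro mult_left_mono taylor(1)[OF f(1)]) simp
    also have "\<dots> = K * ((real n)\<^sup>2 * s\<^sup>2)" by simp
    finally show ?thesis unfolding ns2 by simp
  qed
  have XB: "\<bar>X - B\<bar> \<le> K / n"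
  proof -
    have "X - B = (real n)\<^sup>2 * (f (y + s *\<^sub>R ?e) - 2 * f y + f (y - s *\<^sub>R ?e) - B * s\<^sup>2)"
      unfolding X_def right_diff_distrib[of _ _ "B * s\<^sup>2"] mult.left_commute[of _ B] ns2 by simp
    then have "\<bar>X - B\<bar> \<le> (real n)\<^sup>2 * (K * \<bar>s\<bar> ^ 3)"
      unfolding B_def by (simp only: abs_mult abs_power2) (intro mult_left_mono taylor(2)[OF f(1)], simp)
    also have "\<dots> = K * ((real n)\<^sup>2 * s\<^sup>2) * s" using s by (simp add: power3_eq_cube power2_eq_square)
    finally show ?thesis unfolding ns2 by (simp add: s_def)
  qed
  have Z: "\<bar>Z\<bar> \<le> K"
  proof -
    have "\<bar>f y - f (y - s *\<^sub>R ?e)\<bar> \<le> K * s"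
      using real_deriv_bound[OF line_deriv[OF f(1), of "[]" y j], of K 0 "- s"] f(1) s by (simp add: derivative_bound_def)
    then have "\<bar>Z\<bar> \<le> real n * (K * s)" unfolding Z_def abs_mult by simp
    also have "\<dots> = K * (real n * s)" by simp
    finally show ?thesis unfolding ns by simp
  qed
  have ZA: "\<bar>Z - A\<bar> \<le> K / n"
  proof -
    have "Z - A = real n * (f y - f (y - s *\<^sub>R ?e) - A * s)"
      unfolding Z_def right_diff_distrib[of _ _ "A * s"] mult.left_commute[of _ A] ns by simp
    then have "\<bar>Z - A\<bar> \<le> real n * (K * s\<^sup>2)"
      unfolding A_def by (simp only: abs_mult) (intro mult_mono taylor(3)[OF f(1)], simp_all)
    also have "\<dots> = K * (real n * s) * s" by (simp add: power2_eq_square)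
    finally show ?thesis unfolding ns by (simp add: s_def)
  qed
  have FP: "\<bar>F 0 - P\<bar> \<le> m * (N * ?\<delta>)"
  proof -
    have "\<bar>F 0 - P\<bar> \<le> m * (\<Sum>z\<in>S. \<bar>W 0 z - f y\<bar>)"
      unfolding F_def P_def m_def
      by (rule bern_bounds(2)[where w = "W 0" and w' = "\<lambda>_. f y", OF S(1)]) (use W01 f(2) in auto)
    also have "\<dots> \<le> m * (N * ?\<delta>)" by (intro mult_left_mono sumW m0) (use s in simp)
    finally show ?thesis .
  qed
  have Pm: "\<bar>P\<bar> \<le> m"
    unfolding P_def m_def by (rule bern_bounds(1)[where w = "\<lambda>_. f y" and w' = "\<lambda>_. f y", OF S(1)]) (use f(2) in auto)
  have AK: "\<bar>partial j f p\<bar> \<le> K" for p using f(1) by (simp add: derivative_bound_def)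
  have bp: "\<bar>bern_partial S (c j) z (\<lambda>_. f y)\<bar> \<le> m" for z
    unfolding m_def by (rule bern_bounds(3)[where w = "\<lambda>_. f y" and w' = "\<lambda>_. f y", OF S(1)]) (use f(2) in auto)
  have Rb: "\<bar>R\<bar> \<le> N * (m * K)"
    unfolding R_def N_def
    by (rule order_trans[OF sum_abs], rule sum_bounded_above, unfold abs_mult, intro mult_mono bp) (use AK m0 in \<open>auto simp: A_def\<close>)
  have YR: "\<bar>Y - R\<bar> \<le> N * (m * (N * ?\<delta>) * K + m * ?\<delta>)"
  proof -
    have dF: "(F has_real_derivative (\<Sum>z\<in>S. bern_partial S (c j) z (W \<tau>) * partial j f (y + q z + \<tau> *\<^sub>R ?e))) (at \<tau>)" for \<tau>
      unfolding F_def[abs_def]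
      by (rule bern_derivative[OF S(1)]) (use line_deriv[OF f(1), of "[]"] in \<open>simp add: W_def\<close>)
    obtain \<xi> where \<xi>: "- s < \<xi>" "\<xi> < 0"
      "F 0 - F (- s) = (0 - (- s)) * (\<Sum>z\<in>S. bern_partial S (c j) z (W \<xi>) * partial j f (y + q z + \<xi> *\<^sub>R ?e))"
      using MVT2[of "- s" 0 F "\<lambda>\<tau>. \<Sum>z\<in>S. bern_partial S (c j) z (W \<tau>) * partial j f (y + q z + \<tau> *\<^sub>R ?e)"] dF s by auto
    have \<xi>s: "\<bar>\<xi>\<bar> \<le> s" using \<xi> by simp
    have "Y = (real n * s) * (\<Sum>z\<in>S. bern_partial S (c j) z (W \<xi>) * partial j f (y + q z + \<xi> *\<^sub>R ?e))"
      unfolding Y_def \<xi>(3) by simp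
    then have "Y - R = (\<Sum>z\<in>S. (bern_partial S (c j) z (W \<xi>) - bern_partial S (c j) z (\<lambda>_. f y)) * partial j f (y + q z + \<xi> *\<^sub>R ?e)
        + bern_partial S (c j) z (\<lambda>_. f y) * (partial j f (y + q z + \<xi> *\<^sub>R ?e) - A))"
      unfolding ns R_def by (simp add: sum_subtractf[symmetric] algebra_simps)
    also have "\<bar>\<dots>\<bar> \<le> N * (m * (N * ?\<delta>) * K + m * ?\<delta>)"
      unfolding N_def
    proof (rule order_trans[OF sum_abs], rule sum_bounded_above, rule order_trans[OF abs_triangle_ineq], unfold abs_mult, intro add_mono mult_mono bp AK)
      fix z assume z: "z \<in> S"
      have "\<bar>bern_partial S (c j) z (W \<xi>) - bern_partial S (c j) z (\<lambda>_. f y)\<bar> \<le> m * (\<Sum>z\<in>S. \<bar>W \<xi> z - f y\<bar>)"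
        unfolding m_def by (rule bern_bounds(4)[where w = "W \<xi>" and w' = "\<lambda>_. f y", OF S(1)]) (use W01 f(2) in auto)
      also have "\<dots> \<le> m * (N * ?\<delta>)" by (intro mult_left_mono sumW m0 \<xi>s)
      finally show "\<bar>bern_partial S (c j) z (W \<xi>) - bern_partial S (c j) z (\<lambda>_. f y)\<bar> \<le> m * (real (card S) * ?\<delta>)" by (simp add: N_def)
      show "\<bar>partial j f (y + q z + \<xi> *\<^sub>R ?e) - A\<bar> \<le> ?\<delta>" by (rule pd[OF z \<xi>s])
      show "0 \<le> m * (real (card S) * ?\<delta>)" using m0 K0 by (intro mult_nonneg_nonneg) (auto simp: d0_def)
    qed (use m0 in auto)
    finally show ?thesis .
  qed
  have "(real n)\<^sup>2 * (ex (\<lambda>\<eta>. c j (shift x \<eta>)) * (u (x + \<e> j) - u x) - ex (\<lambda>\<eta>. c j (shift (x - \<e> j) \<eta>)) * (u x - u (x - \<e> j)))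
      - (R * A + P * B) = (F 0 - P) * X + P * (X - B) + (Y - R) * Z + R * (Z - A)"
    unfolding F ux X_def Y_def Z_def by (simp add: power2_eq_square algebra_simps)
  also have "\<bar>\<dots>\<bar> \<le> m * (N * ?\<delta>) * K + m * (K / n) + N * (m * (N * ?\<delta>) * K + m * ?\<delta>) * K + N * (m * K) * (K / n)"
  proof -
    have "\<bar>(F 0 - P) * X\<bar> \<le> m * (N * ?\<delta>) * K" "\<bar>P * (X - B)\<bar> \<le> m * (K / n)"
      "\<bar>(Y - R) * Z\<bar> \<le> N * (m * (N * ?\<delta>) * K + m * ?\<delta>) * K" "\<bar>R * (Z - A)\<bar> \<le> N * (m * K) * (K / n)"
      unfolding abs_mult
      by (rule mult_mono[OF FP X order_trans[OF abs_ge_zero FP] abs_ge_zero] mult_mono[OF Pm XB m0 abs_ge_zero]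
          mult_mono[OF YR Z order_trans[OF abs_ge_zero YR] abs_ge_zero] mult_mono[OF Rb ZA order_trans[OF abs_ge_zero Rb] abs_ge_zero])+
    then show ?thesis by linarith
  qed
  also have "\<dots> = (m * (N * d0) * K + m * K + N * (m * (N * d0) * K + m * d0) * K + N * m * K * K) / n"
    by (simp add: add_divide_distrib algebra_simps)
  finally show ?thesis unfolding flux[unfolded y_def, symmetric] y_def .
qed

section \<open>The discretised solution\<close>

definition limit_velocity :: "('d::finite \<Rightarrow> 'd config \<Rightarrow> real) \<Rightarrow> (real ^ 'd \<Rightarrow> real) \<Rightarrow> real ^ 'd \<Rightarrow> real"
  where "limit_velocity c f y = (\<Sum>j\<in>UNIV. partial j (\<lambda>y. diffusivity c j (f y) * partial j f y) y)"

definition admissible ::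
    "('d::finite \<Rightarrow> 'd config \<Rightarrow> real) \<Rightarrow> real \<Rightarrow> real \<Rightarrow> real \<Rightarrow> (real ^ 'd \<Rightarrow> real) \<Rightarrow> (real \<Rightarrow> real ^ 'd \<Rightarrow> real) \<Rightarrow> bool"
  where "admissible c r T K u\<^sub>0 u \<longleftrightarrow> (\<forall>x. r \<le> u\<^sub>0 x \<and> u\<^sub>0 x \<le> 1 - r) \<and>
    hydrodynamic_solution c T u\<^sub>0 u \<and> sup_Ck_norm T 4 u = ennreal K"

lemma periodic_partial: "periodic f \<Longrightarrow> periodic (partial j f)"
  unfolding periodic_def
proof (intro allI impI)
  fix x k :: "real ^ 'a"
  assume f: "\<forall>x k. (\<forall>i. k $ i \<in> \<int>) \<longrightarrow> f (x + k) = f x" and k: "\<forall>i. k $ i \<in> \<int>"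
  have "f (x + k + s *\<^sub>R axis j 1) = f (x + s *\<^sub>R axis j 1)" for s
  proof -
    have "f (x + k + s *\<^sub>R axis j 1) = f ((x + s *\<^sub>R axis j 1) + k)" by (simp add: ac_simps)
    then show ?thesis using f k by simp
  qed
  then show "partial j f (x + k) = partial j f x" by (simp add: partial_def)
qed

lemma periodic_limit_velocity:
  assumes "periodic f" shows "periodic (limit_velocity c f)"
proof -
  have "periodic (partial j (\<lambda>y. diffusivity c j (f y) * partial j f y))" for j
    using periodic_partial[OF assms, of j] assms by (intro periodic_partial) (simp add: periodic_def)
  then show ?thesis unfolding periodic_def limit_velocity_def by (intro allI impI sum.cong refl) blast
qed

lemma nperiodic_profile:
  assumes n: "1 \<le> n" and f: "periodic f" shows "nperiodic n (profile_at n f)"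
  unfolding nperiodic_def
proof (intro allI impI)
  fix x y :: "'a site" assume xy: "site_cong n x y"
  define k where "k = (\<chi> i. real_of_int (x $ i - y $ i) / real n)"
  have "k $ i \<in> \<int>" for i
  proof -
    have "int n dvd x $ i - y $ i" using xy by (simp add: site_cong_def cong_iff_dvd_diff)
    then obtain a where a: "x $ i - y $ i = int n * a" by (auto elim: dvdE)
    have "k $ i = real_of_int a" unfolding k_def vec_lambda_beta a using n by simp
    then show ?thesis by simp
  qed
  then have "f ((\<chi> i. real_of_int (y $ i) / real n) + k) = f (\<chi> i. real_of_int (y $ i) / real n)"
    using f unfolding periodic_def by blast
  moreover have "(\<chi> i. real_of_int (y $ i) / real n) + k = (\<chi> i. real_of_int (x $ i) / real n)"
    by (simp add: k_def vec_eq_iff diff_divide_distrib)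
  ultimately show "profile_at n f x = profile_at n f y" by simp
qed

lemma profile_differences:
  assumes n: "1 \<le> n" and f: "derivative_bound K f"
  shows "\<bar>profile_at n f (x + \<e> j) - profile_at n f x\<bar> \<le> K / n"
    and "\<bar>profile_at n f (x + \<e> j) - 2 * profile_at n f x + profile_at n f (x - \<e> j)\<bar> \<le> K / (real n)\<^sup>2"
proof -
  let ?y = "\<chi> i. real_of_int (x $ i) / real n" and ?e = "axis j 1 :: real ^ 'a"
  have ux: "profile_at n f (x + \<e> j) = f (?y + (1 / real n) *\<^sub>R ?e)" "profile_at n f (x - \<e> j) = f (?y - (1 / real n) *\<^sub>R ?e)"
    by (rule arg_cong[where f = f], simp add: vec_eq_iff axis_def add_divide_distrib diff_divide_distrib)+
  show "\<bar>profile_at n f (x + \<e> j) - profile_at n f x\<bar> \<le> K / n"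
    using real_deriv_bound[OF line_deriv[OF f, of "[]" ?y j], of K "1 / real n" 0] f
    unfolding ux by (simp add: derivative_bound_def)
  show "\<bar>profile_at n f (x + \<e> j) - 2 * profile_at n f x + profile_at n f (x - \<e> j)\<bar> \<le> K / (real n)\<^sup>2"
    using taylor(1)[OF f, of ?y "1 / real n" j] unfolding ux by (simp add: power_divide)
qed

lemma drift_consistent:
  fixes c :: "'d::finite \<Rightarrow> 'd config \<Rightarrow> real"
  assumes S: "finite S" "\<And>j. reads S (c j)" "offset_bound S D"
  shows "\<exists>L. \<forall>n\<ge>2 * D + 1. \<forall>f x. derivative_bound K f \<longrightarrow> (\<forall>x. 0 \<le> f x \<and> f x \<le> 1) \<longrightarrow>
    torus_profile n (profile_at n f) r \<longrightarrow>
    \<bar>torus_profile.discrete_drift n (profile_at n f) c x - profile_at n (limit_velocity c f) x\<bar> \<le> L / n"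
proof -
  define N where "N = real (card S)"
  define d0 where "d0 = K * (real CARD('d) * real D + 1)"
  define E where "E j = (let m = mass S (c j) in
    m * (N * d0) * K + m * K + N * (m * (N * d0) * K + m * d0) * K + N * m * K * K)" for j
  have "\<bar>torus_profile.discrete_drift n (profile_at n f) c x - profile_at n (limit_velocity c f) x\<bar> \<le> (\<Sum>j\<in>UNIV. E j) / n"
    if n: "2 * D + 1 \<le> n" and f: "derivative_bound K f" "\<And>x. 0 \<le> f x \<and> f x \<le> 1"
      and tp: "torus_profile n (profile_at n f) r" for n f x
  proof -
    interpret torus_profile n "profile_at n f" r by (rule tp)
    let ?u = "profile_at n f"
    let ?A = "\<lambda>j. ex (\<lambda>\<eta>. c j (shift x \<eta>)) * (?u (x + \<e> j) - ?u x) - ex (\<lambda>\<eta>. c j (shift (x - \<e> j) \<eta>)) * (?u x - ?u (x - \<e> j))"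
    let ?B = "\<lambda>j. partial j (\<lambda>y. diffusivity c j (f y) * partial j f y) (\<chi> i. real_of_int (x $ i) / real n)"
    have eq: "discrete_drift c x - profile_at n (limit_velocity c f) x = (\<Sum>j\<in>UNIV. (real n)\<^sup>2 * ?A j - ?B j)"
      unfolding discrete_drift_def limit_velocity_def by (simp only: sum_distrib_left sum_subtractf[symmetric])
    have le: "(\<Sum>j\<in>UNIV. \<bar>(real n)\<^sup>2 * ?A j - ?B j\<bar>) \<le> (\<Sum>j\<in>UNIV. E j / n)"
    proof (rule sum_mono)
      fix j :: 'd
      show "\<bar>(real n)\<^sup>2 * ?A j - ?B j\<bar> \<le> E j / n"
        using consistency_direction[where c = c and S = S and D = D and f = f and K = K and j = j and x = x, OF refl f(1) f(2) S(1) S(2) S(3) n]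
        unfolding E_def Let_def N_def d0_def .
    qed
    show ?thesis unfolding eq sum_divide_distrib by (rule order_trans[OF sum_abs le])
  qed
  then show ?thesis by blast
qed

lemma admissible_profile:
  fixes c h :: "'d::finite \<Rightarrow> 'd config \<Rightarrow> real"
  assumes gr: "gradient_rates c h" and r: "0 < r" "r < 1 / 2" and ad: "admissible c r T K u\<^sub>0 u"
    and n: "1 \<le> n" and s: "s \<in> {0..T}"
  shows "torus_profile n (profile_at n (u s)) r"
    and "((\<lambda>s. profile_at n (u s) x) has_real_derivative profile_at n (limit_velocity c (u s)) x) (at s within {0..T})"
    and "nperiodic n (profile_at n (limit_velocity c (u s)))"
    and "derivative_bound (max K 0) (u s)" and "0 \<le> u s y \<and> u s y \<le> 1"
proof -
  have sol: "hydrodynamic_solution c T u\<^sub>0 u" and i: "r \<le> u\<^sub>0 x \<and> u\<^sub>0 x \<le> 1 - r" and K: "sup_Ck_norm T 4 u = ennreal K" for x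
    using ad unfolding admissible_def by blast+
  have p: "periodic (u s)" and b: "0 \<le> u s y \<and> u s y \<le> 1"
    and d: "((\<lambda>s. u s x) has_real_derivative limit_velocity c (u s) x) (at s within {0..T})" for x y
    using sol s unfolding hydrodynamic_solution_def limit_velocity_def by blast+
  show "torus_profile n (profile_at n (u s)) r"
    using n r nperiodic_profile[OF n p] hydrodynamic_bounds[OF gr sol i s] by (simp add: torus_profile_def)
  show "((\<lambda>s. profile_at n (u s) x) has_real_derivative profile_at n (limit_velocity c (u s)) x) (at s within {0..T})"
    by (rule d)
  show "nperiodic n (profile_at n (limit_velocity c (u s)))" by (rule nperiodic_profile[OF n periodic_limit_velocity[OF p]])
  show "derivative_bound (max K 0) (u s)" by (rule derivative_bound_from_norm[OF K s])
  show "0 \<le> u s y \<and> u s y \<le> 1" by (rule b)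
qed

lemma (in torus_dynamics) entropy_estimate_iff:
  assumes prof: "\<And>s. s \<in> {0..T} \<Longrightarrow> torus_profile n (profile_at n (u s)) r"
    and \<mu>: "set_pmf \<mu> \<subseteq> \<Xi>" and t: "t \<in> {0..T}" and u0: "u 0 = u\<^sub>0"
  shows "entropy_estimate c n \<mu> u\<^sub>0 u C \<kappa> t \<longleftrightarrow>
    ent (profile_at n (u t)) (pmf \<mu>) t + integral {0..t} (\<lambda>s. (real n)\<^sup>2 * enrg (profile_at n (u s)) (pmf \<mu>) s)
    \<le> (ent (profile_at n (u 0)) (pmf \<mu>) 0 + C * \<kappa>) * exp (C * t)"
proof -
  have "integral {0..t} (\<lambda>s. (real n)\<^sup>2 * energy c n (density_at c n \<mu> s (u s)) (profile_measure n (u s)))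
    = integral {0..t} (\<lambda>s. (real n)\<^sup>2 * enrg (profile_at n (u s)) (pmf \<mu>) s)"
    by (rule Henstock_Kurzweil_Integration.integral_cong) (use t in \<open>simp add: statement_bridge(2)[OF prof \<mu>]\<close>)
  moreover have "0 \<in> {0..T}" using t by simp
  ultimately show ?thesis
    unfolding entropy_estimate_def u0[symmetric]
    by (simp only: statement_bridge(1)[OF prof \<mu>] t)
qed

section \<open>Choice of the box and conclusion\<close>

text \<open>The box of the replacement step has sides \<open>m ^ 2 ^ k\<close>, \<open>k < d\<close>, hence volume
  \<open>m ^ (2 ^ d - 1)\<close>; its longest side may be of the order of \<open>n\<close>.  The resulting error, the number
  of sites divided by this volume, is of order \<open>1\<close>, \<open>n powr (1/2)\<close> and \<open>n powr (5/4)\<close> in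
  dimensions \<open>1\<close>, \<open>2\<close> and \<open>3\<close>.\<close>

definition box_exponent :: "nat \<Rightarrow> real"
  where "box_exponent d = real d - real (2 ^ d - 1) / 2 ^ (d - 1)"

lemma box_side:
  assumes n: "4 \<le> n"
  shows "\<exists>m\<ge>1. 4 * m ^ (2 ^ (d - 1)) \<le> n \<and>
    real n ^ d / real m ^ (2 ^ d - 1) \<le> (2 ^ (2 ^ d - 1) * 4 powr (real (2 ^ d - 1) / 2 ^ (d - 1))) * real n powr box_exponent d"
proof -
  define q :: nat where "q = 2 ^ (d - 1)"
  define k :: nat where "k = 2 ^ d - 1"
  define y where "y = (real n / 4) powr (1 / real q)"
  define m where "m = nat \<lfloor>y\<rfloor>"
  have q: "0 < q" by (simp add: q_def)
  have y1: "1 \<le> y" unfolding y_def using n by (intro ge_one_powr_ge_zero) auto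
  have yp: "y ^ l = (real n / 4) powr (real l / real q)" for l
  proof -
    have "y ^ l = y powr real l" using y1 by (simp add: powr_realpow)
    then show ?thesis by (simp add: y_def powr_powr)
  qed
  have m1: "1 \<le> m" using y1 by (simp add: m_def le_nat_iff)
  have my: "real m \<le> y" "y / 2 \<le> real m"
  proof -
    have f: "1 \<le> \<lfloor>y\<rfloor>" using y1 by simp
    then have "real m = real_of_int \<lfloor>y\<rfloor>" by (simp add: m_def)
    moreover have "1 \<le> real_of_int \<lfloor>y\<rfloor>" using f by linarith
    ultimately show "real m \<le> y" "y / 2 \<le> real m" using floor_correct[of y] by linarith+
  qed
  have "real m ^ q \<le> y ^ q" using my by (intro power_mono) auto
  also have "\<dots> = real n / 4" unfolding yp using q n by simp
  finally have "real (4 * m ^ q) \<le> real n" by simp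
  then have a: "4 * m ^ q \<le> n" by linarith
  let ?a = "real k / real q"
  have np: "0 < real n" using n by simp
  have "real n powr ?a / (4 powr ?a * 2 ^ k) = (y / 2) ^ k"
    unfolding power_divide yp by (simp add: powr_divide)
  also have "\<dots> \<le> real m ^ k" using my y1 by (intro power_mono) auto
  finally have le: "real n powr ?a / (4 powr ?a * 2 ^ k) \<le> real m ^ k" .
  have "real n ^ d / real m ^ k \<le> real n ^ d / (real n powr ?a / (4 powr ?a * 2 ^ k))"
    using np m1 by (intro divide_left_mono le) auto
  also have "\<dots> = (2 ^ k * 4 powr ?a) * (real n powr real d / real n powr ?a)"
    using np by (simp add: powr_realpow)
  also have "real n powr real d / real n powr ?a = real n powr box_exponent d"
    by (simp add: box_exponent_def powr_diff k_def q_def)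
  finally show ?thesis using m1 a unfolding k_def q_def by (intro exI[of _ m]) simp
qed

text \<open>For \<open>C\<close> above the constants of the production bound and of the box, the
  error of the replacement is at most \<open>C * \<kappa>\<close>, and the production bound has
  the form required for the entropy estimate.\<close>

lemma entropy_estimate_large:
  fixes c h :: "'d::finite \<Rightarrow> 'd config \<Rightarrow> real"
  assumes gr: "gradient_rates c h" and r: "0 < r" "r < 1 / 2"
  shows "\<exists>C0 n1. \<forall>C\<ge>C0. \<forall>n\<ge>n1. \<forall>\<kappa> u\<^sub>0 u \<mu> t. real n powr box_exponent CARD('d) \<le> \<kappa> \<longrightarrow>
    admissible c r T K u\<^sub>0 u \<longrightarrow> set_pmf \<mu> \<subseteq> torus_configs n \<longrightarrow> t \<in> {0..T} \<longrightarrow>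
    entropy_estimate c n \<mu> u\<^sub>0 u C \<kappa> t"
proof -
  obtain S M c0 where S: "finite S" "0 < c0" "\<And>j \<eta>. c0 \<le> c j \<eta>" "\<And>j. reads (S - {0, \<e> j}) (c j)" "0 \<in> S" "\<And>j. \<e> j \<in> S"
    by (rule gradient_rates_data[OF gr]) blast
  obtain D where D: "offset_bound S D" using offset_bound_exists[OF S(1)] by blast
  have rd: "reads S (c j)" for j by (rule reads_mono[OF S(4)]) auto
  obtain L0 where L0: "\<forall>n\<ge>2 * D + 1. \<forall>f x. derivative_bound (max K 0) f \<longrightarrow> (\<forall>x. 0 \<le> f x \<and> f x \<le> 1) \<longrightarrow>
    torus_profile n (profile_at n f) r \<longrightarrow>
    \<bar>torus_profile.discrete_drift n (profile_at n f) c x - profile_at n (limit_velocity c f) x\<bar> \<le> L0 / n"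
    using drift_consistent[where c = c and S = S and D = D and K = "max K 0" and r = r, OF S(1) rd D] by blast
  define L where "L = max (max K 0) L0"
  have c02: "0 < c0 / 2" using S(2) by simp
  obtain C1 n0 where C1: "0 \<le> C1" and P: "\<forall>n\<ge>n0. \<forall>u m v f. slow_profile r L n u m \<longrightarrow>
    (\<forall>x j. \<bar>u (x + \<e> j) - 2 * u x + u (x - \<e> j)\<bar> \<le> L / (real n)\<^sup>2) \<longrightarrow>
    nperiodic n v \<longrightarrow> (\<forall>x. \<bar>torus_profile.discrete_drift n u c x - v x\<bar> \<le> L / n) \<longrightarrow>
    torus_profile.pos_density n u f \<longrightarrow>
    torus_profile.ex n u (\<lambda>\<eta>. f \<eta> * torus_profile.production n u c v \<eta>)
    \<le> c0 / 2 * (real n)\<^sup>2 * torus_profile.total_energy n u f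
      + C1 * (torus_profile.ex n u (\<lambda>\<eta>. f \<eta> * ln (f \<eta>)) + real n ^ CARD('d) / real m ^ (2 ^ CARD('d) - 1))"
    using production_bound[OF gr c02, of r L] by blast
  define C2 :: real where "C2 = 2 ^ (2 ^ CARD('d) - 1) * 4 powr (real (2 ^ CARD('d) - 1) / 2 ^ (CARD('d) - 1))"
  have "entropy_estimate c n \<mu> u\<^sub>0 u C \<kappa> t"
    if C: "max C1 C2 \<le> C" and n: "max n0 (2 * D + 4) \<le> n" and \<kappa>: "real n powr box_exponent CARD('d) \<le> \<kappa>"
      and ad: "admissible c r T K u\<^sub>0 u" and \<mu>: "set_pmf \<mu> \<subseteq> torus_configs n" and t: "t \<in> {0..T}"
    for C n \<kappa> u\<^sub>0 u \<mu> t
  proof -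
    have n': "n0 \<le> n" "2 * D + 1 \<le> n" "2 * D + 2 \<le> n" "4 \<le> n" "1 \<le> n" using n by auto
    have C': "C1 \<le> C" "C2 \<le> C" "0 \<le> C" using C C1 by auto
    have \<kappa>0: "0 \<le> \<kappa>" using order_trans[OF powr_ge_zero \<kappa>] .
    interpret torus_dynamics n c
      by unfold_locales (use n' S(2) S(3) in \<open>auto intro: order_trans[OF less_imp_le]\<close>)
    note ap = admissible_profile[OF gr r ad n'(5)]
    obtain m where m: "1 \<le> m" "4 * m ^ (2 ^ (CARD('d) - 1)) \<le> n"
      "real n ^ CARD('d) / real m ^ (2 ^ CARD('d) - 1) \<le> C2 * real n powr box_exponent CARD('d)"
      using box_side[OF n'(4), of "CARD('d)"] unfolding C2_def by blast
    have "0 \<le> C2" by (simp add: C2_def)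
    then have B: "real n ^ CARD('d) / real m ^ (2 ^ CARD('d) - 1) \<le> C * \<kappa>"
      using m(3) mult_mono[OF C'(2) \<kappa> C'(3) powr_ge_zero] by linarith
    have prod: "torus_profile.ex n (profile_at n (u s)) (\<lambda>\<eta>. f \<eta> * torus_profile.production n (profile_at n (u s)) c (profile_at n (limit_velocity c (u s))) \<eta>)
      \<le> c0 / 2 * (real n)\<^sup>2 * torus_profile.total_energy n (profile_at n (u s)) f
        + C * (torus_profile.ex n (profile_at n (u s)) (\<lambda>\<eta>. f \<eta> * ln (f \<eta>)) + C * \<kappa>)"
      if s: "s \<in> {0..T}" and f: "torus_profile.pos_density n (profile_at n (u s)) f" for s f
    proof -
      interpret torus_profile n "profile_at n (u s)" r by (rule ap(1)[OF s])
      let ?U = "profile_at n (u s)" and ?v = "profile_at n (limit_velocity c (u s))"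
      let ?B = "real n ^ CARD('d) / real m ^ (2 ^ CARD('d) - 1)"
      have sp: "slow_profile r L n ?U m"
        unfolding slow_profile_def
      proof (intro conjI allI m(1,2) torus_profile_axioms)
        fix x j
        have "max K 0 / n \<le> L / n" by (rule divide_right_mono) (auto simp: L_def)
        then show "\<bar>?U (x + \<e> j) - ?U x\<bar> \<le> L / n"
          by (rule order_trans[OF profile_differences(1)[OF n'(5) ap(4)[OF s]]])
      qed
      have d2: "\<forall>x j. \<bar>?U (x + \<e> j) - 2 * ?U x + ?U (x - \<e> j)\<bar> \<le> L / (real n)\<^sup>2"
      proof (intro allI)
        fix x j
        have "max K 0 / (real n)\<^sup>2 \<le> L / (real n)\<^sup>2" by (rule divide_right_mono) (auto simp: L_def)
        then show "\<bar>?U (x + \<e> j) - 2 * ?U x + ?U (x - \<e> j)\<bar> \<le> L / (real n)\<^sup>2"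
          by (rule order_trans[OF profile_differences(2)[OF n'(5) ap(4)[OF s]]])
      qed
      have dr: "\<forall>x. \<bar>discrete_drift c x - ?v x\<bar> \<le> L / n"
      proof
        fix x
        have "L0 / n \<le> L / n" by (rule divide_right_mono) (auto simp: L_def)
        moreover have "\<bar>discrete_drift c x - ?v x\<bar> \<le> L0 / n"
          using L0 n'(2) ap(1,4,5)[OF s] by blast
        ultimately show "\<bar>discrete_drift c x - ?v x\<bar> \<le> L / n" by linarith
      qed
      have "ex (\<lambda>\<eta>. f \<eta> * production c ?v \<eta>) \<le> c0 / 2 * (real n)\<^sup>2 * total_energy f + C1 * (entropy f + ?B)"
        by (rule P[rule_format, OF n'(1) sp d2[rule_format] ap(3)[OF s] dr[rule_format] f])
      moreover have "C1 * (entropy f + ?B) \<le> C * (entropy f + C * \<kappa>)"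
        using entropy_nonneg[OF f] B C' by (intro mult_mono) auto
      ultimately show ?thesis by linarith
    qed
    have w: "(\<Sum>\<eta>\<in>\<Xi>. pmf \<mu> \<eta>) = 1" by (rule sum_pmf_eq_1[OF fin \<mu>])
    have u0: "u 0 = u\<^sub>0" using ad by (simp add: admissible_def hydrodynamic_solution_def)
    have "ent (profile_at n (u t)) (pmf \<mu>) t + integral {0..t} (\<lambda>s. (real n)\<^sup>2 * enrg (profile_at n (u s)) (pmf \<mu>) s)
      \<le> (ent (profile_at n (u 0)) (pmf \<mu>) 0 + C * \<kappa>) * exp (C * t)"
      by (rule entropy_estimate_nonneg[where U = "\<lambda>s. profile_at n (u s)" and v = "\<lambda>s. profile_at n (limit_velocity c (u s))"
            and r = r and T = T and S = S and D = D and ?c0.0 = c0 and w = "pmf \<mu>" and C = C and \<kappa> = "C * \<kappa>" and t = t,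
            OF ap(1) ap(2) S(4) D n'(3) S(5) S(6) S(3) pmf_nonneg w prod C'(3) mult_nonneg_nonneg[OF C'(3) \<kappa>0] t])
    then show ?thesis by (subst entropy_estimate_iff[where T = T and r = r and u = u, OF ap(1) \<mu> t u0])
  qed
  then show ?thesis by blast
qed

text \<open>The crude bound depends on \<open>n\<close> but neither on the initial law nor on the
  solution, so finitely many values of \<open>n\<close> are covered by one constant.\<close>

lemma entropy_estimate_small:
  fixes c h :: "'d::finite \<Rightarrow> 'd config \<Rightarrow> real"
  assumes gr: "gradient_rates c h" and r: "0 < r" "r < 1 / 2"
  shows "\<exists>C0. \<forall>C\<ge>C0. \<forall>n\<ge>1. n < N \<longrightarrow> (\<forall>\<kappa>\<ge>1. \<forall>u\<^sub>0 u \<mu> t.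
    admissible c r T K u\<^sub>0 u \<longrightarrow> set_pmf \<mu> \<subseteq> torus_configs n \<longrightarrow> t \<in> {0..T} \<longrightarrow>
    entropy_estimate c n \<mu> u\<^sub>0 u C \<kappa> t)"
proof -
  obtain S M c0 where M: "0 < c0" "\<And>j \<eta>. c0 \<le> c j \<eta>" "\<And>j \<eta>. \<bar>c j \<eta>\<bar> \<le> M"
    by (rule gradient_rates_data[OF gr]) blast
  define B where "B n = (1 / r ^ (n ^ CARD('d))) * ln (1 / r ^ (n ^ CARD('d)))
      + T * ((real n)\<^sup>2 * (real CARD('d) * real n ^ CARD('d) * (M * (1 / r ^ (n ^ CARD('d))))))" for n
  define C0 where "C0 = (\<Sum>n<N. \<bar>B n\<bar>)"
  have "entropy_estimate c n \<mu> u\<^sub>0 u C \<kappa> t"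
    if C: "C0 \<le> C" and n: "1 \<le> n" "n < N" and \<kappa>: "1 \<le> \<kappa>"
      and ad: "admissible c r T K u\<^sub>0 u" and \<mu>: "set_pmf \<mu> \<subseteq> torus_configs n" and t: "t \<in> {0..T}"
    for C n \<kappa> u\<^sub>0 u \<mu> t
  proof -
    have "\<bar>B n\<bar> \<le> C0" unfolding C0_def using n by (intro member_le_sum) auto
    then have C': "0 \<le> C" "B n \<le> C" using C by linarith+
    have "C * 1 \<le> C * \<kappa>" using C' \<kappa> by (intro mult_left_mono)
    then have b: "B n \<le> C * \<kappa>" using C' by linarith
    interpret torus_dynamics n c
      by unfold_locales (use n M in \<open>auto intro: order_trans[OF less_imp_le]\<close>)
    note ap = admissible_profile[OF gr r ad n(1)]
    have cM: "c j \<eta> \<le> M" for j \<eta> using M(3)[of j \<eta>] by linarith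
    have w: "(\<Sum>\<eta>\<in>\<Xi>. pmf \<mu> \<eta>) = 1" by (rule sum_pmf_eq_1[OF fin \<mu>])
    have u0: "u 0 = u\<^sub>0" using ad by (simp add: admissible_def hydrodynamic_solution_def)
    have "ent (profile_at n (u t)) (pmf \<mu>) t + integral {0..t} (\<lambda>s. (real n)\<^sup>2 * enrg (profile_at n (u s)) (pmf \<mu>) s)
      \<le> (ent (profile_at n (u 0)) (pmf \<mu>) 0 + C * \<kappa>) * exp (C * t)"
      by (rule entropy_estimate_crude[where U = "\<lambda>s. profile_at n (u s)" and v = "\<lambda>s. profile_at n (limit_velocity c (u s))"
            and r = r and T = T and M = M and w = "pmf \<mu>" and C = C and \<kappa> = "C * \<kappa>" and t = t,
            OF ap(1) ap(2) cM pmf_nonneg w t b[unfolded B_def] C'(1)])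
    then show ?thesis by (subst entropy_estimate_iff[where T = T and r = r and u = u, OF ap(1) \<mu> t u0])
  qed
  then show ?thesis by blast
qed

lemma entropy_estimate_all:
  fixes c h :: "'d::finite \<Rightarrow> 'd config \<Rightarrow> real"
  assumes gr: "gradient_rates c h" and r: "0 < r" "r < 1 / 2"
  shows "\<exists>C>0. \<forall>n\<ge>1. \<forall>\<kappa>\<ge>1. \<forall>u\<^sub>0 u \<mu> t. real n powr box_exponent CARD('d) \<le> \<kappa> \<longrightarrow>
    admissible c r T K u\<^sub>0 u \<longrightarrow> set_pmf \<mu> \<subseteq> torus_configs n \<longrightarrow> t \<in> {0..T} \<longrightarrow>
    entropy_estimate c n \<mu> u\<^sub>0 u C \<kappa> t"
proof -
  obtain C0 n1 where large: "\<forall>C\<ge>C0. \<forall>n\<ge>n1. \<forall>\<kappa> u\<^sub>0 u \<mu> t. real n powr box_exponent CARD('d) \<le> \<kappa> \<longrightarrow>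
    admissible c r T K u\<^sub>0 u \<longrightarrow> set_pmf \<mu> \<subseteq> torus_configs n \<longrightarrow> t \<in> {0..T} \<longrightarrow>
    entropy_estimate c n \<mu> u\<^sub>0 u C \<kappa> t"
    using entropy_estimate_large[OF gr r, of T K] by blast
  obtain C0' where small: "\<forall>C\<ge>C0'. \<forall>n\<ge>1. n < n1 \<longrightarrow> (\<forall>\<kappa>\<ge>1. \<forall>u\<^sub>0 u \<mu> t.
    admissible c r T K u\<^sub>0 u \<longrightarrow> set_pmf \<mu> \<subseteq> torus_configs n \<longrightarrow> t \<in> {0..T} \<longrightarrow>
    entropy_estimate c n \<mu> u\<^sub>0 u C \<kappa> t)"
    using entropy_estimate_small[OF gr r, of n1 T K] by blast
  let ?C = "max 1 (max C0 C0')"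
  have "0 < ?C" "C0 \<le> ?C" "C0' \<le> ?C" by simp_all
  moreover have "entropy_estimate c n \<mu> u\<^sub>0 u ?C \<kappa> t"
    if "1 \<le> n" "1 \<le> \<kappa>" "real n powr box_exponent CARD('d) \<le> \<kappa>" "admissible c r T K u\<^sub>0 u"
      "set_pmf \<mu> \<subseteq> torus_configs n" "t \<in> {0..T}" for n \<kappa> u\<^sub>0 u \<mu> t
    using large small that \<open>C0 \<le> ?C\<close> \<open>C0' \<le> ?C\<close> by (cases "n < n1") (blast, meson linorder_not_less)
  ultimately show ?thesis by blast
qed

section \<open>The entropy estimate in dimensions one, two and three\<close>

theorem theorem3p3:
  fixes c h :: "'d::finite \<Rightarrow> 'd config \<Rightarrow> real"
    and r T K :: real
  assumes "gradient_rates c h"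
    and "0 < T"
    and "0 < r" and "r < 1 / 2"
  shows
    "(CARD('d) = 1 \<longrightarrow>
       (\<forall>b::real. 0 < b \<and> b < 1 / 6 \<longrightarrow>
         (\<exists>C>0. \<forall>\<beta> u\<^sub>0 u.
            0 < \<beta> \<and> \<beta> < 1 \<and> (\<forall>x. r \<le> u\<^sub>0 x \<and> u\<^sub>0 x \<le> 1 - r) \<and> holder_space 4 \<beta> u\<^sub>0 \<and>
            hydrodynamic_solution c T u\<^sub>0 u \<and> sup_Ck_norm T 4 u = ennreal K \<longrightarrow>
            (\<forall>n\<ge>1. \<forall>\<mu>. set_pmf \<mu> \<subseteq> torus_configs n \<longrightarrow>
               (\<forall>t\<in>{0..T}. entropy_estimate c n \<mu> u\<^sub>0 u C (real n powr (1 / 3 + b)) t)))))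
     \<and>
     (CARD('d) = 2 \<longrightarrow>
         (\<exists>C>0. \<forall>\<beta> u\<^sub>0 u.
            0 < \<beta> \<and> \<beta> < 1 \<and> (\<forall>x. r \<le> u\<^sub>0 x \<and> u\<^sub>0 x \<le> 1 - r) \<and> holder_space 4 \<beta> u\<^sub>0 \<and>
            hydrodynamic_solution c T u\<^sub>0 u \<and> sup_Ck_norm T 4 u = ennreal K \<longrightarrow>
            (\<forall>n\<ge>1. \<forall>\<mu>. set_pmf \<mu> \<subseteq> torus_configs n \<longrightarrow>
               (\<forall>t\<in>{0..T}. entropy_estimate c n \<mu> u\<^sub>0 u C (real n powr (4 / 5)) t))))
     \<and>
     (CARD('d) = 3 \<longrightarrow>
         (\<exists>C>0. \<forall>\<kappa>>1. \<exists>n\<^sub>0. \<forall>\<beta> u\<^sub>0 u.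
            0 < \<beta> \<and> \<beta> < 1 \<and> (\<forall>x. r \<le> u\<^sub>0 x \<and> u\<^sub>0 x \<le> 1 - r) \<and> holder_space 4 \<beta> u\<^sub>0 \<and>
            hydrodynamic_solution c T u\<^sub>0 u \<and> sup_Ck_norm T 4 u = ennreal K \<longrightarrow>
            (\<forall>n\<ge>n\<^sub>0. \<forall>\<mu>. set_pmf \<mu> \<subseteq> torus_configs n \<longrightarrow>
               (\<forall>t\<in>{0..T}. entropy_estimate c n \<mu> u\<^sub>0 u C (real n powr (3 / 2) / \<kappa> ^ 3) t))))"
proof -
  obtain C where C: "0 < C" and est: "\<And>n \<kappa> u\<^sub>0 u \<mu> t. 1 \<le> n \<Longrightarrow> 1 \<le> \<kappa> \<Longrightarrow> real n powr box_exponent CARD('d) \<le> \<kappa> \<Longrightarrow>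
    admissible c r T K u\<^sub>0 u \<Longrightarrow> set_pmf \<mu> \<subseteq> torus_configs n \<Longrightarrow> t \<in> {0..T} \<Longrightarrow>
    entropy_estimate c n \<mu> u\<^sub>0 u C \<kappa> t"
    using entropy_estimate_all[OF assms(1,3,4), of T K] by blast
  have one: "1 \<le> real n powr a" if "1 \<le> n" "0 \<le> a" for n :: nat and a :: real
    using that by (intro ge_one_powr_ge_zero) auto
  have d1: "entropy_estimate c n \<mu> u\<^sub>0 u C (real n powr (1 / 3 + b)) t"
    if "CARD('d) = 1" "0 < b" "admissible c r T K u\<^sub>0 u" "1 \<le> n" "set_pmf \<mu> \<subseteq> torus_configs n" "t \<in> {0..T}"
    for b u\<^sub>0 u n \<mu> t
  proof (rule est[OF that(4) one _ that(3,5,6)])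
    show "real n powr box_exponent CARD('d) \<le> real n powr (1 / 3 + b)"
      using that(1,2,4) by (intro powr_mono) (auto simp: box_exponent_def)
  qed (use that in auto)
  have d2: "entropy_estimate c n \<mu> u\<^sub>0 u C (real n powr (4 / 5)) t"
    if "CARD('d) = 2" "admissible c r T K u\<^sub>0 u" "1 \<le> n" "set_pmf \<mu> \<subseteq> torus_configs n" "t \<in> {0..T}"
    for u\<^sub>0 u n \<mu> t
  proof (rule est[OF that(3) one _ that(2,4,5)])
    show "real n powr box_exponent CARD('d) \<le> real n powr (4 / 5)"
      using that(1,3) by (intro powr_mono) (auto simp: box_exponent_def)
  qed (use that in auto)
  have d3: "entropy_estimate c n \<mu> u\<^sub>0 u C (real n powr (3 / 2) / \<kappa> ^ 3) t"
    if d: "CARD('d) = 3" and \<kappa>: "1 < \<kappa>" and ad: "admissible c r T K u\<^sub>0 u" and n: "nat \<lceil>\<kappa> ^ 12\<rceil> \<le> n"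
      and \<mu>: "set_pmf \<mu> \<subseteq> torus_configs n" and t: "t \<in> {0..T}"
    for \<kappa> u\<^sub>0 u n \<mu> t
  proof -
    have nk: "\<kappa> ^ 12 \<le> real n" using n by linarith
    have "1 \<le> \<kappa> ^ 12" using \<kappa> by (intro one_le_power) simp
    then have n1: "1 \<le> n" using nk by linarith
    \<comment> \<open>The factor \<open>n powr (1/4)\<close> between the two powers of \<open>n\<close> absorbs \<open>\<kappa> ^ 3\<close> as soon as \<open>n \<ge> \<kappa> ^ 12\<close>.\<close>
    have "\<kappa> ^ 3 = (\<kappa> ^ 12) powr (1 / 4)"
    proof -
      have "(\<kappa> ^ 12) powr (1 / 4) = (\<kappa> powr 12) powr (1 / 4)" using \<kappa> by simp
      also have "\<dots> = \<kappa> powr 3" unfolding powr_powr by simp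
      finally show ?thesis using \<kappa> by simp
    qed
    also have "\<dots> \<le> real n powr (1 / 4)" using nk \<kappa> by (intro powr_mono2) auto
    finally have "real n powr (5 / 4) * \<kappa> ^ 3 \<le> real n powr (5 / 4) * real n powr (1 / 4)" by (intro mult_left_mono) auto
    also have "\<dots> = real n powr (3 / 2)" by (simp flip: powr_add)
    finally have le: "real n powr (5 / 4) \<le> real n powr (3 / 2) / \<kappa> ^ 3" using \<kappa> by (simp add: pos_le_divide_eq)
    have e: "box_exponent CARD('d) = 5 / 4" using d by (simp add: box_exponent_def)
    show ?thesis
      by (rule est[OF n1 order_trans[OF one[OF n1] le] _ ad \<mu> t]) (use le in \<open>auto simp: e\<close>)
  qed
  show ?thesis
  proof (intro conjI impI allI)
    fix b :: real assume d: "CARD('d) = 1" "0 < b \<and> b < 1 / 6"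
    show "\<exists>C>0. \<forall>\<beta> u\<^sub>0 u.
            0 < \<beta> \<and> \<beta> < 1 \<and> (\<forall>x. r \<le> u\<^sub>0 x \<and> u\<^sub>0 x \<le> 1 - r) \<and> holder_space 4 \<beta> u\<^sub>0 \<and>
            hydrodynamic_solution c T u\<^sub>0 u \<and> sup_Ck_norm T 4 u = ennreal K \<longrightarrow>
            (\<forall>n\<ge>1. \<forall>\<mu>. set_pmf \<mu> \<subseteq> torus_configs n \<longrightarrow>
               (\<forall>t\<in>{0..T}. entropy_estimate c n \<mu> u\<^sub>0 u C (real n powr (1 / 3 + b)) t))"
      by (intro exI[of _ C] conjI C allI impI ballI d1[OF d(1)]) (use d(2) in \<open>auto simp: admissible_def\<close>)
  next
    assume d: "CARD('d) = 2"
    show "\<exists>C>0. \<forall>\<beta> u\<^sub>0 u.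
            0 < \<beta> \<and> \<beta> < 1 \<and> (\<forall>x. r \<le> u\<^sub>0 x \<and> u\<^sub>0 x \<le> 1 - r) \<and> holder_space 4 \<beta> u\<^sub>0 \<and>
            hydrodynamic_solution c T u\<^sub>0 u \<and> sup_Ck_norm T 4 u = ennreal K \<longrightarrow>
            (\<forall>n\<ge>1. \<forall>\<mu>. set_pmf \<mu> \<subseteq> torus_configs n \<longrightarrow>
               (\<forall>t\<in>{0..T}. entropy_estimate c n \<mu> u\<^sub>0 u C (real n powr (4 / 5)) t))"
      by (intro exI[of _ C] conjI C allI impI ballI d2[OF d]) (auto simp: admissible_def)
  next
    assume d: "CARD('d) = 3"
    show "\<exists>C>0. \<forall>\<kappa>>1. \<exists>n\<^sub>0. \<forall>\<beta> u\<^sub>0 u.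
            0 < \<beta> \<and> \<beta> < 1 \<and> (\<forall>x. r \<le> u\<^sub>0 x \<and> u\<^sub>0 x \<le> 1 - r) \<and> holder_space 4 \<beta> u\<^sub>0 \<and>
            hydrodynamic_solution c T u\<^sub>0 u \<and> sup_Ck_norm T 4 u = ennreal K \<longrightarrow>
            (\<forall>n\<ge>n\<^sub>0. \<forall>\<mu>. set_pmf \<mu> \<subseteq> torus_configs n \<longrightarrow>
               (\<forall>t\<in>{0..T}. entropy_estimate c n \<mu> u\<^sub>0 u C (real n powr (3 / 2) / \<kappa> ^ 3) t))"
    proof (rule exI[of _ C], intro conjI C allI impI)
      fix \<kappa> :: real assume \<kappa>: "1 < \<kappa>"
      show "\<exists>n\<^sub>0. \<forall>\<beta> u\<^sub>0 u.
            0 < \<beta> \<and> \<beta> < 1 \<and> (\<forall>x. r \<le> u\<^sub>0 x \<and> u\<^sub>0 x \<le> 1 - r) \<and> holder_space 4 \<beta> u\<^sub>0 \<and>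
            hydrodynamic_solution c T u\<^sub>0 u \<and> sup_Ck_norm T 4 u = ennreal K \<longrightarrow>
            (\<forall>n\<ge>n\<^sub>0. \<forall>\<mu>. set_pmf \<mu> \<subseteq> torus_configs n \<longrightarrow>
               (\<forall>t\<in>{0..T}. entropy_estimate c n \<mu> u\<^sub>0 u C (real n powr (3 / 2) / \<kappa> ^ 3) t))"
        by (intro exI[of _ "nat \<lceil>\<kappa> ^ 12\<rceil>"] allI impI ballI d3[OF d \<kappa>]) (auto simp: admissible_def)
    qed
  qed
qed

end
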